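(* Any critically finite real quadratic map $f$ is uniquely determined up to conjugacy by its combinatorics $\vec m$. In fact the conjugacy class $\langle f\rangle$ is the unique fixed point of the associated pull-back transformation $T: X_n/G\to X_n/G$. If the combinatorics is minimal and is different from $(1,3,4,3,1,0)$ and from its image $(5,4,2,1,2,4)$ under orientation reversal, then this fixed point is a global attractor: for every starting point in $X_n/G$ the iterates of $T$ converge to this fixed point, so that the iterated pull-back transformation always converges to a map in the required conjugacy class.
   Context: Let $\widehat{\mathbb R}=\mathbb R\cup\{\infty\}$, an oriented circle. A real quadratic map is a rational map of degree two with real coefficients whose two critical points lie in $\widehat{\mathbb R}$; then $f(\widehat{\mathbb R})$ is a closed arc bounded by the two critical values. Let $G=\mathrm{PSL}_2(\mathbb R)$ be the group of orientation preserving real fractional linear transformations. Two real quadratic maps $f,g$ are conjugate if $g=L\circ f\circ L^{-1}$ for some $L\in G$; $\langle f\rangle$ denotes the conjugacy class. The map is critically finite if both critical points have finite forward orbit. Combinatorics of a critically finite map. (A critically finite map always has at least one critical point in $f(\widehat{\mathbb R})$.) After a conjugation assume $f(\widehat{\mathbb R})\subset\mathbb R$. If one critical point is outside $f(\widehat{\mathbb R})$, conjugate further so that all critical points are finite and this critical point lies to the left of $f(\widehat{\mathbb R})$ if its critical value is the maximum of $f(\widehat{\mathbb R})$, and to the right if its critical value is the minimum. Let $x_0<x_1<\dots<x_n$ be all critical and postcritical points. The combinatorics is the list $\vec m=(m_0,\dots,m_n)$ with $f(x_j)=x_{m_j}$. The orientation reversal of $\vec m$ is $(n-m_n,\dots,n-m_0)$.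 Admissible combinatorics: a list $\vec m=(m_0,\dots,m_n)$ of integers in $[0,n]$ such that (1) $\max m_j-\min m_j$ is $n$ or $n-1$, and in the case $n-1$ either $m_0=n$ or $m_n=0$; (2) after the cyclic permutation placing the smallest entry first, the sequence is strictly increasing from the smallest to the largest entry, followed by a strictly decreasing sequence which never gets as far as the smallest. Combinatorics of critically finite maps are admissible. The critical indices are the index $j_1$ of the smallest entry and the index $j_2$ of the largest. The associated piecewise linear map $\mathbf f:[0,n]\to[0,n]$ sends $j\mapsto m_j$ and is linear between consecutive integers. The combinatorics is minimal if it is admissible, every index is critical or in the forward orbit of a critical index, and for every edge $[j-1,j]$ some forward image under $\mathbf f$ contains a critical index. Pull-back. $X_n$ is the set of $(n+1)$-tuples $\vec x=(x_0,\dots,x_n)$ of distinct points of $\widehat{\mathbb R}$ in positive cyclic order, with $G$ acting diagonally. Given admissible $\vec m$ and $\vec x\in X_n$, choose a real quadratic map $f$ for which $f(\widehat{\mathbb R})$ is the arc running in the positive direction from $x_{m_{j_1}}$ to $x_{m_{j_2}}$. The critical points of $f$ divide $\widehat{\mathbb R}$ into a half-circle on which $f$ preserves orientation and one on which it reverses orientation, giving branches $f_+^{-1},f_-^{-1}$ of $f^{-1}$ on $f(\widehat{\mathbb R})$. Put $y_j=f_{\pm}^{-1}(x_{m_j})$, using $f_+^{-1}$ if $j$ lies (cyclically) between $j_1$ and $j_2$ in positive order (increasing lap) and $f_-^{-1}$ otherwise. Then $T([\vec x])=[\vec y]$ is a well defined map $X_n/G\to X_n/G$. A conjugacy class $\langle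 f\rangle$ with combinatorics $\vec m$ is identified with the point $[(x_0,\dots,x_n)]\in X_n/G$ given by its critical and postcritical points, labelled in increasing order $x_0<x_1<\dots<x_n$ after $f$ has been conjugated by an element of $G$ so that $f(\widehat{\mathbb R})\subset\mathbb R$ and so that, if one critical point is outside $f(\widehat{\mathbb R})$, this critical point is finite and lies to the left of $f(\widehat{\mathbb R})$ if its critical value is the maximum of $f(\widehat{\mathbb R})$, and to the right if its critical value is the minimum; a fixed point of $T$ determines a unique conjugacy class of quadratic maps satisfying $f(x_j)=x_{m_j}$ with critical points $x_{j_1},x_{j_2}$. *)

theory Defs
  imports "HOL-Analysis.Analysis" "HOL-Computational_Algebra.Polynomial"
    "HOL-Library.Option_ord"
begin

text \<open>
  The projective line over a field \<open>K\<close> is the type \<open>K option\<close>, with \<open>None\<close> as the point at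
  infinity. \<open>Option_ord\<close> makes \<open>real option\<close> a linear order with \<open>None\<close> as its least element;
  the cyclic order that this induces is the positive orientation of the circle.
\<close>

definition cyc :: "'a::linorder \<Rightarrow> 'a \<Rightarrow> 'a \<Rightarrow> bool" where
  "cyc a b c \<longleftrightarrow> a < b \<and> b < c \<or> b < c \<and> c < a \<or> c < a \<and> a < b"

text \<open>For \<open>a \<noteq> b\<close>, the closed arc running in the positive direction from \<open>a\<close> to \<open>b\<close>.\<close>

definition circle_arc :: "'a::linorder \<Rightarrow> 'a \<Rightarrow> 'a set" where
  "circle_arc a b = {a, b} \<union> {z. cyc a z b}"

text \<open>
  The rational map \<open>p / q\<close> on the projective line, for coprime \<open>p\<close> and \<open>q\<close>. Its degree is
  \<open>max (degree p) (degree q)\<close>.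
\<close>

definition rat_map :: "'a::field poly \<Rightarrow> 'a poly \<Rightarrow> 'a option \<Rightarrow> 'a option" where
  "rat_map p q z =
    (case z of
      Some x \<Rightarrow> if poly q x = 0 then None else Some (poly p x / poly q x)
    | None \<Rightarrow>
        (let d = max (degree p) (degree q)
         in if coeff q d = 0 then None else Some (coeff p d / coeff q d)))"

text \<open>
  Local charts centered at a point of the projective line: \<open>t \<mapsto> a + t\<close> at a finite point \<open>a\<close>
  and \<open>t \<mapsto> 1 / t\<close> at infinity. A critical point is one where the derivative, computed in these
  charts, vanishes. Values of \<open>to_chart w\<close> away from \<open>w\<close> are irrelevant.
\<close>

definition of_chart :: "'a::real_normed_field option \<Rightarrow> 'a \<Rightarrow> 'a option" where
  "of_chart c t =
    (case c of
      Some a \<Rightarrow> Some (a + t)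
    | None \<Rightarrow> if t = 0 then None else Some (inverse t))"

definition to_chart :: "'a::real_normed_field option \<Rightarrow> 'a option \<Rightarrow> 'a" where
  "to_chart w z =
    (case w of
      Some a \<Rightarrow> (case z of Some b \<Rightarrow> b - a | None \<Rightarrow> 0)
    | None \<Rightarrow> (case z of Some b \<Rightarrow> inverse b | None \<Rightarrow> 0))"

definition critical_point :: "('a::real_normed_field option \<Rightarrow> 'a option) \<Rightarrow> 'a option \<Rightarrow> bool" where
  "critical_point F c \<longleftrightarrow>
    ((\<lambda>t. to_chart (F c) (F (of_chart c t))) has_field_derivative 0) (at 0)"

text \<open>
  A real quadratic map is given by its restriction to the real circle, but the condition on its
  critical points concerns the map of the Riemann sphere.
\<close>

definition real_quadratic :: "(real option \<Rightarrow> real option) \<Rightarrow> bool" where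
  "real_quadratic f \<longleftrightarrow>
    (\<exists>p q. coprime p q \<and> max (degree p) (degree q) = 2 \<and> f = rat_map p q \<and>
      (\<forall>z. critical_point (rat_map (map_poly complex_of_real p) (map_poly complex_of_real q)) z
        \<longrightarrow> z \<in> range (map_option complex_of_real)))"

definition PSL2R :: "(real option \<Rightarrow> real option) set" where
  "PSL2R = {rat_map [:b, a:] [:d, c:] | a b c d. a * d - b * c > 0}"

definition conjugate :: "(real option \<Rightarrow> real option) \<Rightarrow> (real option \<Rightarrow> real option) \<Rightarrow> bool" where
  "conjugate f g \<longleftrightarrow> (\<exists>L\<in>PSL2R. g = L \<circ> f \<circ> inv L)"

definition critically_finite :: "(real option \<Rightarrow> real option) \<Rightarrow> bool" where
  "critically_finite f \<longleftrightarrow> (\<forall>c. critical_point f c \<longrightarrow> finite (range (\<lambda>k. (f ^^ k) c)))"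

text \<open>The critical and postcritical points.\<close>

definition marked_points :: "(real option \<Rightarrow> real option) \<Rightarrow> real option set" where
  "marked_points f = {(f ^^ k) c | k c. critical_point f c}"


subsection \<open>Configuration space\<close>

definition circle_topology :: "real option topology" where
  "circle_topology = Alexandroff_compactification euclidean"

definition config :: "nat \<Rightarrow> (nat \<Rightarrow> real option) set" where
  "config n = {x \<in> {..n} \<rightarrow>\<^sub>E UNIV.
     inj_on x {..n} \<and> (\<forall>i j k. i < j \<and> j < k \<and> k \<le> n \<longrightarrow> cyc (x i) (x j) (x k))}"

definition config_topology :: "nat \<Rightarrow> (nat \<Rightarrow> real option) topology" where
  "config_topology n = subtopology (product_topology (\<lambda>_. circle_topology) {..n}) (config n)"

definition orbit :: "nat \<Rightarrow> (nat \<Rightarrow> real option) \<Rightarrow> (nat \<Rightarrow> real option) set" where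
  "orbit n x = {restrict (L \<circ> x) {..n} | L. L \<in> PSL2R}"

definition moduli :: "nat \<Rightarrow> (nat \<Rightarrow> real option) set set" where
  "moduli n = orbit n ` config n"

text \<open>The quotient topology.\<close>

definition moduli_topology :: "nat \<Rightarrow> (nat \<Rightarrow> real option) set topology" where
  "moduli_topology n =
    topology (\<lambda>U. U \<subseteq> moduli n \<and> openin (config_topology n) {x \<in> config n. orbit n x \<in> U})"

lemma openin_moduli_topology:
  "openin (moduli_topology n) U \<longleftrightarrow>
    U \<subseteq> moduli n \<and> openin (config_topology n) {x \<in> config n. orbit n x \<in> U}"
proof -
  have "istopology (\<lambda>U. U \<subseteq> moduli n \<and> openin (config_topology n) {x \<in> config n. orbit n x \<in> U})"
    unfolding istopology_def
  proof (intro conjI allI impI)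
    fix S T
    assume S: "S \<subseteq> moduli n \<and> openin (config_topology n) {x \<in> config n. orbit n x \<in> S}"
      and T: "T \<subseteq> moduli n \<and> openin (config_topology n) {x \<in> config n. orbit n x \<in> T}"
    show "S \<inter> T \<subseteq> moduli n" using S by blast
    have "{x \<in> config n. orbit n x \<in> S \<inter> T} =
        {x \<in> config n. orbit n x \<in> S} \<inter> {x \<in> config n. orbit n x \<in> T}" by blast
    then show "openin (config_topology n) {x \<in> config n. orbit n x \<in> S \<inter> T}"
      using S T by (simp add: openin_Int)
  next
    fix K
    assume K: "\<forall>S\<in>K. S \<subseteq> moduli n \<and> openin (config_topology n) {x \<in> config n. orbit n x \<in> S}"
    then show "\<Union> K \<subseteq> moduli n" by blast
    have "{x \<in> config n. orbit n x \<in> \<Union> K} = (\<Union>S\<in>K. {x \<in> config n. orbit n x \<in> S})" by blast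
    then show "openin (config_topology n) {x \<in> config n. orbit n x \<in> \<Union> K}"
      using K by (auto intro!: openin_Union)
  qed
  then show ?thesis
    by (simp add: moduli_topology_def)
qed

lemma topspace_config_topology: "topspace (config_topology n) = config n"
proof -
  have "topspace circle_topology = UNIV"
    by (simp add: circle_topology_def UNIV_option_conv)
  then show ?thesis
    by (auto simp: config_topology_def config_def)
qed

lemma topspace_moduli_topology: "topspace (moduli_topology n) = moduli n"
proof -
  have "{x \<in> config n. orbit n x \<in> moduli n} = topspace (config_topology n)"
    by (auto simp: topspace_config_topology moduli_def)
  then have "openin (moduli_topology n) (moduli n)"
    by (simp add: openin_moduli_topology)
  then show ?thesis
    by (metis openin_moduli_topology openin_subset openin_topspace subset_antisym)
qed


subsection \<open>Combinatorics\<close>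

text \<open>
  The normalization used to label the marked points. As \<open>None\<close> is not a value of \<open>g\<close>, the order
  comparisons below are comparisons of real numbers.
\<close>

definition normalized :: "(real option \<Rightarrow> real option) \<Rightarrow> bool" where
  "normalized g \<longleftrightarrow> None \<notin> range g \<and>
    (\<forall>c. critical_point g c \<and> c \<notin> range g \<longrightarrow> c \<noteq> None \<and>
      ((\<forall>z. g z \<le> g c) \<longrightarrow> (\<forall>z. c < g z)) \<and>
      ((\<forall>z. g c \<le> g z) \<longrightarrow> (\<forall>z. g z < c)))"

text \<open>
  Combinatorics are lists \<open>(m\<^sub>0, \<dots>, m\<^sub>n)\<close> of length \<open>n + 1\<close>. The predicate says that after some
  normalizing conjugation the marked points are \<open>x\<^sub>0 < \<dots> < x\<^sub>n\<close> and \<open>x\<^sub>j\<close> is mapped to the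
  point with index \<open>m\<^sub>j\<close>.
\<close>

definition labelling :: "(real option \<Rightarrow> real option) \<Rightarrow> nat list \<Rightarrow> nat \<Rightarrow> (nat \<Rightarrow> real) \<Rightarrow> bool" where
  "labelling f m n x \<longleftrightarrow>
    (\<exists>g. conjugate f g \<and> normalized g \<and>
      strict_mono_on {..n} x \<and> Some ` x ` {..n} = marked_points g \<and>
      length m = n + 1 \<and>
      (\<forall>j\<le>n. m ! j \<le> n \<and> g (Some (x j)) = Some (x (m ! j))))"

definition combinatorics :: "(real option \<Rightarrow> real option) \<Rightarrow> nat list" where
  "combinatorics f = (THE m. \<exists>n x. labelling f m n x)"

text \<open>The point of the moduli space with which the conjugacy class of \<open>f\<close> is identified.\<close>

definition class_point :: "(real option \<Rightarrow> real option) \<Rightarrow> (nat \<Rightarrow> real option) set" where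
  "class_point f =
    (THE \<xi>. \<exists>m n x. labelling f m n x \<and> \<xi> = orbit n (\<lambda>j\<in>{..n}. Some (x j)))"

text \<open>The critical indices \<open>j\<^sub>1\<close> and \<open>j\<^sub>2\<close>; they are unique for admissible lists.\<close>

definition crit_min :: "nat list \<Rightarrow> nat" where
  "crit_min m = (THE j. j < length m \<and> m ! j = Min (set m))"

definition crit_max :: "nat list \<Rightarrow> nat" where
  "crit_max m = (THE j. j < length m \<and> m ! j = Max (set m))"

definition admissible_comb :: "nat list \<Rightarrow> bool" where
  "admissible_comb m \<longleftrightarrow> m \<noteq> [] \<and>
    (let n = length m - 1 in
      (\<forall>j\<le>n. m ! j \<le> n) \<and>
      (Max (set m) = Min (set m) + n \<or>
        Max (set m) + 1 = Min (set m) + n \<and> (m ! 0 = n \<or> m ! n = 0)) \<and>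
      (\<exists>r\<le>n. \<exists>k\<le>n. let s = rotate r m in
        s ! 0 = Min (set m) \<and>
        (\<forall>i<k. s ! i < s ! (i + 1)) \<and>
        (\<forall>i. k \<le> i \<and> i < n \<longrightarrow> s ! (i + 1) < s ! i) \<and>
        (\<forall>i. 1 \<le> i \<and> i \<le> n \<longrightarrow> s ! 0 < s ! i)))"

text \<open>
  The associated piecewise linear map of \<open>{0..n}\<close>. At the right end point the out-of-range entry
  \<open>m ! (n + 1)\<close> is multiplied by zero.
\<close>

definition pl_map :: "nat list \<Rightarrow> real \<Rightarrow> real" where
  "pl_map m t =
    (let k = nat \<lfloor>t\<rfloor> in real (m ! k) + (t - real k) * (real (m ! (k + 1)) - real (m ! k)))"

definition minimal_comb :: "nat list \<Rightarrow> bool" where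
  "minimal_comb m \<longleftrightarrow> admissible_comb m \<and>
    (\<forall>j<length m. \<exists>c\<in>{crit_min m, crit_max m}. \<exists>k. ((\<lambda>i. m ! i) ^^ k) c = j) \<and>
    (\<forall>j\<in>{1..length m - 1}. \<exists>c\<in>{crit_min m, crit_max m}. \<exists>k.
      real c \<in> (pl_map m ^^ k) ` {real j - 1..real j})"


subsection \<open>Pull-back\<close>

text \<open>
  The two closed half-circles bounded by the critical points of \<open>f\<close>, on which \<open>f\<close> respectively
  preserves and reverses orientation.
\<close>

definition increasing_lap :: "(real option \<Rightarrow> real option) \<Rightarrow> real option set \<Rightarrow> bool" where
  "increasing_lap f A \<longleftrightarrow>
    (\<exists>c d. c \<noteq> d \<and> critical_point f c \<and> critical_point f d \<and> A = circle_arc c d) \<and>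
    (\<forall>u\<in>A. \<forall>v\<in>A. \<forall>w\<in>A. cyc u v w \<longrightarrow> cyc (f u) (f v) (f w))"

definition decreasing_lap :: "(real option \<Rightarrow> real option) \<Rightarrow> real option set \<Rightarrow> bool" where
  "decreasing_lap f A \<longleftrightarrow>
    (\<exists>c d. c \<noteq> d \<and> critical_point f c \<and> critical_point f d \<and> A = circle_arc c d) \<and>
    (\<forall>u\<in>A. \<forall>v\<in>A. \<forall>w\<in>A. cyc u v w \<longrightarrow> cyc (f w) (f v) (f u))"

text \<open>
  The result does not depend on the choices of the representative \<open>x\<close> and of the map \<open>f\<close>. The
  condition \<open>j \<in> circle_arc j\<^sub>1 j\<^sub>2\<close> is about the cyclic order of the indices.
\<close>

definition pullback :: "nat list \<Rightarrow> (nat \<Rightarrow> real option) set \<Rightarrow> (nat \<Rightarrow> real option) set" where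
  "pullback m \<xi> =
    (let n = length m - 1; j\<^sub>1 = crit_min m; j\<^sub>2 = crit_max m in
      THE \<eta>. \<exists>x\<in>\<xi>. \<exists>f A B.
        real_quadratic f \<and> range f = circle_arc (x (m ! j\<^sub>1)) (x (m ! j\<^sub>2)) \<and>
        increasing_lap f A \<and> decreasing_lap f B \<and>
        \<eta> = orbit n (\<lambda>j\<in>{..n}. inv_into (if j \<in> circle_arc j\<^sub>1 j\<^sub>2 then A else B) f (x (m ! j))))"

end

theory Submission
  imports Defs "HOL-Complex_Analysis.Great_Picard"
begin

text \<open>
  Send the critical indices to \<open>0\<close> and \<open>\<infinity>\<close> and a third index to \<open>\<plusminus> 1\<close>. The components of the pull-back
  are then square roots of cross ratios, with signs given by the laps. They lift to holomorphic
  motions of the marked points, so Schottky's theorem makes the iterates equicontinuous. At a fixed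
  point the transpose of the derivative is the push-forward, under a quadratic rational map, of
  quadratic differentials with simple poles at the marked points. The push-forward does not increase
  the \<open>L\<^sup>1\<close> norm, and it can preserve the norm of all iterates only if it adds equal contributions of
  \<open>z\<close> and \<open>- z\<close> every time; counting poles (an integrable differential on the sphere has at least
  four) leaves four marked points besides the critical ones, which pins down the combinatorics to the two
  exceptional lists. In all other cases the fixed point attracts locally, hence by equicontinuity
  globally, and is therefore unique; for the exceptional lists the fixed point equation is solved
  explicitly. A fixed point together with its combinatorics determines the map in the normal form
  \<open>M \<circ> z\<^sup>2 \<circ> L\<close>, up to a rescaling that is absorbed by a conjugation.
\<close>

section \<open>Integrable simple poles\<close>

text \<open>The L1 norm contracts without a rate, and equality in single steps does occur.
  Compactness takes the place of a rate: Schottky's theorem bounds all powers of the derivative at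
  once, so the orbit of a differential under push-forward has limit points, the norm is constant
  along the orbit of a limit point, and only permanently isometric orbits have to be excluded. The
  same uniform bounds lead from local to global: normalized configurations form a convex set of real
  vectors, and the segment from the fixed point to a starting point is crossed in steps whose length
  does not depend on the number of iterations. Integration takes place in the plane, with one
  critical index at infinity. A simple pole there means decay like \<open>1 / cmod z ^ 3\<close>,
  which amounts to two vanishing moments of the residues. All marked points are real, so the real
  axis can be discarded as a null set. Existence of the fixed point is no issue, since
  \<open>f\<close> itself provides one. With two marked points no third index is available for the
  normalization; the moduli space is then a single point and is treated separately.\<close>

definition cpx :: "real^2 \<Rightarrow> complex" where "cpx v = Complex (v $ 1) (v $ 2)"
text \<open>The change of variables theorem used below is about \<open>real^'n\<close>; these two
  mutually inverse linear maps carry plane integrals there and back.\<close>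

definition vec_of_cpx :: "complex \<Rightarrow> real^2" where "vec_of_cpx z = vector [Re z, Im z]"

lemma cpx_inverse [simp]: "cpx (vec_of_cpx z) = z" "vec_of_cpx (cpx v) = v"
  by (simp_all add: cpx_def vec_of_cpx_def vec_eq_iff forall_2)

lemma bounded_linear_cpx: "bounded_linear cpx"
  by (auto intro!: linearI simp: cpx_def complex_eq_iff linear_conv_bounded_linear[symmetric])

lemma bounded_linear_vec_of_cpx: "bounded_linear vec_of_cpx"
  by (auto intro!: linearI simp: vec_of_cpx_def vec_eq_iff forall_2 linear_conv_bounded_linear[symmetric])

lemma cpx_measurable [measurable]: "cpx \<in> borel_measurable borel"
  using linear_continuous_on[OF bounded_linear_cpx, of UNIV] by (rule borel_measurable_continuous_onI)

text \<open>\<open>lborel\<close> is characterized by the measure of boxes, and \<open>cpx\<close>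
  matches boxes with boxes of the same side lengths.\<close>

lemma distr_cpx: "distr lborel borel cpx = lborel"
proof (rule lborel_eqI[symmetric])
  fix l u :: complex
  assume le: "\<And>b. b \<in> Basis \<Longrightarrow> l \<bullet> b \<le> u \<bullet> b"
  have le': "Re l \<le> Re u" "Im l \<le> Im u"
    using le[of 1] le[of \<i>] by (auto simp: Basis_complex_def)
  have eq: "cpx -` box l u = box (vec_of_cpx l) (vec_of_cpx u)"
    by (auto simp: box_def Basis_complex_def cpx_def vec_of_cpx_def Basis_vec_def inner_axis forall_2 UNIV_2)
  have B: "Basis = {axis 1 1, axis 2 (1::real) :: real^2}"
    by (auto simp: Basis_vec_def UNIV_2)
  have ne: "axis 1 1 \<noteq> (axis 2 1 :: real^2)"
    by (simp add: axis_eq_axis)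
  have "emeasure (distr lborel borel cpx) (box l u) = emeasure lborel (box (vec_of_cpx l) (vec_of_cpx u))"
    by (subst emeasure_distr) (auto simp: eq)
  also have "\<dots> = (\<Prod>b\<in>Basis. (vec_of_cpx u - vec_of_cpx l) \<bullet> b)"
    by (rule emeasure_lborel_box) (use le' in \<open>auto simp: B vec_of_cpx_def inner_axis\<close>)
  also have "\<dots> = (\<Prod>b\<in>Basis. (u - l) \<bullet> b)"
    using ne by (simp add: B Basis_complex_def vec_of_cpx_def inner_axis)
  finally show "emeasure (distr lborel borel cpx) (box l u) = (\<Prod>b\<in>Basis. (u - l) \<bullet> b)" .
qed simp

lemma nn_integral_cpx:
  assumes [measurable]: "g \<in> borel_measurable borel"
  shows "(\<integral>\<^sup>+z. g z \<partial>lborel) = (\<integral>\<^sup>+v. g (cpx v) \<partial>lborel)"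
  by (subst distr_cpx[symmetric]) (simp add: nn_integral_distr)

text \<open>A bridge between two notions of integral: norms of differentials are handled as
  nonnegative integrals, which may be infinite, while the change of variables theorem speaks of
  absolute integrability and a finite value.\<close>

lemma nn_integral_eq_iff_abs:
  fixes u :: "'a::euclidean_space \<Rightarrow> real"
  assumes [measurable]: "(\<lambda>x. indicator S x * u x) \<in> borel_measurable borel"
    and "\<And>x. x \<in> S \<Longrightarrow> 0 \<le> u x" and "0 \<le> b"
  shows "(\<integral>\<^sup>+x. ennreal (u x) * indicator S x \<partial>lborel) = ennreal b \<longleftrightarrow>
    u absolutely_integrable_on S \<and> integral S u = b"
proof
  have eq: "(\<integral>\<^sup>+x. ennreal (u x) * indicator S x \<partial>lborel) = (\<integral>\<^sup>+x. ennreal (indicator S x * u x) \<partial>lborel)"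
    by (intro nn_integral_cong) (auto simp: indicator_def)
  assume L: "(\<integral>\<^sup>+x. ennreal (u x) * indicator S x \<partial>lborel) = ennreal b"
  have "((\<lambda>x. indicator S x * u x) has_integral b) UNIV"
    by (rule nn_integral_has_integral) (use assms L eq in \<open>auto simp: indicator_def\<close>)
  then have "(u has_integral b) S"
    by (simp add: indicator_def of_bool_def if_distrib[of "\<lambda>x. x * u y" for y] has_integral_restrict_UNIV cong: if_cong)
  then show "u absolutely_integrable_on S \<and> integral S u = b"
    using assms(2) by (auto simp: has_integral_iff absolutely_integrable_on_iff_nonneg)
next
  assume "u absolutely_integrable_on S \<and> integral S u = b"
  then have "(u has_integral b) S"
    by (auto simp: has_integral_iff set_lebesgue_integral_eq_integral)
  then show "(\<integral>\<^sup>+x. ennreal (u x) * indicator S x \<partial>lborel) = ennreal b"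
    using assms(2) by (intro nn_integral_has_integral_lebesgue') auto
qed

text \<open>Multiplication by \<open>w\<close> is a rotation combined with a dilation by
  \<open>cmod w\<close>, which scales areas by the square.\<close>

lemma det_cpx_mult: "det (matrix (\<lambda>h. vec_of_cpx (w * cpx h))) = (cmod w)\<^sup>2"
  by (simp add: det_2 matrix_def vec_of_cpx_def cpx_def axis_def cmod_power2) (simp add: power2_eq_square)

text \<open>By the Cauchy-Riemann equations the Jacobian of \<open>f\<close> is
  \<open>(cmod (deriv f z))\<^sup>2\<close>. Applied to \<open>G = cmod q\<close> it says that the
  L1 norm of a quadratic differential, which is multiplied by \<open>(deriv f)\<^sup>2\<close> under
  a change of coordinate, does not depend on the coordinate.\<close>

theorem nn_integral_holomorphic_image:
  fixes f :: "complex \<Rightarrow> complex" and G :: "complex \<Rightarrow> real"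
  assumes S: "open S" and f: "f holomorphic_on S" and inj: "inj_on f S"
    and G: "continuous_on (f ` S) G" "\<And>w. 0 \<le> G w"
  shows "(\<integral>\<^sup>+z. ennreal ((cmod (deriv f z))\<^sup>2 * G (f z)) * indicator S z \<partial>lborel)
    = (\<integral>\<^sup>+w. ennreal (G w) * indicator (f ` S) w \<partial>lborel)"
proof -
  define g where "g = vec_of_cpx \<circ> f \<circ> cpx"
  define S' where "S' = cpx -` S"
  have opS': "open S'"
    unfolding S'_def using S linear_continuous_on[OF bounded_linear_cpx, of UNIV]
    by (simp add: continuous_on_open_vimage)
  have der: "(g has_derivative (\<lambda>h. vec_of_cpx (deriv f (cpx v) * cpx h))) (at v within S')"
    if "v \<in> S'" for v
  proof -
    have "(f has_field_derivative deriv f (cpx v)) (at (cpx v))"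
      using that f S by (simp add: S'_def holomorphic_derivI)
    then have "(f has_derivative (*) (deriv f (cpx v))) (at (cpx v))"
      by (simp add: has_field_derivative_def)
    then have "((f \<circ> cpx) has_derivative (*) (deriv f (cpx v)) \<circ> cpx) (at v)"
      by (intro diff_chain_at bounded_linear_imp_has_derivative bounded_linear_cpx)
    then have "((\<lambda>x. vec_of_cpx ((f \<circ> cpx) x)) has_derivative (\<lambda>x. vec_of_cpx (((*) (deriv f (cpx v)) \<circ> cpx) x))) (at v)"
      by (rule bounded_linear.has_derivative[OF bounded_linear_vec_of_cpx])
    then show ?thesis
      by (auto simp: g_def o_def intro: has_derivative_at_withinI)
  qed
  have inj': "inj_on g S'"
    using inj unfolding inj_on_def g_def S'_def o_def
    by (metis cpx_inverse vimageE)
  have img: "cpx -` (f ` S) = g ` S'"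
    unfolding g_def S'_def by (auto simp: image_iff) (metis cpx_inverse vimageI)
  have opim: "open (f ` S)"
    by (meson S f inj open_mapping_thm3)
  have contf: "continuous_on S f" using f by (rule holomorphic_on_imp_continuous_on)
  have contL: "continuous_on S (\<lambda>z. (cmod (deriv f z))\<^sup>2 * G (f z))"
    by (intro continuous_intros holomorphic_on_imp_continuous_on[OF holomorphic_deriv[OF f S]]
        continuous_on_compose2[OF G(1) contf]) auto
  have mL: "(\<lambda>z. indicator S z * ((cmod (deriv f z))\<^sup>2 * G (f z))) \<in> borel_measurable borel"
    using borel_measurable_continuous_on_indicator[OF _ contL] S by simp
  have mR: "(\<lambda>z. indicator (f ` S) z * G z) \<in> borel_measurable borel"
    using borel_measurable_continuous_on_indicator[OF _ G(1)] opim by simp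
  define L where "L = (\<lambda>v. (cmod (deriv f (cpx v)))\<^sup>2 * G (f (cpx v)))"
  define R where "R = (\<lambda>v. G (cpx v))"
  have ind1: "indicator S' v = (indicator S (cpx v)::real)" for v
    by (simp add: S'_def indicator_def)
  have ind2: "indicator (g ` S') v = (indicator (f ` S) (cpx v) :: real)" for v
    by (simp only: img[symmetric]) (simp add: indicator_def)
  note ind = ind1 ind2
  have mL': "(\<lambda>v. indicator S' v * L v) \<in> borel_measurable borel"
    using measurable_compose[OF cpx_measurable mL] unfolding L_def ind .
  have mR': "(\<lambda>v. indicator (g ` S') v * R v) \<in> borel_measurable borel"
    using measurable_compose[OF cpx_measurable mR] unfolding R_def ind .
  have cv: "L absolutely_integrable_on S' \<and> integral S' L = b \<longleftrightarrow>
      R absolutely_integrable_on (g ` S') \<and> integral (g ` S') R = b" for b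
  proof -
    \<comment> \<open>The theorem is stated for vector valued functions, so the scalar integrands
      are wrapped into \<open>real^1\<close>.\<close>
    have "(\<lambda>x. \<bar>det (matrix (\<lambda>h. vec_of_cpx (deriv f (cpx x) * cpx h)))\<bar> *\<^sub>R (vec (R (g x)) :: real^1)) absolutely_integrable_on S' \<and>
           integral S' (\<lambda>x. \<bar>det (matrix (\<lambda>h. vec_of_cpx (deriv f (cpx x) * cpx h)))\<bar> *\<^sub>R (vec (R (g x)) :: real^1)) = vec b
     \<longleftrightarrow> (\<lambda>x. vec (R x) :: real^1) absolutely_integrable_on (g ` S') \<and> integral (g ` S') (\<lambda>x. vec (R x) :: real^1) = vec b"
      by (rule has_absolute_integral_change_of_variables) (use opS' der inj' in auto)
    then show ?thesis
      unfolding absolutely_integrable_on_1_iff integral_on_1_eq det_cpx_mult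
      by (simp add: R_def L_def g_def)
  qed
  have nn: "(\<integral>\<^sup>+v. ennreal (L v) * indicator S' v \<partial>lborel) = ennreal b \<longleftrightarrow>
      (\<integral>\<^sup>+v. ennreal (R v) * indicator (g ` S') v \<partial>lborel) = ennreal b" if "0 \<le> b" for b
    using cv[of b] that G(2) mL' mR' by (simp add: nn_integral_eq_iff_abs L_def R_def)
  \<comment> \<open>Finite values agree by \<open>nn\<close>; as the equivalence holds for every
    finite value, one side is infinite exactly when the other is.\<close>
  have eq: "(\<integral>\<^sup>+v. ennreal (L v) * indicator S' v \<partial>lborel) =
      (\<integral>\<^sup>+v. ennreal (R v) * indicator (g ` S') v \<partial>lborel)"
  proof (cases "\<integral>\<^sup>+v. ennreal (L v) * indicator S' v \<partial>lborel" rule: ennreal_cases)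
    case (real r)
    then show ?thesis using nn[of r] by simp
  next
    case top
    show ?thesis
    proof (cases "\<integral>\<^sup>+v. ennreal (R v) * indicator (g ` S') v \<partial>lborel" rule: ennreal_cases)
      case (real r)
      then show ?thesis using nn[of r] by simp
    qed (use top in simp)
  qed
  have "(\<integral>\<^sup>+z. ennreal ((cmod (deriv f z))\<^sup>2 * G (f z)) * indicator S z \<partial>lborel) =
      (\<integral>\<^sup>+z. ennreal (indicator S z * ((cmod (deriv f z))\<^sup>2 * G (f z))) \<partial>lborel)"
    by (intro nn_integral_cong) (auto simp: indicator_def)
  also have "\<dots> = (\<integral>\<^sup>+v. ennreal (indicator S' v * L v) \<partial>lborel)"
    using mL by (subst nn_integral_cpx) (simp_all add: ind L_def)
  also have "\<dots> = (\<integral>\<^sup>+v. ennreal (L v) * indicator S' v \<partial>lborel)"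
    by (intro nn_integral_cong) (auto simp: indicator_def)
  also note eq
  also have "(\<integral>\<^sup>+v. ennreal (R v) * indicator (g ` S') v \<partial>lborel) = (\<integral>\<^sup>+v. ennreal (indicator (g ` S') v * R v) \<partial>lborel)"
    by (intro nn_integral_cong) (auto simp: indicator_def)
  also have "\<dots> = (\<integral>\<^sup>+w. ennreal (indicator (f ` S) w * G w) \<partial>lborel)"
    using mR by (subst nn_integral_cpx) (simp_all add: ind R_def)
  also have "\<dots> = (\<integral>\<^sup>+w. ennreal (G w) * indicator (f ` S) w \<partial>lborel)"
    by (intro nn_integral_cong) (auto simp: indicator_def)
  finally show ?thesis .
qed

lemma AE_Im_nonzero: "AE z in lborel. Im z \<noteq> 0"
proof -
  have "negligible {z. \<i> \<bullet> z = (0::real)}" by (rule negligible_hyperplane) simp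
  moreover have "{z. \<i> \<bullet> z = (0::real)} = {z. Im z = 0}" by (auto simp: inner_complex_def)
  ultimately have "{z. Im z = 0} \<in> null_sets lebesgue" by (simp add: negligible_iff_null_sets)
  then have "AE z in lebesgue. z \<notin> {z. Im z = 0}" by (rule AE_not_in)
  then show ?thesis by (simp add: AE_completion_iff)
qed

lemma AE_Re_nonzero: "AE z in lborel. Re z \<noteq> 0"
proof -
  have "negligible {z. (1::complex) \<bullet> z = (0::real)}" by (rule negligible_hyperplane) simp
  moreover have "{z. (1::complex) \<bullet> z = (0::real)} = {z. Re z = 0}" by (auto simp: inner_complex_def)
  ultimately have "{z. Re z = 0} \<in> null_sets lebesgue" by (simp add: negligible_iff_null_sets)
  then have "AE z in lebesgue. z \<notin> {z. Re z = 0}" by (rule AE_not_in)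
  then show ?thesis by (simp add: AE_completion_iff)
qed

lemma inj_on_square_right_half_plane: "inj_on (\<lambda>z::complex. z\<^sup>2) {z. Re z > 0}"
proof (rule inj_onI)
  fix z w :: complex assume "z \<in> {z. Re z > 0}" "w \<in> {z. Re z > 0}" "z\<^sup>2 = w\<^sup>2"
  moreover have "z \<noteq> - w" using calculation by (auto simp: complex_eq_iff)
  ultimately show "z = w" using power2_eq_iff by blast
qed

lemma csqrt_quadrant: "Im w \<noteq> 0 \<Longrightarrow> Re (csqrt w) > 0 \<and> Im (csqrt w) \<noteq> 0"
proof -
  assume "Im w \<noteq> 0"
  moreover have "w = (csqrt w)\<^sup>2" by simp
  ultimately have "Im ((csqrt w)\<^sup>2) \<noteq> 0" by simp
  then have "Re (csqrt w) \<noteq> 0" "Im (csqrt w) \<noteq> 0" by (auto simp: power2_eq_square)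
  then show ?thesis using csqrt_principal[of w] by auto
qed

lemma emeasure_half_ball_finite: "emeasure lborel {z. Re z > 0 \<and> cmod z < r} < \<infinity>"
proof -
  have "emeasure lborel {z. Re z > 0 \<and> cmod z < r} \<le> emeasure lborel (ball (0::complex) r)"
    by (rule emeasure_mono) auto
  also have "\<dots> < \<infinity>" by (rule emeasure_lborel_ball_finite)
  finally show ?thesis .
qed

lemma open_half_ball: "open {z. Re z > 0 \<and> cmod z < r}"
  by (intro open_Collect_conj open_Collect_less continuous_intros)

text \<open>
  The integrands below are pulled back by \<open>z \<mapsto> z\<^sup>2\<close> and \<open>z \<mapsto> 1 / z\<^sup>2\<close> to the constant \<open>4\<close>.
\<close>

lemma nn_integral_inverse_norm_finite:
  "(\<integral>\<^sup>+w. ennreal (1 / cmod w) * indicator {w. cmod w < R} w \<partial>lborel) < \<infinity>"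
proof (cases "R > 0")
  case True
  let ?S = "{z. Re z > 0 \<and> cmod z < sqrt R}"
  \<comment> \<open>The square of the right half disc is the slit disc. Points of the real axis are
    left out, which costs only a null set in the integral.\<close>
  have sub: "w \<in> (\<lambda>z. z\<^sup>2) ` ?S" if "Im w \<noteq> 0" "cmod w < R" for w
  proof (rule image_eqI)
    show "w = (csqrt w)\<^sup>2" by simp
    have "(cmod (csqrt w))\<^sup>2 = cmod w" by (simp flip: norm_power)
    then have "cmod (csqrt w) < sqrt R" using that by (metis real_less_rsqrt)
    then show "csqrt w \<in> ?S" using csqrt_quadrant[OF that(1)] by simp
  qed
  have "(\<integral>\<^sup>+w. ennreal (1 / cmod w) * indicator {w. cmod w < R} w \<partial>lborel)
    \<le> (\<integral>\<^sup>+w. ennreal (1 / cmod w) * indicator ((\<lambda>z. z\<^sup>2) ` ?S) w \<partial>lborel)"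
    by (rule nn_integral_mono_AE, rule AE_mp[OF AE_Im_nonzero]) (use sub in \<open>auto simp: indicator_def intro!: AE_I2\<close>)
  also have "\<dots> = (\<integral>\<^sup>+z. ennreal ((cmod (deriv (\<lambda>z. z\<^sup>2) z))\<^sup>2 * (1 / cmod (z\<^sup>2))) * indicator ?S z \<partial>lborel)"
  proof (rule nn_integral_holomorphic_image[symmetric])
    show "inj_on (\<lambda>z. z\<^sup>2) ?S" by (rule inj_on_subset[OF inj_on_square_right_half_plane]) auto
    show "continuous_on ((\<lambda>z. z\<^sup>2) ` ?S) (\<lambda>w. 1 / cmod w)"
      by (intro continuous_intros) auto
  qed (auto intro!: holomorphic_intros open_half_ball)
  also have "\<dots> = (\<integral>\<^sup>+z. 4 * indicator ?S z \<partial>lborel)"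
  proof (rule nn_integral_cong)
    fix z :: complex
    have "deriv (\<lambda>z. z\<^sup>2) z = 2 * z"
      by (rule DERIV_imp_deriv) (auto intro!: derivative_eq_intros)
    then show "ennreal ((cmod (deriv (\<lambda>z. z\<^sup>2) z))\<^sup>2 * (1 / cmod (z\<^sup>2))) * indicator ?S z = 4 * indicator ?S z"
      by (auto simp: indicator_def norm_mult norm_power power_mult_distrib)
  qed
  also have "\<dots> = 4 * emeasure lborel ?S"
    by (rule nn_integral_cmult_indicator) (use open_half_ball[of "sqrt R"] in simp)
  also have "\<dots> < \<infinity>"
    using emeasure_half_ball_finite[of "sqrt R"] by (simp add: ennreal_mult_less_top)
  finally show ?thesis .
next
  case False
  then have "(\<integral>\<^sup>+w. ennreal (1 / cmod w) * indicator {w. cmod w < R} w \<partial>lborel) = (\<integral>\<^sup>+w. 0 \<partial>(lborel :: complex measure))"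
    by (intro nn_integral_cong) (auto simp: indicator_def, smt (verit) norm_ge_zero)
  then show ?thesis by simp
qed

lemma nn_integral_inverse_cube_norm_finite:
  assumes "R > 0"
  shows "(\<integral>\<^sup>+w. ennreal (1 / cmod w ^ 3) * indicator {w. cmod w > R} w \<partial>lborel) < \<infinity>"
proof -
  let ?S = "{z. Re z > 0 \<and> cmod z < sqrt (1 / R)}"
  let ?f = "\<lambda>z::complex. 1 / z\<^sup>2"
  have nz: "z \<noteq> 0" if "z \<in> ?S" for z using that by auto
  have sub: "w \<in> ?f ` ?S" if "Im w \<noteq> 0" "cmod w > R" for w
  proof (rule image_eqI)
    have w0: "w \<noteq> 0" using that by auto
    show "w = 1 / (csqrt (1 / w))\<^sup>2" using w0 by simp
    have "(cmod (csqrt (1 / w)))\<^sup>2 = 1 / cmod w" by (simp flip: norm_power add: norm_divide)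
    also have "\<dots> < 1 / R" using that assms by (simp add: frac_less2)
    finally have "cmod (csqrt (1 / w)) < sqrt (1 / R)" by (rule real_less_rsqrt)
    moreover have "Im (1 / w) \<noteq> 0" using that(1) by (simp add: Im_divide)
    ultimately show "csqrt (1 / w) \<in> ?S" using csqrt_quadrant[of "1 / w"] by simp
  qed
  have "(\<integral>\<^sup>+w. ennreal (1 / cmod w ^ 3) * indicator {w. cmod w > R} w \<partial>lborel)
    \<le> (\<integral>\<^sup>+w. ennreal (1 / cmod w ^ 3) * indicator (?f ` ?S) w \<partial>lborel)"
    by (rule nn_integral_mono_AE, rule AE_mp[OF AE_Im_nonzero]) (use sub in \<open>auto simp: indicator_def intro!: AE_I2\<close>)
  also have "\<dots> = (\<integral>\<^sup>+z. ennreal ((cmod (deriv ?f z))\<^sup>2 * (1 / cmod (?f z) ^ 3)) * indicator ?S z \<partial>lborel)"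
  proof (rule nn_integral_holomorphic_image[symmetric])
    show "inj_on ?f ?S"
      using inj_on_square_right_half_plane by (auto simp: inj_on_def)
    show "continuous_on (?f ` ?S) (\<lambda>w. 1 / cmod w ^ 3)"
      by (intro continuous_intros) auto
    show "?f holomorphic_on ?S" by (intro holomorphic_intros) auto
  qed (auto intro!: open_half_ball)
  also have "\<dots> = (\<integral>\<^sup>+z. 4 * indicator ?S z \<partial>lborel)"
  proof (rule nn_integral_cong)
    fix z :: complex
    show "ennreal ((cmod (deriv ?f z))\<^sup>2 * (1 / cmod (?f z) ^ 3)) * indicator ?S z = 4 * indicator ?S z"
    proof (cases "z \<in> ?S")
      case True
      then have z: "z \<noteq> 0" by auto
      have "(?f has_field_derivative - 2 / z ^ 3) (at z)"
        using z by (auto intro!: derivative_eq_intros simp: field_simps power2_eq_square power3_eq_cube)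
      then have "deriv ?f z = - 2 / z ^ 3" by (rule DERIV_imp_deriv)
      moreover have "cmod (- 2 / z ^ 3) = 2 / cmod z ^ 3" by (simp add: norm_divide norm_power)
      ultimately have "(cmod (deriv ?f z))\<^sup>2 * (1 / cmod (?f z) ^ 3) = 4"
        using z by (simp add: norm_divide norm_power power_divide flip: power_mult)
      then show ?thesis using True by simp
    qed simp
  qed
  also have "\<dots> = 4 * emeasure lborel ?S"
    by (rule nn_integral_cmult_indicator) (use open_half_ball[of "sqrt (1/R)"] in simp)
  also have "\<dots> < \<infinity>"
    using emeasure_half_ball_finite[of "sqrt (1/R)"] by (simp add: ennreal_mult_less_top)
  finally show ?thesis .
qed

subsection \<open>Rational functions with simple poles\<close>

text \<open>\<open>E \<zeta>\<close> is the residue at \<open>\<zeta>\<close>. As the coefficient of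
  a quadratic differential such a function is locally integrable; integrability at infinity is a
  condition on the moments of \<open>E\<close>.\<close>

definition simple_poles :: "complex set \<Rightarrow> (complex \<Rightarrow> complex) \<Rightarrow> complex \<Rightarrow> complex" where
  "simple_poles Z E z = (\<Sum>\<zeta>\<in>Z. E \<zeta> / (z - \<zeta>))"

lemma simple_poles_measurable [measurable]: "simple_poles Z E \<in> borel_measurable borel"
  unfolding simple_poles_def by measurable

lemma simple_poles_holomorphic: "U \<inter> Z = {} \<Longrightarrow> simple_poles Z E holomorphic_on U"
  unfolding simple_poles_def by (intro holomorphic_intros) auto

text \<open>In the expansion of \<open>E \<zeta> / (z - \<zeta>)\<close> at infinity the two
  vanishing moments remove the terms in \<open>1 / z\<close> and \<open>1 / z\<^sup>2\<close>. For
  the differential this leaves at most a simple pole at infinity.\<close>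

lemma simple_poles_decay:
  assumes "finite Z" "(\<Sum>\<zeta>\<in>Z. E \<zeta>) = 0" "(\<Sum>\<zeta>\<in>Z. \<zeta> * E \<zeta>) = 0"
  obtains R C where "R > 0" "\<And>z. cmod z > R \<Longrightarrow> cmod (simple_poles Z E z) \<le> C / cmod z ^ 3"
proof
  \<comment> \<open>Every pole has modulus at most \<open>(R - 1) / 2\<close>, so that
    \<open>cmod (z - \<zeta>)\<close> is at least half of \<open>cmod z\<close> beyond radius
    \<open>R\<close>.\<close>
  define R where "R = 2 * (\<Sum>\<zeta>\<in>Z. cmod \<zeta>) + 1"
  have Z: "cmod \<zeta> \<le> (R - 1) / 2" if "\<zeta> \<in> Z" for \<zeta>
    using member_le_sum[of \<zeta> Z cmod] that assms(1) by (simp add: R_def)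
  have sn: "(\<Sum>\<zeta>\<in>Z. cmod \<zeta>) \<ge> 0" by (intro sum_nonneg) auto
  then show "R > 0" by (simp add: R_def)
  define C where "C = (\<Sum>\<zeta>\<in>Z. 2 * cmod (\<zeta>\<^sup>2 * E \<zeta>))"
  fix z assume z: "cmod z > R"
  then have z0: "z \<noteq> 0" using \<open>R > 0\<close> by auto
  have zn: "z - \<zeta> \<noteq> 0" "cmod (z - \<zeta>) \<ge> cmod z / 2" if "\<zeta> \<in> Z" for \<zeta>
    using Z[OF that] z \<open>R > 0\<close> norm_triangle_ineq2[of z \<zeta>] by auto
  have "E \<zeta> / (z - \<zeta>) = E \<zeta> / z + \<zeta> * E \<zeta> / z\<^sup>2 + (\<zeta>\<^sup>2 * E \<zeta>) / (z\<^sup>2 * (z - \<zeta>))" if "\<zeta> \<in> Z" for \<zeta>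
    using zn[OF that] z0 by (simp add: field_simps power2_eq_square)
  then have "simple_poles Z E z = (\<Sum>\<zeta>\<in>Z. E \<zeta> / z + \<zeta> * E \<zeta> / z\<^sup>2 + (\<zeta>\<^sup>2 * E \<zeta>) / (z\<^sup>2 * (z - \<zeta>)))"
    unfolding simple_poles_def by (intro sum.cong) auto
  also have "\<dots> = (\<Sum>\<zeta>\<in>Z. (\<zeta>\<^sup>2 * E \<zeta>) / (z\<^sup>2 * (z - \<zeta>)))"
    using assms by (simp add: sum.distrib flip: sum_divide_distrib)
  also have "cmod \<dots> \<le> (\<Sum>\<zeta>\<in>Z. 2 * cmod (\<zeta>\<^sup>2 * E \<zeta>) / cmod z ^ 3)"
  proof (rule sum_norm_le)
    fix \<zeta> assume "\<zeta> \<in> Z"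
    then have le: "cmod z ^ 3 / 2 \<le> cmod (z\<^sup>2 * (z - \<zeta>))"
      using zn(2)[of \<zeta>] mult_left_mono[of "cmod z / 2" "cmod (z - \<zeta>)" "(cmod z)\<^sup>2"]
      by (simp add: norm_mult norm_power power3_eq_cube power2_eq_square)
    have "cmod (\<zeta>\<^sup>2 * E \<zeta> / (z\<^sup>2 * (z - \<zeta>))) = cmod (\<zeta>\<^sup>2 * E \<zeta>) / cmod (z\<^sup>2 * (z - \<zeta>))"
      by (rule norm_divide)
    also have "\<dots> \<le> cmod (\<zeta>\<^sup>2 * E \<zeta>) / (cmod z ^ 3 / 2)"
      using le z0 by (intro divide_left_mono mult_pos_pos) (auto simp: \<open>\<zeta> \<in> Z\<close> zn)
    finally show "cmod (\<zeta>\<^sup>2 * E \<zeta> / (z\<^sup>2 * (z - \<zeta>))) \<le> 2 * cmod (\<zeta>\<^sup>2 * E \<zeta>) / cmod z ^ 3"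
      by (simp add: mult.commute)
  qed
  also have "\<dots> = C / cmod z ^ 3" by (simp add: C_def sum_divide_distrib)
  finally show "cmod (simple_poles Z E z) \<le> C / cmod z ^ 3" .
qed

lemma nn_integral_lborel_shift:
  fixes g :: "complex \<Rightarrow> ennreal"
  assumes [measurable]: "g \<in> borel_measurable borel"
  shows "(\<integral>\<^sup>+z. g (z - \<zeta>) \<partial>lborel) = (\<integral>\<^sup>+z. g z \<partial>lborel)"
proof -
  have "(\<integral>\<^sup>+z. g z \<partial>lborel) = (\<integral>\<^sup>+z. g z \<partial>(distr lborel borel ((+) (- \<zeta>))))"
    by (simp add: lborel_distr_plus)
  also have "\<dots> = (\<integral>\<^sup>+z. g (z - \<zeta>) \<partial>lborel)"
    by (subst nn_integral_distr) auto
  finally show ?thesis ..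
qed

lemma simple_poles_integrable:
  assumes "finite Z" "(\<Sum>\<zeta>\<in>Z. E \<zeta>) = 0" "(\<Sum>\<zeta>\<in>Z. \<zeta> * E \<zeta>) = 0"
  shows "(\<integral>\<^sup>+z. ennreal (cmod (simple_poles Z E z)) \<partial>lborel) < \<infinity>"
proof -
  obtain R C where R: "R > 0" and C: "\<And>z. cmod z > R \<Longrightarrow> cmod (simple_poles Z E z) \<le> C / cmod z ^ 3"
    using simple_poles_decay[OF assms] by blast
  define far where "far = (\<lambda>z. ennreal \<bar>C\<bar> * (ennreal (1 / cmod z ^ 3) * indicator {w. cmod w > R} z))"
  \<comment> \<open>The disc of radius \<open>R + cmod \<zeta> + 1\<close> about
    \<open>\<zeta>\<close> contains the closed disc of radius \<open>R\<close> about the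
    origin.\<close>
  define near where "near = (\<lambda>\<zeta> z. ennreal (cmod (E \<zeta>)) * (ennreal (1 / cmod (z - \<zeta>)) * indicator ({w. cmod w < R + cmod \<zeta> + 1}) (z - \<zeta>)))"
  have [measurable]: "far \<in> borel_measurable borel" "near \<zeta> \<in> borel_measurable borel" for \<zeta>
    unfolding far_def near_def by measurable
  have le: "ennreal (cmod (simple_poles Z E z)) \<le> far z + (\<Sum>\<zeta>\<in>Z. near \<zeta> z)" for z
  proof (cases "cmod z > R")
    case True
    have "C / cmod z ^ 3 \<le> \<bar>C\<bar> * (1 / cmod z ^ 3)" by (simp add: divide_right_mono)
    then have "ennreal (cmod (simple_poles Z E z)) \<le> far z"
      using C[OF True] True by (simp add: far_def ennreal_mult'[symmetric] ennreal_leI)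
    then show ?thesis by (simp add: add_increasing2)
  next
    case False
    have "cmod (simple_poles Z E z) \<le> (\<Sum>\<zeta>\<in>Z. cmod (E \<zeta>) * (1 / cmod (z - \<zeta>)))"
      unfolding simple_poles_def by (rule sum_norm_le) (simp add: norm_divide)
    then have "ennreal (cmod (simple_poles Z E z)) \<le> (\<Sum>\<zeta>\<in>Z. ennreal (cmod (E \<zeta>) * (1 / cmod (z - \<zeta>))))"
      by (subst sum_ennreal) (auto intro: ennreal_leI)
    also have "\<dots> = (\<Sum>\<zeta>\<in>Z. near \<zeta> z)"
    proof (rule sum.cong[OF refl])
      fix \<zeta> assume "\<zeta> \<in> Z"
      have "z - \<zeta> \<in> {w. cmod w < R + cmod \<zeta> + 1}"
        using False norm_triangle_ineq4[of z \<zeta>] by simp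
      then show "ennreal (cmod (E \<zeta>) * (1 / cmod (z - \<zeta>))) = near \<zeta> z"
        by (simp add: near_def ennreal_mult'[symmetric])
    qed
    finally show ?thesis by (simp add: add_increasing)
  qed
  have "(\<integral>\<^sup>+z. near \<zeta> z \<partial>lborel) < \<infinity>" for \<zeta>
  proof -
    have "(\<integral>\<^sup>+z. ennreal (1 / cmod (z - \<zeta>)) * indicator ({w. cmod w < R + cmod \<zeta> + 1}) (z - \<zeta>) \<partial>lborel) =
      (\<integral>\<^sup>+z. ennreal (1 / cmod z) * indicator ({w. cmod w < R + cmod \<zeta> + 1}) z \<partial>lborel)"
      by (rule nn_integral_lborel_shift) measurable
    then show ?thesis
      unfolding near_def using nn_integral_inverse_norm_finite[of "R + cmod \<zeta> + 1"]
      by (subst nn_integral_cmult) (auto simp: ennreal_mult_less_top)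
  qed
  then have near_fin: "(\<Sum>\<zeta>\<in>Z. \<integral>\<^sup>+z. near \<zeta> z \<partial>lborel) < \<infinity>"
    using assms(1) by simp
  have far_fin: "(\<integral>\<^sup>+z. far z \<partial>lborel) < \<infinity>"
    unfolding far_def using nn_integral_inverse_cube_norm_finite[OF R]
    by (subst nn_integral_cmult) (auto simp: ennreal_mult_less_top)
  have "(\<integral>\<^sup>+z. ennreal (cmod (simple_poles Z E z)) \<partial>lborel) \<le> (\<integral>\<^sup>+z. far z + (\<Sum>\<zeta>\<in>Z. near \<zeta> z) \<partial>lborel)"
    by (rule nn_integral_mono) (rule le)
  also have "\<dots> = (\<integral>\<^sup>+z. far z \<partial>lborel) + (\<Sum>\<zeta>\<in>Z. \<integral>\<^sup>+z. near \<zeta> z \<partial>lborel)"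
    by (subst nn_integral_add) (auto simp: nn_integral_sum)
  also have "\<dots> < \<infinity>" using near_fin far_fin by simp
  finally show ?thesis .
qed

text \<open>Clearing denominators turns the sum into a polynomial with infinitely many zeros; at
  \<open>\<zeta>\<close> only the summand of \<open>\<zeta>\<close> survives.\<close>

lemma simple_poles_independent:
  assumes Z: "finite Z" and U: "infinite U" and eq: "\<And>z. z \<in> U \<Longrightarrow> z \<notin> Z \<Longrightarrow> simple_poles Z E z = 0"
    and "\<zeta> \<in> Z"
  shows "E \<zeta> = 0"
proof -
  define P where "P = (\<Sum>\<zeta>\<in>Z. smult (E \<zeta>) (\<Prod>\<eta>\<in>Z - {\<zeta>}. [:- \<eta>, 1:]))"
  have pr: "(\<Prod>\<eta>\<in>Z. z - \<eta>) / (z - \<zeta>) = (\<Prod>\<eta>\<in>Z - {\<zeta>}. z - \<eta>)" if "\<zeta> \<in> Z" "z \<notin> Z" for z \<zeta>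
    using that Z prod.remove[of Z \<zeta> "\<lambda>\<eta>. z - \<eta>"] by auto
  have P: "poly P z = (\<Sum>\<zeta>\<in>Z. E \<zeta> * (\<Prod>\<eta>\<in>Z - {\<zeta>}. z - \<eta>))" for z
    by (simp add: P_def poly_sum poly_prod)
  have "poly P z = 0" if "z \<in> U - Z" for z
  proof -
    have "poly P z = (\<Sum>\<zeta>\<in>Z. (\<Prod>\<eta>\<in>Z. z - \<eta>) * (E \<zeta> / (z - \<zeta>)))"
      unfolding P by (rule sum.cong[OF refl]) (use that pr in \<open>auto simp flip: pr\<close>)
    also have "\<dots> = (\<Prod>\<eta>\<in>Z. z - \<eta>) * simple_poles Z E z"
      by (simp add: simple_poles_def sum_distrib_left)
    finally show ?thesis using eq[of z] that by simp
  qed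
  then have "U - Z \<subseteq> {z. poly P z = 0}" by auto
  moreover have "infinite (U - Z)" using U Z by simp
  ultimately have "P = 0"
    using poly_roots_finite[of P] by (meson finite_subset)
  then have "0 = poly P \<zeta>" by simp
  also have "\<dots> = (\<Sum>\<xi>\<in>Z. if \<xi> = \<zeta> then E \<zeta> * (\<Prod>\<eta>\<in>Z - {\<zeta>}. \<zeta> - \<eta>) else 0)"
    unfolding P by (rule sum.cong[OF refl]) (use Z assms(4) in auto)
  also have "\<dots> = E \<zeta> * (\<Prod>\<eta>\<in>Z - {\<zeta>}. \<zeta> - \<eta>)" using Z assms(4) by simp
  finally show ?thesis using Z by auto
qed

section \<open>Contraction of the push-forward\<close>

text \<open>A fundamental domain of \<open>z \<mapsto> - z\<close> up to the two axes, which are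
  null sets. Squaring is injective on it, and it avoids the real axis, where all poles will
  lie.\<close>

abbreviation quadrants :: "complex set" where "quadrants \<equiv> {z. Re z > 0 \<and> Im z \<noteq> 0}"

lemma open_quadrants: "open quadrants"
  by (intro open_Collect_conj open_Collect_less open_Collect_neq continuous_intros)

lemma open_nonreal: "open {z. Im z \<noteq> 0}"
  by (intro open_Collect_neq continuous_intros)

lemma nn_integral_quadrants:
  assumes [measurable]: "q \<in> borel_measurable borel" and q: "continuous_on {z. Im z \<noteq> 0} q"
  shows "(\<integral>\<^sup>+z. ennreal (cmod (q z)) \<partial>lborel) =
    (\<integral>\<^sup>+z. (ennreal (cmod (q z)) + ennreal (cmod (q (- z)))) * indicator quadrants z \<partial>lborel)"
proof -
  have [measurable]: "quadrants \<in> sets borel" "uminus ` quadrants \<in> sets borel"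
    using open_quadrants open_negations[OF open_quadrants] by auto
  have "(\<integral>\<^sup>+z. ennreal (cmod (q z)) \<partial>lborel) =
    (\<integral>\<^sup>+z. ennreal (cmod (q z)) * indicator quadrants z + ennreal (cmod (q z)) * indicator (uminus ` quadrants) z \<partial>lborel)"
  proof (rule nn_integral_cong_AE, rule AE_mp[OF AE_Im_nonzero], rule AE_mp[OF AE_Re_nonzero], rule AE_I2, intro impI)
    fix z assume "Re z \<noteq> 0" "Im z \<noteq> 0"
    moreover have "z \<in> uminus ` quadrants \<longleftrightarrow> - z \<in> quadrants"
      by (auto simp: image_iff) (metis add.inverse_inverse neg_0_less_iff_less neg_equal_0_iff_equal uminus_complex.simps)
    ultimately show "ennreal (cmod (q z)) = ennreal (cmod (q z)) * indicator quadrants z + ennreal (cmod (q z)) * indicator (uminus ` quadrants) z"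
      by (auto simp: indicator_def)
  qed
  also have "\<dots> = (\<integral>\<^sup>+z. ennreal (cmod (q z)) * indicator quadrants z \<partial>lborel) +
     (\<integral>\<^sup>+z. ennreal (cmod (q z)) * indicator (uminus ` quadrants) z \<partial>lborel)"
    by (rule nn_integral_add) auto
  also have "(\<integral>\<^sup>+z. ennreal (cmod (q z)) * indicator (uminus ` quadrants) z \<partial>lborel) =
     (\<integral>\<^sup>+z. ennreal ((cmod (deriv uminus z))\<^sup>2 * cmod (q (- z))) * indicator quadrants z \<partial>lborel)"
    by (rule nn_integral_holomorphic_image[symmetric])
       (auto intro!: open_quadrants holomorphic_intros continuous_on_norm continuous_on_subset[OF q])
  also have "\<dots> = (\<integral>\<^sup>+z. ennreal (cmod (q (- z))) * indicator quadrants z \<partial>lborel)"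
  proof (rule nn_integral_cong)
    fix z :: complex
    have "deriv uminus z = (- 1 :: complex)"
      by (rule DERIV_imp_deriv) (auto intro!: derivative_eq_intros)
    then show "ennreal ((cmod (deriv uminus z))\<^sup>2 * cmod (q (- z))) * indicator quadrants z = ennreal (cmod (q (- z))) * indicator quadrants z"
      by simp
  qed
  also have "(\<integral>\<^sup>+z. ennreal (cmod (q z)) * indicator quadrants z \<partial>lborel) + \<dots> =
    (\<integral>\<^sup>+z. ennreal (cmod (q z)) * indicator quadrants z + ennreal (cmod (q (- z))) * indicator quadrants z \<partial>lborel)"
    by (rule nn_integral_add[symmetric]) measurable
  finally show ?thesis by (simp add: distrib_right)
qed

text \<open>A real Moebius transformation after squaring: the quadratic maps with critical points 0
  and infinity. Evenness makes \<open>z\<close> and \<open>- z\<close> the two preimages of a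
  point.\<close>

locale even_quadratic =
  fixes a b c d :: real
  assumes det: "a * d - b * c \<noteq> 0"
begin

definition qmap :: "complex \<Rightarrow> complex" where
  "qmap z = (of_real a * z\<^sup>2 + of_real b) / (of_real c * z\<^sup>2 + of_real d)"

lemma denom_nonzero: "Im u \<noteq> 0 \<Longrightarrow> of_real c * u + of_real d \<noteq> (0::complex)"
  using det by (auto simp: complex_eq_iff)

lemma Im_moebius:
  assumes "Im u \<noteq> 0"
  shows "Im ((of_real a * u + of_real b) / (of_real c * u + of_real d)) \<noteq> 0"
proof
  let ?w = "(of_real a * u + of_real b) / (of_real c * u + of_real d)"
  assume "Im ?w = 0"
  then have "of_real a * u + of_real b = of_real (Re ?w) * (of_real c * u + of_real d)"
    using denom_nonzero[OF assms] by (simp add: complex_is_Real_iff[symmetric] of_real_Re)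
  then have im: "a * Im u = Re ?w * (c * Im u)" and re: "a * Re u + b = Re ?w * (c * Re u + d)"
    by (simp_all add: complex_eq_iff)
  have a: "a = Re ?w * c" using im assms by simp
  have "b = Re ?w * d" using re a by (simp add: distrib_left) (metis add_left_cancel mult.assoc)
  with a have "a * d - b * c = 0" by (metis mult.assoc mult.commute right_minus_eq)
  then show False using det by simp
qed

lemma Im_square: "z \<in> quadrants \<Longrightarrow> Im (z\<^sup>2) \<noteq> 0"
  by (auto simp: power2_eq_square)

lemma qmap_inj: "inj_on qmap quadrants"
proof (rule inj_onI)
  fix z w assume z: "z \<in> quadrants" and w: "w \<in> quadrants" and eq: "qmap z = qmap w"
  have "(of_real a * z\<^sup>2 + of_real b) * (of_real c * w\<^sup>2 + of_real d) = (of_real a * w\<^sup>2 + of_real b) * (of_real c * z\<^sup>2 + of_real d)"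
    using eq denom_nonzero Im_square z w unfolding qmap_def by (auto simp: frac_eq_eq)
  then have "of_real (a * d - b * c) * (z\<^sup>2 - w\<^sup>2) = 0" by (simp add: algebra_simps)
  then have "z\<^sup>2 = w\<^sup>2" using det by (simp del: of_real_diff of_real_mult)
  then show "z = w" using inj_on_square_right_half_plane z w by (auto simp: inj_on_def)
qed

text \<open>Squaring maps the quadrants onto the non-real points, with inverse \<open>csqrt\<close>,
  and a real Moebius transformation permutes these. The inverse transformation is again an instance
  of this locale.\<close>

lemma qmap_image: "qmap ` quadrants = {w. Im w \<noteq> 0}"
proof (intro equalityI subsetI)
  fix w assume "w \<in> qmap ` quadrants"
  then show "w \<in> {w. Im w \<noteq> 0}" unfolding qmap_def using Im_moebius Im_square by auto
next
  fix w assume "w \<in> {w. Im w \<noteq> 0}"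
  then have w: "Im w \<noteq> 0" by simp
  interpret inv: even_quadratic d "- b" "- c" a
    by unfold_locales (use det in \<open>simp add: algebra_simps\<close>)
  define u where "u = (of_real d * w + of_real (- b)) / (of_real (- c) * w + of_real a)"
  have u: "Im u \<noteq> 0" unfolding u_def by (rule inv.Im_moebius[OF w])
  have nz: "of_real (- c) * w + of_real a \<noteq> (0::complex)" by (rule inv.denom_nonzero[OF w])
  have "of_real a * u + of_real b = w * (of_real c * u + of_real d)"
    using nz unfolding u_def by (simp add: divide_simps) (simp add: algebra_simps)
  then have "qmap (csqrt u) = w"
    using denom_nonzero[OF u] by (simp add: qmap_def)
  then show "w \<in> qmap ` quadrants" using csqrt_quadrant[OF u] by auto
qed

lemma qmap_deriv:
  assumes "of_real c * z\<^sup>2 + of_real d \<noteq> (0::complex)"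
  shows "(qmap has_field_derivative of_real (a * d - b * c) * (2 * z) / (of_real c * z\<^sup>2 + of_real d)\<^sup>2) (at z)"
proof -
  have "(qmap has_field_derivative
     (of_real a * (2 * z) * (of_real c * z\<^sup>2 + of_real d) - (of_real a * z\<^sup>2 + of_real b) * (of_real c * (2 * z)))
       / ((of_real c * z\<^sup>2 + of_real d) * (of_real c * z\<^sup>2 + of_real d))) (at z)"
    unfolding qmap_def using assms by (auto intro!: derivative_eq_intros)
  then show ?thesis by (simp add: algebra_simps power2_eq_square)
qed

lemma qmap_holomorphic: "qmap holomorphic_on quadrants"
  unfolding holomorphic_on_def field_differentiable_def
  using qmap_deriv denom_nonzero Im_square by (meson has_field_derivative_at_within)

text \<open>The hypothesis \<open>eq\<close> says that \<open>q'\<close> is the push-forward of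
  \<open>q\<close>: since \<open>(deriv qmap z)\<^sup>2\<close> is even in \<open>z\<close>, the
  contributions of the two preimages share this factor. Conformal invariance turns the norm over the
  plane into an integral over the quadrants.\<close>

lemma L1_pushforward:
  assumes q': "continuous_on {z. Im z \<noteq> 0} q'"
    and eq: "\<And>z. z \<in> quadrants \<Longrightarrow> (deriv qmap z)\<^sup>2 * q' (qmap z) = q z + q (- z)"
  shows "(\<integral>\<^sup>+z. ennreal (cmod (q' z)) \<partial>lborel) =
    (\<integral>\<^sup>+z. ennreal (cmod (q z + q (- z))) * indicator quadrants z \<partial>lborel)"
proof -
  have "(\<integral>\<^sup>+z. ennreal (cmod (q' z)) \<partial>lborel) = (\<integral>\<^sup>+z. ennreal (cmod (q' z)) * indicator (qmap ` quadrants) z \<partial>lborel)"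
    by (rule nn_integral_cong_AE, rule AE_mp[OF AE_Im_nonzero]) (auto simp: qmap_image intro!: AE_I2)
  also have "\<dots> = (\<integral>\<^sup>+z. ennreal ((cmod (deriv qmap z))\<^sup>2 * cmod (q' (qmap z))) * indicator quadrants z \<partial>lborel)"
    by (rule nn_integral_holomorphic_image[symmetric])
       (auto intro!: open_quadrants qmap_holomorphic qmap_inj continuous_on_norm q' simp: qmap_image)
  also have "\<dots> = (\<integral>\<^sup>+z. ennreal (cmod (q z + q (- z))) * indicator quadrants z \<partial>lborel)"
    by (rule nn_integral_cong) (auto simp: indicator_def norm_mult norm_power simp flip: eq)
  finally show ?thesis .
qed

lemma L1_contraction:
  assumes [measurable]: "q \<in> borel_measurable borel"
    and q: "continuous_on {z. Im z \<noteq> 0} q" and q': "continuous_on {z. Im z \<noteq> 0} q'"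
    and eq: "\<And>z. z \<in> quadrants \<Longrightarrow> (deriv qmap z)\<^sup>2 * q' (qmap z) = q z + q (- z)"
  shows "(\<integral>\<^sup>+z. ennreal (cmod (q' z)) \<partial>lborel) \<le> (\<integral>\<^sup>+z. ennreal (cmod (q z)) \<partial>lborel)"
proof -
  have "(\<integral>\<^sup>+z. ennreal (cmod (q' z)) \<partial>lborel) =
    (\<integral>\<^sup>+z. ennreal (cmod (q z + q (- z))) * indicator quadrants z \<partial>lborel)"
    by (rule L1_pushforward[OF q' eq])
  also have "\<dots> \<le> (\<integral>\<^sup>+z. (ennreal (cmod (q z)) + ennreal (cmod (q (- z)))) * indicator quadrants z \<partial>lborel)"
    by (intro nn_integral_mono mult_right_mono) (auto simp flip: ennreal_plus intro: ennreal_leI norm_triangle_ineq)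
  also have "\<dots> = (\<integral>\<^sup>+z. ennreal (cmod (q z)) \<partial>lborel)"
    by (rule nn_integral_quadrants[OF assms(1) q, symmetric])
  finally show ?thesis .
qed

text \<open>Equal norms force equality in the triangle inequality almost everywhere. Both sides are
  continuous on the quadrants, so the set where it fails is open and null, hence empty.\<close>

lemma L1_equality:
  assumes [measurable]: "q \<in> borel_measurable borel"
    and q: "continuous_on {z. Im z \<noteq> 0} q" and q': "continuous_on {z. Im z \<noteq> 0} q'"
    and eq: "\<And>z. z \<in> quadrants \<Longrightarrow> (deriv qmap z)\<^sup>2 * q' (qmap z) = q z + q (- z)"
    and iso: "(\<integral>\<^sup>+z. ennreal (cmod (q' z)) \<partial>lborel) = (\<integral>\<^sup>+z. ennreal (cmod (q z)) \<partial>lborel)"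
    and fin: "(\<integral>\<^sup>+z. ennreal (cmod (q z)) \<partial>lborel) < \<infinity>"
    and z: "z \<in> quadrants"
  shows "cmod (q z + q (- z)) = cmod (q z) + cmod (q (- z))"
proof -
  have [measurable]: "quadrants \<in> sets borel" using open_quadrants by auto
  define u where "u = (\<lambda>z. cmod (q z + q (- z)) * indicator quadrants z)"
  define v where "v = (\<lambda>z. (cmod (q z) + cmod (q (- z))) * indicator quadrants z)"
  have [measurable]: "u \<in> borel_measurable borel" "v \<in> borel_measurable borel" unfolding u_def v_def by measurable
  have uv: "u z \<le> v z" "0 \<le> u z" for z
    by (auto simp: u_def v_def indicator_def norm_triangle_ineq)
  have iu: "(\<integral>\<^sup>+z. ennreal (u z) \<partial>lborel) = (\<integral>\<^sup>+z. ennreal (cmod (q' z)) \<partial>lborel)"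
    by (subst L1_pushforward[OF q' eq]) (auto simp: u_def indicator_def intro!: nn_integral_cong)
  have iv: "(\<integral>\<^sup>+z. ennreal (v z) \<partial>lborel) = (\<integral>\<^sup>+z. ennreal (cmod (q z)) \<partial>lborel)"
    by (subst nn_integral_quadrants[OF assms(1) q]) (auto simp: v_def indicator_def intro!: nn_integral_cong)
  have "(\<integral>\<^sup>+z. (ennreal (v z) - ennreal (u z)) \<partial>lborel) = (\<integral>\<^sup>+z. ennreal (v z) \<partial>lborel) - (\<integral>\<^sup>+z. ennreal (u z) \<partial>lborel)"
    using fin iu iso uv by (intro nn_integral_diff) (auto intro!: AE_I2 ennreal_leI)
  also have "\<dots> = 0" using iu iv iso fin by simp
  finally have "AE z in lborel. ennreal (v z) - ennreal (u z) = 0"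
    by (subst (asm) nn_integral_0_iff_AE) auto
  then have ae: "AE z in lborel. z \<notin> {z \<in> quadrants. cmod (q z + q (- z)) \<noteq> cmod (q z) + cmod (q (- z))}" (is "AE z in lborel. z \<notin> ?N")
  proof (rule AE_mp, intro AE_I2 impI)
    fix z assume "ennreal (v z) - ennreal (u z) = 0"
    then have "ennreal (v z - u z) = 0" using uv by (simp add: ennreal_minus)
    then have "v z = u z" using uv[of z] by (simp add: ennreal_eq_0_iff)
    then show "z \<notin> ?N" by (auto simp: u_def v_def indicator_def split: if_splits)
  qed
  have qm: "continuous_on quadrants (\<lambda>z. q (- z))"
    by (rule continuous_on_compose2[OF q]) (auto intro!: continuous_intros)
  have qq: "continuous_on quadrants q" by (rule continuous_on_subset[OF q]) auto
  have "open ?N"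
  proof -
    have "open (quadrants \<inter> (\<lambda>z. cmod (q z + q (- z)) - (cmod (q z) + cmod (q (- z)))) -` (- {0}))"
      by (intro continuous_open_preimage continuous_intros qm qq open_quadrants)
    moreover have "\<dots> = ?N" by auto
    ultimately show ?thesis by simp
  qed
  moreover have "negligible ?N"
  proof -
    have "?N \<in> null_sets lborel"
      using ae \<open>open ?N\<close> by (subst AE_iff_null_sets) auto
    then show ?thesis by (simp add: negligible_iff_null_sets null_sets_completionI)
  qed
  ultimately have "?N = {}" using open_not_negligible by blast
  then show ?thesis using z by blast
qed

end

section \<open>Rigidity of the equality case\<close>

lemma holomorphic_real_constant:
  assumes "f holomorphic_on S" "open S" "connected S" "\<And>z. z \<in> S \<Longrightarrow> f z \<in> \<real>"
  shows "f constant_on S"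
proof (rule ccontr)
  assume nc: "\<not> f constant_on S"
  then have ne: "S \<noteq> {}" by (auto simp: constant_on_def)
  \<comment> \<open>A nonconstant holomorphic function is open, but a subset of the real axis is
    null.\<close>
  have "open (f ` S)" by (rule open_mapping_thm[OF assms(1-3) assms(2) subset_refl nc])
  moreover have "f ` S \<subseteq> {z. \<i> \<bullet> z = 0}" using assms(4) by (auto simp: inner_complex_def complex_is_Real_iff)
  then have "negligible (f ` S)" by (rule negligible_subset[rotated]) (rule negligible_hyperplane, simp)
  ultimately show False using open_not_negligible ne by blast
qed

text \<open>Equality in the triangle inequality makes the quotient of the values at
  \<open>- z\<close> and \<open>z\<close> a nonnegative real, hence a constant \<kappa> by
  holomorphy. Comparing residues and applying \<open>z \<mapsto> - z\<close> twice gives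
  \<open>\<kappa>\<^sup>2 = 1\<close>, so \<kappa> is 1: the function is even, and its residues are
  odd.\<close>

lemma simple_poles_even:
  assumes Z: "finite Z" "uminus ` Z = Z" "Z \<subseteq> \<real>"
    and eq: "\<And>z. z \<in> quadrants \<Longrightarrow>
      cmod (simple_poles Z E z + simple_poles Z E (- z)) = cmod (simple_poles Z E z) + cmod (simple_poles Z E (- z))"
    and "\<zeta> \<in> Z"
  shows "E (- \<zeta>) = - E \<zeta>"
proof (cases "\<forall>z\<in>quadrants. simple_poles Z E z = 0")
  case True
  have inf: "infinite quadrants"
  proof
    assume "finite quadrants"
    then have "negligible quadrants" by (rule negligible_finite)
    moreover have "1 + \<i> \<in> quadrants" by simp
    ultimately show False using open_not_negligible[OF open_quadrants] by blast
  qed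
  have "E \<zeta> = 0" if "\<zeta> \<in> Z" for \<zeta>
    by (rule simple_poles_independent[OF Z(1) inf _ that]) (use True in blast)
  moreover have "- \<zeta> \<in> Z" using Z(2) \<open>\<zeta> \<in> Z\<close> by blast
  ultimately show ?thesis using \<open>\<zeta> \<in> Z\<close> by simp
next
  case False
  let ?q = "simple_poles Z E"
  obtain z0 where z0: "z0 \<in> quadrants" "?q z0 \<noteq> 0" using False by blast
  have disj: "{z. Im z \<noteq> 0} \<inter> Z = {}" using Z(3) by (auto simp: complex_is_Real_iff)
  have hol: "?q holomorphic_on {z. Im z \<noteq> 0}" by (rule simple_poles_holomorphic[OF disj])
  have "open (quadrants \<inter> ?q -` (- {0}))"
    by (intro continuous_open_preimage open_quadrants continuous_on_subset[OF holomorphic_on_imp_continuous_on[OF hol]]) auto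
  moreover have "z0 \<in> quadrants \<inter> ?q -` (- {0})" using z0 by simp
  ultimately obtain e where e: "e > 0" "ball z0 e \<subseteq> quadrants \<inter> ?q -` (- {0})"
    using open_contains_ball_eq by blast
  define h where "h = (\<lambda>z. ?q (- z) / ?q z)"
  have h: "h z = of_real (cmod (?q (- z)) / cmod (?q z))" if "z \<in> ball z0 e" for z
  proof -
    have zq: "z \<in> quadrants" "?q z \<noteq> 0" using e that by auto
    have "cmod (?q z) *\<^sub>R ?q (- z) = cmod (?q (- z)) *\<^sub>R ?q z"
      using eq[OF zq(1)] by (simp only: norm_triangle_eq)
    then show ?thesis using zq(2) by (simp add: h_def scaleR_conv_of_real field_simps)
  qed
  have "h constant_on ball z0 e"
  proof (rule holomorphic_real_constant)
    have hol1: "?q holomorphic_on ball z0 e" by (rule holomorphic_on_subset[OF hol]) (use e in auto)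
    have "(?q \<circ> uminus) holomorphic_on ball z0 e"
      by (rule holomorphic_on_compose_gen[OF _ hol]) (use e in \<open>auto intro!: holomorphic_intros\<close>)
    then show "h holomorphic_on ball z0 e"
      unfolding h_def o_def using e by (intro holomorphic_intros hol1) auto
    show "h z \<in> \<real>" if "z \<in> ball z0 e" for z using h[OF that] by simp
  qed auto
  then obtain k where k: "\<And>z. z \<in> ball z0 e \<Longrightarrow> h z = k" by (auto simp: constant_on_def)
  have "k = of_real (cmod (?q (- z0)) / cmod (?q z0))" using k[of z0] h[of z0] e(1) by simp
  then obtain \<kappa> :: real where \<kappa>: "k = of_real \<kappa>" "\<kappa> \<ge> 0"
    by (metis divide_nonneg_nonneg norm_ge_zero)
  have rel: "?q (- z) = of_real \<kappa> * ?q z" if "z \<in> ball z0 e" for z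
  proof -
    have "?q z \<noteq> 0" using e(2) that by blast
    then show ?thesis using k[OF that] \<kappa>(1) by (simp add: h_def field_simps)
  qed
  have neg: "?q (- z) = (\<Sum>\<zeta>\<in>Z. - E (- \<zeta>) / (z - \<zeta>))" if "z \<in> ball z0 e" for z
  proof -
    have "?q (- z) = (\<Sum>\<zeta>\<in>uminus ` Z. E \<zeta> / (- z - \<zeta>))" using Z(2) by (simp add: simple_poles_def)
    also have "\<dots> = (\<Sum>\<zeta>\<in>Z. E (- \<zeta>) / (- z + \<zeta>))" by (subst sum.reindex) (auto simp: inj_on_def)
    also have "\<dots> = (\<Sum>\<zeta>\<in>Z. - E (- \<zeta>) / (z - \<zeta>))"
      by (rule sum.cong[OF refl]) (metis minus_diff_eq minus_divide_divide uminus_add_conv_diff add.commute)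
    finally show ?thesis .
  qed
  have "infinite (ball z0 e)"
    using open_not_negligible[of "ball z0 e"] e(1) negligible_finite by auto
  then have odd: "- E (- \<zeta>) - of_real \<kappa> * E \<zeta> = 0" if "\<zeta> \<in> Z" for \<zeta>
  proof (rule simple_poles_independent[OF Z(1) _ _ that])
    fix z assume z: "z \<in> ball z0 e"
    have "simple_poles Z (\<lambda>\<zeta>. - E (- \<zeta>) - of_real \<kappa> * E \<zeta>) z = (\<Sum>\<zeta>\<in>Z. - E (- \<zeta>) / (z - \<zeta>)) - of_real \<kappa> * ?q z"
      by (simp add: simple_poles_def diff_divide_distrib sum_subtractf sum_distrib_left)
    then show "simple_poles Z (\<lambda>\<zeta>. - E (- \<zeta>) - of_real \<kappa> * E \<zeta>) z = 0"
      using neg[OF z] rel[OF z] by simp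
  qed
  have mem: "- \<zeta> \<in> Z" if "\<zeta> \<in> Z" for \<zeta> using Z(2) that by blast
  have sq: "E \<zeta> = of_real (\<kappa>\<^sup>2) * E \<zeta>" if "\<zeta> \<in> Z" for \<zeta>
  proof -
    have "E (- \<zeta>) = - (of_real \<kappa> * E \<zeta>)"
      using odd[OF that] by (metis add.inverse_inverse eq_iff_diff_eq_0)
    moreover have "E \<zeta> = - (of_real \<kappa> * E (- \<zeta>))"
      using odd[OF mem[OF that]] by (metis add.inverse_inverse eq_iff_diff_eq_0)
    ultimately show ?thesis by (simp add: power2_eq_square)
  qed
  obtain \<xi> where "\<xi> \<in> Z" "E \<xi> \<noteq> 0"
    using z0(2) sum.neutral[of Z "\<lambda>\<zeta>. E \<zeta> / (z0 - \<zeta>)"] by (auto simp: simple_poles_def)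
  then have "\<kappa>\<^sup>2 = 1" using sq[of \<xi>] by (metis mult_cancel_right1 of_real_eq_1_iff)
  then have "\<kappa> = 1" using \<kappa>(2) by (simp add: power2_eq_1_iff)
  then have "- E (- \<zeta>) = E \<zeta>" using odd[OF \<open>\<zeta> \<in> Z\<close>] by (metis eq_iff_diff_eq_0 mult_1 of_real_1)
  then show ?thesis by (metis add.inverse_inverse)
qed

section \<open>Cross ratios and quadratic differentials\<close>

text \<open>
  Points of the projective line over the indices \<open>0, \<dots>, n\<close>, with \<open>x j2\<close> at infinity, in homogeneous
  coordinates \<open>(x i : 1)\<close> for \<open>i \<noteq> j2\<close> and \<open>(1 : 0)\<close> for \<open>j2\<close>.
\<close>

definition bracket :: "nat \<Rightarrow> (nat \<Rightarrow> 'a::field) \<Rightarrow> nat \<Rightarrow> nat \<Rightarrow> 'a" where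
  "bracket j2 x i k = x i * of_bool (k \<noteq> j2) - x k * of_bool (i \<noteq> j2)"

text \<open>As a function of the point \<open>i\<close> this is the Moebius coordinate taking
  \<open>r\<close>, \<open>k\<close>, \<open>s\<close> to 0, 1, infinity.\<close>

definition cross_ratio :: "nat \<Rightarrow> (nat \<Rightarrow> 'a::field) \<Rightarrow> nat \<Rightarrow> nat \<Rightarrow> nat \<Rightarrow> nat \<Rightarrow> 'a" where
  "cross_ratio j2 x i k r s = bracket j2 x i r * bracket j2 x k s / (bracket j2 x i s * bracket j2 x k r)"

text \<open>A bracket is linear in \<open>x\<close>, so this is its logarithmic derivative in the
  direction \<open>v\<close>.\<close>

definition dlog_bracket :: "nat \<Rightarrow> (nat \<Rightarrow> 'a::field) \<Rightarrow> (nat \<Rightarrow> 'a) \<Rightarrow> nat \<Rightarrow> nat \<Rightarrow> 'a" where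
  "dlog_bracket j2 x v i k = bracket j2 v i k / bracket j2 x i k"

text \<open>\<open>p_fixed\<close> is the fixed point equation of the pull-back with both sides
  squared, so that the choice of branches does not enter. The value \<open>p j2 = 1\<close> is the
  first homogeneous coordinate of infinity.\<close>

locale postcritical_data =
  fixes n j1 j2 a :: nat and m :: "nat \<Rightarrow> nat" and p :: "nat \<Rightarrow> real"
  assumes idx: "j1 \<le> n" "j2 \<le> n" "a \<le> n" "j1 \<noteq> j2" "a \<noteq> j1" "a \<noteq> j2"
    and m_le: "i \<le> n \<Longrightarrow> m i \<le> n"
    and m_crit: "m j1 \<noteq> m j2"
    and m_noncrit: "i \<le> n \<Longrightarrow> i \<noteq> j1 \<Longrightarrow> i \<noteq> j2 \<Longrightarrow> m i \<noteq> m j1 \<and> m i \<noteq> m j2"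
    and p_j1: "p j1 = 0" and p_j2: "p j2 = 1"
    and p_inj: "i \<le> n \<Longrightarrow> k \<le> n \<Longrightarrow> i \<noteq> j2 \<Longrightarrow> k \<noteq> j2 \<Longrightarrow> p i = p k \<Longrightarrow> i = k"
    and p_fixed: "i \<le> n \<Longrightarrow> i \<noteq> j1 \<Longrightarrow> i \<noteq> j2 \<Longrightarrow>
      (p i)\<^sup>2 = cross_ratio j2 p (m i) (m a) (m j1) (m j2)"
begin

abbreviation "br \<equiv> bracket j2 p"

lemma br_nonzero: "i \<le> n \<Longrightarrow> k \<le> n \<Longrightarrow> i \<noteq> k \<Longrightarrow> br i k \<noteq> 0"
  using p_inj p_j2 by (auto simp: bracket_def)

text \<open>\<open>rA\<close>, \<open>rB\<close>, \<open>rC\<close>, \<open>rD\<close> below are the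
  coefficients of the map in \<open>z\<^sup>2\<close> that takes 0 to the point of
  \<open>m j1\<close> and infinity to that of \<open>m j2\<close>. The remaining factor \<kappa> is
  determined by requiring that 1, the square of \<open>p a\<close>, goes to the point of
  \<open>m a\<close>.\<close>

definition \<kappa> :: real where "\<kappa> = - (br (m j1) (m a) / br (m j2) (m a))"

lemma ma: "m a \<le> n" "m j1 \<le> n" "m j2 \<le> n" "m a \<noteq> m j1" "m a \<noteq> m j2"
  using m_noncrit[of a] idx m_le by auto

lemma \<kappa>_nonzero: "\<kappa> \<noteq> 0"
  using br_nonzero ma by (auto simp: \<kappa>_def)

definition rA :: real where "rA = \<kappa> * p (m j2)"
definition rB :: real where "rB = p (m j1)"
definition rC :: real where "rC = \<kappa> * of_bool (m j2 \<noteq> j2)"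
definition rD :: real where "rD = of_bool (m j1 \<noteq> j2)"

lemma det_nonzero: "rA * rD - rB * rC \<noteq> 0"
proof -
  have "rA * rD - rB * rC = \<kappa> * br (m j2) (m j1)"
    by (simp add: bracket_def algebra_simps rA_def rB_def rC_def rD_def)
  then show ?thesis using \<kappa>_nonzero br_nonzero ma m_crit by auto
qed

sublocale even_quadratic rA rB rC rD
  by unfold_locales (rule det_nonzero)

text \<open>The fixed point equation makes \<open>p (m i)\<close> the image of \<open>p i\<close>
  under the map just defined. It is multiplied out, so that \<open>m i = j2\<close>, the value
  infinity, is included.\<close>

lemma p_conj:
  assumes "i \<le> n" "i \<noteq> j1" "i \<noteq> j2"
  shows "(rA * (p i)\<^sup>2 + rB) * of_bool (m i \<noteq> j2) = p (m i) * (rC * (p i)\<^sup>2 + rD)"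
proof -
  have nz: "br (m i) (m j2) \<noteq> 0" "br (m a) (m j1) \<noteq> 0" "br (m j2) (m a) \<noteq> 0"
    using br_nonzero ma m_noncrit[OF assms] m_le[OF assms(1)] by auto
  have anti: "br k l = - br l k" for k l by (simp add: bracket_def)
  have "(p i)\<^sup>2 * (br (m i) (m j2) * br (m a) (m j1)) = br (m i) (m j1) * br (m a) (m j2)"
    using nz by (simp add: p_fixed[OF assms] cross_ratio_def)
  moreover have "\<kappa> * br (m j2) (m a) = br (m a) (m j1)"
    using nz anti[of "m j1"] by (simp add: \<kappa>_def)
  ultimately have "(p i)\<^sup>2 * br (m i) (m j2) * \<kappa> * br (m j2) (m a) = br (m i) (m j1) * - br (m j2) (m a)"
    using anti[of "m a" "m j2"] by (simp add: mult.assoc)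
  then have "((p i)\<^sup>2 * \<kappa> * br (m i) (m j2) + br (m i) (m j1)) * br (m j2) (m a) = 0"
    by (simp add: algebra_simps)
  then have "(p i)\<^sup>2 * \<kappa> * br (m i) (m j2) + br (m i) (m j1) = 0" using nz by simp
  then show ?thesis by (simp add: bracket_def algebra_simps rA_def rB_def rC_def rD_def)
qed

text \<open>Three indices are normalized; these are the free ones, the coordinates of the tangent
  space of the moduli space.\<close>

definition J :: "nat set" where "J = {..n} - {j1, j2, a}"

text \<open>Half the logarithmic derivative of the cross ratio, times \<open>x j\<close>. This is
  the derivative of the square root in the pull-back when \<open>x j\<close> is that square root, as
  it is at a fixed point.\<close>

definition tangent :: "(nat \<Rightarrow> 'a::field_char_0) \<Rightarrow> (nat \<Rightarrow> 'a) \<Rightarrow> nat \<Rightarrow> 'a" where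
  "tangent x v j = x j / 2 *
    (dlog_bracket j2 x v (m j) (m j1) + dlog_bracket j2 x v (m a) (m j2)
     - dlog_bracket j2 x v (m j) (m j2) - dlog_bracket j2 x v (m a) (m j1))"

definition pc :: "nat \<Rightarrow> complex" where "pc i = of_real (p i)"

lemma pc_inj: "i \<le> n \<Longrightarrow> k \<le> n \<Longrightarrow> i \<noteq> j2 \<Longrightarrow> k \<noteq> j2 \<Longrightarrow> pc i = pc k \<longleftrightarrow> i = k"
  using p_inj by (auto simp: pc_def)

lemma pc_simps: "pc j1 = 0" "pc j2 = 1" by (simp_all add: pc_def p_j1 p_j2)

lemma pc_a: "pc a \<noteq> 0"
  using pc_inj[of a j1] idx pc_simps by auto

text \<open>The kernel behind the duality. For \<open>i\<close> in \<open>J\<close> it is, in the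
  variable \<open>w\<close>, a quadratic differential with simple poles at 0, \<open>pc a\<close>,
  \<open>pc i\<close> and infinity. As a function of the point \<open>pc i\<close> it is a vector
  field with its only pole at \<open>w\<close> that vanishes at the three normalized points, i.e. a
  tangent vector of the normalized configurations.\<close>

definition qd :: "complex \<Rightarrow> nat \<Rightarrow> complex" where
  "qd w i = of_bool (i \<noteq> j2) * (pc i * (pc i - pc a)) / (w * (w - pc a) * (w - pc i))"

lemma qd_partial_fractions:
  assumes "w \<noteq> 0" "w \<noteq> pc a" "w \<noteq> pc i" "i \<noteq> j2"
  shows "qd w i = 1 / (w - pc i) - 1 / w - pc i / pc a * (1 / (w - pc a) - 1 / w)"
proof -
  have "w - pc i \<noteq> 0" "w - pc a \<noteq> 0" using assms by auto
  then show ?thesis using assms pc_a by (simp add: qd_def divide_simps) (simp add: algebra_simps)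
qed

text \<open>In the difference of \<open>qd\<close> at \<open>i\<close> and \<open>k\<close> the
  terms \<open>1 / w\<close> cancel, and the part linear in the point is proportional to
  \<open>pc i - pc k\<close>. Division leaves a product of two Cauchy kernels and a correction that
  does not depend on the finite points \<open>i\<close> and \<open>k\<close>.\<close>

lemma dlog_qd:
  assumes "i \<le> n" "k \<le> n" "i \<noteq> k" and w: "w \<noteq> 0" "w \<noteq> pc a" "w \<noteq> pc i" "w \<noteq> pc k"
  shows "dlog_bracket j2 pc (qd w) i k = of_bool (i \<noteq> j2) * of_bool (k \<noteq> j2) *
    (1 / (w - pc i) * (1 / (w - pc k)) - 1 / pc a * (1 / (w - pc a) - 1 / w))"
proof (cases "i = j2 \<or> k = j2")
  case True
  then show ?thesis by (auto simp: dlog_bracket_def bracket_def qd_def)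
next
  case False
  then have "pc i - pc k \<noteq> 0" using assms pc_inj by auto
  moreover have "w - pc i \<noteq> 0" "w - pc k \<noteq> 0" using w by auto
  moreover have "1 / (w - pc i) - 1 / (w - pc k) = (pc i - pc k) * (1 / (w - pc i) * (1 / (w - pc k)))"
    using calculation by (simp add: divide_simps)
  moreover have "qd w i - qd w k = (1 / (w - pc i) - 1 / (w - pc k)) - (pc i - pc k) * (1 / pc a * (1 / (w - pc a) - 1 / w))"
  proof -
    define h where "h = 1 / pc a * (1 / (w - pc a) - 1 / w)"
    have "qd w l = 1 / (w - pc l) - 1 / w - pc l * h" if "w \<noteq> pc l" "l \<noteq> j2" for l
      using qd_partial_fractions[OF w(1,2) that] by (simp add: h_def)
    then have "qd w i - qd w k = (1 / (w - pc i) - 1 / (w - pc k)) - (pc i - pc k) * h"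
      using False w by (simp add: left_diff_distrib)
    then show ?thesis unfolding h_def .
  qed
  ultimately have "qd w i - qd w k = (pc i - pc k) * (1 / (w - pc i) * (1 / (w - pc k)) - 1 / pc a * (1 / (w - pc a) - 1 / w))"
    by (simp only: right_diff_distrib)
  then show ?thesis using False \<open>pc i - pc k \<noteq> 0\<close>
    by (simp add: dlog_bracket_def bracket_def)
qed

definition gf :: "complex \<Rightarrow> nat \<Rightarrow> complex" where "gf w i = of_bool (i \<noteq> j2) / (w - pc i)"

text \<open>The four products of Cauchy kernels combine into one product of two differences, which
  \<open>gf_qmap\<close> evaluates after composition with the map.\<close>

lemma tangent_qd:
  assumes j: "j \<le> n" "j \<noteq> j1" "j \<noteq> j2" and w: "Im w \<noteq> 0"
  shows "tangent pc (qd w) j = pc j / 2 * ((gf w (m j) - gf w (m a)) * (gf w (m j1) - gf w (m j2)))"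
proof -
  have nw: "w \<noteq> 0" "w \<noteq> pc i" for i using w by (auto simp: pc_def)
  have mj: "m j \<le> n" "m j \<noteq> m j1" "m j \<noteq> m j2" using m_le m_noncrit j by auto
  define h where "h = 1 / pc a * (1 / (w - pc a) - 1 / w)"
  define e :: "nat \<Rightarrow> complex" where "e = (\<lambda>i. of_bool (i \<noteq> j2))"
  have D: "dlog_bracket j2 pc (qd w) i k = gf w i * gf w k - e i * e k * h" if "i \<le> n" "k \<le> n" "i \<noteq> k" for i k
    unfolding dlog_qd[OF that nw(1) nw(2) nw(2) nw(2)] by (simp add: gf_def h_def e_def)
  \<comment> \<open>Each factor is nonzero only if one of its two indices is \<open>j2\<close>. This
    cannot happen for both factors, as \<open>m j\<close> and \<open>m a\<close> differ from
    \<open>m j1\<close> and \<open>m j2\<close>. So the correction \<open>h\<close> drops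
    out.\<close>
  have e0: "(e (m j) - e (m a)) * (e (m j1) - e (m j2)) = 0"
    using mj ma m_crit by (auto simp: e_def)
  have "tangent pc (qd w) j = pc j / 2 * ((gf w (m j) - gf w (m a)) * (gf w (m j1) - gf w (m j2)) - (e (m j) - e (m a)) * (e (m j1) - e (m j2)) * h)"
    unfolding tangent_def using mj ma by (simp add: D algebra_simps)
  then show ?thesis by (simp add: e0)
qed

definition cA :: complex where "cA = of_real rA"
definition cB :: complex where "cB = of_real rB"
definition cC :: complex where "cC = of_real rC"
definition cD :: complex where "cD = of_real rD"
definition Det :: complex where "Det = cA * cD - cB * cC"

abbreviation "den z \<equiv> cC * z\<^sup>2 + cD"
abbreviation "num z \<equiv> cA * z\<^sup>2 + cB"

lemma qmap_eq: "qmap z = num z / den z"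
  by (simp add: qmap_def cA_def cB_def cC_def cD_def)

lemma Det_eq: "Det = of_real (rA * rD - rB * rC)"
  by (simp add: Det_def cA_def cB_def cC_def cD_def)

lemma Det_nonzero: "Det \<noteq> 0"
  unfolding Det_eq using det_nonzero by (simp only: of_real_eq_0_iff) simp

lemma den_nonzero: "z \<in> quadrants \<Longrightarrow> den z \<noteq> 0"
  using denom_nonzero[OF Im_square] by (simp add: cC_def cD_def)

lemma deriv_qmap:
  assumes "den z \<noteq> 0" shows "(qmap has_field_derivative Det * (2 * z) / (den z)\<^sup>2) (at z)"
  using qmap_deriv[of z] assms unfolding Det_eq by (simp add: cC_def cD_def)

lemma pc_conj:
  assumes "i \<le> n" "i \<noteq> j1" "i \<noteq> j2"
  shows "num (pc i) * of_bool (m i \<noteq> j2) = pc (m i) * den (pc i)"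
proof -
  have "complex_of_real ((rA * (p i)\<^sup>2 + rB) * of_bool (m i \<noteq> j2)) = of_real (p (m i) * (rC * (p i)\<^sup>2 + rD))"
    by (simp only: p_conj[OF assms])
  then show ?thesis by (cases "m i = j2") (simp_all add: pc_def cA_def cB_def cC_def cD_def)
qed

lemma num_den: "num z * den w - num w * den z = Det * (z\<^sup>2 - w\<^sup>2)"
  by (simp add: Det_def algebra_simps)

lemma den_pc_nonzero:
  assumes "i \<le> n" "i \<noteq> j1" "i \<noteq> j2" "m i \<noteq> j2"
  shows "den (pc i) \<noteq> 0"
proof
  assume d: "den (pc i) = 0"
  then have "num (pc i) = 0" using pc_conj[OF assms(1-3)] assms(4) by simp
  then have "Det * (0 - (pc i)\<^sup>2) = 0" "Det * (1 - (pc i)\<^sup>2) = 0"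
    using num_den[of 0 "pc i"] num_den[of 1 "pc i"] d by auto
  then have "(pc i)\<^sup>2 = 0" "(pc i)\<^sup>2 = 1" using Det_nonzero by auto
  then show False by simp
qed

text \<open>For Moebius functions of the square, \<open>qmap z - qmap u\<close> is
  \<open>Det * (z\<^sup>2 - u\<^sup>2)\<close> over the product of the denominators. The reciprocal
  stays meaningful if the value at \<open>u\<close> is infinity: then its denominator and
  \<open>gf\<close> are both 0.\<close>

lemma gf_qmap:
  assumes z: "z \<in> quadrants"
  shows "i \<le> n \<Longrightarrow> i \<noteq> j1 \<Longrightarrow> i \<noteq> j2 \<Longrightarrow> gf (qmap z) (m i) = den z * den (pc i) / (Det * (z\<^sup>2 - (pc i)\<^sup>2))"
    and "gf (qmap z) (m j1) = den z * cD / (Det * z\<^sup>2)"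
    and "gf (qmap z) (m j2) = - (den z * cC / Det)"
proof -
  have Im: "Im (z\<^sup>2) \<noteq> 0" by (rule Im_square[OF z])
  have dz: "den z \<noteq> 0" by (rule den_nonzero[OF z])
  note Det = Det_nonzero
  have z0: "z \<noteq> 0" using z by auto
  \<comment> \<open>\<open>N\<close> and \<open>D\<close> are homogeneous coordinates of the point
    of index \<open>l\<close>, so that the images of the other indices and the two critical values
    are treated alike.\<close>
  have key: "gf (qmap z) l = den z * D / (Det * X)"
    if e: "of_bool (l \<noteq> j2) * N = pc l * D" and x: "X \<noteq> 0"
      and rel: "num z * D - N * den z = Det * X" and nz: "l = j2 \<Longrightarrow> D = 0" "l \<noteq> j2 \<Longrightarrow> D \<noteq> 0" for l N D X
  proof (cases "l = j2")
    case True
    then show ?thesis using nz by (simp add: gf_def)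
  next
    case False
    have D0: "D \<noteq> 0" using nz False by simp
    have N: "N = pc l * D" using e False by simp
    have "(qmap z - pc l) * (den z * D) = Det * X"
    proof -
      have "(qmap z - pc l) * (den z * D) = (qmap z * den z) * D - pc l * D * den z"
        by (simp add: algebra_simps)
      also have "qmap z * den z = num z" using dz by (simp add: qmap_eq)
      finally show ?thesis using rel N by simp
    qed
    moreover have DX: "Det * X \<noteq> 0" using Det x by simp
    ultimately have eq: "Det * X = den z * D * (qmap z - pc l)" and "qmap z - pc l \<noteq> 0"
      by (auto simp: mult.commute)
    then have "1 / (qmap z - pc l) = den z * D / (Det * X)"
      using DX by (subst frac_eq_eq) simp_all
    then show ?thesis using False by (simp add: gf_def)
  qed
  show "gf (qmap z) (m i) = den z * den (pc i) / (Det * (z\<^sup>2 - (pc i)\<^sup>2))" if i: "i \<le> n" "i \<noteq> j1" "i \<noteq> j2"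
  proof (rule key)
    show c': "of_bool (m i \<noteq> j2) * num (pc i) = pc (m i) * den (pc i)"
      using pc_conj[OF i] by (simp add: mult.commute)
    show "z\<^sup>2 - (pc i)\<^sup>2 \<noteq> 0" using Im by (auto simp: pc_def)
    show rel: "num z * den (pc i) - num (pc i) * den z = Det * (z\<^sup>2 - (pc i)\<^sup>2)"
      by (rule num_den)
    show "den (pc i) = 0" if "m i = j2" using c' that pc_simps by simp
    show "den (pc i) \<noteq> 0" if "m i \<noteq> j2" using den_pc_nonzero[OF i that] .
  qed
  have e1: "of_bool (m j1 \<noteq> j2) * cB = pc (m j1) * cD" and nz1: "m j1 = j2 \<Longrightarrow> cD = 0" "m j1 \<noteq> j2 \<Longrightarrow> cD \<noteq> 0"
    by (auto simp: pc_def cB_def cD_def rB_def rD_def)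
  have r1: "num z * cD - cB * den z = Det * z\<^sup>2"
    by (simp add: Det_def algebra_simps)
  show "gf (qmap z) (m j1) = den z * cD / (Det * z\<^sup>2)"
    by (rule key[OF e1 _ r1 nz1]) (use z0 in auto)
  have e2: "of_bool (m j2 \<noteq> j2) * cA = pc (m j2) * cC" and nz2: "m j2 = j2 \<Longrightarrow> cC = 0" "m j2 \<noteq> j2 \<Longrightarrow> cC \<noteq> 0"
    using \<kappa>_nonzero by (auto simp: pc_def cA_def cC_def rA_def rC_def)
  have r2: "num z * cC - cA * den z = Det * (- 1)"
    by (simp add: Det_def algebra_simps)
  have "gf (qmap z) (m j2) = den z * cC / (Det * (- 1))"
    by (rule key[OF e2 _ r2 nz2]) auto
  then show "gf (qmap z) (m j2) = - (den z * cC / Det)" by simp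
qed

text \<open>
  Pushing forward the quadratic differential \<open>qd\<close> is dual to the derivative of the pull-back.
\<close>

lemma pushforward_qd:
  assumes z: "z \<in> quadrants" and j: "j \<le> n" "j \<noteq> j1" "j \<noteq> j2"
  shows "(deriv qmap z)\<^sup>2 * tangent pc (qd (qmap z)) j = qd z j + qd (- z) j"
proof -
  have Im: "Im (z\<^sup>2) \<noteq> 0" by (rule Im_square[OF z])
  have dz: "den z \<noteq> 0" by (rule den_nonzero[OF z])
  note Det = Det_nonzero
  have z0: "z \<noteq> 0" using z by auto
  have zi: "z\<^sup>2 - (pc i)\<^sup>2 \<noteq> 0" for i using Im by (auto simp: pc_def)
  then have zi': "z - pc i \<noteq> 0" "- z - pc i \<noteq> 0" "z + pc i \<noteq> 0" for i by (auto simp: power2_eq_square algebra_simps) (metis add_eq_0_iff minus_mult_minus)+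
  have fz: "Im (qmap z) \<noteq> 0" using qmap_image z by blast
  define G where "G = den z * den z"
  define W where "W = (z\<^sup>2 - (pc j)\<^sup>2) * (z\<^sup>2 - (pc a)\<^sup>2)"
  have W: "W \<noteq> 0" using zi by (simp add: W_def)
  have d1: "gf (qmap z) (m j) - gf (qmap z) (m a) = den z * (den z * ((pc j)\<^sup>2 - (pc a)\<^sup>2)) / (Det * W)"
  proof -
    have "gf (qmap z) (m j) - gf (qmap z) (m a) =
      den z * (den (pc j) * (z\<^sup>2 - (pc a)\<^sup>2) - den (pc a) * (z\<^sup>2 - (pc j)\<^sup>2)) / (Det * W)"
    proof -
      have "e * X / (D * u) - e * Y / (D * v) = e * (X * v - Y * u) / (D * (u * v))"
        if "D \<noteq> 0" "u \<noteq> 0" "v \<noteq> 0" for e X Y D u v :: complex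
        using that by (simp add: field_simps)
      from this[OF Det zi zi] show ?thesis
        unfolding gf_qmap(1)[OF z j] gf_qmap(1)[OF z idx(3,5,6)] W_def .
    qed
    also have "den (pc j) * (z\<^sup>2 - (pc a)\<^sup>2) - den (pc a) * (z\<^sup>2 - (pc j)\<^sup>2) = den z * ((pc j)\<^sup>2 - (pc a)\<^sup>2)"
      by (simp add: algebra_simps)
    finally show ?thesis .
  qed
  have d2: "gf (qmap z) (m j1) - gf (qmap z) (m j2) = G / (Det * z\<^sup>2)"
    unfolding gf_qmap(2)[OF z] gf_qmap(3)[OF z] G_def using z0 Det
    by (simp add: divide_simps) (simp add: algebra_simps)
  have "deriv qmap z = Det * (2 * z) / (den z)\<^sup>2"
    by (rule DERIV_imp_deriv[OF deriv_qmap[OF dz]])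
  then have "(deriv qmap z)\<^sup>2 * tangent pc (qd (qmap z)) j =
     (Det * (2 * z) / G)\<^sup>2 * (pc j / 2 * (G * ((pc j)\<^sup>2 - (pc a)\<^sup>2) / (Det * W) * (G / (Det * z\<^sup>2))))"
    unfolding tangent_qd[OF j fz] d1 d2 by (simp add: G_def power2_eq_square mult.assoc)
  \<comment> \<open>The fourth power of \<open>den z\<close> from the two differences cancels
    against the squared derivative, and so do \<open>Det\<close> and \<open>z\<close>; a factor
    \<open>4 / 2\<close> remains.\<close>
  also have "\<dots> = 2 * pc j * ((pc j)\<^sup>2 - (pc a)\<^sup>2) / W"
    using Det W z0 dz by (simp add: G_def power2_eq_square)
  also have "\<dots> = qd z j + qd (- z) j"
  proof -
    have W': "W = (z - pc j) * (z + pc j) * ((z - pc a) * (z + pc a))" by (simp add: W_def power2_eq_square algebra_simps)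
    have "qd (- z) j = - (pc j * (pc j - pc a) / (z * (z + pc a) * (z + pc j)))"
    proof -
      have "- z * (- z - pc a) * (- z - pc j) = - (z * (z + pc a) * (z + pc j))" by (simp add: algebra_simps)
      then show ?thesis using j(3) by (simp add: qd_def)
    qed
    then show ?thesis unfolding W' using j(3) z0 zi'
      by (simp add: qd_def divide_simps) (simp add: algebra_simps power2_eq_square)
  qed
  finally show ?thesis .
qed

end

section \<open>Residues and the counting of poles\<close>

lemma simple_poles_minus:
  assumes "uminus ` Z = Z"
  shows "simple_poles Z E (- z) = simple_poles Z (\<lambda>\<zeta>. - E (- \<zeta>)) z"
proof -
  have "simple_poles Z E (- z) = (\<Sum>\<zeta>\<in>uminus ` Z. E \<zeta> / (- z - \<zeta>))" using assms by (simp add: simple_poles_def)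
  also have "\<dots> = (\<Sum>\<zeta>\<in>Z. E (- \<zeta>) / (- z + \<zeta>))" by (subst sum.reindex) (auto simp: inj_on_def)
  also have "\<dots> = (\<Sum>\<zeta>\<in>Z. - E (- \<zeta>) / (z - \<zeta>))"
    by (rule sum.cong[OF refl]) (metis minus_diff_eq minus_divide_divide uminus_add_conv_diff add.commute)
  finally show ?thesis by (simp add: simple_poles_def)
qed

lemma simple_poles_residue:
  assumes "finite Z"
  shows "((\<lambda>z. (z - \<zeta>) * simple_poles Z E z) \<longlongrightarrow> (if \<zeta> \<in> Z then E \<zeta> else 0)) (at \<zeta>)"
proof -
  have "((\<lambda>z. (if \<zeta> \<in> Z then E \<zeta> else 0) + (z - \<zeta>) * (\<Sum>\<eta>\<in>Z - {\<zeta>}. E \<eta> / (z - \<eta>)))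
    \<longlongrightarrow> (if \<zeta> \<in> Z then E \<zeta> else 0) + (\<zeta> - \<zeta>) * (\<Sum>\<eta>\<in>Z - {\<zeta>}. E \<eta> / (\<zeta> - \<eta>))) (at \<zeta>)"
    by (intro tendsto_intros) auto
  moreover have "\<forall>\<^sub>F z in at \<zeta>. (if \<zeta> \<in> Z then E \<zeta> else 0) + (z - \<zeta>) * (\<Sum>\<eta>\<in>Z - {\<zeta>}. E \<eta> / (z - \<eta>)) = (z - \<zeta>) * simple_poles Z E z"
    unfolding eventually_at_filter
  proof (intro always_eventually allI impI)
    fix z assume "z \<noteq> \<zeta>"
    then show "(if \<zeta> \<in> Z then E \<zeta> else 0) + (z - \<zeta>) * (\<Sum>\<eta>\<in>Z - {\<zeta>}. E \<eta> / (z - \<eta>)) = (z - \<zeta>) * simple_poles Z E z"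
      using assms by (cases "\<zeta> \<in> Z") (auto simp: simple_poles_def sum.remove[of Z \<zeta>] distrib_left)
  qed
  ultimately show ?thesis by (simp add: tendsto_cong)
qed

text \<open>\<open>R k\<close> stands for the poles of the k-th push-forward away from 0 and
  infinity. A pole that is not a critical value has two poles above it, so
  \<open>card (R k) - 4\<close> at least halves in every step and is eventually 0. Equality in the
  count then makes both critical values poles and sends every pole to one of the two others. Thus
  the critical orbits stay among the poles, and in the end every index of \<open>S\<close> is a
  pole.\<close>

lemma pole_count_stabilizes:
  fixes R :: "nat \<Rightarrow> nat set" and m :: "nat \<Rightarrow> nat"
  assumes R: "\<And>k. R k \<subseteq> {..n} - {j1, j2}" and card4: "\<And>k. card (R k) \<ge> 4"
    and pre: "\<And>k l. l \<in> R (Suc k) \<Longrightarrow> l \<notin> {m j1, m j2} \<Longrightarrow>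
      \<exists>r\<in>R k. \<exists>r'\<in>R k. r \<noteq> r' \<and> Q r r' \<and> m r = l \<and> m r' = l"
    and post: "\<And>i. i \<le> n \<Longrightarrow> i \<notin> {j1, j2} \<Longrightarrow> \<exists>k. i = (m ^^ Suc k) j1 \<or> i = (m ^^ Suc k) j2"
    and S: "S = {..n} - {j1, j2}"
  shows "card S = 4 \<and> {m j1, m j2} \<subseteq> S \<and> m ` S \<subseteq> S - {m j1, m j2} \<and>
    (\<forall>l\<in>S - {m j1, m j2}. \<exists>r\<in>S. \<exists>r'\<in>S. r \<noteq> r' \<and> Q r r' \<and> m r = l \<and> m r' = l)"
proof -
  let ?V = "{m j1, m j2}"
  have finR: "finite (R k)" for k using R[of k] finite_subset by blast
  define F where "F = (\<lambda>k l. {r \<in> R k. m r = l})"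
  have cardF: "card (F k l) \<ge> 2" if l: "l \<in> R (Suc k) - ?V" for k l
  proof -
    obtain r r' where "r \<in> R k" "r' \<in> R k" "r \<noteq> r'" "m r = l" "m r' = l" using pre[of l k] l by auto
    then have "{r, r'} \<subseteq> F k l" "card {r, r'} = 2" by (auto simp: F_def)
    then show ?thesis by (metis F_def card_mono finR finite_Collect_conjI finite_Int Collect_conj_eq Collect_mem_eq)
  qed
  have cardU: "card (\<Union>l\<in>R (Suc k) - ?V. F k l) \<ge> 2 * card (R (Suc k) - ?V)" for k
  proof -
    have "card (\<Union>l\<in>R (Suc k) - ?V. F k l) = (\<Sum>l\<in>R (Suc k) - ?V. card (F k l))"
      by (rule card_UN_disjoint) (auto simp: F_def finR)
    also have "\<dots> \<ge> (\<Sum>l\<in>R (Suc k) - ?V. 2)" by (rule sum_mono) (use cardF in blast)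
    finally show ?thesis by simp
  qed
  have sub: "(\<Union>l\<in>R (Suc k) - ?V. F k l) \<subseteq> R k" for k by (auto simp: F_def)
  have cardV: "card (R k) \<le> card (R k - ?V) + card (R k \<inter> ?V)" for k
    using finR[of k] by (metis card_Int_Diff add.commute le_refl)
  have V2: "card (R k \<inter> ?V) \<le> 2" for k
    by (rule order_trans[OF card_mono[of ?V]]) (auto simp: card_insert_if)
  have le: "2 * card (R (Suc k) - ?V) \<le> card (R k)" for k
    using cardU[of k] card_mono[OF finR sub, of k] by linarith
  define x where "x = (\<lambda>k. card (R k) - 4)"
  have x: "card (R k) = 4 + x k" for k using card4[of k] by (simp add: x_def)
  \<comment> \<open>Of the \<open>4 + x (Suc k)\<close> poles at most two are critical values; each
    of the others needs two poles of the previous step.\<close>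
  have half: "2 * x (Suc k) \<le> x k" for k
    using le[of k] cardV[of "Suc k"] V2[of "Suc k"] x[of k] x[of "Suc k"] by linarith
  have "x k * 2 ^ k \<le> x 0" for k
  proof (induction k)
    case (Suc k)
    have "x (Suc k) * 2 ^ Suc k = (2 * x (Suc k)) * 2 ^ k" by simp
    also have "\<dots> \<le> x k * 2 ^ k" using half[of k] by (intro mult_right_mono) auto
    finally show ?case using Suc by linarith
  qed simp
  then have x0: "x k = 0" if "k \<ge> x 0" for k
    using that less_exp[of k] by (metis le_less_trans leD mult_le_mono1 mult_1 less_one not_le order_trans)
  have V: "?V \<subseteq> R (Suc k)" and mR: "m ` R k \<subseteq> R (Suc k) - ?V" if "k \<ge> x 0" for k
  proof -
    have c4: "card (R k) = 4" "card (R (Suc k)) = 4" using x x0 that by auto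
    have "card (R (Suc k) \<inter> ?V) \<ge> 2" using le[of k] c4 cardV[of "Suc k"] by linarith
    moreover have "card ?V \<le> 2" by (auto simp: card_insert_if)
    ultimately have "R (Suc k) \<inter> ?V = ?V"
      by (intro card_subset_eq) (auto intro: le_antisym card_mono)
    then show "?V \<subseteq> R (Suc k)" by blast
    have "card (R (Suc k) - ?V) \<ge> 2" using c4 cardV[of "Suc k"] V2[of "Suc k"] by linarith
    then have "card (\<Union>l\<in>R (Suc k) - ?V. F k l) = card (R k)"
      using cardU[of k] card_mono[OF finR sub, of k] c4 by linarith
    then have "(\<Union>l\<in>R (Suc k) - ?V. F k l) = R k" using card_subset_eq[OF finR sub] by blast
    then show "m ` R k \<subseteq> R (Suc k) - ?V" by (force simp: F_def)
  qed
  \<comment> \<open>By \<open>V\<close> the critical values are poles from step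
    \<open>x 0 + 1\<close> on, and by \<open>mR\<close> their images are poles one step
    later.\<close>
  have fw: "(m ^^ Suc i) j1 \<in> R k \<and> (m ^^ Suc i) j2 \<in> R k" if "k \<ge> x 0 + Suc i" for i k
    using that
  proof (induction i arbitrary: k)
    case 0
    then show ?case using V[of "k - 1"] by (cases k) auto
  next
    case (Suc i)
    then obtain k' where k: "k = Suc k'" by (cases k) auto
    have "(m ^^ Suc i) j1 \<in> R k' \<and> (m ^^ Suc i) j2 \<in> R k'" using Suc k by simp
    then show ?case using mR[of k'] Suc.prems k by auto
  qed
  have "\<exists>N. \<forall>k\<ge>N. i \<in> R k" if i: "i \<in> S" for i
  proof -
    have "i \<le> n" "i \<notin> {j1, j2}" using i S by auto
    then obtain k where "i = (m ^^ Suc k) j1 \<or> i = (m ^^ Suc k) j2" using post by blast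
    then show ?thesis using fw by metis
  qed
  then obtain N where N: "\<And>i k. i \<in> S \<Longrightarrow> k \<ge> N i \<Longrightarrow> i \<in> R k" by metis
  define K where "K = x 0 + (\<Sum>i\<in>S. N i)"
  have finS: "finite S" by (simp add: S)
  have RS: "R k = S" if "k \<ge> K" for k
  proof
    show "R k \<subseteq> S" using R S by simp
    show "S \<subseteq> R k"
    proof
      fix i assume i: "i \<in> S"
      then have "N i \<le> (\<Sum>i\<in>S. N i)" using finS by (intro member_le_sum) auto
      then show "i \<in> R k" using N[OF i] that by (simp add: K_def)
    qed
  qed
  have K0: "K \<ge> x 0" by (simp add: K_def)
  have "card S = 4" using x[of K] x0[OF K0] RS[of K] by simp
  moreover have "?V \<subseteq> S" using V[OF K0] RS[of "Suc K"] by simp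
  moreover have "m ` S \<subseteq> S - ?V" using mR[OF K0] RS[of "Suc K"] RS[of K] by simp
  moreover have "\<forall>l\<in>S - ?V. \<exists>r\<in>S. \<exists>r'\<in>S. r \<noteq> r' \<and> Q r r' \<and> m r = l \<and> m r' = l"
    using pre[of _ K] RS[of "Suc K"] RS[of K] by simp
  ultimately show ?thesis by blast
qed

section \<open>The push-forward as a linear map on coefficients\<close>

context postcritical_data begin

lemma finite_J: "finite J" by (simp add: J_def)

lemma J_iff: "j \<in> J \<longleftrightarrow> j \<le> n \<and> j \<noteq> j1 \<and> j \<noteq> j2 \<and> j \<noteq> a" by (auto simp: J_def)

abbreviation unit_vec :: "nat \<Rightarrow> nat \<Rightarrow> 'b::zero_neq_one" where "unit_vec i k \<equiv> of_bool (k = i)"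

lemma tangent_expand:
  fixes v :: "nat \<Rightarrow> 'b::field_char_0"
  assumes v: "\<And>i. i \<le> n \<Longrightarrow> i \<notin> J \<Longrightarrow> v i = 0" and j: "j \<le> n"
  shows "tangent x v j = (\<Sum>i\<in>J. v i * tangent x (unit_vec i) j)"
proof -
  have vk: "v k = (\<Sum>i\<in>J. v i * of_bool (k = i))" if "k \<le> n" for k
    using v[OF that] finite_J by (simp add: of_bool_def if_distrib[of "\<lambda>t. v _ * t"] sum.delta cong: if_cong)
  have D: "dlog_bracket j2 x v r s = (\<Sum>i\<in>J. v i * dlog_bracket j2 x (unit_vec i) r s)" if "r \<le> n" "s \<le> n" for r s
  proof -
    have "bracket j2 v r s = (\<Sum>i\<in>J. v i * bracket j2 (unit_vec i) r s)"
      unfolding bracket_def using vk[OF that(1)] vk[OF that(2)]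
      by (simp add: right_diff_distrib sum_subtractf flip: sum_distrib_right mult.assoc)
    then show ?thesis by (simp add: dlog_bracket_def sum_divide_distrib)
  qed
  have mj: "m j \<le> n" using m_le j by simp
  show ?thesis
    unfolding tangent_def using mj ma
    by (simp add: D sum_distrib_left right_diff_distrib distrib_left sum_subtractf sum.distrib mult.assoc mult.left_commute)
qed

lemma tangent_of_real: "tangent (\<lambda>i. of_real (x i)) (\<lambda>i. of_real (v i)) j = (of_real (tangent x v j) :: 'b::{field_char_0, real_field})"
  by (simp add: tangent_def dlog_bracket_def bracket_def)

lemma tangent_pc_unit: "tangent pc (unit_vec i) j = of_real (tangent p (unit_vec i) j)"
proof -
  have "(\<lambda>k. of_real (unit_vec i k)) = (unit_vec i :: nat \<Rightarrow> complex)" by auto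
  then show ?thesis
    using tangent_of_real[of p "unit_vec i" j, where 'b = complex] by (simp add: pc_def[abs_def])
qed

text \<open>The negatives are included to have one pole set for a differential at \<open>z\<close>
  and at \<open>- z\<close>.\<close>

definition Z :: "complex set" where "Z = pc ` ({..n} - {j2}) \<union> uminus ` pc ` ({..n} - {j2})"

lemma Z: "finite Z" "uminus ` Z = Z" "Z \<subseteq> \<real>"
  by (auto simp: Z_def pc_def image_Un image_image)

lemma pc_in_Z: "i \<le> n \<Longrightarrow> i \<noteq> j2 \<Longrightarrow> pc i \<in> Z" by (auto simp: Z_def)

lemma zero_in_Z: "0 \<in> Z" using pc_in_Z[of j1] idx pc_simps by simp

text \<open>Residues of the combination of the \<open>qd _ j\<close> with coefficients
  \<open>c j\<close>, as given by \<open>qd_partial_fractions\<close>.\<close>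

definition pole_coeff :: "(nat \<Rightarrow> real) \<Rightarrow> complex \<Rightarrow> complex" where
  "pole_coeff c \<zeta> = (\<Sum>j\<in>J. of_real (c j) * (of_bool (\<zeta> = pc j) - of_bool (\<zeta> = 0)
     - pc j / pc a * (of_bool (\<zeta> = pc a) - of_bool (\<zeta> = 0))))"

definition qdiff :: "(nat \<Rightarrow> real) \<Rightarrow> complex \<Rightarrow> complex" where
  "qdiff c = simple_poles Z (pole_coeff c)"

text \<open>The transpose of the derivative \<open>tangent\<close>, acting on row vectors.\<close>

definition row_action :: "(nat \<Rightarrow> real) \<Rightarrow> nat \<Rightarrow> real" where
  "row_action c i = (\<Sum>j\<in>J. c j * tangent p (unit_vec i) j)"

definition L1 :: "(nat \<Rightarrow> real) \<Rightarrow> ennreal" where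
  "L1 c = (\<integral>\<^sup>+z. ennreal (cmod (qdiff c z)) \<partial>lborel)"

lemma sum_Z: "\<zeta> \<in> Z \<Longrightarrow> (\<Sum>\<eta>\<in>Z. of_bool (\<eta> = \<zeta>) * g \<eta>) = (g \<zeta> :: complex)"
  using Z(1) by (simp add: of_bool_def if_distrib[of "\<lambda>t. t * g _"] sum.delta' cong: if_cong)

text \<open>One identity with three uses. The bracket on the right is the error of linear
  interpolation between 0 and \<open>pc a\<close>; it vanishes for \<open>g = 1\<close> and for the
  identity, which yields the moment conditions, and for the Cauchy kernel it is
  \<open>qd\<close>.\<close>

lemma sum_pole_coeff:
  "(\<Sum>\<zeta>\<in>Z. pole_coeff c \<zeta> * g \<zeta>) = (\<Sum>j\<in>J. of_real (c j) * (g (pc j) - g 0 - pc j / pc a * (g (pc a) - g 0)))"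
proof -
  have "(\<Sum>\<zeta>\<in>Z. pole_coeff c \<zeta> * g \<zeta>) = (\<Sum>j\<in>J. of_real (c j) * (\<Sum>\<zeta>\<in>Z. (of_bool (\<zeta> = pc j) - of_bool (\<zeta> = 0)
     - pc j / pc a * (of_bool (\<zeta> = pc a) - of_bool (\<zeta> = 0))) * g \<zeta>))"
    unfolding pole_coeff_def sum_distrib_right by (subst sum.swap) (simp add: sum_distrib_left mult.assoc)
  also have "\<dots> = (\<Sum>j\<in>J. of_real (c j) * (g (pc j) - g 0 - pc j / pc a * (g (pc a) - g 0)))"
  proof (rule sum.cong[OF refl])
    fix j assume "j \<in> J"
    then have "pc j \<in> Z" "pc a \<in> Z" using pc_in_Z idx by (auto simp: J_iff)
    have "(\<Sum>\<zeta>\<in>Z. (of_bool (\<zeta> = pc j) - of_bool (\<zeta> = 0) - pc j / pc a * (of_bool (\<zeta> = pc a) - of_bool (\<zeta> = 0))) * g \<zeta>)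
      = (\<Sum>\<zeta>\<in>Z. of_bool (\<zeta> = pc j) * g \<zeta>) - (\<Sum>\<zeta>\<in>Z. of_bool (\<zeta> = 0) * g \<zeta>)
        - pc j / pc a * ((\<Sum>\<zeta>\<in>Z. of_bool (\<zeta> = pc a) * g \<zeta>) - (\<Sum>\<zeta>\<in>Z. of_bool (\<zeta> = 0) * g \<zeta>))"
      by (simp add: left_diff_distrib right_diff_distrib sum_subtractf sum_distrib_left mult.assoc)
    then show "of_real (c j) * (\<Sum>\<zeta>\<in>Z. (of_bool (\<zeta> = pc j) - of_bool (\<zeta> = 0) - pc j / pc a * (of_bool (\<zeta> = pc a) - of_bool (\<zeta> = 0))) * g \<zeta>)
      = of_real (c j) * (g (pc j) - g 0 - pc j / pc a * (g (pc a) - g 0))"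
      using \<open>pc j \<in> Z\<close> \<open>pc a \<in> Z\<close> zero_in_Z by (simp only: sum_Z)
  qed
  finally show ?thesis .
qed

lemma pole_coeff_sums: "(\<Sum>\<zeta>\<in>Z. pole_coeff c \<zeta>) = 0" "(\<Sum>\<zeta>\<in>Z. \<zeta> * pole_coeff c \<zeta>) = 0"
  using sum_pole_coeff[of c "\<lambda>_. 1"] sum_pole_coeff[of c "\<lambda>\<zeta>. \<zeta>"] pc_a by (simp_all add: mult.commute)

lemma qdiff_eq:
  assumes "Im w \<noteq> 0"
  shows "qdiff c w = (\<Sum>j\<in>J. of_real (c j) * qd w j)"
proof -
  have nw: "w \<noteq> 0" "w \<noteq> pc i" for i using assms by (auto simp: pc_def)
  have "qdiff c w = (\<Sum>\<zeta>\<in>Z. pole_coeff c \<zeta> * (1 / (w - \<zeta>)))"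
    by (simp add: qdiff_def simple_poles_def)
  also have "\<dots> = (\<Sum>j\<in>J. of_real (c j) * qd w j)"
    unfolding sum_pole_coeff by (rule sum.cong[OF refl]) (simp add: qd_partial_fractions[OF nw(1) nw(2) nw(2)] J_iff)
  finally show ?thesis .
qed

text \<open>For fixed \<open>w\<close> the vector \<open>qd w\<close> vanishes at the normalized
  indices, so the derivative can be expanded in unit vectors. Exchanging the two sums after
  \<open>pushforward_qd\<close> moves the matrix from the vectors to the coefficients,
  transposed.\<close>

lemma qdiff_pushforward:
  assumes z: "z \<in> quadrants"
  shows "(deriv qmap z)\<^sup>2 * qdiff (row_action c) (qmap z) = qdiff c z + qdiff c (- z)"
proof -
  have fz: "Im (qmap z) \<noteq> 0" using qmap_image z by blast
  have ex: "tangent pc (qd w) j = (\<Sum>i\<in>J. qd w i * of_real (tangent p (unit_vec i) j))" if "j \<le> n" for w j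
  proof -
    have "tangent pc (qd w) j = (\<Sum>i\<in>J. qd w i * tangent pc (unit_vec i) j)"
      by (rule tangent_expand[OF _ that]) (auto simp: J_iff qd_def pc_simps)
    then show ?thesis by (simp add: tangent_pc_unit)
  qed
  have "qdiff (row_action c) (qmap z) = (\<Sum>i\<in>J. (\<Sum>j\<in>J. of_real (c j) * of_real (tangent p (unit_vec i) j)) * qd (qmap z) i)"
    by (simp add: qdiff_eq[OF fz] row_action_def)
  also have "\<dots> = (\<Sum>j\<in>J. of_real (c j) * (\<Sum>i\<in>J. qd (qmap z) i * of_real (tangent p (unit_vec i) j)))"
    unfolding sum_distrib_right by (subst sum.swap) (simp add: sum_distrib_left mult_ac)
  also have "\<dots> = (\<Sum>j\<in>J. of_real (c j) * tangent pc (qd (qmap z)) j)"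
    by (rule sum.cong[OF refl]) (simp add: ex J_iff)
  finally have "(deriv qmap z)\<^sup>2 * qdiff (row_action c) (qmap z) =
    (\<Sum>j\<in>J. of_real (c j) * ((deriv qmap z)\<^sup>2 * tangent pc (qd (qmap z)) j))"
    by (simp add: sum_distrib_left mult.left_commute)
  also have "\<dots> = (\<Sum>j\<in>J. of_real (c j) * (qd z j + qd (- z) j))"
    by (rule sum.cong[OF refl]) (simp add: pushforward_qd[OF z] J_iff)
  also have "\<dots> = qdiff c z + qdiff c (- z)"
    using z by (simp add: qdiff_eq distrib_left sum.distrib)
  finally show ?thesis .
qed

lemma qdiff_cont: "continuous_on {z. Im z \<noteq> 0} (qdiff c)"
proof -
  have "{z. Im z \<noteq> 0} \<inter> Z = {}" using Z(3) by (auto simp: complex_is_Real_iff)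
  then show ?thesis unfolding qdiff_def
    by (intro holomorphic_on_imp_continuous_on simple_poles_holomorphic)
qed

lemma qdiff_measurable: "qdiff c \<in> borel_measurable borel"
  unfolding qdiff_def by (rule simple_poles_measurable)

lemma L1_finite: "L1 c < \<infinity>"
  unfolding L1_def qdiff_def by (rule simple_poles_integrable[OF Z(1) pole_coeff_sums])

lemma L1_row_action: "L1 (row_action c) \<le> L1 c"
  unfolding L1_def by (rule L1_contraction[OF qdiff_measurable qdiff_cont qdiff_cont qdiff_pushforward])

lemma pole_coeff_odd:
  assumes "L1 (row_action c) = L1 c" "\<zeta> \<in> Z"
  shows "pole_coeff c (- \<zeta>) = - pole_coeff c \<zeta>"
proof (rule simple_poles_even[OF Z _ assms(2)])
  fix z assume "z \<in> quadrants"
  then show "cmod (simple_poles Z (pole_coeff c) z + simple_poles Z (pole_coeff c) (- z)) =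
    cmod (simple_poles Z (pole_coeff c) z) + cmod (simple_poles Z (pole_coeff c) (- z))"
    using L1_equality[OF qdiff_measurable qdiff_cont qdiff_cont qdiff_pushforward, of c z] assms(1) L1_finite[of c]
    by (simp add: L1_def qdiff_def)
qed

lemma pole_coeff_support:
  assumes "pole_coeff c \<zeta> \<noteq> 0"
  obtains r where "r \<le> n" "r \<noteq> j2" "\<zeta> = pc r"
proof -
  have "\<exists>r. r \<le> n \<and> r \<noteq> j2 \<and> \<zeta> = pc r"
  proof (rule ccontr)
    assume H: "\<not> ?thesis"
    have z: "\<zeta> \<noteq> 0" "\<zeta> \<noteq> pc a" using H idx pc_simps by auto
    have "pole_coeff c \<zeta> = 0"
      unfolding pole_coeff_def by (rule sum.neutral) (use H z in \<open>auto simp: J_iff\<close>)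
    then show False using assms by simp
  qed
  then show ?thesis using that by blast
qed

definition pole_idx :: "(nat \<Rightarrow> real) \<Rightarrow> nat set" where
  "pole_idx c = {r. r \<le> n \<and> r \<noteq> j2 \<and> pole_coeff c (pc r) \<noteq> 0}"

lemma pole_idx_support:
  assumes "pole_coeff c \<zeta> \<noteq> 0"
  obtains r where "r \<in> pole_idx c" "\<zeta> = pc r"
proof -
  obtain r where "r \<le> n" "r \<noteq> j2" "\<zeta> = pc r" using assms by (rule pole_coeff_support)
  then show ?thesis using that[of r] assms by (simp add: pole_idx_def)
qed

lemma pole_idx_neg:
  assumes iso: "L1 (row_action c) = L1 c" and r: "r \<in> pole_idx c"
  obtains r' where "r' \<in> pole_idx c" "pc r' = - pc r"
proof -
  have "pole_coeff c (- pc r) \<noteq> 0"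
    using pole_coeff_odd[OF iso pc_in_Z, of r] r by (auto simp: pole_idx_def)
  then obtain r' where "r' \<in> pole_idx c" "- pc r = pc r'" by (rule pole_idx_support)
  then show ?thesis using that[of r'] by simp
qed

lemma pole_idx_j1:
  assumes iso: "L1 (row_action c) = L1 c" shows "j1 \<notin> pole_idx c"
  using pole_coeff_odd[OF iso zero_in_Z] pc_simps by (auto simp: pole_idx_def)

text \<open>Odd residues come in pairs \<open>\<plusminus> u\<close>. With one pair only, the first
  moment would be twice \<open>u\<close> times its residue, which is not 0. So there are at least
  two pairs.\<close>

lemma pole_idx_card:
  assumes iso: "L1 (row_action c) = L1 c" and "L1 c \<noteq> 0"
  shows "card (pole_idx c) \<ge> 4"
proof -
  have fin: "finite (pole_idx c)" by (simp add: pole_idx_def)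
  have pc0: "pc i \<noteq> 0" if "i \<in> pole_idx c" for i
  proof
    assume "pc i = 0"
    then have "i = j1" using pc_inj[of i j1] that idx pc_simps by (auto simp: pole_idx_def)
    then show False using that pole_idx_j1[OF iso] by simp
  qed
  have "\<exists>\<zeta>. pole_coeff c \<zeta> \<noteq> 0"
  proof (rule ccontr)
    assume "\<not> ?thesis"
    then have "qdiff c z = 0" for z by (simp add: qdiff_def simple_poles_def)
    then show False using \<open>L1 c \<noteq> 0\<close> by (simp add: L1_def)
  qed
  then obtain r where r: "r \<in> pole_idx c" using pole_idx_support by blast
  obtain r' where r': "r' \<in> pole_idx c" "pc r' = - pc r" using pole_idx_neg[OF iso r] .
  have "\<exists>s\<in>pole_idx c. s \<noteq> r \<and> s \<noteq> r'"
  proof (rule ccontr)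
    assume H: "\<not> (\<exists>s\<in>pole_idx c. s \<noteq> r \<and> s \<noteq> r')"
    have supp: "\<zeta> = pc r \<or> \<zeta> = pc r'" if nz: "pole_coeff c \<zeta> \<noteq> 0" for \<zeta>
    proof -
      obtain i where "i \<in> pole_idx c" "\<zeta> = pc i" using nz by (rule pole_idx_support)
      then have "i = r \<or> i = r'" using H by auto
      then show "\<zeta> = pc r \<or> \<zeta> = pc r'" using \<open>\<zeta> = pc i\<close> by auto
    qed
    have ne: "pc r \<noteq> pc r'" using r'(2) pc0[OF r] by (auto simp: complex_eq_iff)
    have inZ: "pc r \<in> Z" "pc r' \<in> Z" using r r'(1) pc_in_Z by (auto simp: pole_idx_def)
    have "0 = (\<Sum>\<zeta>\<in>Z. \<zeta> * pole_coeff c \<zeta>)" by (simp add: pole_coeff_sums)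
    also have "\<dots> = (\<Sum>\<zeta>\<in>{pc r, pc r'}. \<zeta> * pole_coeff c \<zeta>)"
      by (rule sum.mono_neutral_right) (use Z(1) inZ supp in auto)
    also have "\<dots> = pc r * pole_coeff c (pc r) + pc r' * pole_coeff c (pc r')" using ne by simp
    also have "\<dots> = 2 * pc r * pole_coeff c (pc r)"
      using pole_coeff_odd[OF iso inZ(1)] r'(2) by simp
    finally show False using pc0[OF r] r by (simp add: pole_idx_def)
  qed
  then obtain s where s: "s \<in> pole_idx c" "s \<noteq> r" "s \<noteq> r'" by blast
  obtain s' where s': "s' \<in> pole_idx c" "pc s' = - pc s" using pole_idx_neg[OF iso s(1)] .
  have inj: "pc i = pc k \<longleftrightarrow> i = k" if "i \<in> pole_idx c" "k \<in> pole_idx c" for i k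
    using that pc_inj by (auto simp: pole_idx_def)
  have "r \<noteq> r'" "s' \<noteq> s" using r'(2) s'(2) pc0[OF r] pc0[OF s(1)] by (auto simp: complex_eq_iff)
  moreover have "s' \<noteq> r" "s' \<noteq> r'" using s s' r r' inj by (metis add.inverse_inverse)+
  ultimately have "card {r, r', s, s'} = 4" using s by auto
  moreover have "{r, r', s, s'} \<subseteq> pole_idx c" using r r' s s' by auto
  ultimately show ?thesis using card_mono[OF fin] by metis
qed

text \<open>Let \<open>z0\<close> be a preimage of the pole. The differential of \<open>c\<close> is
  even, so the pulled back differential is twice that of \<open>c\<close>, and pulling back
  multiplies a residue by the derivative at \<open>z0\<close>, which is not 0. So \<open>c\<close>
  has a pole at \<open>z0\<close>, which is therefore a marked point, and one at \<open>- z0\<close>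
  by symmetry.\<close>

lemma pole_idx_preimage:
  assumes iso: "L1 (row_action c) = L1 c" and l: "l \<in> pole_idx (row_action c)" "l \<noteq> m j1" "l \<noteq> m j2"
  shows "\<exists>r\<in>pole_idx c. \<exists>r'\<in>pole_idx c. r \<noteq> r' \<and> p r' = - p r \<and> m r = l \<and> m r' = l"
proof -
  let ?c' = "row_action c"
  have ln: "l \<le> n" "l \<noteq> j2" "pole_coeff ?c' (pc l) \<noteq> 0" using l by (auto simp: pole_idx_def)
  define \<xi> where "\<xi> = pc l"
  have "rA - rC * p l = \<kappa> * br (m j2) l" "rD * p l - rB = - br (m j1) l"
    using ln by (simp_all add: rA_def rB_def rC_def rD_def bracket_def algebra_simps)
  then have "rA - rC * p l \<noteq> 0" "rD * p l - rB \<noteq> 0"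
    using \<kappa>_nonzero br_nonzero ma ln l by auto
  moreover have "cA - cC * \<xi> = of_real (rA - rC * p l)" "cD * \<xi> - cB = of_real (rD * p l - rB)"
    by (simp_all add: cA_def cB_def cC_def cD_def \<xi>_def pc_def)
  ultimately have nz: "cA - cC * \<xi> \<noteq> 0" "cD * \<xi> - cB \<noteq> 0" by (simp_all only: of_real_eq_0_iff not_False_eq_True)
  \<comment> \<open>The equation \<open>qmap z = \<xi>\<close> solved for the square of
    \<open>z\<close>. Numerator and denominator are nonzero because \<open>l\<close> is neither of
    the critical values.\<close>
  define u where "u = (cD * \<xi> - cB) / (cA - cC * \<xi>)"
  define z0 where "z0 = csqrt u"
  have u0: "u \<noteq> 0" using nz by (simp add: u_def)
  have z0: "z0\<^sup>2 = u" "z0 \<noteq> 0" "Re z0 \<ge> 0"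
    using u0 csqrt_principal[of u] by (auto simp: z0_def)
  have "den z0 = Det / (cA - cC * \<xi>)"
    unfolding z0(1) u_def Det_def using nz by (simp add: divide_simps) (simp add: algebra_simps)
  then have d0: "den z0 \<noteq> 0" using nz Det_nonzero by simp
  have num0: "num z0 = \<xi> * den z0"
    unfolding z0(1) u_def using nz by (simp add: divide_simps) (simp add: algebra_simps)
  have f0: "qmap z0 = \<xi>" using d0 num0 by (simp add: qmap_eq)
  define D where "D = Det * (2 * z0) / (den z0)\<^sup>2"
  have D0: "D \<noteq> 0" using Det_nonzero z0 d0 by (simp add: D_def)
  have der: "(qmap has_field_derivative D) (at z0)" unfolding D_def by (rule deriv_qmap[OF d0])
  \<comment> \<open>The push-forward identity is available in \<open>quadrants\<close> only, while
    \<open>z0\<close> may lie on the boundary. Moving away from both axes, in the direction given by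
    the sign of \<open>Im z0\<close>, gives a sequence inside.\<close>
  define dir where "dir = (if Im z0 \<ge> 0 then 1 + \<i> else 1 - \<i>)"
  define s where "s = (\<lambda>k. z0 + of_real (inverse (real (Suc k))) * dir)"
  have sq: "s k \<in> quadrants" for k
  proof -
    define t where "t = inverse (real (Suc k))"
    have t: "t > 0" by (simp add: t_def)
    have "Re (s k) = Re z0 + t" "Im (s k) = (if Im z0 \<ge> 0 then Im z0 + t else Im z0 - t)"
      unfolding s_def t_def[symmetric] by (auto simp: dir_def)
    then show ?thesis using t z0(3) by auto
  qed
  have slim: "s \<longlonglongrightarrow> z0"
  proof -
    have "(\<lambda>k. z0 + of_real (inverse (real (Suc k))) * dir) \<longlonglongrightarrow> z0 + of_real 0 * dir"
      by (intro tendsto_intros LIMSEQ_inverse_real_of_nat)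
    then show ?thesis by (simp add: s_def)
  qed
  have sne: "s k \<noteq> z0" for k by (auto simp: s_def dir_def complex_eq_iff)
  have flt: "filterlim s (at z0) sequentially"
    using slim sne by (simp add: filterlim_at)
  have fIm: "Im (qmap (s k)) \<noteq> 0" for k using qmap_image sq by blast
  have fne: "qmap (s k) \<noteq> \<xi>" for k using fIm[of k] by (auto simp: \<xi>_def pc_def)
  have flim: "(\<lambda>k. qmap (s k)) \<longlonglongrightarrow> \<xi>"
    using isCont_tendsto_compose[OF DERIV_isCont[OF der] slim] f0 by simp
  have fflt: "filterlim (\<lambda>k. qmap (s k)) (at \<xi>) sequentially"
    using flim fne by (simp add: filterlim_at)
  have lim1: "(\<lambda>k. (s k - z0) * qdiff c (s k)) \<longlonglongrightarrow> (if z0 \<in> Z then pole_coeff c z0 else 0)"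
    unfolding qdiff_def by (rule filterlim_compose[OF simple_poles_residue[OF Z(1)] flt])
  have "(\<lambda>k. (qmap (s k) - \<xi>) * qdiff ?c' (qmap (s k))) \<longlonglongrightarrow> (if \<xi> \<in> Z then pole_coeff ?c' \<xi> else 0)"
    unfolding qdiff_def by (rule filterlim_compose[OF simple_poles_residue[OF Z(1)] fflt])
  then have lim2: "(\<lambda>k. (qmap (s k) - \<xi>) * qdiff ?c' (qmap (s k))) \<longlonglongrightarrow> pole_coeff ?c' \<xi>"
    using pc_in_Z ln by (simp add: \<xi>_def)
  have "((\<lambda>z. (qmap z - qmap z0) / (z - z0)) \<longlongrightarrow> D) (at z0)"
    using der by (simp add: has_field_derivative_iff)
  then have lim3: "(\<lambda>k. (qmap (s k) - \<xi>) / (s k - z0)) \<longlonglongrightarrow> D"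
    unfolding f0[symmetric] by (rule filterlim_compose[OF _ flt])
  have "(\<lambda>k. Det * (2 * s k) / (den (s k))\<^sup>2) \<longlonglongrightarrow> D"
    unfolding D_def using d0 by (intro tendsto_intros slim) auto
  then have "(\<lambda>k. (Det * (2 * s k) / (den (s k))\<^sup>2)\<^sup>2 * ((qmap (s k) - \<xi>) * qdiff ?c' (qmap (s k))) / ((qmap (s k) - \<xi>) / (s k - z0)))
    \<longlonglongrightarrow> D\<^sup>2 * pole_coeff ?c' \<xi> / D"
    by (intro tendsto_intros lim2 lim3 D0)
  moreover have "(Det * (2 * s k) / (den (s k))\<^sup>2)\<^sup>2 * ((qmap (s k) - \<xi>) * qdiff ?c' (qmap (s k))) / ((qmap (s k) - \<xi>) / (s k - z0))
    = 2 * ((s k - z0) * qdiff c (s k))" for k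
  proof -
    have even: "qdiff c (- s k) = qdiff c (s k)"
    proof -
      have "qdiff c (- s k) = simple_poles Z (\<lambda>\<zeta>. - pole_coeff c (- \<zeta>)) (s k)"
        unfolding qdiff_def by (rule simple_poles_minus[OF Z(2)])
      also have "\<dots> = qdiff c (s k)"
        unfolding qdiff_def simple_poles_def by (rule sum.cong[OF refl]) (simp add: pole_coeff_odd[OF iso])
      finally show ?thesis .
    qed
    have "deriv qmap (s k) = Det * (2 * s k) / (den (s k))\<^sup>2"
      by (rule DERIV_imp_deriv[OF deriv_qmap[OF den_nonzero[OF sq]]])
    then have "(Det * (2 * s k) / (den (s k))\<^sup>2)\<^sup>2 * qdiff ?c' (qmap (s k)) = 2 * qdiff c (s k)"
      using qdiff_pushforward[OF sq[of k], of c] even by simp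
    moreover have "X * (F * Q) / (F / S) = S * (X * Q)" if "F \<noteq> 0" for X F Q S :: complex
      using that by simp
    ultimately show ?thesis using fne[of k] by simp
  qed
  ultimately have "(\<lambda>k. 2 * ((s k - z0) * qdiff c (s k))) \<longlonglongrightarrow> D\<^sup>2 * pole_coeff ?c' \<xi> / D" by simp
  moreover have "(\<lambda>k. 2 * ((s k - z0) * qdiff c (s k))) \<longlonglongrightarrow> 2 * (if z0 \<in> Z then pole_coeff c z0 else 0)"
    by (intro tendsto_intros lim1)
  ultimately have "2 * (if z0 \<in> Z then pole_coeff c z0 else 0) = D\<^sup>2 * pole_coeff ?c' \<xi> / D"
    using LIMSEQ_unique by blast
  moreover have "D\<^sup>2 * pole_coeff ?c' \<xi> / D \<noteq> 0" using D0 ln by (simp add: \<xi>_def)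
  ultimately have "pole_coeff c z0 \<noteq> 0" by (auto split: if_splits)
  then obtain r where r: "r \<le> n" "r \<noteq> j2" "z0 = pc r" by (rule pole_coeff_support)
  then have rp: "r \<in> pole_idx c" using \<open>pole_coeff c z0 \<noteq> 0\<close> by (simp add: pole_idx_def)
  obtain r' where r': "r' \<in> pole_idx c" "pc r' = - pc r" using pole_idx_neg[OF iso rp] .
  have ml: "m i = l" if "i \<in> pole_idx c" "(pc i)\<^sup>2 = z0\<^sup>2" for i
  proof -
    have i: "i \<le> n" "i \<noteq> j1" "i \<noteq> j2" using that pole_idx_j1[OF iso] by (auto simp: pole_idx_def)
    have "\<xi> * den z0 * of_bool (m i \<noteq> j2) = pc (m i) * den z0"
      using pc_conj[OF i] num0 that(2) by simp
    then have "\<xi> * of_bool (m i \<noteq> j2) = pc (m i)" using d0 by simp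
    moreover have "m i \<noteq> j2"
    proof
      assume "m i = j2"
      then show False using calculation pc_simps by simp
    qed
    ultimately have "pc (m i) = pc l" "m i \<noteq> j2" by (simp_all add: \<xi>_def)
    then show ?thesis using pc_inj m_le[OF i(1)] ln by blast
  qed
  have "r \<noteq> r'" using r'(2) z0(2) r(3) by (auto simp: complex_eq_iff)
  moreover have "p r' = - p r" using r'(2) by (simp add: pc_def flip: of_real_minus)
  moreover have "m r = l" using ml[OF rp] r by simp
  moreover have "m r' = l" using ml[OF r'(1)] r r'(2) by simp
  ultimately show ?thesis using rp r' by blast
qed

theorem isometric_imp_exceptional:
  assumes iso: "\<And>k. L1 ((row_action ^^ k) c) = L1 c" and "L1 c \<noteq> 0"
    and post: "\<And>i. i \<le> n \<Longrightarrow> i \<notin> {j1, j2} \<Longrightarrow> \<exists>k. i = (m ^^ Suc k) j1 \<or> i = (m ^^ Suc k) j2"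
    and S: "S = {..n} - {j1, j2}"
  shows "card S = 4 \<and> {m j1, m j2} \<subseteq> S \<and> m ` S \<subseteq> S - {m j1, m j2} \<and>
    (\<forall>l\<in>S - {m j1, m j2}. \<exists>r\<in>S. \<exists>r'\<in>S. r \<noteq> r' \<and> p r' = - p r \<and> m r = l \<and> m r' = l)"
proof -
  define R where "R = (\<lambda>k. pole_idx ((row_action ^^ k) c))"
  have iso': "L1 (row_action ((row_action ^^ k) c)) = L1 ((row_action ^^ k) c)" for k
    using iso[of "Suc k"] iso[of k] by simp
  have sub: "R k \<subseteq> {..n} - {j1, j2}" for k
    using pole_idx_j1[OF iso'] by (auto simp: R_def pole_idx_def)
  have four: "4 \<le> card (R k)" for k
    unfolding R_def using pole_idx_card[OF iso'] iso[of k] assms(2) by simp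
  have pre: "\<exists>r\<in>R k. \<exists>r'\<in>R k. r \<noteq> r' \<and> p r' = - p r \<and> m r = l \<and> m r' = l"
    if "l \<in> R (Suc k)" "l \<notin> {m j1, m j2}" for k l
    using pole_idx_preimage[OF iso', of l k] that by (simp add: R_def)
  show ?thesis
    by (rule pole_count_stabilizes[where R = R and Q = "\<lambda>r r'. p r' = - p r", OF sub four pre post S])
qed

end

section \<open>Holomorphic motions and equicontinuity\<close>

text \<open>Circles of radius 1/4 about points of modulus at most 1/4 stay where \<open>C\<close> is
  a bound. Cauchy's inequality on them bounds the first two derivatives by \<open>4 * C\<close> and
  \<open>2 * 16 * C\<close>, the constants of the Taylor estimates.\<close>

lemma bounded_holomorphic_estimates:
  assumes f: "f holomorphic_on ball 0 1" and C: "\<And>z. cmod z \<le> 1/2 \<Longrightarrow> cmod (f z) \<le> C"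
  shows "cmod (deriv f 0) \<le> 4 * C"
    and "cmod t \<le> 1/4 \<Longrightarrow> cmod (f t - f 0) \<le> 4 * C * cmod t"
    and "cmod t \<le> 1/4 \<Longrightarrow> cmod (f t - f 0 - t * deriv f 0) \<le> 32 * C * (cmod t)\<^sup>2"
proof -
  have bound: "cmod ((deriv ^^ k) f z) \<le> fact k * C / (1/4) ^ k" if "cmod z \<le> 1/4" for k z
  proof (rule Cauchy_inequality)
    have sub: "cball z (1/4) \<subseteq> ball 0 1"
    proof
      fix w assume "w \<in> cball z (1/4)"
      then have "cmod (w - z) \<le> 1/4" by (simp add: dist_norm norm_minus_commute)
      then have "cmod w \<le> 1/2" using that norm_triangle_ineq[of "w - z" z] by simp
      then show "w \<in> ball 0 1" by simp
    qed
    show "f holomorphic_on ball z (1/4)" using f sub by (meson ball_subset_cball holomorphic_on_subset order_trans)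
    show "continuous_on (cball z (1/4)) f"
      using f sub by (meson holomorphic_on_imp_continuous_on continuous_on_subset)
    show "cmod (f x) \<le> C" if "cmod (z - x) = 1/4" for x
      using C[of x] \<open>cmod z \<le> 1/4\<close> that norm_triangle_ineq2[of x z] by (simp add: norm_minus_commute)
  qed simp
  have der: "((deriv ^^ k) f has_field_derivative (deriv ^^ Suc k) f z) (at z within cball 0 (1/4))" if "z \<in> cball 0 (1/4)" for k z
  proof -
    have "(deriv ^^ k) f holomorphic_on ball 0 1" using f by (intro holomorphic_higher_deriv) auto
    moreover have "z \<in> ball 0 1" using that by simp
    ultimately show ?thesis
      by (metis comp_apply funpow.simps(2) has_field_derivative_at_within holomorphic_derivI open_ball)
  qed
  show "cmod (deriv f 0) \<le> 4 * C" using bound[of 0 1] by simp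
  show "cmod (f t - f 0) \<le> 4 * C * cmod t" if "cmod t \<le> 1/4"
  proof -
    have "cmod ((deriv ^^ 0) f t - (\<Sum>i\<le>0. (deriv ^^ i) f 0 * (t - 0) ^ i / fact i)) \<le> 4 * C * cmod (t - 0) ^ Suc 0 / fact 0"
    proof (rule complex_Taylor[where S = "cball 0 (1/4)"])
      show "cmod ((deriv ^^ Suc 0) f x) \<le> 4 * C" if "x \<in> cball 0 (1/4)" for x
        using bound[of x 1] that by simp
      show "((deriv ^^ i) f has_field_derivative (deriv ^^ Suc i) f x) (at x within cball 0 (1/4))"
        if "x \<in> cball 0 (1/4)" for i x by (rule der[OF that])
    qed (use that in auto)
    then show ?thesis by simp
  qed
  show "cmod (f t - f 0 - t * deriv f 0) \<le> 32 * C * (cmod t)\<^sup>2" if "cmod t \<le> 1/4"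
  proof -
    have "cmod ((deriv ^^ 0) f t - (\<Sum>i\<le>1. (deriv ^^ i) f 0 * (t - 0) ^ i / fact i)) \<le> 32 * C * cmod (t - 0) ^ Suc 1 / fact 1"
    proof (rule complex_Taylor[where S = "cball 0 (1/4)"])
      show "cmod ((deriv ^^ Suc 1) f x) \<le> 32 * C" if "x \<in> cball 0 (1/4)" for x
        using bound[of x 2] that by (simp add: numeral_2_eq_2 power2_eq_square)
      show "((deriv ^^ i) f has_field_derivative (deriv ^^ Suc i) f x) (at x within cball 0 (1/4))"
        if "x \<in> cball 0 (1/4)" for i x by (rule der[OF that])
    qed (use that in auto)
    then show ?thesis by (simp add: power2_eq_square algebra_simps)
  qed
qed

text \<open>The quotient is continuous with values in \<open>{1, -1}\<close>: on a connected set a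
  square root is determined by its value at one point.\<close>

lemma square_eq_imp_const_ratio:
  fixes f g :: "complex \<Rightarrow> complex"
  assumes "connected S" "continuous_on S f" "continuous_on S g"
    and sq: "\<And>z. z \<in> S \<Longrightarrow> (f z)\<^sup>2 = (g z)\<^sup>2" and nz: "\<And>z. z \<in> S \<Longrightarrow> g z \<noteq> 0"
    and "w \<in> S" "z \<in> S"
  shows "f z / g z = f w / g w"
proof -
  have "(\<lambda>z. f z / g z) constant_on S"
  proof (rule continuous_finite_range_constant)
    show "continuous_on S (\<lambda>z. f z / g z)" using assms by (intro continuous_intros) auto
    have "f z / g z = 1 \<or> f z / g z = - 1" if "z \<in> S" for z
      using sq[OF that] nz[OF that] by (auto simp: power2_eq_iff)
    then have "(\<lambda>z. f z / g z) ` S \<subseteq> {1, -1}" by blast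
    then show "finite ((\<lambda>z. f z / g z) ` S)" by (rule finite_subset) simp
  qed (rule assms(1))
  then show ?thesis using assms(6,7) by (auto simp: constant_on_def)
qed

text \<open>The Pluecker relation for four vectors of a plane; it turns an equation between cross
  ratios into the vanishing of a bracket.\<close>

lemma bracket_plucker:
  "bracket j2 x i r * bracket j2 x k s - bracket j2 x k r * bracket j2 x i s = bracket j2 x i k * bracket j2 x r s"
  by (simp add: bracket_def algebra_simps)

text \<open>\<open>Y\<close> is the space of normalized configurations in affine coordinates and
  \<open>T\<close> the pull-back on it. All conditions that define \<open>Y\<close> are linear, so
  \<open>Y\<close> is convex; this supplies linear motions and, at the end, the segments along which
  attraction is propagated.\<close>

locale lift_data =
  fixes n j1 j2 a :: nat and m :: "nat \<Rightarrow> nat" and \<sigma> :: "nat \<Rightarrow> real" and prec :: "nat \<Rightarrow> nat \<Rightarrow> bool"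
    and Y :: "(nat \<Rightarrow> real) set" and T :: "(nat \<Rightarrow> real) \<Rightarrow> nat \<Rightarrow> real"
  assumes idx: "j1 \<le> n" "j2 \<le> n" "a \<le> n" "j1 \<noteq> j2" "a \<noteq> j1" "a \<noteq> j2"
    and m_le: "i \<le> n \<Longrightarrow> m i \<le> n"
    and m_crit: "m j1 \<noteq> m j2"
    and m_noncrit: "i \<le> n \<Longrightarrow> i \<noteq> j1 \<Longrightarrow> i \<noteq> j2 \<Longrightarrow> m i \<noteq> m j1 \<and> m i \<noteq> m j2"
    and sign: "\<sigma> i = 1 \<or> \<sigma> i = - 1"
    and prec: "i \<le> n \<Longrightarrow> k \<le> n \<Longrightarrow> i \<noteq> j2 \<Longrightarrow> k \<noteq> j2 \<Longrightarrow> i \<noteq> k \<Longrightarrow> prec i k \<or> prec k i"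
      "prec i k \<Longrightarrow> i \<noteq> j2 \<and> k \<noteq> j2"
    and Y_eq: "Y = {X. X j1 = 0 \<and> X j2 = 1 \<and> X a = \<sigma> a \<and> (\<forall>i\<le>n. \<forall>k\<le>n. prec i k \<longrightarrow> X i < X k)}"
    and T_eq: "T X i = (if i = j1 then 0 else if i = j2 then 1 else \<sigma> i * sqrt (cross_ratio j2 X (m i) (m a) (m j1) (m j2)))"
    and T_Y: "X \<in> Y \<Longrightarrow> T X \<in> Y"
    and CR_pos: "X \<in> Y \<Longrightarrow> i \<le> n \<Longrightarrow> i \<noteq> j1 \<Longrightarrow> i \<noteq> j2 \<Longrightarrow> cross_ratio j2 X (m i) (m a) (m j1) (m j2) > 0"
begin

lemma ma: "m a \<le> n" "m j1 \<le> n" "m j2 \<le> n" "m a \<noteq> m j1" "m a \<noteq> m j2"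
  using m_noncrit[of a] idx m_le by auto

lemma sign_square: "\<sigma> i * \<sigma> i = 1" "(\<sigma> i)\<^sup>2 = 1" "\<bar>\<sigma> i\<bar> = 1" "\<sigma> i \<noteq> 0"
  using sign[of i] by auto

lemma Y_norm: "X \<in> Y \<Longrightarrow> X j1 = 0 \<and> X j2 = 1 \<and> X a = \<sigma> a" by (simp add: Y_eq)

lemma Y_prec: "X \<in> Y \<Longrightarrow> i \<le> n \<Longrightarrow> k \<le> n \<Longrightarrow> prec i k \<Longrightarrow> X i < X k" by (simp add: Y_eq)

lemma Y_inj: "X \<in> Y \<Longrightarrow> i \<le> n \<Longrightarrow> k \<le> n \<Longrightarrow> i \<noteq> j2 \<Longrightarrow> k \<noteq> j2 \<Longrightarrow> i \<noteq> k \<Longrightarrow> X i \<noteq> X k"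
  using Y_prec prec by (metis less_irrefl)

lemma T_pow_Y: "X \<in> Y \<Longrightarrow> (T ^^ k) X \<in> Y"
  by (induction k) (auto intro: T_Y)

lemma T_cong: "(\<And>i. i \<le> n \<Longrightarrow> X i = X' i) \<Longrightarrow> i \<le> n \<Longrightarrow> T X i = T X' i"
  using ma m_le by (simp add: T_eq cross_ratio_def bracket_def)

text \<open>A holomorphic motion of the normalized marked points that is a path in \<open>Y\<close>
  over the real interval. Radius 2 leaves room for the closed unit disc, on which Schottky's theorem
  is applied.\<close>

definition motion :: "(nat \<Rightarrow> complex \<Rightarrow> complex) \<Rightarrow> bool" where
  "motion \<phi> \<longleftrightarrow> (\<forall>i\<le>n. \<phi> i holomorphic_on ball 0 2) \<and>
    (\<forall>t\<in>ball 0 2. \<phi> j1 t = 0 \<and> \<phi> j2 t = 1 \<and> \<phi> a t = of_real (\<sigma> a) \<and>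
      (\<forall>i\<le>n. \<forall>k\<le>n. i \<noteq> j2 \<longrightarrow> k \<noteq> j2 \<longrightarrow> i \<noteq> k \<longrightarrow> \<phi> i t \<noteq> \<phi> k t)) \<and>
    (\<forall>t. \<bar>t\<bar> < 2 \<longrightarrow> (\<lambda>i. Re (\<phi> i (of_real t))) \<in> Y \<and> (\<forall>i\<le>n. Im (\<phi> i (of_real t)) = 0))"

definition trace :: "(nat \<Rightarrow> complex \<Rightarrow> complex) \<Rightarrow> real \<Rightarrow> nat \<Rightarrow> real" where
  "trace \<phi> t i = Re (\<phi> i (of_real t))"

lemma motion_trace:
  assumes "motion \<phi>" "\<bar>t\<bar> < 2"
  shows "trace \<phi> t \<in> Y" "i \<le> n \<Longrightarrow> \<phi> i (of_real t) = of_real (trace \<phi> t i)"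
  using assms by (auto simp: motion_def trace_def[abs_def] complex_eq_iff)

lemma motion_hol: "motion \<phi> \<Longrightarrow> i \<le> n \<Longrightarrow> \<phi> i holomorphic_on ball 0 2"
  by (simp add: motion_def)

lemma motion_distinct:
  "motion \<phi> \<Longrightarrow> t \<in> ball 0 2 \<Longrightarrow> i \<le> n \<Longrightarrow> k \<le> n \<Longrightarrow> i \<noteq> j2 \<Longrightarrow> k \<noteq> j2 \<Longrightarrow> i \<noteq> k \<Longrightarrow> \<phi> i t \<noteq> \<phi> k t"
  by (simp add: motion_def)

lemma motion_norm: "motion \<phi> \<Longrightarrow> t \<in> ball 0 2 \<Longrightarrow> \<phi> j1 t = 0 \<and> \<phi> j2 t = 1 \<and> \<phi> a t = of_real (\<sigma> a)"
  by (simp add: motion_def)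

lemma motion_bracket:
  assumes "motion \<phi>" "t \<in> ball 0 2" "i \<le> n" "k \<le> n" "i \<noteq> k"
  shows "bracket j2 (\<lambda>i. \<phi> i t) i k \<noteq> 0"
  using motion_distinct[OF assms(1-4)] motion_norm[OF assms(1,2)] assms(5) by (auto simp: bracket_def)

definition CR :: "(nat \<Rightarrow> complex \<Rightarrow> complex) \<Rightarrow> nat \<Rightarrow> complex \<Rightarrow> complex" where
  "CR \<phi> i t = cross_ratio j2 (\<lambda>i. \<phi> i t) (m i) (m a) (m j1) (m j2)"

lemma bracket_hol:
  assumes "motion \<phi>" "i \<le> n" "k \<le> n"
  shows "(\<lambda>t. bracket j2 (\<lambda>i. \<phi> i t) i k) holomorphic_on ball 0 2"
  unfolding bracket_def using assms by (intro holomorphic_intros motion_hol)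

lemma CR_hol:
  assumes "motion \<phi>" "i \<le> n" "i \<noteq> j1" "i \<noteq> j2"
  shows "CR \<phi> i holomorphic_on ball 0 2"
  unfolding CR_def[abs_def] cross_ratio_def
proof (intro holomorphic_intros bracket_hol assms(1))
  show "bracket j2 (\<lambda>i. \<phi> i t) (m i) (m j2) * bracket j2 (\<lambda>i. \<phi> i t) (m a) (m j1) \<noteq> 0" if "t \<in> ball 0 2" for t
    using motion_bracket[OF assms(1) that] m_noncrit[OF assms(2-4)] ma m_le[OF assms(2)] by simp
qed (use m_le[OF assms(2)] ma in auto)

lemma CR_nonzero:
  assumes "motion \<phi>" "i \<le> n" "i \<noteq> j1" "i \<noteq> j2" "t \<in> ball 0 2"
  shows "CR \<phi> i t \<noteq> 0"
  unfolding CR_def cross_ratio_def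
  using assms m_noncrit[OF assms(2-4)] ma m_le[OF assms(2)] motion_bracket[OF assms(1,5)] by auto

lemma CR_real:
  assumes "motion \<phi>" "\<bar>t\<bar> < 2" "i \<le> n"
  shows "CR \<phi> i (of_real t) = of_real (cross_ratio j2 (trace \<phi> t) (m i) (m a) (m j1) (m j2))"
proof -
  have "bracket j2 (\<lambda>i. \<phi> i (of_real t)) r s = of_real (bracket j2 (trace \<phi> t) r s)" if "r \<le> n" "s \<le> n" for r s
    using motion_trace(2)[OF assms(1,2)] that by (simp add: bracket_def)
  then show ?thesis unfolding CR_def cross_ratio_def using ma m_le[OF assms(3)] by simp
qed

lemma CR_a: "motion \<phi> \<Longrightarrow> t \<in> ball 0 2 \<Longrightarrow> CR \<phi> a t = 1"
  unfolding CR_def cross_ratio_def using motion_bracket[of \<phi> t] ma by (simp add: mult.commute)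

lemma CR_inj:
  assumes "motion \<phi>" "i \<le> n" "i \<noteq> j1" "i \<noteq> j2" "k \<le> n" "k \<noteq> j1" "k \<noteq> j2" "t \<in> ball 0 2" "m i \<noteq> m k"
  shows "CR \<phi> i t \<noteq> CR \<phi> k t"
proof
  assume eq: "CR \<phi> i t = CR \<phi> k t"
  let ?b = "bracket j2 (\<lambda>i. \<phi> i t)"
  have nz: "?b r s \<noteq> 0" if "r \<le> n" "s \<le> n" "r \<noteq> s" for r s using motion_bracket[OF assms(1,8) that] .
  have "m i \<noteq> m j2" "m k \<noteq> m j2" "m i \<le> n" "m k \<le> n" using m_noncrit assms m_le by auto
  then have "?b (m i) (m j1) * ?b (m k) (m j2) = ?b (m k) (m j1) * ?b (m i) (m j2)"
    using eq nz ma unfolding CR_def cross_ratio_def by (simp add: divide_simps)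
  then have "?b (m i) (m k) * ?b (m j1) (m j2) = 0"
    using bracket_plucker[of j2 "\<lambda>i. \<phi> i t" "m i" "m j1" "m k" "m j2"] by simp
  then show False using nz \<open>m i \<le> n\<close> \<open>m k \<le> n\<close> ma m_crit assms(9) by auto
qed

text \<open>The cross ratios have no zeros on a disc, so they have holomorphic square roots. Points
  over different values have different squares; two points over the same value have a constant
  ratio, which is not 1 at time 0. Hence the lift is again a motion.\<close>

lemma motion_lift:
  assumes \<phi>: "motion \<phi>"
  obtains \<psi> where "motion \<psi>"
    "\<And>i t. i \<le> n \<Longrightarrow> i \<noteq> j1 \<Longrightarrow> i \<noteq> j2 \<Longrightarrow> t \<in> ball 0 2 \<Longrightarrow> (\<psi> i t)\<^sup>2 = CR \<phi> i t"
    "\<And>i t. i \<le> n \<Longrightarrow> \<bar>t\<bar> < 2 \<Longrightarrow> trace \<psi> t i = T (trace \<phi> t) i"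
proof -
  have "\<exists>g. g holomorphic_on ball 0 2 \<and> (\<forall>z\<in>ball 0 2. CR \<phi> i z = (g z)\<^sup>2)"
    if i: "i \<le> n" "i \<noteq> j1" "i \<noteq> j2" for i
  proof -
    obtain g where "g holomorphic_on ball 0 2" "\<And>z. z \<in> ball 0 2 \<Longrightarrow> CR \<phi> i z = (g z)\<^sup>2"
      by (rule contractible_imp_holomorphic_sqrt[OF CR_hol[OF \<phi> i] _ CR_nonzero[OF \<phi> i]])
         (auto intro: convex_imp_contractible)
    then show ?thesis by blast
  qed
  then obtain g where g: "\<And>i. i \<le> n \<Longrightarrow> i \<noteq> j1 \<Longrightarrow> i \<noteq> j2 \<Longrightarrow> g i holomorphic_on ball 0 2"
    "\<And>i z. i \<le> n \<Longrightarrow> i \<noteq> j1 \<Longrightarrow> i \<noteq> j2 \<Longrightarrow> z \<in> ball 0 2 \<Longrightarrow> CR \<phi> i z = (g i z)\<^sup>2"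
    by metis
  define r where "r = (\<lambda>i t. T (trace \<phi> t) i)"
  \<comment> \<open>The constant \<open>r i 0 / g i 0\<close> is 1 or -1 and selects the branch that
    agrees with \<open>T\<close> at time 0. Indices beyond \<open>n\<close> just follow
    \<open>T\<close>, so that the real traces agree at every index.\<close>
  define \<psi> where "\<psi> = (\<lambda>i t. if i = j1 then 0 else if i = j2 then 1 else if i \<le> n then of_real (r i 0) / g i 0 * g i t else of_real (r i (Re t)))"
  have in2: "complex_of_real t \<in> ball 0 2 \<longleftrightarrow> \<bar>t\<bar> < 2" for t by simp
  have rsq: "CR \<phi> i (of_real t) = (of_real (r i t))\<^sup>2" if "i \<le> n" "i \<noteq> j1" "i \<noteq> j2" "\<bar>t\<bar> < 2" for i t
  proof -
    have "(r i t)\<^sup>2 = cross_ratio j2 (trace \<phi> t) (m i) (m a) (m j1) (m j2)"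
      using CR_pos[OF motion_trace(1)[OF \<phi> that(4)] that(1-3)] that
      by (simp add: r_def T_eq power_mult_distrib sign_square)
    then show ?thesis using CR_real[OF \<phi> that(4,1)] by (simp flip: of_real_power)
  qed
  have r0: "r i t \<noteq> 0" if "i \<le> n" "i \<noteq> j1" "i \<noteq> j2" "\<bar>t\<bar> < 2" for i t
    using CR_pos[OF motion_trace(1)[OF \<phi> that(4)] that(1-3)] that sign_square by (simp add: r_def T_eq)
  have g0: "g i t \<noteq> 0" if "i \<le> n" "i \<noteq> j1" "i \<noteq> j2" "t \<in> ball 0 2" for i t
    using g(2)[OF that] CR_nonzero[OF \<phi> that] by auto
  have \<psi>sq: "(\<psi> i t)\<^sup>2 = CR \<phi> i t" if i: "i \<le> n" "i \<noteq> j1" "i \<noteq> j2" and t: "t \<in> ball 0 2" for i t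
  proof -
    have "(of_real (r i 0))\<^sup>2 = (g i 0)\<^sup>2" using rsq[OF i, of 0] g(2)[OF i, of 0] by simp
    then show ?thesis using i t g0[OF i, of 0] g(2)[OF i t] by (simp add: \<psi>_def power_mult_distrib power_divide)
  qed
  have \<psi>hol: "\<psi> i holomorphic_on ball 0 2" if "i \<le> n" for i
  proof (cases "i = j1 \<or> i = j2")
    case True
    then have "\<psi> i = (\<lambda>_. if i = j1 then 0 else 1)" by (auto simp: \<psi>_def)
    then show ?thesis by simp
  next
    case False
    then have "\<psi> i = (\<lambda>t. of_real (r i 0) / g i 0 * g i t)" using that by (auto simp: \<psi>_def)
    then show ?thesis using False that by (auto intro!: holomorphic_intros g)
  qed
  have \<psi>nz: "\<psi> i t \<noteq> 0" if "i \<le> n" "i \<noteq> j1" "i \<noteq> j2" "t \<in> ball 0 2" for i t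
    using \<psi>sq[OF that] CR_nonzero[OF \<phi> that] by auto
  have \<psi>0: "\<psi> i 0 = of_real (r i 0)" if "i \<le> n" "i \<noteq> j1" "i \<noteq> j2" for i
    using that g0[OF that, of 0] by (simp add: \<psi>_def)
  have rcont: "continuous_on {-2<..<2} (r i)" if i: "i \<le> n" for i
  proof (cases "i = j1 \<or> i = j2")
    case True
    then have "r i = (\<lambda>_. if i = j1 then 0 else 1)" by (auto simp: r_def T_eq)
    then show ?thesis by simp
  next
    case False
    have eq: "r i t = \<sigma> i * sqrt (Re (CR \<phi> i (of_real t)))" if "t \<in> {-2<..<2}" for t
    proof -
      have "\<bar>t\<bar> < 2" using that by auto
      from CR_real[OF \<phi> this i] show ?thesis using False by (simp add: r_def T_eq)
    qed
    have "continuous_on {-2<..<2} (\<lambda>t. \<sigma> i * sqrt (Re (CR \<phi> i (of_real t))))"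
      by (intro continuous_intros continuous_on_compose2[OF holomorphic_on_imp_continuous_on[OF CR_hol[OF \<phi> i]]])
         (use False in auto)
    then show ?thesis using eq continuous_on_cong by (metis (no_types, lifting))
  qed
  have \<psi>r: "\<psi> i (of_real t) = of_real (r i t)" if i: "i \<le> n" and t: "\<bar>t\<bar> < 2" for i t
  proof (cases "i = j1 \<or> i = j2")
    case True
    then show ?thesis by (auto simp: \<psi>_def r_def T_eq)
  next
    case False
    have nz: "r i s \<noteq> 0" if "s \<in> {-2<..<2}" for s
  proof -
    have "\<bar>s\<bar> < 2" using that by auto
    then show ?thesis using r0[OF i] False by blast
  qed
    have c1: "continuous_on {-2<..<2} (\<lambda>s. \<psi> i (of_real s))"
      by (rule continuous_on_compose2[OF holomorphic_on_imp_continuous_on[OF \<psi>hol[OF i]]]) (auto intro!: continuous_intros)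
    \<comment> \<open>Neither function vanishes on the interval, so the sign chosen at 0 is right
      throughout.\<close>
    have "(\<lambda>s. \<psi> i (of_real s) / of_real (r i s)) constant_on {-2<..<2}"
    proof (rule continuous_finite_range_constant)
      show "continuous_on {-2<..<2} (\<lambda>s. \<psi> i (of_real s) / of_real (r i s))"
        by (intro continuous_intros c1 rcont[OF i]) (use nz in auto)
      have rsq': "(\<psi> i (of_real s))\<^sup>2 = (of_real (r i s))\<^sup>2" if "s \<in> {-2<..<2}" for s
      proof -
        have s: "\<bar>s\<bar> < 2" using that by auto
        then have "complex_of_real s \<in> ball 0 2" by simp
        then show ?thesis using \<psi>sq[OF i] rsq[OF i _ _ s] False by metis
      qed
      have "\<psi> i (of_real s) / of_real (r i s) = 1 \<or> \<psi> i (of_real s) / of_real (r i s) = - 1" if "s \<in> {-2<..<2}" for s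
      proof -
        have "\<psi> i (of_real s) = of_real (r i s) \<or> \<psi> i (of_real s) = - of_real (r i s)"
          using rsq'[OF that] by (simp only: power2_eq_iff)
        then show ?thesis using nz[OF that] by (elim disjE) simp_all
      qed
      then have "(\<lambda>s. \<psi> i (of_real s) / of_real (r i s)) ` {-2<..<2} \<subseteq> {1, -1}" by blast
      then show "finite ((\<lambda>s. \<psi> i (of_real s) / of_real (r i s)) ` {-2<..<2})" by (rule finite_subset) simp
    qed (simp add: connected_Ioo)
    then obtain K where K: "\<And>s. s \<in> {-2<..<2} \<Longrightarrow> \<psi> i (of_real s) / of_real (r i s) = K"
      by (auto simp: constant_on_def)
    have "K = 1" using K[of 0] \<psi>0[OF i] False nz[of 0] by simp
    moreover have "t \<in> {-2<..<2}" using t by auto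
    ultimately show ?thesis using K[of t] nz[of t] by simp
  qed
  have rY: "r' \<in> Y" if "\<bar>t\<bar> < 2" "r' = (\<lambda>i. r i t)" for t r'
    using T_Y[OF motion_trace(1)[OF \<phi> that(1)]] that by (simp add: r_def)
  have \<psi>tr: "Re (\<psi> i (of_real t)) = r i t" if "\<bar>t\<bar> < 2" for i t
    using \<psi>r[OF _ that, of i] by (cases "i \<le> n") (auto simp: \<psi>_def r_def T_eq)
  have dist: "\<psi> i t \<noteq> \<psi> k t" if i: "i \<le> n" "i \<noteq> j2" and k: "k \<le> n" "k \<noteq> j2" and "i \<noteq> k" and t: "t \<in> ball 0 2" for i k t
  proof (cases "i = j1 \<or> k = j1")
    case True
    then show ?thesis using \<psi>nz[OF i(1) _ i(2) t] \<psi>nz[OF k(1) _ k(2) t] \<open>i \<noteq> k\<close> by (auto simp: \<psi>_def)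
  next
    case False
    show ?thesis
    proof (cases "m i = m k")
      case True
      have "\<psi> i t / \<psi> k t = \<psi> i 0 / \<psi> k 0"
      proof (rule square_eq_imp_const_ratio)
        show "(\<psi> i z)\<^sup>2 = (\<psi> k z)\<^sup>2" if "z \<in> ball 0 2" for z
          using \<psi>sq[OF i(1) _ i(2) that] \<psi>sq[OF k(1) _ k(2) that] False True by (simp add: CR_def)
      qed (use t False \<psi>hol i k \<psi>nz in \<open>auto intro: holomorphic_on_imp_continuous_on\<close>)
      moreover have "r i 0 \<noteq> r k 0" using Y_inj[OF rY[of 0, OF _ refl] i(1) k(1) i(2) k(2) \<open>i \<noteq> k\<close>] by simp
      then have "\<psi> i 0 \<noteq> \<psi> k 0" using \<psi>0 False i k by simp
      ultimately show ?thesis using \<psi>nz[OF k(1) _ k(2), of 0] \<psi>nz[OF k(1) _ k(2) t] False by auto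
    next
      case ne: False
      then show ?thesis
        using CR_inj[OF \<phi> i(1) _ i(2) k(1) _ k(2) t ne] \<psi>sq[OF i(1) _ i(2) t] \<psi>sq[OF k(1) _ k(2) t] False by auto
    qed
  qed
  have \<psi>a: "\<psi> a t = of_real (\<sigma> a)" if t: "t \<in> ball 0 2" for t
  proof -
    have "\<psi> a t / 1 = \<psi> a 0 / 1"
      by (rule square_eq_imp_const_ratio[where S = "ball 0 2"])
         (use \<psi>sq[OF idx(3,5,6)] CR_a[OF \<phi>] \<psi>hol[OF idx(3)] t in \<open>auto intro: holomorphic_on_imp_continuous_on\<close>)
    moreover have "r a 0 = \<sigma> a" using Y_norm[OF rY[of 0, OF _ refl]] by simp
    ultimately show ?thesis using \<psi>0[OF idx(3,5,6)] by simp
  qed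
  have "motion \<psi>"
    unfolding motion_def
  proof (intro conjI ballI allI impI)
    fix t :: real assume t: "\<bar>t\<bar> < 2"
    show "(\<lambda>i. Re (\<psi> i (of_real t))) \<in> Y" by (rule rY[OF t]) (simp add: \<psi>tr[OF t])
    show "Im (\<psi> i (of_real t)) = 0" if "i \<le> n" for i using \<psi>r[OF that t] by simp
  qed (use \<psi>hol dist \<psi>a idx in \<open>auto simp: \<psi>_def\<close>)
  moreover have "trace \<psi> t i = T (trace \<phi> t) i" if "i \<le> n" "\<bar>t\<bar> < 2" for i t
    using \<psi>tr[OF that(2)] by (simp add: trace_def r_def)
  ultimately show ?thesis using that \<psi>sq by blast
qed

lemma motion_orbit:
  assumes "motion \<phi>"
  obtains \<Phi> where "\<Phi> 0 = \<phi>" "\<And>k. motion (\<Phi> k)"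
    "\<And>k i t. i \<le> n \<Longrightarrow> i \<noteq> j1 \<Longrightarrow> i \<noteq> j2 \<Longrightarrow> t \<in> ball 0 2 \<Longrightarrow> (\<Phi> (Suc k) i t)\<^sup>2 = CR (\<Phi> k) i t"
    "\<And>k i t. i \<le> n \<Longrightarrow> \<bar>t\<bar> < 2 \<Longrightarrow> \<Phi> k i (of_real t) = of_real ((T ^^ k) (trace \<phi> t) i)"
proof -
  define P where "P = (\<lambda>\<phi> \<psi>. motion \<psi> \<and> (\<forall>i t. i \<le> n \<and> i \<noteq> j1 \<and> i \<noteq> j2 \<and> t \<in> ball 0 2 \<longrightarrow> (\<psi> i t)\<^sup>2 = CR \<phi> i t) \<and>
     (\<forall>i t. i \<le> n \<and> \<bar>t\<bar> < 2 \<longrightarrow> trace \<psi> t i = T (trace \<phi> t) i))"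
  define L where "L = (\<lambda>\<phi>. SOME \<psi>. P \<phi> \<psi>)"
  have PL: "P \<phi> (L \<phi>)" if "motion \<phi>" for \<phi>
  proof -
    obtain \<psi> where "motion \<psi>"
      "\<And>i t. i \<le> n \<Longrightarrow> i \<noteq> j1 \<Longrightarrow> i \<noteq> j2 \<Longrightarrow> t \<in> ball 0 2 \<Longrightarrow> (\<psi> i t)\<^sup>2 = CR \<phi> i t"
      "\<And>i t. i \<le> n \<Longrightarrow> \<bar>t\<bar> < 2 \<Longrightarrow> trace \<psi> t i = T (trace \<phi> t) i"
      using \<open>motion \<phi>\<close> by (rule motion_lift) blast
    then have "P \<phi> \<psi>" by (simp add: P_def)
    then show ?thesis unfolding L_def by (rule someI[of "P \<phi>"])
  qed
  have L: "motion (L \<phi>)"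
    "i \<le> n \<Longrightarrow> i \<noteq> j1 \<Longrightarrow> i \<noteq> j2 \<Longrightarrow> t \<in> ball 0 2 \<Longrightarrow> (L \<phi> i t)\<^sup>2 = CR \<phi> i t"
    "i \<le> n \<Longrightarrow> \<bar>s\<bar> < 2 \<Longrightarrow> trace (L \<phi>) s i = T (trace \<phi> s) i" if "motion \<phi>" for \<phi> i t s
    using PL[OF that] by (simp_all add: P_def)
  define \<Phi> where "\<Phi> = (\<lambda>k. (L ^^ k) \<phi>)"
  have mo: "motion (\<Phi> k)" for k by (induction k) (auto simp: \<Phi>_def assms L)
  have tr: "trace (\<Phi> k) t i = (T ^^ k) (trace \<phi> t) i" if "i \<le> n" "\<bar>t\<bar> < 2" for k i t
    using that(1)
  proof (induction k arbitrary: i)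
    case (Suc k)
    have "trace (\<Phi> (Suc k)) t i = T (trace (\<Phi> k) t) i"
      using L(3)[OF mo Suc.prems that(2), of k] by (simp add: \<Phi>_def)
    also have "\<dots> = T ((T ^^ k) (trace \<phi> t)) i" using Suc by (intro T_cong) auto
    finally show ?case by simp
  qed (simp add: \<Phi>_def)
  show ?thesis
  proof (rule that[of \<Phi>])
    show "(\<Phi> (Suc k) i t)\<^sup>2 = CR (\<Phi> k) i t" if "i \<le> n" "i \<noteq> j1" "i \<noteq> j2" "t \<in> ball 0 2" for k i t
      using L(2)[OF mo that, of k] by (simp add: \<Phi>_def)
    show "\<Phi> k i (of_real t) = of_real ((T ^^ k) (trace \<phi> t) i)" if "i \<le> n" "\<bar>t\<bar> < 2" for k i t
      using motion_trace(2)[OF mo that(2,1)] tr[OF that] by simp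
  qed (auto simp: mo, simp add: \<Phi>_def)
qed

text \<open>The bound of Schottky's theorem on the disc of radius 1/2: the exponent
  \<open>2 + 2 * r + 12 * t / (1 - t)\<close> is \<open>14 + 2 * r\<close> for
  \<open>t = 1/2\<close>.\<close>

definition Sch :: "real \<Rightarrow> real" where "Sch r = exp (pi * exp (pi * (14 + 2 * r)))"

lemma Sch_ge_1: "Sch r \<ge> 1" by (simp add: Sch_def)

text \<open>Normalized coordinates of a motion omit the values \<open>0\<close> and \<open>\<sigma> a\<close>.\<close>

lemma motion_bound:
  assumes \<phi>: "motion \<phi>" and i: "i \<le> n" and r: "cmod (\<phi> i 0) \<le> r" and z: "cmod z \<le> 1/2"
  shows "cmod (\<phi> i z) \<le> Sch r"
proof (cases "i = j1 \<or> i = j2 \<or> i = a")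
  case True
  have "z \<in> ball 0 2" using z by simp
  then have "cmod (\<phi> i z) \<le> 1" using True motion_norm[OF \<phi>] sign_square by auto
  then show ?thesis using Sch_ge_1[of r] by linarith
next
  case False
  have sub: "cball 0 1 \<subseteq> ball (0::complex) 2" by auto
  have "cmod (\<phi> i z / of_real (\<sigma> a)) \<le> exp (pi * exp (pi * (2 + 2 * r + 12 * (1/2) / (1 - 1/2))))"
  proof (rule Schottky[where f = "\<lambda>z. \<phi> i z / of_real (\<sigma> a)"])
    show "(\<lambda>z. \<phi> i z / of_real (\<sigma> a)) holomorphic_on cball 0 1"
      using sign_square by (intro holomorphic_intros holomorphic_on_subset[OF motion_hol[OF \<phi> i] sub]) auto
    show "cmod (\<phi> i 0 / of_real (\<sigma> a)) \<le> r" using r sign_square by (simp add: norm_divide)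
    show "\<not> (\<phi> i z / of_real (\<sigma> a) = 0 \<or> \<phi> i z / of_real (\<sigma> a) = 1)" if "z \<in> cball 0 1" for z
    proof -
      have zb: "z \<in> ball 0 2" using that sub by blast
      show ?thesis
        using motion_distinct[OF \<phi> zb i idx(1)] motion_distinct[OF \<phi> zb i idx(3)] motion_norm[OF \<phi> zb] False idx sign_square[of a]
        by auto
    qed
  qed (use z in auto)
  then show ?thesis using sign_square by (simp add: norm_divide Sch_def algebra_simps)
qed

lemma motion_estimates:
  assumes \<phi>: "motion \<phi>" and i: "i \<le> n" and r: "cmod (\<phi> i 0) \<le> r"
  shows "cmod (deriv (\<phi> i) 0) \<le> 4 * Sch r"
    and "cmod t \<le> 1/4 \<Longrightarrow> cmod (\<phi> i t - \<phi> i 0) \<le> 4 * Sch r * cmod t"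
    and "cmod t \<le> 1/4 \<Longrightarrow> cmod (\<phi> i t - \<phi> i 0 - t * deriv (\<phi> i) 0) \<le> 32 * Sch r * (cmod t)\<^sup>2"
proof -
  have "\<phi> i holomorphic_on ball 0 1"
    by (rule holomorphic_on_subset[OF motion_hol[OF \<phi> i]]) auto
  note * = bounded_holomorphic_estimates[OF this motion_bound[OF \<phi> i r]]
  show "cmod (deriv (\<phi> i) 0) \<le> 4 * Sch r"
    and "cmod t \<le> 1/4 \<Longrightarrow> cmod (\<phi> i t - \<phi> i 0) \<le> 4 * Sch r * cmod t"
    and "cmod t \<le> 1/4 \<Longrightarrow> cmod (\<phi> i t - \<phi> i 0 - t * deriv (\<phi> i) 0) \<le> 32 * Sch r * (cmod t)\<^sup>2"
    using * by auto
qed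

text \<open>The factor 5: with velocities at most \<delta> and times of modulus below 2, the
  difference of two points changes by at most \<open>4 * \<delta>\<close>, so points at distance
  \<open>5 * \<delta>\<close> remain apart.\<close>

definition gap :: "(nat \<Rightarrow> real) \<Rightarrow> real \<Rightarrow> bool" where
  "gap X \<delta> \<longleftrightarrow> (\<forall>i\<le>n. \<forall>k\<le>n. prec i k \<longrightarrow> X k - X i \<ge> 5 * \<delta>)"

lemma gap_exists:
  assumes "X \<in> Y" obtains \<delta> where "\<delta> > 0" "gap X \<delta>"
proof -
  let ?D = "insert 1 ((\<lambda>(i, k). X k - X i) ` {(i, k). i \<le> n \<and> k \<le> n \<and> prec i k})"
  have fin: "finite ?D"
    by (rule finite.insertI, rule finite_imageI, rule finite_subset[of _ "{..n} \<times> {..n}"]) auto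
  have "\<forall>d\<in>?D. d > 0" using Y_prec[OF assms] by auto
  then have "Min ?D > 0" using fin by (subst Min_gr_iff) auto
  moreover have "gap X (Min ?D / 5)"
    unfolding gap_def using fin by (auto intro!: Min_le)
  ultimately show ?thesis using that[of "Min ?D / 5"] by simp
qed

lemma linear_motion:
  assumes y: "y \<in> Y" and \<delta>: "\<delta> > 0" "gap y \<delta>"
    and v: "v j1 = 0" "v j2 = 0" "v a = 0" "\<And>i. i \<le> n \<Longrightarrow> \<bar>v i\<bar> \<le> \<delta>"
  shows "motion (\<lambda>i t. of_real (y i) + t * of_real (v i))"
  unfolding motion_def
proof (intro conjI allI ballI impI)
  have diff: "cmod (t * of_real (v k) - t * of_real (v i)) \<le> 4 * \<delta>" if "cmod t < 2" "i \<le> n" "k \<le> n" for t i k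
  proof -
    have "cmod (t * of_real (v k) - t * of_real (v i)) = cmod t * \<bar>v k - v i\<bar>"
      by (simp flip: right_diff_distrib of_real_diff add: norm_mult)
    also have "\<dots> \<le> 2 * (2 * \<delta>)" using that v(4)[of i] v(4)[of k] by (intro mult_mono) auto
    finally show ?thesis by simp
  qed
  have sep: "of_real (y i) + t * of_real (v i) \<noteq> of_real (y k) + t * of_real (v k)"
    if "t \<in> ball 0 2" "i \<le> n" "k \<le> n" "prec i k" for i k and t :: complex
  proof
    assume "of_real (y i) + t * of_real (v i) = of_real (y k) + t * of_real (v k)"
    then have "t * of_real (v k) - t * of_real (v i) = - of_real (y k - y i)" by (simp add: algebra_simps)
    then have "cmod (t * of_real (v k) - t * of_real (v i)) = \<bar>y k - y i\<bar>" by (simp only: norm_minus_cancel norm_of_real)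
    then show False using diff[of t i k] \<delta> that by (auto simp: gap_def) (smt (verit))
  qed
  show "of_real (y i) + t * of_real (v i) \<noteq> of_real (y k) + t * of_real (v k)"
    if "t \<in> ball 0 2" "i \<le> n" "k \<le> n" "i \<noteq> j2" "k \<noteq> j2" "i \<noteq> k" for i k and t :: complex
    using prec(1)[OF that(2-6)] sep[OF that(1-3)] sep[OF that(1,3,2)] by metis
  fix t :: real assume t: "\<bar>t\<bar> < 2"
  have "y i + t * v i < y k + t * v k" if "i \<le> n" "k \<le> n" "prec i k" for i k
  proof -
    have "cmod (of_real t * of_real (v k) - of_real t * of_real (v i)) = \<bar>t * v k - t * v i\<bar>"
      by (simp flip: of_real_mult of_real_diff)
    then have "\<bar>t * v k - t * v i\<bar> \<le> 4 * \<delta>" using diff[of "of_real t" i k] that t by simp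
    moreover have "y k - y i \<ge> 5 * \<delta>" using \<delta> that by (auto simp: gap_def)
    ultimately show ?thesis using \<delta>(1) by linarith
  qed
  then show "(\<lambda>i. Re (of_real (y i) + of_real t * of_real (v i))) \<in> Y"
    using Y_norm[OF y] v by (simp add: Y_eq)
qed (use Y_norm[OF y] v in \<open>auto intro!: holomorphic_intros\<close>)

text \<open>The constants below do not depend on the number \<open>k\<close> of iterations.\<close>

lemma pullback_equicontinuous:
  assumes y: "y \<in> Y" and \<delta>: "\<delta> > 0" "gap y \<delta>" and x: "x \<in> Y"
    and e: "0 < e" "e \<le> 1/4" "\<And>i. i \<le> n \<Longrightarrow> \<bar>x i - y i\<bar> \<le> e * \<delta>"
    and r: "\<And>i. i \<le> n \<Longrightarrow> \<bar>(T ^^ k) y i\<bar> \<le> r" and i: "i \<le> n"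
  shows "\<bar>(T ^^ k) x i - (T ^^ k) y i\<bar> \<le> 4 * Sch r * e"
proof -
  \<comment> \<open>The linear motion from \<open>y\<close> in this direction reaches
    \<open>x\<close> at time \<open>e\<close>, and its velocities are at most \<delta>. The
    displacement of the k-th lift during this time is the quantity to be bounded.\<close>
  define v where "v = (\<lambda>i. (x i - y i) / e)"
  have v: "v j1 = 0" "v j2 = 0" "v a = 0" "\<And>i. i \<le> n \<Longrightarrow> \<bar>v i\<bar> \<le> \<delta>"
    using Y_norm[OF x] Y_norm[OF y] e by (auto simp: v_def divide_simps mult.commute)
  define \<phi> where "\<phi> = (\<lambda>i t. complex_of_real (y i) + t * of_real (v i))"
  have mo: "motion \<phi>" unfolding \<phi>_def by (rule linear_motion[OF y \<delta> v])
  obtain \<Phi> where \<Phi>: "\<And>k. motion (\<Phi> k)" "\<And>k i t. i \<le> n \<Longrightarrow> \<bar>t\<bar> < 2 \<Longrightarrow> \<Phi> k i (of_real t) = of_real ((T ^^ k) (trace \<phi> t) i)"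
    by (rule motion_orbit[OF mo]) blast
  have t0: "trace \<phi> 0 = y" and te: "trace \<phi> e = x"
    using e(1) by (auto simp: trace_def \<phi>_def v_def)
  have "cmod (\<Phi> k i (of_real e) - \<Phi> k i 0) \<le> 4 * Sch r * cmod (of_real e)"
    using motion_estimates(2)[OF \<Phi>(1) i, of k r "of_real e"] \<Phi>(2)[OF i, of 0 k] r[OF i] e t0 by simp
  then show ?thesis
    using \<Phi>(2)[OF i, of 0 k] \<Phi>(2)[OF i, of e k] e t0 te by (simp flip: of_real_diff)
qed

end

section \<open>Global attraction\<close>

lemma bounded_finite_subsequence:
  fixes u :: "nat \<Rightarrow> nat \<Rightarrow> real"
  assumes "finite J" "\<And>k i. i \<in> J \<Longrightarrow> \<bar>u k i\<bar> \<le> B"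
  shows "\<exists>r d. strict_mono r \<and> (\<forall>i\<in>J. (\<lambda>k. u (r k) i) \<longlonglongrightarrow> d i)"
  using assms
proof (induction J)
  case empty
  show ?case by (rule exI[of _ id]) (auto simp: strict_mono_def)
next
  case (insert j J)
  then have "\<exists>r d. strict_mono r \<and> (\<forall>i\<in>J. (\<lambda>k. u (r k) i) \<longlonglongrightarrow> d i)" by simp
  then obtain r d where r: "strict_mono r" "\<forall>i\<in>J. (\<lambda>k. u (r k) i) \<longlonglongrightarrow> d i" by blast
  have "\<forall>k. u (r k) j \<in> {- B..B}" using insert.prems[of j] by (auto simp: abs_le_iff minus_le_iff)
  then obtain l s where s: "strict_mono s" "((\<lambda>k. u (r k) j) \<circ> s) \<longlonglongrightarrow> l"
    using compact_Icc[of "- B" B] unfolding compact_def by metis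
  have "(\<lambda>k. u ((r \<circ> s) k) i) \<longlonglongrightarrow> (d(j := l)) i" if "i \<in> insert j J" for i
  proof (cases "i = j")
    case True
    then show ?thesis using s(2) by (simp add: o_def)
  next
    case False
    then have "(\<lambda>k. u (r k) i) \<longlonglongrightarrow> d i" using that r by auto
    then show ?thesis using LIMSEQ_subseq_LIMSEQ[OF _ s(1)] False by (fastforce simp: o_def)
  qed
  moreover have "strict_mono (r \<circ> s)" using r(1) s(1) by (rule strict_mono_o)
  ultimately show ?case by blast
qed

locale attracting_data = lift_data +
  fixes p :: "nat \<Rightarrow> real"
  assumes p_Y: "p \<in> Y" and T_p: "i \<le> n \<Longrightarrow> T p i = p i"
begin

sublocale postcritical_data n j1 j2 a m p
proof unfold_locales
  show "p j1 = 0" "p j2 = 1" using Y_norm[OF p_Y] by auto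
  show "i = k" if "i \<le> n" "k \<le> n" "i \<noteq> j2" "k \<noteq> j2" "p i = p k" for i k
    using Y_inj[OF p_Y that(1-4)] that(5) by auto
  show "(p i)\<^sup>2 = cross_ratio j2 p (m i) (m a) (m j1) (m j2)" if "i \<le> n" "i \<noteq> j1" "i \<noteq> j2" for i
    using T_p[OF that(1)] CR_pos[OF p_Y that] that
    by (metis T_eq less_imp_le mult_1 power_mult_distrib real_sqrt_pow2 sign_square(2))
qed (use idx m_le m_crit m_noncrit in auto)

lemma T_pow_p: "i \<le> n \<Longrightarrow> (T ^^ k) p i = p i"
proof (induction k arbitrary: i)
  case (Suc k)
  have "(T ^^ Suc k) p i = T p i" using Suc by (simp add: T_cong[of "(T ^^ k) p" p])
  then show ?case using T_p Suc by simp
qed simp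

definition tangent_map :: "(nat \<Rightarrow> real) \<Rightarrow> nat \<Rightarrow> real" where
  "tangent_map v i = (if i \<in> J then tangent p v i else 0)"

lemma tangent_map_supp: "i \<notin> J \<Longrightarrow> (tangent_map ^^ k) v i = (if k = 0 then v i else 0)"
  by (cases k) (auto simp: tangent_map_def)

lemma CR_deriv:
  assumes \<phi>: "motion \<phi>" and i: "i \<le> n" "i \<noteq> j1" "i \<noteq> j2"
  shows "(CR \<phi> i has_field_derivative CR \<phi> i 0 *
    (dlog_bracket j2 (\<lambda>i. \<phi> i 0) (\<lambda>i. deriv (\<phi> i) 0) (m i) (m j1) + dlog_bracket j2 (\<lambda>i. \<phi> i 0) (\<lambda>i. deriv (\<phi> i) 0) (m a) (m j2)
     - dlog_bracket j2 (\<lambda>i. \<phi> i 0) (\<lambda>i. deriv (\<phi> i) 0) (m i) (m j2) - dlog_bracket j2 (\<lambda>i. \<phi> i 0) (\<lambda>i. deriv (\<phi> i) 0) (m a) (m j1))) (at 0)"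
proof -
  define b where "b = (\<lambda>r s t. bracket j2 (\<lambda>i. \<phi> i t) r s)"
  define db where "db = (\<lambda>r s. bracket j2 (\<lambda>i. deriv (\<phi> i) 0) r s)"
  have der: "(b r s has_field_derivative db r s) (at 0)" if "r \<le> n" "s \<le> n" for r s
  proof -
    have "(\<phi> k has_field_derivative deriv (\<phi> k) 0) (at 0)" if "k \<le> n" for k
      by (rule holomorphic_derivI[OF motion_hol[OF \<phi> that]]) auto
    then show ?thesis unfolding b_def db_def bracket_def using that
      by (auto intro!: derivative_eq_intros)
  qed
  have mi: "m i \<le> n" "m i \<noteq> m j1" "m i \<noteq> m j2" using m_le m_noncrit i by auto
  have nz: "b r s 0 \<noteq> 0" if "r \<le> n" "s \<le> n" "r \<noteq> s" for r s
    unfolding b_def by (rule motion_bracket[OF \<phi> _ that]) simp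
  have eq: "CR \<phi> i = (\<lambda>t. b (m i) (m j1) t * b (m a) (m j2) t / (b (m i) (m j2) t * b (m a) (m j1) t))"
    by (simp add: CR_def[abs_def] cross_ratio_def b_def)
  have "(CR \<phi> i has_field_derivative
     ((db (m i) (m j1) * b (m a) (m j2) 0 + db (m a) (m j2) * b (m i) (m j1) 0) * (b (m i) (m j2) 0 * b (m a) (m j1) 0)
      - (b (m i) (m j1) 0 * b (m a) (m j2) 0) * (db (m i) (m j2) * b (m a) (m j1) 0 + db (m a) (m j1) * b (m i) (m j2) 0))
     / ((b (m i) (m j2) 0 * b (m a) (m j1) 0) * (b (m i) (m j2) 0 * b (m a) (m j1) 0))) (at 0)"
    unfolding eq using mi ma nz by (intro DERIV_divide DERIV_mult der) auto
  moreover have "((d1 * b2 + d2 * b1) * (b3 * b4) - (b1 * b2) * (d3 * b4 + d4 * b3)) / ((b3 * b4) * (b3 * b4))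
    = b1 * b2 / (b3 * b4) * (d1 / b1 + d2 / b2 - d3 / b3 - d4 / b4)"
    if "b1 \<noteq> 0" "b2 \<noteq> 0" "b3 \<noteq> 0" "b4 \<noteq> 0" for b1 b2 b3 b4 d1 d2 d3 d4 :: complex
    using that by (simp add: field_simps)
  moreover have "CR \<phi> i 0 *
    (dlog_bracket j2 (\<lambda>i. \<phi> i 0) (\<lambda>i. deriv (\<phi> i) 0) (m i) (m j1) + dlog_bracket j2 (\<lambda>i. \<phi> i 0) (\<lambda>i. deriv (\<phi> i) 0) (m a) (m j2)
     - dlog_bracket j2 (\<lambda>i. \<phi> i 0) (\<lambda>i. deriv (\<phi> i) 0) (m i) (m j2) - dlog_bracket j2 (\<lambda>i. \<phi> i 0) (\<lambda>i. deriv (\<phi> i) 0) (m a) (m j1))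
    = b (m i) (m j1) 0 * b (m a) (m j2) 0 / (b (m i) (m j2) 0 * b (m a) (m j1) 0) *
     (db (m i) (m j1) / b (m i) (m j1) 0 + db (m a) (m j2) / b (m a) (m j2) 0 - db (m i) (m j2) / b (m i) (m j2) 0 - db (m a) (m j1) / b (m a) (m j1) 0)"
    unfolding dlog_bracket_def by (simp add: eq b_def db_def)
  ultimately show ?thesis using nz mi ma by metis
qed

text \<open>The logarithmic derivative of a square is twice that of the root, whichever branch is
  taken.\<close>

lemma lift_deriv:
  assumes \<phi>: "motion \<phi>" and \<psi>: "motion \<psi>" and i: "i \<le> n" "i \<noteq> j1" "i \<noteq> j2"
    and sq: "\<And>t. t \<in> ball 0 2 \<Longrightarrow> (\<psi> i t)\<^sup>2 = CR \<phi> i t"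
  shows "deriv (\<psi> i) 0 = \<psi> i 0 / 2 *
    (dlog_bracket j2 (\<lambda>i. \<phi> i 0) (\<lambda>i. deriv (\<phi> i) 0) (m i) (m j1) + dlog_bracket j2 (\<lambda>i. \<phi> i 0) (\<lambda>i. deriv (\<phi> i) 0) (m a) (m j2)
     - dlog_bracket j2 (\<lambda>i. \<phi> i 0) (\<lambda>i. deriv (\<phi> i) 0) (m i) (m j2) - dlog_bracket j2 (\<lambda>i. \<phi> i 0) (\<lambda>i. deriv (\<phi> i) 0) (m a) (m j1))"
    (is "_ = _ * ?S")
proof -
  have "(\<psi> i has_field_derivative deriv (\<psi> i) 0) (at 0)"
    by (rule holomorphic_derivI[OF motion_hol[OF \<psi> i(1)]]) auto
  then have "((\<lambda>t. (\<psi> i t)\<^sup>2) has_field_derivative 2 * \<psi> i 0 * deriv (\<psi> i) 0) (at 0)"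
    by (auto intro!: derivative_eq_intros)
  moreover have "((\<lambda>t. (\<psi> i t)\<^sup>2) has_field_derivative CR \<phi> i 0 * ?S) (at 0)"
    by (rule has_field_derivative_transform_within_open[OF CR_deriv[OF \<phi> i], of "ball 0 2"]) (auto simp: sq)
  ultimately have "2 * \<psi> i 0 * deriv (\<psi> i) 0 = CR \<phi> i 0 * ?S" by (rule DERIV_unique)
  moreover have "CR \<phi> i 0 = \<psi> i 0 * \<psi> i 0" "CR \<phi> i 0 \<noteq> 0"
    using sq[of 0] CR_nonzero[OF \<phi> i, of 0] by (auto simp: power2_eq_square)
  ultimately have "\<psi> i 0 * (2 * deriv (\<psi> i) 0) = \<psi> i 0 * (\<psi> i 0 * ?S)" and nz: "\<psi> i 0 \<noteq> 0"
    by (simp_all only: mult_ac) simp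
  then have "2 * deriv (\<psi> i) 0 = \<psi> i 0 * ?S" unfolding mult_left_cancel[OF nz] by simp
  then show ?thesis by (simp add: field_simps)
qed

lemma motion_deriv_zero:
  assumes \<phi>: "motion \<phi>" and i: "i \<in> {j1, j2, a}"
  shows "deriv (\<phi> i) 0 = 0"
proof -
  have "(\<phi> i has_field_derivative 0) (at 0)"
    by (rule has_field_derivative_transform_within_open[OF DERIV_const[of "\<phi> i 0"], of "ball 0 2"])
       (use i motion_norm[OF \<phi>] in auto)
  then show ?thesis by (rule DERIV_imp_deriv)
qed

definition R :: real where "R = Max ((\<lambda>i. \<bar>p i\<bar>) ` {..n})"

lemma R: "i \<le> n \<Longrightarrow> \<bar>p i\<bar> \<le> R" unfolding R_def by (intro Max_ge) auto

text \<open>Lifts of a motion that starts at the fixed point start there again, and each lift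
  applies the derivative of the pull-back to the velocity. So the bounds for motions apply to all
  powers of that derivative, independently of \<open>k\<close>.\<close>

lemma linearized_orbit:
  assumes \<delta>: "\<delta> > 0" "gap p \<delta>" and v: "\<And>i. i \<notin> J \<Longrightarrow> v i = 0" "\<And>i. \<bar>v i\<bar> \<le> \<delta>"
  shows "\<exists>\<Phi>. (\<forall>k. motion (\<Phi> k)) \<and> (\<forall>k. \<forall>i\<le>n. \<Phi> k i 0 = of_real (p i)) \<and>
    (\<forall>k. \<forall>i\<le>n. deriv (\<Phi> k i) 0 = of_real ((tangent_map ^^ k) v i)) \<and>
    (\<forall>k. \<forall>i\<le>n. \<forall>t. \<bar>t\<bar> < 2 \<longrightarrow> \<Phi> k i (of_real t) = of_real ((T ^^ k) (\<lambda>i. p i + t * v i) i))"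
proof -
  define \<phi> where "\<phi> = (\<lambda>i t. complex_of_real (p i) + t * of_real (v i))"
  have mo: "motion \<phi>" unfolding \<phi>_def by (rule linear_motion[OF p_Y \<delta>]) (use v in \<open>auto simp: J_iff\<close>)
  obtain \<Phi> where \<Phi>: "\<Phi> 0 = \<phi>" "\<And>k. motion (\<Phi> k)"
    "\<And>k i t. i \<le> n \<Longrightarrow> i \<noteq> j1 \<Longrightarrow> i \<noteq> j2 \<Longrightarrow> t \<in> ball 0 2 \<Longrightarrow> (\<Phi> (Suc k) i t)\<^sup>2 = CR (\<Phi> k) i t"
    "\<And>k i t. i \<le> n \<Longrightarrow> \<bar>t\<bar> < 2 \<Longrightarrow> \<Phi> k i (of_real t) = of_real ((T ^^ k) (trace \<phi> t) i)"
    by (rule motion_orbit[OF mo]) blast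
  have tr: "trace \<phi> t = (\<lambda>i. p i + t * v i)" for t by (auto simp: trace_def \<phi>_def)
  have at0: "\<Phi> k i 0 = of_real (p i)" if "i \<le> n" for k i
    using \<Phi>(4)[OF that, of 0 k] T_pow_p[OF that, of k] by (simp add: tr)
  have der: "deriv (\<Phi> k i) 0 = of_real ((tangent_map ^^ k) v i)" if "i \<le> n" for k i
    using that
  proof (induction k arbitrary: i)
    case 0
    have "((\<lambda>t. complex_of_real (p i) + t * of_real (v i)) has_field_derivative of_real (v i)) (at 0)"
      by (auto intro!: derivative_eq_intros)
    then show ?case using \<Phi>(1) by (simp add: \<phi>_def DERIV_imp_deriv)
  next
    case (Suc k)
    show ?case
    proof (cases "i \<in> J")
      case False
      then have "i \<in> {j1, j2, a}" using Suc.prems by (auto simp: J_iff)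
      then show ?thesis using motion_deriv_zero[OF \<Phi>(2)] False by (simp add: tangent_map_def)
    next
      case True
      then have i: "i \<le> n" "i \<noteq> j1" "i \<noteq> j2" by (auto simp: J_iff)
      have D: "dlog_bracket j2 (\<lambda>i. \<Phi> k i 0) (\<lambda>i. deriv (\<Phi> k i) 0) r s =
          of_real (dlog_bracket j2 p ((tangent_map ^^ k) v) r s)" if "r \<le> n" "s \<le> n" for r s
        using that by (simp add: dlog_bracket_def bracket_def at0 Suc.IH)
      have "(tangent_map ^^ Suc k) v i = tangent p ((tangent_map ^^ k) v) i"
        using True by (simp add: tangent_map_def[of "(tangent_map ^^ k) v"])
      moreover have "deriv (\<Phi> (Suc k) i) 0 = of_real (p i / 2 *
         (dlog_bracket j2 p ((tangent_map ^^ k) v) (m i) (m j1) + dlog_bracket j2 p ((tangent_map ^^ k) v) (m a) (m j2)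
          - dlog_bracket j2 p ((tangent_map ^^ k) v) (m i) (m j2) - dlog_bracket j2 p ((tangent_map ^^ k) v) (m a) (m j1)))"
        using lift_deriv[OF \<Phi>(2)[of k] \<Phi>(2)[of "Suc k"] i \<Phi>(3)[OF i]] ma m_le[OF i(1)]
        by (simp add: D at0 i del: funpow.simps)
      ultimately show ?thesis by (simp only: tangent_def)
    qed
  qed
  show ?thesis
    by (rule exI[of _ \<Phi>]) (use \<Phi>(2,4) at0 der in \<open>simp add: tr\<close>)
qed

lemma tangent_map_bound:
  assumes \<delta>: "\<delta> > 0" "gap p \<delta>" and v: "\<And>i. i \<notin> J \<Longrightarrow> v i = 0" "\<And>i. \<bar>v i\<bar> \<le> \<delta>" and i: "i \<le> n"
  shows "\<bar>(tangent_map ^^ k) v i\<bar> \<le> 4 * Sch R"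
proof -
  obtain \<Phi> where "\<forall>k. motion (\<Phi> k)" "\<forall>k. \<forall>i\<le>n. \<Phi> k i 0 = of_real (p i)"
    "\<forall>k. \<forall>i\<le>n. deriv (\<Phi> k i) 0 = of_real ((tangent_map ^^ k) v i)"
    using linearized_orbit[of \<delta> v, OF \<delta> v] by blast
  note \<Phi> = this[rule_format]
  have "cmod (deriv (\<Phi> k i) 0) \<le> 4 * Sch R"
    by (rule motion_estimates(1)[OF \<Phi>(1) i]) (use \<Phi>(2)[OF i] R[OF i] in simp)
  then show ?thesis using \<Phi>(3)[OF i] by simp
qed

lemma tangent_map_expand:
  assumes v: "\<And>i. i \<notin> J \<Longrightarrow> v i = 0" and j: "j \<in> J"
  shows "tangent_map v j = (\<Sum>i\<in>J. v i * tangent p (unit_vec i) j)"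
  using tangent_expand[of v j p] v j by (auto simp: tangent_map_def J_iff)

lemma row_action_dual:
  assumes v: "\<And>i. i \<notin> J \<Longrightarrow> v i = 0"
  shows "(\<Sum>j\<in>J. c j * (tangent_map ^^ k) v j) = (\<Sum>i\<in>J. (row_action ^^ k) c i * v i)"
proof (induction k arbitrary: c)
  case (Suc k)
  define w where "w = (tangent_map ^^ k) v"
  have w: "w i = 0" if "i \<notin> J" for i using that v tangent_map_supp[OF that, of k v] by (simp add: w_def)
  have "(\<Sum>j\<in>J. c j * (tangent_map ^^ Suc k) v j) = (\<Sum>j\<in>J. c j * tangent_map w j)" by (simp add: w_def)
  also have "\<dots> = (\<Sum>j\<in>J. \<Sum>i\<in>J. c j * (w i * tangent p (unit_vec i) j))"
    by (rule sum.cong[OF refl]) (simp add: tangent_map_expand[OF w] sum_distrib_left)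
  also have "\<dots> = (\<Sum>i\<in>J. row_action c i * w i)"
    by (subst sum.swap) (simp add: row_action_def sum_distrib_left mult.commute[of _ "w _"] mult.left_commute)
  also have "\<dots> = (\<Sum>i\<in>J. (row_action ^^ k) (row_action c) i * v i)" using Suc.IH by (simp add: w_def)
  finally show ?case by (simp add: funpow_swap1)
qed simp

lemma row_action_unit:
  assumes "i \<in> J"
  shows "(row_action ^^ k) c i = (\<Sum>j\<in>J. c j * (tangent_map ^^ k) (unit_vec i) j)"
proof -
  have "(\<Sum>j\<in>J. c j * (tangent_map ^^ k) (unit_vec i) j) = (\<Sum>l\<in>J. (row_action ^^ k) c l * of_bool (l = i))"
    by (rule row_action_dual) (use assms in auto)
  also have "\<dots> = (row_action ^^ k) c i"
    using assms finite_J by (simp add: of_bool_def if_distrib[of "\<lambda>t. _ * t"] sum.delta cong: if_cong)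
  finally show ?thesis ..
qed

lemma tangent_map_scale:
  assumes "\<And>i. i \<notin> J \<Longrightarrow> v i = 0"
  shows "(tangent_map ^^ k) (\<lambda>i. s * v i) j = s * (tangent_map ^^ k) v j"
proof (induction k arbitrary: j)
  case (Suc k)
  have "(tangent_map ^^ k) (\<lambda>i. s * v i) = (\<lambda>j. s * (tangent_map ^^ k) v j)"
    using Suc.IH by (rule ext)
  then have "(tangent_map ^^ Suc k) (\<lambda>i. s * v i) j = tangent_map (\<lambda>j. s * (tangent_map ^^ k) v j) j"
    by simp
  also have "\<dots> = s * tangent_map ((tangent_map ^^ k) v) j"
    by (simp add: tangent_map_def tangent_def dlog_bracket_def bracket_def diff_divide_distrib algebra_simps)
  finally show ?case by simp
qed simp

text \<open>Boundedness of the powers passes to the transpose; \<delta> times a unit vector is an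
  admissible velocity.\<close>

lemma row_action_bounded: "\<exists>B. \<forall>k. \<forall>i\<in>J. \<bar>(row_action ^^ k) c i\<bar> \<le> B"
proof -
  obtain \<delta> where \<delta>: "\<delta> > 0" "gap p \<delta>" using gap_exists[OF p_Y] .
  define B where "B = (\<Sum>j\<in>J. \<bar>c j\<bar> * (4 * Sch R / \<delta>))"
  have "\<bar>(row_action ^^ k) c i\<bar> \<le> B" if i: "i \<in> J" for k i
  proof -
    have b: "\<bar>(tangent_map ^^ k) (unit_vec i) j\<bar> \<le> 4 * Sch R / \<delta>" if "j \<in> J" for j
    proof -
      have "\<bar>(tangent_map ^^ k) (\<lambda>l. \<delta> * unit_vec i l) j\<bar> \<le> 4 * Sch R"
        by (rule tangent_map_bound[OF \<delta>]) (use i that \<delta> in \<open>auto simp: J_iff\<close>)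
      moreover have "(tangent_map ^^ k) (\<lambda>l. \<delta> * unit_vec i l) j = \<delta> * (tangent_map ^^ k) (unit_vec i) j"
        by (rule tangent_map_scale) (use i in auto)
      ultimately show ?thesis using \<delta>(1) by (simp add: abs_mult field_simps)
    qed
    have "\<bar>(row_action ^^ k) c i\<bar> \<le> (\<Sum>j\<in>J. \<bar>c j * (tangent_map ^^ k) (unit_vec i) j\<bar>)"
      unfolding row_action_unit[OF i] by (rule sum_abs)
    also have "\<dots> \<le> B" unfolding B_def
      by (rule sum_mono, simp only: abs_mult) (intro mult_left_mono b abs_ge_zero)
    finally show ?thesis .
  qed
  then show ?thesis by blast
qed

definition N :: "(nat \<Rightarrow> real) \<Rightarrow> real" where "N c = enn2real (L1 c)"

lemma N_L1: "L1 c = ennreal (N c)" "N c \<ge> 0"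
  using L1_finite[of c] by (auto simp: N_def)

lemma qdiff_add: "qdiff c z = qdiff d z + (\<Sum>j\<in>J. of_real (c j - d j) * qdiff (unit_vec j) z)"
proof -
  have u: "qdiff (unit_vec j) z = simple_poles Z (\<lambda>\<zeta>. of_bool (\<zeta> = pc j) - of_bool (\<zeta> = 0)
     - pc j / pc a * (of_bool (\<zeta> = pc a) - of_bool (\<zeta> = 0))) z" if "j \<in> J" for j
  proof -
    have "pole_coeff (unit_vec j) \<zeta> = of_bool (\<zeta> = pc j) - of_bool (\<zeta> = 0)
     - pc j / pc a * (of_bool (\<zeta> = pc a) - of_bool (\<zeta> = 0))" for \<zeta>
    proof -
      have "pole_coeff (unit_vec j) \<zeta> = (\<Sum>i\<in>J. if i = j then of_bool (\<zeta> = pc i) - of_bool (\<zeta> = 0)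
         - pc i / pc a * (of_bool (\<zeta> = pc a) - of_bool (\<zeta> = 0)) else 0)"
        unfolding pole_coeff_def by (rule sum.cong) auto
      then show ?thesis using that finite_J by simp
    qed
    then have "pole_coeff (unit_vec j) = (\<lambda>\<zeta>. of_bool (\<zeta> = pc j) - of_bool (\<zeta> = 0)
     - pc j / pc a * (of_bool (\<zeta> = pc a) - of_bool (\<zeta> = 0)))" by (rule ext)
    then show ?thesis by (simp only: qdiff_def)
  qed
  have lin: "qdiff c z = (\<Sum>j\<in>J. of_real (c j) * qdiff (unit_vec j) z)" for c
  proof -
    have "qdiff c z = (\<Sum>\<zeta>\<in>Z. \<Sum>j\<in>J. of_real (c j) * ((of_bool (\<zeta> = pc j) - of_bool (\<zeta> = 0)
     - pc j / pc a * (of_bool (\<zeta> = pc a) - of_bool (\<zeta> = 0))) / (z - \<zeta>)))"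
      unfolding qdiff_def simple_poles_def pole_coeff_def by (simp add: sum_divide_distrib)
    also have "\<dots> = (\<Sum>j\<in>J. of_real (c j) * qdiff (unit_vec j) z)"
      by (subst sum.swap) (simp add: u simple_poles_def sum_distrib_left)
    finally show ?thesis .
  qed
  show ?thesis unfolding lin[of c] lin[of d]
    by (simp add: left_diff_distrib sum_subtractf)
qed

text \<open>A Lipschitz estimate, from which the norm is continuous in the coefficients.\<close>

lemma N_triangle: "N c \<le> N d + (\<Sum>j\<in>J. \<bar>c j - d j\<bar> * N (unit_vec j))"
proof -
  have [measurable]: "qdiff c \<in> borel_measurable borel" for c by (rule qdiff_measurable)
  have "cmod (qdiff c z) \<le> cmod (qdiff d z) + (\<Sum>j\<in>J. \<bar>c j - d j\<bar> * cmod (qdiff (unit_vec j) z))" for z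
  proof -
    have "cmod (qdiff c z) \<le> cmod (qdiff d z) + cmod (\<Sum>j\<in>J. of_real (c j - d j) * qdiff (unit_vec j) z)"
      unfolding qdiff_add[of c z d] by (rule norm_triangle_ineq)
    also have "cmod (\<Sum>j\<in>J. of_real (c j - d j) * qdiff (unit_vec j) z) \<le> (\<Sum>j\<in>J. \<bar>c j - d j\<bar> * cmod (qdiff (unit_vec j) z))"
      by (rule sum_norm_le) (simp add: norm_mult flip: of_real_diff)
    finally show ?thesis by simp
  qed
  then have le: "ennreal (cmod (qdiff c z)) \<le> ennreal (cmod (qdiff d z)) + (\<Sum>j\<in>J. ennreal \<bar>c j - d j\<bar> * ennreal (cmod (qdiff (unit_vec j) z)))" for z
    by (simp add: sum_ennreal ennreal_leI sum_nonneg flip: ennreal_plus ennreal_mult)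
  have "L1 c \<le> (\<integral>\<^sup>+z. ennreal (cmod (qdiff d z)) + (\<Sum>j\<in>J. ennreal \<bar>c j - d j\<bar> * ennreal (cmod (qdiff (unit_vec j) z))) \<partial>lborel)"
    unfolding L1_def by (rule nn_integral_mono) (rule le)
  also have "\<dots> = L1 d + (\<Sum>j\<in>J. ennreal \<bar>c j - d j\<bar> * L1 (unit_vec j))"
    unfolding L1_def by (subst nn_integral_add) (auto simp: nn_integral_sum nn_integral_cmult)
  also have "\<dots> = ennreal (N d + (\<Sum>j\<in>J. \<bar>c j - d j\<bar> * N (unit_vec j)))"
    using N_L1(2) by (simp add: N_L1(1) sum_ennreal sum_nonneg flip: ennreal_plus ennreal_mult)
  finally have "ennreal (N c) \<le> ennreal (N d + (\<Sum>j\<in>J. \<bar>c j - d j\<bar> * N (unit_vec j)))"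
    by (simp only: N_L1(1))
  moreover have "N d + (\<Sum>j\<in>J. \<bar>c j - d j\<bar> * N (unit_vec j)) \<ge> 0"
    by (intro add_nonneg_nonneg sum_nonneg mult_nonneg_nonneg N_L1(2)) auto
  ultimately show ?thesis by (simp only: ennreal_le_iff)
qed

lemma N_tendsto:
  assumes "\<And>j. j \<in> J \<Longrightarrow> (\<lambda>k. u k j) \<longlonglongrightarrow> d j"
  shows "(\<lambda>k. N (u k)) \<longlonglongrightarrow> N d"
proof -
  have "\<bar>N (u k) - N d\<bar> \<le> (\<Sum>j\<in>J. \<bar>u k j - d j\<bar> * N (unit_vec j))" for k
    using N_triangle[of "u k" d] N_triangle[of d "u k"] by (simp add: abs_minus_commute abs_le_iff)
  moreover have "(\<lambda>k. \<Sum>j\<in>J. \<bar>u k j - d j\<bar> * N (unit_vec j)) \<longlonglongrightarrow> (\<Sum>j\<in>J. \<bar>d j - d j\<bar> * N (unit_vec j))"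
    by (intro tendsto_intros assms)
  ultimately have "(\<lambda>k. N (u k) - N d) \<longlonglongrightarrow> 0"
    by (intro Lim_null_comparison[of "\<lambda>k. N (u k) - N d" "\<lambda>k. \<Sum>j\<in>J. \<bar>u k j - d j\<bar> * N (unit_vec j)"]) simp_all
  then show ?thesis by (rule LIM_zero_cancel)
qed

lemma row_action_tendsto:
  assumes "\<And>j. j \<in> J \<Longrightarrow> (\<lambda>k. u k j) \<longlonglongrightarrow> d j" "i \<in> J"
  shows "(\<lambda>k. (row_action ^^ s) (u k) i) \<longlonglongrightarrow> (row_action ^^ s) d i"
  using assms(2)
proof (induction s arbitrary: i)
  case (Suc s)
  have "(\<lambda>k. row_action ((row_action ^^ s) (u k)) i) \<longlonglongrightarrow> row_action ((row_action ^^ s) d) i"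
    unfolding row_action_def[of _ i] by (intro tendsto_intros Suc.IH)
  then show ?case by simp
qed (use assms in simp)

text \<open>A differential of norm 0 vanishes off the real axis by continuity, so its residues are
  0; the residue at \<open>pc j\<close> is the coefficient \<open>d j\<close>.\<close>

lemma N_eq_0:
  assumes "N d = 0" "j \<in> J"
  shows "d j = 0"
proof -
  have [measurable]: "qdiff d \<in> borel_measurable borel" by (rule qdiff_measurable)
  let ?B = "{z. Im z \<noteq> 0} \<inter> qdiff d -` (- {0})"
  have "L1 d = 0" using N_L1(1)[of d] assms(1) by simp
  then have ae: "AE z in lborel. qdiff d z = 0"
    unfolding L1_def by (subst (asm) nn_integral_0_iff_AE) auto
  have op: "open ?B" by (rule continuous_open_preimage[OF qdiff_cont open_nonreal]) auto
  have "AE z in lborel. z \<notin> ?B" using ae by eventually_elim simp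
  then have "?B \<in> null_sets lborel" using op by (subst (asm) AE_iff_null_sets[symmetric]) auto
  then have "negligible ?B" by (simp add: negligible_iff_null_sets null_sets_completionI)
  then have "?B = {}" using open_not_negligible[OF op] by blast
  then have zero: "qdiff d z = 0" if "Im z \<noteq> 0" for z using that by auto
  have "infinite {z. Im z \<noteq> 0}"
  proof
    assume "finite {z. Im z \<noteq> 0}"
    then have "negligible {z. Im z \<noteq> 0}" by (rule negligible_finite)
    moreover have "\<i> \<in> {z. Im z \<noteq> 0}" by simp
    ultimately show False using open_not_negligible[OF open_nonreal] by blast
  qed
  then have "pole_coeff d (pc j) = 0"
    by (rule simple_poles_independent[OF Z(1)]) (use zero assms(2) pc_in_Z in \<open>auto simp: qdiff_def J_iff\<close>)
  moreover have "pole_coeff d (pc j) = (\<Sum>i\<in>J. if i = j then of_real (d j) else 0)"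
    unfolding pole_coeff_def
  proof (rule sum.cong[OF refl])
    fix i assume "i \<in> J"
    then show "of_real (d i) * (of_bool (pc j = pc i) - of_bool (pc j = 0) - pc i / pc a * (of_bool (pc j = pc a) - of_bool (pc j = 0)))
      = (if i = j then of_real (d j) else 0)"
      using assms(2) pc_inj[of j i] pc_inj[of j j1] pc_inj[of j a] idx pc_simps by (auto simp: J_iff)
  qed
  ultimately show ?thesis using finite_J assms(2) by simp
qed

text \<open>The norms along the orbit decrease to a limit \<open>L\<close>. A limit point of the
  bounded orbit and all its images have norm \<open>L\<close>, so \<open>nonexc\<close> applies and
  gives norm 0. Hence 0 is the only limit point.\<close>

lemma row_action_tendsto_zero:
  assumes nonexc: "\<forall>c. (\<forall>k. L1 ((row_action ^^ k) c) = L1 c) \<longrightarrow> L1 c = 0" and i: "i \<in> J"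
  shows "(\<lambda>k. (row_action ^^ k) c i) \<longlonglongrightarrow> 0"
proof (rule ccontr)
  assume nlim: "\<not> ?thesis"
  define u where "u = (\<lambda>k. (row_action ^^ k) c)"
  obtain B where B: "\<And>k i. i \<in> J \<Longrightarrow> \<bar>u k i\<bar> \<le> B" using row_action_bounded[of c] by (auto simp: u_def)
  have dec: "N (u (Suc k)) \<le> N (u k)" for k
    using L1_row_action[of "u k"] N_L1 by (simp add: u_def ennreal_le_iff)
  then have "decseq (\<lambda>k. N (u k))" by (rule decseq_SucI)
  then obtain L where L: "(\<lambda>k. N (u k)) \<longlonglongrightarrow> L" using decseq_convergent[of "\<lambda>k. N (u k)" 0] N_L1(2) by metis
  have lim: "N ((row_action ^^ s) d) = L"
    if r: "strict_mono r" and d: "\<And>j. j \<in> J \<Longrightarrow> (\<lambda>k. u (r k) j) \<longlonglongrightarrow> d j" for r d s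
  proof -
    have "(\<lambda>k. N ((row_action ^^ s) (u (r k)))) \<longlonglongrightarrow> N ((row_action ^^ s) d)"
      by (intro N_tendsto row_action_tendsto d)
    moreover have "(row_action ^^ s) (u (r k)) = u (r k + s)" for k
      by (simp add: u_def funpow_add add.commute[of _ s])
    moreover have "(\<lambda>k. N (u (r k + s))) \<longlonglongrightarrow> L"
    proof -
      have "strict_mono (\<lambda>k. r k + s)" using r by (simp add: strict_mono_def)
      from LIMSEQ_subseq_LIMSEQ[OF L this] show ?thesis by (simp add: o_def)
    qed
    ultimately show ?thesis using LIMSEQ_unique by auto
  qed
  have Nd: "N d = 0" if r: "strict_mono r" and d: "\<And>j. j \<in> J \<Longrightarrow> (\<lambda>k. u (r k) j) \<longlonglongrightarrow> d j" for r d
  proof -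
    have "L1 ((row_action ^^ k) d) = L1 d" for k
      using lim[OF r d, of k] lim[OF r d, of 0] N_L1(1) by simp
    then have "L1 d = 0" using nonexc by blast
    then show ?thesis by (simp add: N_def)
  qed
  obtain e where e: "e > 0" "\<And>k0. \<exists>k\<ge>k0. \<bar>u k i\<bar> \<ge> e"
    using nlim unfolding LIMSEQ_iff by (auto simp: u_def not_less)
  have inf: "infinite {k. \<bar>u k i\<bar> \<ge> e}"
    unfolding infinite_nat_iff_unbounded_le using e(2) by auto
  define s where "s = enumerate {k. \<bar>u k i\<bar> \<ge> e}"
  have s: "strict_mono s" "\<And>k. \<bar>u (s k) i\<bar> \<ge> e"
    using strict_mono_enumerate[OF inf] enumerate_in_set[OF inf] by (auto simp: s_def)
  obtain r d where r: "strict_mono r" "\<And>j. j \<in> J \<Longrightarrow> (\<lambda>k. u (s (r k)) j) \<longlonglongrightarrow> d j"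
    using bounded_finite_subsequence[OF finite_J, of "\<lambda>k. u (s k)" B] B by blast
  have "N d = 0" by (rule Nd[OF strict_mono_o[OF s(1) r(1)]]) (use r in \<open>simp add: o_def\<close>)
  then have "d i = 0" using N_eq_0 i by simp
  moreover have "\<bar>d i\<bar> \<ge> e"
    by (rule tendsto_lowerbound[OF tendsto_rabs[OF r(2)[OF i]]]) (use s in auto)
  ultimately show False using e(1) by simp
qed

lemma T_pow_cong: "(\<And>i. i \<le> n \<Longrightarrow> X i = X' i) \<Longrightarrow> i \<le> n \<Longrightarrow> (T ^^ k) X i = (T ^^ k) X' i"
proof (induction k arbitrary: i)
  case (Suc k)
  have "T ((T ^^ k) X) i = T ((T ^^ k) X') i" by (rule T_cong) (use Suc in auto)
  then show ?case by simp
qed simp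

lemma tangent_map_contracts:
  assumes nonexc: "\<forall>c. (\<forall>k. L1 ((row_action ^^ k) c) = L1 c) \<longrightarrow> L1 c = 0"
  shows "\<exists>K. \<forall>v V i. (\<forall>i. i \<notin> J \<longrightarrow> v i = 0) \<longrightarrow> (\<forall>i. \<bar>v i\<bar> \<le> V) \<longrightarrow> \<bar>(tangent_map ^^ K) v i\<bar> \<le> V / 2"
proof -
  \<comment> \<open>If every entry of the matrix is at most \<eta>, a sum over \<open>card J\<close>
    columns contributes at most \<open>V / 2\<close>.\<close>
  define \<eta> where "\<eta> = 1 / (2 * (real (card J) + 1))"
  have \<eta>: "\<eta> > 0" by (simp add: \<eta>_def)
  have "\<forall>\<^sub>F k in sequentially. \<forall>j\<in>J. \<forall>i\<in>J. \<bar>(row_action ^^ k) (unit_vec j) i\<bar> < \<eta>"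
  proof (intro eventually_ball_finite finite_J ballI)
    fix i j assume "i \<in> J"
    show "\<forall>\<^sub>F k in sequentially. \<bar>(row_action ^^ k) (unit_vec j) i\<bar> < \<eta>"
      using tendstoD[OF row_action_tendsto_zero[OF nonexc \<open>i \<in> J\<close>] \<eta>] by (simp add: dist_real_def)
  qed
  then obtain K0 where K0: "\<And>k. k \<ge> K0 \<Longrightarrow> \<forall>j\<in>J. \<forall>i\<in>J. \<bar>(row_action ^^ k) (unit_vec j) i\<bar> < \<eta>"
    unfolding eventually_sequentially by blast
  define K where "K = Suc K0"
  have K: "\<bar>(row_action ^^ K) (unit_vec j) i\<bar> \<le> \<eta>" if "j \<in> J" "i \<in> J" for i j
    using K0[of K] that by (force simp: K_def simp del: funpow.simps)
  have "\<bar>(tangent_map ^^ K) v i\<bar> \<le> V / 2"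
    if v: "\<And>i. i \<notin> J \<Longrightarrow> v i = 0" and V: "\<And>i. \<bar>v i\<bar> \<le> V" for v V i
  proof -
    have V0: "V \<ge> 0" using V[of 0] by linarith
    show ?thesis
    proof (cases "i \<in> J")
      case False
      then show ?thesis using V0 tangent_map_supp[OF False, of K v] by (simp add: K_def del: funpow.simps)
    next
      case True
      have "(tangent_map ^^ K) v i = (\<Sum>j\<in>J. unit_vec i j * (tangent_map ^^ K) v j)"
        using True finite_J by (simp add: of_bool_def if_distrib[of "\<lambda>t. t * _"] sum.delta cong: if_cong)
      also have "\<dots> = (\<Sum>j\<in>J. (row_action ^^ K) (unit_vec i) j * v j)" by (rule row_action_dual[OF v])
      finally have "\<bar>(tangent_map ^^ K) v i\<bar> \<le> (\<Sum>j\<in>J. \<bar>(row_action ^^ K) (unit_vec i) j * v j\<bar>)"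
        by (simp add: sum_abs)
      also have "\<dots> \<le> (\<Sum>j\<in>J. \<eta> * V)"
        by (rule sum_mono) (auto simp: abs_mult intro!: mult_mono K True V \<eta>[THEN less_imp_le])
      also have "\<dots> = (real (card J) * \<eta>) * V" by simp
      also have "\<dots> \<le> 1 / 2 * V"
        by (rule mult_right_mono[OF _ V0]) (simp add: \<eta>_def field_simps)
      finally show ?thesis by simp
    qed
  qed
  then show ?thesis by blast
qed

text \<open>The linear part of the K-th iterate halves distances; the quadratic Taylor remainder
  costs at most another quarter as long as the distance is at most \<open>\<eta>0\<close>.\<close>

lemma local_contraction:
  assumes nonexc: "\<forall>c. (\<forall>k. L1 ((row_action ^^ k) c) = L1 c) \<longrightarrow> L1 c = 0"
    and \<delta>: "\<delta> > 0" "gap p \<delta>"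
  shows "\<exists>K \<eta>0. \<eta>0 > 0 \<and> \<eta>0 \<le> \<delta> / 4 \<and>
    (\<forall>x \<eta> i. x \<in> Y \<longrightarrow> 0 < \<eta> \<longrightarrow> \<eta> \<le> \<eta>0 \<longrightarrow> (\<forall>i. i \<le> n \<longrightarrow> \<bar>x i - p i\<bar> \<le> \<eta>) \<longrightarrow> i \<le> n \<longrightarrow>
       \<bar>(T ^^ K) x i - p i\<bar> \<le> 3 / 4 * \<eta>)"
proof -
  obtain K where K: "\<forall>v V i. (\<forall>i. i \<notin> J \<longrightarrow> v i = 0) \<longrightarrow> (\<forall>i. \<bar>v i\<bar> \<le> V) \<longrightarrow> \<bar>(tangent_map ^^ K) v i\<bar> \<le> V / 2"
    using tangent_map_contracts[OF nonexc] by blast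
  define S where "S = Sch R"
  have S: "S \<ge> 1" using Sch_ge_1 by (simp add: S_def)
  \<comment> \<open>The first bound keeps the time \<open>\<eta> / \<delta>\<close> at most 1/4, as
    \<open>motion_estimates\<close> demands; the second makes the remainder
    \<open>32 * S * (\<eta> / \<delta>)\<^sup>2\<close> at most \<open>\<eta> / 4\<close>.\<close>
  define \<eta>0 where "\<eta>0 = min (\<delta> / 4) (\<delta>\<^sup>2 / (128 * S))"
  have \<eta>0: "\<eta>0 > 0" "\<eta>0 \<le> \<delta> / 4" "\<eta>0 \<le> \<delta>\<^sup>2 / (128 * S)" using \<delta> S by (auto simp: \<eta>0_def)
  have "\<bar>(T ^^ K) x i - p i\<bar> \<le> 3 / 4 * \<eta>"
    if x: "x \<in> Y" and \<eta>: "0 < \<eta>" "\<eta> \<le> \<eta>0" and le: "\<And>i. i \<le> n \<Longrightarrow> \<bar>x i - p i\<bar> \<le> \<eta>" and i: "i \<le> n" for x \<eta> i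
  proof -
    define t where "t = \<eta> / \<delta>"
    have t: "0 < t" "t \<le> 1/4" using \<eta> \<eta>0 \<delta> by (auto simp: t_def divide_simps)
    define v where "v = (\<lambda>i. if i \<in> J then (x i - p i) / t else 0)"
    have v: "\<And>i. i \<notin> J \<Longrightarrow> v i = 0" by (simp add: v_def)
    have v': "\<bar>v i\<bar> \<le> \<delta>" for i
    proof (cases "i \<in> J")
      case True
      then have "\<bar>x i - p i\<bar> \<le> t * \<delta>" using le[of i] \<delta> by (simp add: t_def J_iff)
      then show ?thesis using t True by (simp add: v_def divide_simps mult.commute)
    qed (use \<delta> in \<open>simp add: v_def\<close>)
    have xv: "p i + t * v i = x i" if "i \<le> n" for i
    proof (cases "i \<in> J")
      case False
      then show ?thesis using Y_norm[OF x] Y_norm[OF p_Y] that by (auto simp: v_def J_iff)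
    qed (use t in \<open>simp add: v_def\<close>)
    obtain \<Phi> where "\<forall>k. motion (\<Phi> k)" "\<forall>k. \<forall>i\<le>n. \<Phi> k i 0 = of_real (p i)"
      "\<forall>k. \<forall>i\<le>n. deriv (\<Phi> k i) 0 = of_real ((tangent_map ^^ k) v i)"
      "\<forall>k. \<forall>i\<le>n. \<forall>t. \<bar>t\<bar> < 2 \<longrightarrow> \<Phi> k i (of_real t) = of_real ((T ^^ k) (\<lambda>i. p i + t * v i) i)"
      using linearized_orbit[of \<delta> v, OF \<delta> v v'] by blast
    note \<Phi> = this[rule_format]
    have "\<Phi> K i (of_real t) = of_real ((T ^^ K) x i)"
      using \<Phi>(4)[OF i, of t K] t T_pow_cong[of "\<lambda>i. p i + t * v i" x i K] xv i by simp
    moreover have "cmod (\<Phi> K i (of_real t) - \<Phi> K i 0 - of_real t * deriv (\<Phi> K i) 0) \<le> 32 * Sch R * (cmod (of_real t))\<^sup>2"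
      by (rule motion_estimates(3)[OF \<Phi>(1) i]) (use \<Phi>(2)[OF i] R[OF i] t in auto)
    ultimately have est: "\<bar>(T ^^ K) x i - p i - t * (tangent_map ^^ K) v i\<bar> \<le> 32 * S * t\<^sup>2"
      using \<Phi>(2,3)[OF i] by (simp add: S_def flip: of_real_diff of_real_mult)
    have "\<bar>t * (tangent_map ^^ K) v i\<bar> \<le> t * (\<delta> / 2)"
      using K[rule_format, of v \<delta> i, OF v v'] t by (simp add: abs_mult)
    also have "\<dots> = \<eta> / 2" using \<delta> by (simp add: t_def)
    finally have lin: "\<bar>t * (tangent_map ^^ K) v i\<bar> \<le> \<eta> / 2" .
    have "32 * S * t\<^sup>2 = \<eta> * (32 * S * \<eta> / \<delta>\<^sup>2)" by (simp add: t_def power2_eq_square)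
    also have "\<dots> \<le> \<eta> * (1 / 4)"
    proof (rule mult_left_mono)
      have "\<eta> \<le> \<delta>\<^sup>2 / (128 * S)" using \<eta> \<eta>0 by linarith
      then show "32 * S * \<eta> / \<delta>\<^sup>2 \<le> 1 / 4" using \<delta> S by (simp add: divide_simps mult_ac)
    qed (use \<eta> in simp)
    finally have "32 * S * t\<^sup>2 \<le> \<eta> / 4" by simp
    then show ?thesis using est lin unfolding abs_le_iff by linarith
  qed
  then show ?thesis using \<eta>0 by blast
qed

text \<open>\<open>local_contraction\<close> controls the multiples of \<open>K\<close>.
  Equicontinuity at the fixed point covers the iterates in between, with a constant that does not
  grow.\<close>

lemma local_attraction:
  assumes nonexc: "\<forall>c. (\<forall>k. L1 ((row_action ^^ k) c) = L1 c) \<longrightarrow> L1 c = 0"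
  shows "\<exists>\<eta>0>0. \<forall>x i. x \<in> Y \<longrightarrow> (\<forall>i. i \<le> n \<longrightarrow> \<bar>x i - p i\<bar> \<le> \<eta>0) \<longrightarrow> i \<le> n \<longrightarrow> (\<lambda>k. (T ^^ k) x i) \<longlonglongrightarrow> p i"
proof -
  obtain \<delta> where \<delta>: "\<delta> > 0" "gap p \<delta>" using gap_exists[OF p_Y] .
  obtain K \<eta>0 where \<eta>0: "\<eta>0 > 0" "\<eta>0 \<le> \<delta> / 4" and con':
    "\<forall>x \<eta> i. x \<in> Y \<longrightarrow> 0 < \<eta> \<longrightarrow> \<eta> \<le> \<eta>0 \<longrightarrow> (\<forall>i. i \<le> n \<longrightarrow> \<bar>x i - p i\<bar> \<le> \<eta>) \<longrightarrow> i \<le> n \<longrightarrow>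
       \<bar>(T ^^ K) x i - p i\<bar> \<le> 3 / 4 * \<eta>"
    using local_contraction[OF nonexc \<delta>] by blast
  note con = con'[rule_format]
  have "(\<lambda>k. (T ^^ k) x i) \<longlonglongrightarrow> p i"
    if x: "x \<in> Y" and le: "\<And>i. i \<le> n \<Longrightarrow> \<bar>x i - p i\<bar> \<le> \<eta>0" and i: "i \<le> n" for x i
  proof -
    have geo: "\<bar>(T ^^ (K * s)) x i - p i\<bar> \<le> (3/4) ^ s * \<eta>0" if "i \<le> n" for s i
      using that
    proof (induction s arbitrary: i)
      case (Suc s)
      have "\<bar>(T ^^ K) ((T ^^ (K * s)) x) i - p i\<bar> \<le> 3 / 4 * ((3/4) ^ s * \<eta>0)"
      proof (rule con)
        show "(3/4) ^ s * \<eta>0 \<le> \<eta>0" using \<eta>0 by (simp add: mult_le_cancel_right1 power_le_one)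
      qed (use Suc \<eta>0 T_pow_Y[OF x] in auto)
      then show ?case by (simp add: funpow_add mult.assoc)
    qed (use le in simp)
    show ?thesis
    proof (rule metric_LIMSEQ_I)
      fix e :: real assume e: "e > 0"
      define C where "C = 4 * Sch R * \<eta>0 / \<delta>"
      have C: "C > 0" using \<eta>0 \<delta> Sch_ge_1[of R] by (simp add: C_def)
      obtain s where s: "(3/4 :: real) ^ s < e / C"
        using real_arch_pow_inv[of "e / C" "3/4"] e C by auto
      have "dist ((T ^^ k) x i) (p i) < e" if k: "k \<ge> K * s" for k
      proof -
        let ?x = "(T ^^ (K * s)) x"
        have "\<bar>(T ^^ (k - K * s)) ?x i - (T ^^ (k - K * s)) p i\<bar> \<le> 4 * Sch R * ((3/4) ^ s * \<eta>0 / \<delta>)"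
        proof (rule pullback_equicontinuous[OF p_Y \<delta> T_pow_Y[OF x]])
          have "(3/4) ^ s * \<eta>0 \<le> 1 * \<eta>0" using \<eta>0 by (intro mult_right_mono power_le_one) auto
          then have "(3/4) ^ s * \<eta>0 \<le> \<delta> / 4" using \<eta>0 by linarith
          then have "(3/4) ^ s * \<eta>0 / \<delta> \<le> \<delta> / 4 / \<delta>" using \<delta>(1) by (intro divide_right_mono) auto
          also have "\<delta> / 4 / \<delta> = 1/4" using \<delta>(1) by simp
          finally show "(3/4) ^ s * \<eta>0 / \<delta> \<le> 1/4" .
        qed (use \<eta>0 \<delta> geo T_pow_p R i in auto)
        moreover have "(T ^^ (k - K * s)) ?x = (T ^^ k) x"
          using k by (metis comp_apply funpow_add le_add_diff_inverse2)
        ultimately have "\<bar>(T ^^ k) x i - p i\<bar> \<le> C * (3/4) ^ s"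
          using T_pow_p[OF i] by (simp add: C_def mult_ac)
        also have "\<dots> < e" using s C by (simp add: field_simps)
        finally show ?thesis by (simp add: dist_real_def)
      qed
      then show "\<exists>k0. \<forall>k\<ge>k0. dist ((T ^^ k) x i) (p i) < e" by blast
    qed
  qed
  then show ?thesis using \<eta>0 by blast
qed

text \<open>Walk along the segment from \<open>p\<close> to \<open>x\<close> inside the convex set
  \<open>Y\<close>. If the orbit of one point of the segment converges to \<open>p\<close>,
  equicontinuity brings the orbit of the next point into the region of local attraction. The step
  length is uniform because an iterate within distance 1 of \<open>p\<close> is used, so that
  \<open>R + 1\<close> always bounds its coordinates.\<close>

theorem global_attraction:
  assumes nonexc: "\<forall>c. (\<forall>k. L1 ((row_action ^^ k) c) = L1 c) \<longrightarrow> L1 c = 0"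
    and x: "x \<in> Y" and i: "i \<le> n"
  shows "(\<lambda>k. (T ^^ k) x i) \<longlonglongrightarrow> p i"
proof -
  obtain \<eta>0 where \<eta>0: "\<eta>0 > 0" and loc':
    "\<forall>x i. x \<in> Y \<longrightarrow> (\<forall>i. i \<le> n \<longrightarrow> \<bar>x i - p i\<bar> \<le> \<eta>0) \<longrightarrow> i \<le> n \<longrightarrow> (\<lambda>k. (T ^^ k) x i) \<longlonglongrightarrow> p i"
    using local_attraction[OF nonexc] by blast
  note loc = loc'[rule_format]
  obtain \<delta>1 where \<delta>1: "\<delta>1 > 0" "gap p \<delta>1" using gap_exists[OF p_Y] .
  obtain \<delta>2 where \<delta>2: "\<delta>2 > 0" "gap x \<delta>2" using gap_exists[OF x] .
  define \<delta> where "\<delta> = min \<delta>1 \<delta>2"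
  have \<delta>: "\<delta> > 0" "gap p \<delta>" "gap x \<delta>"
    using \<delta>1 \<delta>2 by (auto simp: \<delta>_def gap_def min_def intro: order_trans[rotated]) (smt (verit))+
  define X where "X = (\<lambda>u i. (1 - u) * p i + u * x i)"
  have XY: "X u \<in> Y" and gapX: "gap (X u) \<delta>" if u: "0 \<le> u" "u \<le> 1" for u
  proof -
    have d: "X u k - X u i \<ge> 5 * \<delta>" if "i \<le> n" "k \<le> n" "prec i k" for i k
    proof -
      have "p k - p i \<ge> 5 * \<delta>" "x k - x i \<ge> 5 * \<delta>" using \<delta> that by (auto simp: gap_def)
      then have "(1 - u) * (p k - p i) + u * (x k - x i) \<ge> (1 - u) * (5 * \<delta>) + u * (5 * \<delta>)"
        using u by (intro add_mono mult_left_mono) auto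
      then show ?thesis by (simp add: X_def algebra_simps)
    qed
    then show "gap (X u) \<delta>" by (simp add: gap_def)
    have "X u i < X u k" if "i \<le> n" "k \<le> n" "prec i k" for i k using d[OF that] \<delta>(1) by linarith
    then show "X u \<in> Y" using Y_norm[OF p_Y] Y_norm[OF x] by (simp add: Y_eq X_def algebra_simps)
  qed
  define r where "r = R + 1"
  define e where "e = min (1/4) (\<eta>0 / (8 * Sch r))"
  have e: "e > 0" "e \<le> 1/4" "4 * Sch r * e \<le> \<eta>0 / 2"
  proof -
    have S: "Sch r > 0" using Sch_ge_1[of r] by linarith
    then show "e > 0" "e \<le> 1/4" using \<eta>0 by (auto simp: e_def)
    have "4 * Sch r * e \<le> 4 * Sch r * (\<eta>0 / (8 * Sch r))" using S by (intro mult_left_mono) (auto simp: e_def)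
    then show "4 * Sch r * e \<le> \<eta>0 / 2" using S by simp
  qed
  define D where "D = Max ((\<lambda>i. \<bar>x i - p i\<bar>) ` {..n})"
  have D: "\<bar>x i - p i\<bar> \<le> D" if "i \<le> n" for i unfolding D_def using that by (intro Max_ge) auto
  have D0: "D \<ge> 0" using D[OF i] by linarith
  \<comment> \<open>So many steps that consecutive points differ by at most
    \<open>e * \<delta>\<close> in every coordinate.\<close>
  obtain M :: nat where M: "D / (e * \<delta>) < real M" using reals_Archimedean2 by blast
  have M0: "real M > 0" using M D0 e \<delta> by (smt (verit) divide_nonneg_pos mult_pos_pos)
  have "\<forall>i\<le>n. (\<lambda>k. (T ^^ k) (X (real l / real M)) i) \<longlonglongrightarrow> p i" if "l \<le> M" for l
    using that
  proof (induction l)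
    case 0
    have "X 0 = p" by (simp add: X_def)
    then show ?case using loc[of p] p_Y \<eta>0 by simp
  next
    case (Suc l)
    let ?y = "X (real l / real M)" and ?x = "X (real (Suc l) / real M)"
    have u: "0 \<le> real l / real M" "real l / real M \<le> 1" "0 \<le> real (Suc l) / real M" "real (Suc l) / real M \<le> 1"
      using Suc.prems M0 by auto
    have IH: "(\<lambda>k. (T ^^ k) ?y i) \<longlonglongrightarrow> p i" if "i \<le> n" for i using Suc that by simp
    have "\<forall>\<^sub>F k in sequentially. \<forall>i\<in>{..n}. dist ((T ^^ k) ?y i) (p i) < min 1 (\<eta>0 / 2)"
    proof (rule eventually_ball_finite, simp, rule ballI)
      fix i assume "i \<in> {..n}"
      then show "\<forall>\<^sub>F k in sequentially. dist ((T ^^ k) ?y i) (p i) < min 1 (\<eta>0 / 2)"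
        using \<eta>0 by (intro tendstoD[OF IH]) auto
    qed
    then obtain k where k: "\<And>i. i \<le> n \<Longrightarrow> \<bar>(T ^^ k) ?y i - p i\<bar> < min 1 (\<eta>0 / 2)"
      unfolding eventually_sequentially dist_real_def by (metis atMost_iff order_refl)
    have near: "\<bar>(T ^^ k) ?x i - (T ^^ k) ?y i\<bar> \<le> 4 * Sch r * e" if "i \<le> n" for i
    proof (rule pullback_equicontinuous[OF XY[OF u(1,2)] \<delta>(1) gapX[OF u(1,2)] XY[OF u(3,4)] e(1,2) _ _ that])
      fix i assume i: "i \<le> n"
      have "?x i - ?y i = (x i - p i) / real M"
        using M0 by (simp add: X_def field_simps)
      then have "\<bar>?x i - ?y i\<bar> \<le> D / real M"
        using D[OF i] M0 by (simp add: divide_right_mono)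
      also have "\<dots> \<le> e * \<delta>" using M M0 e \<delta> by (simp add: divide_simps mult.commute)
      finally show "\<bar>?x i - ?y i\<bar> \<le> e * \<delta>" .
      have "\<bar>(T ^^ k) ?y i - p i\<bar> < 1" using k[OF i] by simp
      then show "\<bar>(T ^^ k) ?y i\<bar> \<le> r" using R[OF i] unfolding r_def by linarith
    qed
    have "\<bar>(T ^^ k) ?x i - p i\<bar> \<le> \<eta>0" if "i \<le> n" for i
      using near[OF that] k[OF that] e(3) by linarith
    then have "(\<lambda>l. (T ^^ l) ((T ^^ k) ?x) i) \<longlonglongrightarrow> p i" if "i \<le> n" for i
      using loc[OF T_pow_Y[OF XY[OF u(3,4)]] _ that] by blast
    then have "(\<lambda>l. (T ^^ (l + k)) ?x i) \<longlonglongrightarrow> p i" if "i \<le> n" for i using that by (simp add: funpow_add)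
    then show ?case using LIMSEQ_offset[of "\<lambda>l. (T ^^ l) ?x _" k] by blast
  qed
  from this[of M] have "(\<lambda>k. (T ^^ k) (X 1) i) \<longlonglongrightarrow> p i" using i M0 by simp
  moreover have "X 1 = x" by (simp add: X_def)
  ultimately show ?thesis by simp
qed

end

section \<open>Real quadratic maps in normal form\<close>

text \<open>Homogeneous coordinates, which make the formulas uniform at infinity.\<close>

definition pt :: "'a::field \<Rightarrow> 'a \<Rightarrow> 'a option" where
  "pt x y = (if y = 0 then None else Some (x / y))"

lemma pt_simps [simp]: "pt x 1 = Some x" "pt x 0 = None"
  by (simp_all add: pt_def)

lemma pt_scale: "k \<noteq> 0 \<Longrightarrow> pt (k * x) (k * y) = pt x y"
  by (simp add: pt_def)

lemma pt_eq_iff: "x \<noteq> 0 \<or> y \<noteq> 0 \<Longrightarrow> x' \<noteq> 0 \<or> y' \<noteq> 0 \<Longrightarrow> pt x y = pt x' y' \<longleftrightarrow> x * y' = x' * y"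
  by (auto simp: pt_def frac_eq_eq)

lemma pt_cases:
  obtains x y where "z = pt x y" "x \<noteq> 0 \<or> y \<noteq> 0"
proof (cases z)
  case None
  then show ?thesis using that[of 1 0] by simp
next
  case (Some a)
  then show ?thesis using that[of a 1] by simp
qed

definition mob :: "'a::field \<Rightarrow> 'a \<Rightarrow> 'a \<Rightarrow> 'a \<Rightarrow> 'a option \<Rightarrow> 'a option" where
  "mob a b c d = rat_map [:b, a:] [:d, c:]"

lemma mob_pt:
  assumes det: "a * d - b * c \<noteq> 0" and xy: "x \<noteq> 0 \<or> y \<noteq> 0"
  shows "mob a b c d (pt x y) = pt (a * x + b * y) (c * x + d * y)"
proof (cases "y = 0")
  case True
  have "max (degree [:b, a:]) (degree [:d, c:]) = 1" using det by auto
  then show ?thesis using True xy by (auto simp: mob_def rat_map_def pt_def Let_def)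
next
  case False
  have "c * (x / y) + d = 0 \<longleftrightarrow> c * x + d * y = 0"
    using False by (simp add: field_simps)
  moreover have "(b + a * (x / y)) / (d + c * (x / y)) = (a * x + b * y) / (c * x + d * y)"
  proof -
    have "b + a * (x / y) = (a * x + b * y) / y" "d + c * (x / y) = (c * x + d * y) / y"
      using False by (simp_all add: field_simps)
    then show ?thesis using False by simp
  qed
  ultimately show ?thesis using False
    by (simp add: mob_def rat_map_def pt_def add.commute mult.commute)
qed

definition quad_form :: "'a::comm_ring_1 \<Rightarrow> 'a \<Rightarrow> 'a \<Rightarrow> 'a \<Rightarrow> 'a \<Rightarrow> 'a" where
  "quad_form p0 p1 p2 x y = p0 * y\<^sup>2 + p1 * x * y + p2 * x\<^sup>2"

lemma rat_map_quad_pt: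
  assumes deg: "p2 \<noteq> 0 \<or> q2 \<noteq> (0 :: 'a::field)" and xy: "x \<noteq> 0 \<or> y \<noteq> 0"
  shows "rat_map [:p0, p1, p2:] [:q0, q1, q2:] (pt x y) = pt (quad_form p0 p1 p2 x y) (quad_form q0 q1 q2 x y)"
proof (cases "y = 0")
  case True
  have "max (degree [:p0, p1, p2:]) (degree [:q0, q1, q2:]) = 2" using deg by auto
  then have "rat_map [:p0, p1, p2:] [:q0, q1, q2:] None = pt p2 q2"
    by (simp add: rat_map_def pt_def numeral_2_eq_2 Let_def)
  moreover have "pt (quad_form p0 p1 p2 x y) (quad_form q0 q1 q2 x y) = pt (x\<^sup>2 * p2) (x\<^sup>2 * q2)"
    using True by (simp add: quad_form_def mult.commute)
  ultimately show ?thesis using True xy by (simp add: pt_scale)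
next
  case False
  have ev: "poly [:r0, r1, r2:] (x / y) = quad_form r0 r1 r2 x y / y\<^sup>2" for r0 r1 r2
    using False by (simp add: quad_form_def field_simps power2_eq_square)
  show ?thesis using False by (simp add: rat_map_def pt_def ev del: poly_pCons)
qed

text \<open>In the chart at the value the map is \<open>A / B\<close> minus a constant, or
  \<open>B / A\<close> if the value is infinity. Both derivatives have the same numerator up to
  sign.\<close>

lemma chart_derivative_zero_iff:
  fixes A B :: "'a::real_normed_field \<Rightarrow> 'a"
  assumes A: "(A has_field_derivative A') (at 0)" and B: "(B has_field_derivative B') (at 0)"
    and nz: "A 0 \<noteq> 0 \<or> B 0 \<noteq> 0"
  shows "((\<lambda>t. to_chart (pt (A 0) (B 0)) (pt (A t) (B t))) has_field_derivative 0) (at 0) \<longleftrightarrow>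
    A' * B 0 - A 0 * B' = 0"
proof (cases "B 0 = 0")
  case False
  have "\<forall>\<^sub>F t in nhds 0. B t \<noteq> 0"
    using DERIV_isCont[OF B] False
    by (intro tendsto_imp_eventually_ne[of B "B 0"]) (simp_all add: isCont_def tendsto_at_iff_tendsto_nhds)
  then have "\<forall>\<^sub>F t in nhds 0. to_chart (pt (A 0) (B 0)) (pt (A t) (B t)) = A t / B t - A 0 / B 0"
    by eventually_elim (simp add: pt_def to_chart_def False)
  then have "((\<lambda>t. to_chart (pt (A 0) (B 0)) (pt (A t) (B t))) has_field_derivative 0) (at 0) \<longleftrightarrow>
    ((\<lambda>t. A t / B t - A 0 / B 0) has_field_derivative 0) (at 0)"
    by (intro DERIV_cong_ev) auto
  also have "\<dots> \<longleftrightarrow> (A' * B 0 - A 0 * B') / (B 0 * B 0) = 0"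
  proof -
    have "((\<lambda>t. A t / B t - A 0 / B 0) has_field_derivative (A' * B 0 - A 0 * B') / (B 0 * B 0)) (at 0)"
      using False by (auto intro!: derivative_eq_intros A B)
    then show ?thesis by (metis DERIV_unique)
  qed
  finally show ?thesis using False by simp
next
  case True
  then have A0: "A 0 \<noteq> 0" using nz by simp
  have "\<forall>\<^sub>F t in nhds 0. A t \<noteq> 0"
    using DERIV_isCont[OF A] A0
    by (intro tendsto_imp_eventually_ne[of A "A 0"]) (simp_all add: isCont_def tendsto_at_iff_tendsto_nhds)
  then have "\<forall>\<^sub>F t in nhds 0. to_chart (pt (A 0) (B 0)) (pt (A t) (B t)) = B t / A t"
    by eventually_elim (simp add: pt_def to_chart_def True)
  then have "((\<lambda>t. to_chart (pt (A 0) (B 0)) (pt (A t) (B t))) has_field_derivative 0) (at 0) \<longleftrightarrow>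
    ((\<lambda>t. B t / A t) has_field_derivative 0) (at 0)"
    by (intro DERIV_cong_ev) auto
  also have "\<dots> \<longleftrightarrow> (B' * A 0 - B 0 * A') / (A 0 * A 0) = 0"
  proof -
    have "((\<lambda>t. B t / A t) has_field_derivative (B' * A 0 - B 0 * A') / (A 0 * A 0)) (at 0)"
      using A0 by (auto intro!: derivative_eq_intros A B)
    then show ?thesis by (metis DERIV_unique)
  qed
  finally show ?thesis using A0 True by (auto simp: mult.commute)
qed

text \<open>
  The Wronskian of the two quadratic forms is \<open>wa x\<^sup>2 + 2 wb x y + wc y\<^sup>2\<close>; a quarter of its
  discriminant is their resultant.
\<close>

locale quadratic_pair =
  fixes p0 p1 p2 q0 q1 q2 :: real
begin

definition wa :: real where "wa = p2 * q1 - p1 * q2"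
definition wb :: real where "wb = p2 * q0 - p0 * q2"
definition wc :: real where "wc = p1 * q0 - p0 * q1"
definition Res :: real where "Res = wb\<^sup>2 - wa * wc"

end

text \<open>Critical points are the zeros of the Wronskian form, also at infinity: the chart
  \<open>t \<mapsto> 1 / t\<close> is \<open>pt 1 t\<close> in homogeneous coordinates.\<close>

lemma quadratic_pair_critical_point:
  fixes p0 p1 p2 q0 q1 q2 x y :: "'a::real_normed_field"
  assumes deg: "p2 \<noteq> 0 \<or> q2 \<noteq> 0" and xy: "x \<noteq> 0 \<or> y \<noteq> 0"
    and nz: "quad_form p0 p1 p2 x y \<noteq> 0 \<or> quad_form q0 q1 q2 x y \<noteq> 0"
  shows "critical_point (rat_map [:p0, p1, p2:] [:q0, q1, q2:]) (pt x y) \<longleftrightarrow>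
    (p2 * q1 - p1 * q2) * x\<^sup>2 + 2 * (p2 * q0 - p0 * q2) * x * y + (p1 * q0 - p0 * q1) * y\<^sup>2 = 0"
proof (cases "y = 0")
  case True
  then have x: "x \<noteq> 0" using xy by simp
  have eq: "rat_map [:p0, p1, p2:] [:q0, q1, q2:] (of_chart None t) = pt (quad_form p0 p1 p2 1 t) (quad_form q0 q1 q2 1 t)" for t
  proof -
    have "of_chart None t = pt 1 t" by (simp add: of_chart_def pt_def divide_inverse)
    then show ?thesis using rat_map_quad_pt[OF deg, of 1 t] by simp
  qed
  have d: "((\<lambda>t. quad_form r0 r1 r2 1 t) has_field_derivative r1) (at 0)" for r0 r1 r2 :: 'a
    unfolding quad_form_def by (auto intro!: derivative_eq_intros)
  have e0: "rat_map [:p0, p1, p2:] [:q0, q1, q2:] None = pt (quad_form p0 p1 p2 1 0) (quad_form q0 q1 q2 1 0)"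
    using eq[of 0] by (simp add: of_chart_def)
  have "critical_point (rat_map [:p0, p1, p2:] [:q0, q1, q2:]) None \<longleftrightarrow> p1 * quad_form q0 q1 q2 1 0 - quad_form p0 p1 p2 1 0 * q1 = 0"
    unfolding critical_point_def e0 eq using deg
    by (intro chart_derivative_zero_iff d) (simp add: quad_form_def)
  moreover have "p1 * quad_form q0 q1 q2 1 0 - quad_form p0 p1 p2 1 0 * q1 = - (p2 * q1 - p1 * q2)"
    by (simp add: quad_form_def algebra_simps)
  ultimately show ?thesis using True x by (simp only: pt_simps neg_equal_0_iff_equal) simp
next
  case False
  define u where "u = x / y"
  have z: "pt x y = Some u" using False by (simp add: pt_def u_def)
  have x: "x = u * y" using False by (simp add: u_def)
  have qf: "quad_form r0 r1 r2 x y = y\<^sup>2 * quad_form r0 r1 r2 u 1" for r0 r1 r2 :: 'a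
    unfolding x by (simp add: quad_form_def algebra_simps power2_eq_square)
  have nz': "quad_form p0 p1 p2 (u + 0) 1 \<noteq> 0 \<or> quad_form q0 q1 q2 (u + 0) 1 \<noteq> 0"
    using nz False by (simp add: qf)
  have eq: "rat_map [:p0, p1, p2:] [:q0, q1, q2:] (Some (u + t)) = pt (quad_form p0 p1 p2 (u + t) 1) (quad_form q0 q1 q2 (u + t) 1)" for t
    using rat_map_quad_pt[OF deg, of "u + t" 1] by simp
  have d: "((\<lambda>t. quad_form r0 r1 r2 (u + t) 1) has_field_derivative r1 + 2 * r2 * u) (at 0)" for r0 r1 r2 :: 'a
    unfolding quad_form_def by (auto intro!: derivative_eq_intros)
  have e0: "rat_map [:p0, p1, p2:] [:q0, q1, q2:] (Some u) = pt (quad_form p0 p1 p2 (u + 0) 1) (quad_form q0 q1 q2 (u + 0) 1)"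
    using eq[of 0] by simp
  have c1: "critical_point (rat_map [:p0, p1, p2:] [:q0, q1, q2:]) (Some u) \<longleftrightarrow>
      (p1 + 2 * p2 * u) * quad_form q0 q1 q2 (u + 0) 1 - quad_form p0 p1 p2 (u + 0) 1 * (q1 + 2 * q2 * u) = 0"
    unfolding critical_point_def e0 of_chart_def option.case eq
    by (rule chart_derivative_zero_iff[OF d d nz'])
  have c2: "(p1 + 2 * p2 * u) * quad_form q0 q1 q2 (u + 0) 1 - quad_form p0 p1 p2 (u + 0) 1 * (q1 + 2 * q2 * u)
     = (p2 * q1 - p1 * q2) * u\<^sup>2 + 2 * (p2 * q0 - p0 * q2) * u + (p1 * q0 - p0 * q1)"
    by (simp add: quad_form_def algebra_simps power2_eq_square)
  have c3: "(p2 * q1 - p1 * q2) * x\<^sup>2 + 2 * (p2 * q0 - p0 * q2) * x * y + (p1 * q0 - p0 * q1) * y\<^sup>2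
     = y\<^sup>2 * ((p2 * q1 - p1 * q2) * u\<^sup>2 + 2 * (p2 * q0 - p0 * q2) * u + (p1 * q0 - p0 * q1))"
    unfolding x by (simp add: algebra_simps power2_eq_square)
  have "y\<^sup>2 \<noteq> 0" using False by simp
  then show ?thesis unfolding z c1 c2 c3 mult_eq_0_iff by simp
qed

lemma resultant_common_zero:
  fixes p0 p1 p2 q0 q1 q2 x y :: "'a::field"
  assumes "quad_form p0 p1 p2 x y = 0" "quad_form q0 q1 q2 x y = 0" "x \<noteq> 0 \<or> y \<noteq> 0"
  shows "(p2 * q0 - p0 * q2)\<^sup>2 - (p2 * q1 - p1 * q2) * (p1 * q0 - p0 * q1) = 0"
proof -
  define a where "a = p2 * q1 - p1 * q2"
  define b where "b = p2 * q0 - p0 * q2"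
  define c where "c = p1 * q0 - p0 * q1"
  have e1: "y * (a * x + b * y) = 0"
  proof -
    have "y * (a * x + b * y) = p2 * quad_form q0 q1 q2 x y - q2 * quad_form p0 p1 p2 x y"
      by (simp add: a_def b_def quad_form_def algebra_simps power2_eq_square)
    then show ?thesis using assms by simp
  qed
  have e2: "x * (b * x + c * y) = 0"
  proof -
    have "x * (b * x + c * y) = q0 * quad_form p0 p1 p2 x y - p0 * quad_form q0 q1 q2 x y"
      by (simp add: b_def c_def quad_form_def algebra_simps power2_eq_square)
    then show ?thesis using assms by simp
  qed
  have e3: "a * x\<^sup>2 - c * y\<^sup>2 = 0"
  proof -
    have "a * x\<^sup>2 - c * y\<^sup>2 = q1 * quad_form p0 p1 p2 x y - p1 * quad_form q0 q1 q2 x y"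
      by (simp add: a_def c_def quad_form_def algebra_simps power2_eq_square)
    then show ?thesis using assms by simp
  qed
  have "b\<^sup>2 - a * c = 0"
  proof (cases "x = 0 \<or> y = 0")
    case True
    then show ?thesis using e1 e2 e3 assms(3) by auto
  next
    case False
    then have "a * x = - (b * y)" "b * x = - (c * y)" using e1 e2 by (auto simp: eq_neg_iff_add_eq_0)
    have "(b\<^sup>2 - a * c) * (x * y) = (b * x) * (b * y) - (a * x) * (c * y)"
      by (simp add: algebra_simps power2_eq_square)
    also have "\<dots> = 0"
      unfolding \<open>a * x = - (b * y)\<close> \<open>b * x = - (c * y)\<close> by (simp add: mult_ac)
    finally show ?thesis using False by simp
  qed
  then show ?thesis by (simp add: a_def b_def c_def)
qed

context quadratic_pair begin

lemma Res_nonzero_imp: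
  assumes "Res \<noteq> 0"
  shows "x \<noteq> 0 \<or> y \<noteq> 0 \<Longrightarrow> quad_form p0 p1 p2 x y \<noteq> 0 \<or> quad_form q0 q1 q2 x y \<noteq> 0"
    and "z \<noteq> 0 \<or> w \<noteq> 0 \<Longrightarrow> quad_form (complex_of_real p0) (of_real p1) (of_real p2) z w \<noteq> 0 \<or> quad_form (complex_of_real q0) (of_real q1) (of_real q2) z w \<noteq> 0"
    and "p2 \<noteq> 0 \<or> q2 \<noteq> 0"
    and "coprime [:p0, p1, p2:] [:q0, q1, q2:]"
proof -
  show 1: "x \<noteq> 0 \<or> y \<noteq> 0 \<Longrightarrow> quad_form p0 p1 p2 x y \<noteq> 0 \<or> quad_form q0 q1 q2 x y \<noteq> 0" for x y
    using resultant_common_zero[of p0 p1 p2 x y q0 q1 q2] assms by (auto simp: Res_def wa_def wb_def wc_def)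
  show "z \<noteq> 0 \<or> w \<noteq> 0 \<Longrightarrow> quad_form (complex_of_real p0) (of_real p1) (of_real p2) z w \<noteq> 0 \<or> quad_form (complex_of_real q0) (of_real q1) (of_real q2) z w \<noteq> 0"
  proof (rule ccontr)
    assume "z \<noteq> 0 \<or> w \<noteq> 0" "\<not> ?thesis"
    then have "(complex_of_real p2 * of_real q0 - of_real p0 * of_real q2)\<^sup>2 - (of_real p2 * of_real q1 - of_real p1 * of_real q2) * (of_real p1 * of_real q0 - of_real p0 * of_real q1) = 0"
      by (intro resultant_common_zero[of _ _ _ z w]) auto
    then have "complex_of_real Res = 0" by (simp add: Res_def wa_def wb_def wc_def)
    then show False using assms by simp
  qed
  show "p2 \<noteq> 0 \<or> q2 \<noteq> 0" using 1[of 1 0] by (simp add: quad_form_def)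
  show "coprime [:p0, p1, p2:] [:q0, q1, q2:]"
  proof (rule coprimeI)
    fix d assume dp: "d dvd [:p0, p1, p2:]" and dq: "d dvd [:q0, q1, q2:]"
    let ?p = "[:p0, p1, p2:]" and ?q = "[:q0, q1, q2:]"
    have l: "smult p2 ?q - smult q2 ?p = [:wb, wa:]" by (simp add: wa_def wb_def algebra_simps)
    have k: "smult q1 ?p - smult p1 ?q = [:- wc, 0, wa:]" by (simp add: wa_def wc_def algebra_simps)
    have dl: "d dvd [:wb, wa:]" and dk: "d dvd [:- wc, 0, wa:]"
      unfolding l[symmetric] k[symmetric] by (intro dvd_diff dvd_smult dp dq)+
    \<comment> \<open>An explicit Bezout combination: \<open>Res\<close> lies in the ideal generated
      by the two polynomials, so a common divisor divides a nonzero constant.\<close>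
    have "smult wa ([:0, 1:] * [:wb, wa:] - [:- wc, 0, wa:]) - smult wb [:wb, wa:] = [:- Res:]"
      by (simp add: Res_def power2_eq_square algebra_simps)
    moreover have "d dvd smult wa ([:0, 1:] * [:wb, wa:] - [:- wc, 0, wa:]) - smult wb [:wb, wa:]"
      by (intro dvd_diff dvd_smult dvd_mult dl dk)
    ultimately have "d dvd [:- Res:]" by simp
    moreover have "is_unit [:- Res:]" using assms by (simp add: is_unit_const_poly_iff dvd_field_iff)
    ultimately show "is_unit d" by (meson dvd_trans)
  qed
qed

lemma coprime_imp_Res:
  assumes cop: "coprime [:p0, p1, p2:] [:q0, q1, q2:]" and deg: "p2 \<noteq> 0 \<or> q2 \<noteq> 0"
  shows "Res \<noteq> 0"
proof
  let ?p = "[:p0, p1, p2:]" and ?q = "[:q0, q1, q2:]"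
  assume R: "Res = 0"
  show False
  proof (cases "wa = 0")
    case True
    then have wb: "wb = 0" using R by (simp add: Res_def)
    have pq: "smult p2 ?q = smult q2 ?p" using True wb by (simp add: wa_def wb_def mult.commute)
    have "\<not> is_unit ?p \<or> p2 = 0" "\<not> is_unit ?q \<or> q2 = 0" by (auto simp: is_unit_poly_iff)
    moreover have "is_unit ?p" if "p2 \<noteq> 0"
    proof -
      have "?q = smult (1 / p2) (smult p2 ?q)" using that by simp
      also have "\<dots> = smult (q2 / p2) ?p" unfolding pq by simp
      finally have "?p dvd ?q" by (metis dvd_refl dvd_smult)
      then show ?thesis by (rule coprime_common_divisor[OF cop dvd_refl])
    qed
    moreover have "is_unit ?q" if "q2 \<noteq> 0"
    proof -
      have "?p = smult (1 / q2) (smult q2 ?p)" using that by simp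
      also have "\<dots> = smult (p2 / q2) ?q" unfolding pq[symmetric] by simp
      finally have "?q dvd ?p" by (metis dvd_refl dvd_smult)
      then show ?thesis by (rule coprime_common_divisor[OF cop _ dvd_refl])
    qed
    ultimately show False using deg by blast
  next
    case False
    \<comment> \<open>If \<open>Res = 0\<close>, the Wronskian form has the double root
      \<open>x\<close>, which turns out to be a common root of the two polynomials.\<close>
    define x where "x = - wb / wa"
    have b: "wb = - (wa * x)" using False by (simp add: x_def)
    have c: "wc = wa * x\<^sup>2"
    proof -
      have "wa * wc = wa * (wa * x\<^sup>2)" using R by (auto simp: Res_def b power2_eq_square algebra_simps)
      then show ?thesis by (simp only: mult_left_cancel[OF False])
    qed
    have z: "q2 * poly ?p x = p2 * poly ?q x" "q1 * poly ?p x = p1 * poly ?q x"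
    proof -
      have "q2 * poly ?p x - p2 * poly ?q x = - (wa * x + wb)" by (simp add: wa_def wb_def algebra_simps)
      then show "q2 * poly ?p x = p2 * poly ?q x" using b by simp
      have "q1 * poly ?p x - p1 * poly ?q x = wa * x\<^sup>2 - wc" by (simp add: wa_def wc_def algebra_simps power2_eq_square)
      then show "q1 * poly ?p x = p1 * poly ?q x" using c by simp
    qed
    have "wa * poly ?p x = 0" "wa * poly ?q x = 0"
    proof -
      have "wa * poly ?p x = p2 * (q1 * poly ?p x) - p1 * (q2 * poly ?p x)" by (simp only: wa_def left_diff_distrib mult.assoc)
      also have "\<dots> = 0" unfolding z by (simp add: mult.left_commute)
      finally show "wa * poly ?p x = 0" .
      have "wa * poly ?q x = q1 * (p2 * poly ?q x) - q2 * (p1 * poly ?q x)" by (simp only: wa_def left_diff_distrib mult_ac)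
      also have "\<dots> = 0" unfolding z[symmetric] by (simp add: mult.left_commute)
      finally show "wa * poly ?q x = 0" .
    qed
    then have "[:- x, 1:] dvd ?p" "[:- x, 1:] dvd ?q" using False by (auto simp: poly_eq_0_iff_dvd[symmetric])
    then have "is_unit [:- x, 1:]" by (rule coprime_common_divisor[OF cop])
    then show False by (auto simp: is_unit_poly_iff)
  qed
qed

end

section \<open>The group \<open>PSL2R\<close> acting on the oriented circle\<close>

abbreviation sq :: "real option \<Rightarrow> real option" where "sq \<equiv> map_option (\<lambda>x. x\<^sup>2)"

lemma sq_pt: "sq (pt x y) = pt (x\<^sup>2) (y\<^sup>2)"
  by (simp add: pt_def power_divide)

lemma PSL2R_mob: "L \<in> PSL2R \<longleftrightarrow> (\<exists>a b c d. a * d - b * c > 0 \<and> L = mob a b c d)"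
  by (auto simp: PSL2R_def mob_def)

lemma PSL2R_pt:
  assumes "L \<in> PSL2R"
  obtains a b c d where "a * d - b * c > 0" "L = mob a b c d"
    "\<And>x y. x \<noteq> 0 \<or> y \<noteq> 0 \<Longrightarrow> L (pt x y) = pt (a * x + b * y) (c * x + d * y)"
    "\<And>x y. x \<noteq> 0 \<or> y \<noteq> 0 \<Longrightarrow> a * x + b * y \<noteq> 0 \<or> c * x + d * y \<noteq> 0"
proof -
  obtain a b c d where det: "a * d - b * c > 0" and L: "L = mob a b c d" using assms PSL2R_mob by blast
  have nz: "a * x + b * y \<noteq> 0 \<or> c * x + d * y \<noteq> 0" if "x \<noteq> 0 \<or> y \<noteq> 0" for x y
  proof (rule ccontr)
    assume H: "\<not> ?thesis"
    have "(a * d - b * c) * x = d * (a * x + b * y) - b * (c * x + d * y)"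
      "(a * d - b * c) * y = a * (c * x + d * y) - c * (a * x + b * y)"
      by (simp_all add: algebra_simps)
    then show False using H det that by auto
  qed
  show ?thesis by (rule that[OF det L]) (use det nz in \<open>auto simp: L intro!: mob_pt\<close>)
qed

lemma mob_comp:
  fixes a b c d a' b' c' d' :: "'a::field"
  assumes "a * d - b * c \<noteq> 0" "a' * d' - b' * c' \<noteq> 0"
  shows "mob a b c d \<circ> mob a' b' c' d' = mob (a * a' + b * c') (a * b' + b * d') (c * a' + d * c') (c * b' + d * d')"
proof
  fix z :: "'a option"
  obtain x y where z: "z = pt x y" "x \<noteq> 0 \<or> y \<noteq> 0" by (rule pt_cases)
  have nz: "a' * x + b' * y \<noteq> 0 \<or> c' * x + d' * y \<noteq> 0"
  proof (rule ccontr)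
    assume H: "\<not> ?thesis"
    have "(a' * d' - b' * c') * x = d' * (a' * x + b' * y) - b' * (c' * x + d' * y)"
      "(a' * d' - b' * c') * y = a' * (c' * x + d' * y) - c' * (a' * x + b' * y)"
      by (simp_all add: algebra_simps)
    then show False using H assms z by auto
  qed
  have "(a * a' + b * c') * (c * b' + d * d') - (a * b' + b * d') * (c * a' + d * c') = (a * d - b * c) * (a' * d' - b' * c')"
    by (simp add: algebra_simps)
  then have det: "(a * a' + b * c') * (c * b' + d * d') - (a * b' + b * d') * (c * a' + d * c') \<noteq> 0"
    using assms by simp
  have "(mob a b c d \<circ> mob a' b' c' d') z = mob a b c d (pt (a' * x + b' * y) (c' * x + d' * y))"
    by (simp add: z(1) mob_pt[OF assms(2) z(2)])
  also have "\<dots> = pt (a * (a' * x + b' * y) + b * (c' * x + d' * y)) (c * (a' * x + b' * y) + d * (c' * x + d' * y))"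
    by (rule mob_pt[OF assms(1) nz])
  also have "\<dots> = mob (a * a' + b * c') (a * b' + b * d') (c * a' + d * c') (c * b' + d * d') z"
    unfolding z(1) mob_pt[OF det z(2)] by (simp add: algebra_simps)
  finally show "(mob a b c d \<circ> mob a' b' c' d') z = mob (a * a' + b * c') (a * b' + b * d') (c * a' + d * c') (c * b' + d * d') z" .
qed

lemma mob_id: "k \<noteq> 0 \<Longrightarrow> mob k 0 0 k = (id :: 'a::field option \<Rightarrow> 'a option)"
proof
  fix z :: "'a option" assume k: "k \<noteq> 0"
  obtain x y where z: "z = pt x y" "x \<noteq> 0 \<or> y \<noteq> 0" by (rule pt_cases)
  show "mob k 0 0 k z = id z" unfolding z(1) using mob_pt[of k k 0 0 x y] k z(2) by (simp add: pt_scale)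
qed

lemma PSL2R_id [simp]: "id \<in> PSL2R"
  unfolding PSL2R_mob by (rule exI[of _ 1], rule exI[of _ 0], rule exI[of _ 0], rule exI[of _ 1]) (simp add: mob_id)

lemma PSL2R_comp:
  assumes "L \<in> PSL2R" "K \<in> PSL2R" shows "L \<circ> K \<in> PSL2R"
proof -
  obtain a b c d where 1: "a * d - b * c > 0" "L = mob a b c d" using assms PSL2R_mob by blast
  obtain a' b' c' d' where 2: "a' * d' - b' * c' > 0" "K = mob a' b' c' d'" using assms PSL2R_mob by blast
  have "(a * a' + b * c') * (c * b' + d * d') - (a * b' + b * d') * (c * a' + d * c') = (a * d - b * c) * (a' * d' - b' * c')"
    by (simp add: algebra_simps)
  also have "\<dots> > 0" using 1 2 by simp
  finally show ?thesis unfolding PSL2R_mob using mob_comp[of a d b c a' d' b' c'] 1 2 by (metis less_irrefl)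
qed

lemma PSL2R_inverse:
  assumes "L \<in> PSL2R"
  obtains K where "K \<in> PSL2R" "K \<circ> L = id" "L \<circ> K = id"
proof -
  obtain a b c d where 1: "a * d - b * c > 0" "L = mob a b c d" using assms PSL2R_mob by blast
  have 2: "d * a - (- b) * (- c) > 0" using 1 by (simp add: mult.commute)
  have "mob d (- b) (- c) a \<circ> L = mob (a * d - b * c) 0 0 (a * d - b * c)"
    unfolding 1(2) using 1(1) 2 by (subst mob_comp) (auto simp: algebra_simps)
  moreover have "L \<circ> mob d (- b) (- c) a = mob (a * d - b * c) 0 0 (a * d - b * c)"
    unfolding 1(2) using 1(1) 2 by (subst mob_comp) (auto simp: algebra_simps)
  moreover have "mob d (- b) (- c) a \<in> PSL2R" using 2 PSL2R_mob by blast
  ultimately show ?thesis using that mob_id[of "a * d - b * c"] 1 by auto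
qed

lemma PSL2R_bij: "L \<in> PSL2R \<Longrightarrow> bij L"
  by (metis PSL2R_inverse o_bij)

lemma PSL2R_inv: "L \<in> PSL2R \<Longrightarrow> inv L \<in> PSL2R"
  by (metis PSL2R_inverse inv_unique_comp)

lemma PSL2R_inv_simps [simp]:
  assumes "L \<in> PSL2R"
  shows "inv L (L z) = z" "L (inv L z) = z" "inv L \<circ> L = id" "L \<circ> inv L = id" "inv (inv L) = L"
  using PSL2R_bij[OF assms]
  by (auto simp: bij_is_inj bij_is_surj surj_f_inv_f inv_inv_eq fun_eq_iff)

lemma PSL2R_eq_iff [simp]: "L \<in> PSL2R \<Longrightarrow> L u = L v \<longleftrightarrow> u = v"
  using PSL2R_bij by (metis bij_is_inj inj_eq)

text \<open>Each point enters two of the three determinants, so the sign does not depend on its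
  homogeneous coordinates, and a linear map of determinant D > 0 multiplies the product by
  \<open>D ^ 3\<close>. This makes the invariance of the cyclic order under \<open>PSL2R\<close> a
  matter of signs.\<close>

lemma cyc_pt:
  fixes x1 y1 x2 y2 x3 y3 :: real
  assumes "x1 \<noteq> 0 \<or> y1 \<noteq> 0" "x2 \<noteq> 0 \<or> y2 \<noteq> 0" "x3 \<noteq> 0 \<or> y3 \<noteq> 0"
  shows "cyc (pt x1 y1) (pt x2 y2) (pt x3 y3) \<longleftrightarrow>
    (x1 * y2 - x2 * y1) * (x2 * y3 - x3 * y2) * (x3 * y1 - x1 * y3) > 0"
proof -
  have neg: "x < 0 \<longleftrightarrow> - x > 0" for x :: real by simp
  show ?thesis
  proof (cases "y1 = 0")
    case y1: True
    show ?thesis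
    proof (cases "y2 = 0 \<or> y3 = 0")
      case True
      then show ?thesis using y1 by (auto simp: cyc_def pt_def)
    next
      case False
      have "(x1 * y2 - x2 * y1) * (x2 * y3 - x3 * y2) * (x3 * y1 - x1 * y3) = (x1 * y2 * y3)\<^sup>2 * (x3 / y3 - x2 / y2)"
        using y1 False by (simp add: field_simps power2_eq_square)
      moreover have "(x1 * y2 * y3)\<^sup>2 > 0" using y1 False assms by simp
      ultimately show ?thesis using y1 False by (simp add: cyc_def pt_def zero_less_mult_iff)
    qed
  next
    case y1: False
    show ?thesis
    proof (cases "y2 = 0")
      case y2: True
      show ?thesis
      proof (cases "y3 = 0")
        case True
        then show ?thesis using y1 y2 by (auto simp: cyc_def pt_def)
      next
        case False
        have "(x1 * y2 - x2 * y1) * (x2 * y3 - x3 * y2) * (x3 * y1 - x1 * y3) = (x2 * y1 * y3)\<^sup>2 * (x1 / y1 - x3 / y3)"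
          using y1 y2 False by (simp add: field_simps power2_eq_square)
        moreover have "(x2 * y1 * y3)\<^sup>2 > 0" using y1 y2 False assms by simp
        ultimately show ?thesis using y1 y2 False by (simp add: cyc_def pt_def zero_less_mult_iff)
      qed
    next
      case y2: False
      show ?thesis
      proof (cases "y3 = 0")
        case True
        have "(x1 * y2 - x2 * y1) * (x2 * y3 - x3 * y2) * (x3 * y1 - x1 * y3) = (x3 * y1 * y2)\<^sup>2 * (x2 / y2 - x1 / y1)"
          using y1 y2 True by (simp add: field_simps power2_eq_square)
        moreover have "(x3 * y1 * y2)\<^sup>2 > 0" using y1 y2 True assms by simp
        ultimately show ?thesis using y1 y2 True by (simp add: cyc_def pt_def zero_less_mult_iff)
      next
        case y3: False
        define a where "a = x1 / y1"
        define b where "b = x2 / y2"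
        define c where "c = x3 / y3"
        have x: "x1 = a * y1" "x2 = b * y2" "x3 = c * y3" using y1 y2 y3 by (auto simp: a_def b_def c_def)
        have "(x1 * y2 - x2 * y1) * (x2 * y3 - x3 * y2) * (x3 * y1 - x1 * y3) = (y1 * y2 * y3)\<^sup>2 * ((a - b) * (b - c) * (c - a))"
          unfolding x by (simp add: algebra_simps power2_eq_square)
        moreover have "(y1 * y2 * y3)\<^sup>2 > 0" using y1 y2 y3 by simp
        moreover have "(a - b) * (b - c) * (c - a) > 0 \<longleftrightarrow> cyc (Some a) (Some b) (Some c)"
          by (auto simp: cyc_def zero_less_mult_iff mult_less_0_iff)
        ultimately show ?thesis using y1 y2 y3 by (simp add: pt_def a_def b_def c_def zero_less_mult_iff)
      qed
    qed
  qed
qed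

lemma PSL2R_cyc [simp]:
  assumes "L \<in> PSL2R"
  shows "cyc (L u) (L v) (L w) \<longleftrightarrow> cyc u v w"
proof -
  obtain a b c d where L: "a * d - b * c > 0"
    "\<And>x y. x \<noteq> 0 \<or> y \<noteq> 0 \<Longrightarrow> L (pt x y) = pt (a * x + b * y) (c * x + d * y)"
    "\<And>x y. x \<noteq> 0 \<or> y \<noteq> 0 \<Longrightarrow> a * x + b * y \<noteq> 0 \<or> c * x + d * y \<noteq> 0"
    using PSL2R_pt[OF assms] by metis
  obtain x1 y1 where u: "u = pt x1 y1" "x1 \<noteq> 0 \<or> y1 \<noteq> 0" by (rule pt_cases)
  obtain x2 y2 where v: "v = pt x2 y2" "x2 \<noteq> 0 \<or> y2 \<noteq> 0" by (rule pt_cases)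
  obtain x3 y3 where w: "w = pt x3 y3" "x3 \<noteq> 0 \<or> y3 \<noteq> 0" by (rule pt_cases)
  have br: "(a * x + b * y) * (c * x' + d * y') - (a * x' + b * y') * (c * x + d * y) = (a * d - b * c) * (x * y' - x' * y)" for x y x' y'
    by (simp add: algebra_simps)
  define D where "D = a * d - b * c"
  have D3: "D ^ 3 > 0" using L(1) by (simp add: D_def)
  have pos: "(D * X) * (D * Y) * (D * W) > 0 \<longleftrightarrow> X * Y * W > 0" for X Y W
  proof -
    have "(D * X) * (D * Y) * (D * W) = D ^ 3 * (X * Y * W)" by (simp add: power3_eq_cube)
    moreover have "D ^ 3 * 0 < D ^ 3 * (X * Y * W) \<longleftrightarrow> 0 < X * Y * W" by (rule mult_less_cancel_left_pos[OF D3])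
    ultimately show ?thesis by (simp only: mult_zero_right)
  qed
  show ?thesis
    unfolding u(1) v(1) w(1) L(2)[OF u(2)] L(2)[OF v(2)] L(2)[OF w(2)]
      cyc_pt[OF L(3)[OF u(2)] L(3)[OF v(2)] L(3)[OF w(2)]] cyc_pt[OF u(2) v(2) w(2)] br D_def[symmetric]
    by (rule pos)
qed

lemma PSL2R_arc:
  assumes "L \<in> PSL2R" shows "L ` circle_arc a b = circle_arc (L a) (L b)"
proof (intro set_eqI iffI)
  fix z assume "z \<in> L ` circle_arc a b"
  then show "z \<in> circle_arc (L a) (L b)" using PSL2R_cyc[OF assms] by (auto simp: circle_arc_def)
next
  fix z assume z: "z \<in> circle_arc (L a) (L b)"
  define w where "w = inv L z"
  have zw: "z = L w" using assms by (simp add: w_def)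
  have "w \<in> circle_arc a b" using z PSL2R_cyc[OF assms] PSL2R_eq_iff[OF assms] by (auto simp: circle_arc_def zw)
  then show "z \<in> L ` circle_arc a b" using zw by blast
qed

lemma PSL2R_0_inf:
  assumes "u \<noteq> v" obtains L where "L \<in> PSL2R" "L (Some 0) = u" "L None = v"
proof -
  obtain u1 u2 where u: "u = pt u1 u2" "u1 \<noteq> 0 \<or> u2 \<noteq> 0" by (rule pt_cases)
  obtain v1 v2 where v: "v = pt v1 v2" "v1 \<noteq> 0 \<or> v2 \<noteq> 0" by (rule pt_cases)
  have D: "v1 * u2 - u1 * v2 \<noteq> 0" using assms pt_eq_iff[OF u(2) v(2)] u v by auto
  \<comment> \<open>The factor \<open>s\<close> changes the representative of \<open>v\<close>, not
    the point, and makes the determinant positive.\<close>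
  define s where "s = sgn (v1 * u2 - u1 * v2)"
  have s: "s \<noteq> 0" "s * (v1 * u2 - u1 * v2) > 0" using D by (auto simp: s_def sgn_if)
  let ?L = "mob (s * v1) u1 (s * v2) u2"
  have det: "s * v1 * u2 - u1 * (s * v2) > 0" using s(2) by (simp add: algebra_simps)
  have "?L \<in> PSL2R" using det PSL2R_mob by blast
  moreover have det0: "s * v1 * u2 - u1 * (s * v2) \<noteq> 0" using det by linarith
  moreover have "?L (Some 0) = u" using mob_pt[OF det0, of 0 1] u(1) by simp
  moreover have "?L None = v" using mob_pt[OF det0, of 1 0] v(1) s(1) by (simp add: pt_scale)
  ultimately show ?thesis using that by blast
qed

abbreviation scale :: "real \<Rightarrow> real option \<Rightarrow> real option" where "scale t \<equiv> map_option (\<lambda>x. t * x)"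

lemma scale_pt: "t \<noteq> 0 \<Longrightarrow> scale t (pt x y) = pt (t * x) y"
  by (simp add: pt_def)

lemma scale_PSL2R: assumes "t > 0" shows "scale t \<in> PSL2R"
proof -
  have "scale t = mob t 0 0 1"
  proof
    fix z :: "real option" obtain x y where z: "z = pt x y" "x \<noteq> 0 \<or> y \<noteq> 0" by (rule pt_cases)
    show "scale t z = mob t 0 0 1 z" using mob_pt[of t 1 0 0 x y] assms z by (simp add: scale_pt)
  qed
  then show ?thesis using assms PSL2R_mob by (metis diff_zero mult.right_neutral mult_zero_left)
qed

lemma PSL2R_fix_0_inf:
  assumes "L \<in> PSL2R" "L (Some 0) = Some 0" "L None = None"
  obtains t where "t > 0" "L = scale t"
proof -
  obtain a b c d where L: "a * d - b * c > 0"
    "\<And>x y. x \<noteq> 0 \<or> y \<noteq> 0 \<Longrightarrow> L (pt x y) = pt (a * x + b * y) (c * x + d * y)"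
    using PSL2R_pt[OF assms(1)] by metis
  have "pt b d = Some 0" using L(2)[of 0 1] assms(2) by simp
  then have b: "b = 0" by (auto simp: pt_def split: if_splits)
  have "pt a c = None" using L(2)[of 1 0] assms(3) by simp
  then have c: "c = 0" by (auto simp: pt_def split: if_splits)
  have ad: "a * d > 0" using L(1) b c by simp
  have "L z = scale (a / d) z" for z
  proof -
    obtain x y where z: "z = pt x y" "x \<noteq> 0 \<or> y \<noteq> 0" by (rule pt_cases)
    have "d \<noteq> 0" using ad by auto
    then show ?thesis using L(2)[OF z(2)] ad b c by (simp add: z(1) pt_def)
  qed
  moreover have "a / d > 0" using ad by (simp add: zero_less_divide_iff zero_less_mult_iff)
  ultimately show ?thesis using that by blast
qed

text \<open>The map \<open>pt l1 l2 \<mapsto> pt (m1 l1\<^sup>2 + m2 l2\<^sup>2) (m3 l1\<^sup>2 + m4 l2\<^sup>2)\<close> with \<open>l1 = a x + b y\<close> and \<open>l2 = c x + d y\<close>.\<close>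

lemma normal_form_rat_map:
  fixes m1 m2 m3 m4 a b c d :: real
  assumes M: "m1 * m4 - m2 * m3 > 0" and L: "a * d - b * c > 0"
  defines "p \<equiv> [:m1 * b\<^sup>2 + m2 * d\<^sup>2, 2 * (m1 * a * b + m2 * c * d), m1 * a\<^sup>2 + m2 * c\<^sup>2:]"
    and "q \<equiv> [:m3 * b\<^sup>2 + m4 * d\<^sup>2, 2 * (m3 * a * b + m4 * c * d), m3 * a\<^sup>2 + m4 * c\<^sup>2:]"
  shows "mob m1 m2 m3 m4 \<circ> sq \<circ> mob a b c d = rat_map p q"
    and "real_quadratic (rat_map p q)"
    and "x \<noteq> 0 \<or> y \<noteq> 0 \<Longrightarrow> critical_point (rat_map p q) (pt x y) \<longleftrightarrow> (a * x + b * y) * (c * x + d * y) = 0"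
proof -
  define P0 P1 P2 Q0 Q1 Q2 where PQ: "P0 = m1 * b\<^sup>2 + m2 * d\<^sup>2" "P1 = 2 * (m1 * a * b + m2 * c * d)" "P2 = m1 * a\<^sup>2 + m2 * c\<^sup>2"
    "Q0 = m3 * b\<^sup>2 + m4 * d\<^sup>2" "Q1 = 2 * (m3 * a * b + m4 * c * d)" "Q2 = m3 * a\<^sup>2 + m4 * c\<^sup>2"
  have p: "p = [:P0, P1, P2:]" and q: "q = [:Q0, Q1, Q2:]" unfolding p_def q_def PQ by simp_all
  interpret quadratic_pair P0 P1 P2 Q0 Q1 Q2 .
  define D where "D = (m1 * m4 - m2 * m3) * (a * d - b * c)"
  have D: "D > 0" using M L by (simp add: D_def)
  have w: "wa = 2 * D * (a * c)" "wb = D * (a * d + b * c)" "wc = 2 * D * (b * d)"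
    unfolding wa_def wb_def wc_def D_def unfolding PQ by (simp_all add: algebra_simps power2_eq_square)
  have "Res = (D * (a * d - b * c))\<^sup>2"
    unfolding Res_def w by (simp add: algebra_simps power2_eq_square)
  then have R: "Res \<noteq> 0" using D L by simp
  note nz = Res_nonzero_imp[OF R]
  have qf: "quad_form P0 P1 P2 x y = m1 * (a * x + b * y)\<^sup>2 + m2 * (c * x + d * y)\<^sup>2"
    "quad_form Q0 Q1 Q2 x y = m3 * (a * x + b * y)\<^sup>2 + m4 * (c * x + d * y)\<^sup>2" for x y :: real
    unfolding PQ by (simp_all add: quad_form_def algebra_simps power2_eq_square)
  show "mob m1 m2 m3 m4 \<circ> sq \<circ> mob a b c d = rat_map p q"
  proof
    fix z :: "real option" obtain x y where z: "z = pt x y" "x \<noteq> 0 \<or> y \<noteq> 0" by (rule pt_cases)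
    have l: "a * x + b * y \<noteq> 0 \<or> c * x + d * y \<noteq> 0"
    proof (rule ccontr)
      assume H: "\<not> ?thesis"
      have "(a * d - b * c) * x = d * (a * x + b * y) - b * (c * x + d * y)"
        "(a * d - b * c) * y = a * (c * x + d * y) - c * (a * x + b * y)"
        by (simp_all add: algebra_simps)
      then show False using H L z by auto
    qed
    have "mob m1 m2 m3 m4 (sq (mob a b c d z)) = mob m1 m2 m3 m4 (pt ((a * x + b * y)\<^sup>2) ((c * x + d * y)\<^sup>2))"
      unfolding z(1) using L z(2) by (simp add: mob_pt sq_pt)
    also have "\<dots> = pt (m1 * (a * x + b * y)\<^sup>2 + m2 * (c * x + d * y)\<^sup>2) (m3 * (a * x + b * y)\<^sup>2 + m4 * (c * x + d * y)\<^sup>2)"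
      by (rule mob_pt) (use M l in auto)
    also have "\<dots> = rat_map p q z"
      unfolding z(1) p q rat_map_quad_pt[OF nz(3) z(2)] qf ..
    finally show "(mob m1 m2 m3 m4 \<circ> sq \<circ> mob a b c d) z = rat_map p q z" by simp
  qed
  show "critical_point (rat_map p q) (pt x y) \<longleftrightarrow> (a * x + b * y) * (c * x + d * y) = 0" if xy: "x \<noteq> 0 \<or> y \<noteq> 0"
  proof -
    have "critical_point (rat_map p q) (pt x y) \<longleftrightarrow> wa * x\<^sup>2 + 2 * wb * x * y + wc * y\<^sup>2 = 0"
      unfolding p q quadratic_pair_critical_point[OF nz(3) xy nz(1)[OF xy]] wa_def wb_def wc_def ..
    also have "wa * x\<^sup>2 + 2 * wb * x * y + wc * y\<^sup>2 = 2 * D * ((a * x + b * y) * (c * x + d * y))"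
      unfolding w by (simp add: algebra_simps power2_eq_square)
    finally show ?thesis using D by simp
  qed
  show "real_quadratic (rat_map p q)"
    unfolding real_quadratic_def
  proof (intro exI conjI allI impI)
    show "coprime p q" unfolding p q by (rule nz(4))
    show "max (degree p) (degree q) = 2" unfolding p q using nz(3) by auto
    fix z :: "complex option"
    assume cr: "critical_point (rat_map (map_poly complex_of_real p) (map_poly complex_of_real q)) z"
    show "z \<in> range (map_option complex_of_real)"
    proof (cases z)
      case None
      then show ?thesis by (metis option.simps(8) rangeI)
    next
      case (Some u)
      have nzc: "quad_form (complex_of_real P0) (of_real P1) (of_real P2) u 1 \<noteq> 0 \<or> quad_form (complex_of_real Q0) (of_real Q1) (of_real Q2) u 1 \<noteq> 0"
        by (rule nz(2)) simp
      have mp: "map_poly complex_of_real [:r0, r1, r2:] = [:of_real r0, of_real r1, of_real r2:]" for r0 r1 r2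
        by (simp add: map_poly_pCons)
      have degc: "complex_of_real P2 \<noteq> 0 \<or> complex_of_real Q2 \<noteq> 0"
        using nz(3) by (simp only: of_real_eq_0_iff)
      have "critical_point (rat_map (map_poly complex_of_real p) (map_poly complex_of_real q)) (pt u 1) \<longleftrightarrow>
         of_real wa * u\<^sup>2 + 2 * of_real wb * u * 1 + of_real wc * 1\<^sup>2 = 0"
        unfolding p q mp
        by (subst quadratic_pair_critical_point[OF degc _ nzc]) (simp_all add: wa_def wb_def wc_def)
      then have "of_real wa * u\<^sup>2 + 2 * of_real wb * u + of_real wc = 0" using cr Some by simp
      moreover have "of_real wa * u\<^sup>2 + 2 * of_real wb * u + of_real wc = 2 * of_real D * ((of_real a * u + of_real b) * (of_real c * u + of_real d))"
        unfolding w by (simp add: algebra_simps power2_eq_square)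
      ultimately have "(of_real a * u + of_real b) = 0 \<or> (of_real c * u + of_real d) = 0" using D by simp
      then have "Im u = 0"
      proof
        assume h: "of_real a * u + of_real b = 0"
        then have "a \<noteq> 0" using L by auto
        moreover have "a * Im u = 0" using arg_cong[OF h, of Im] by simp
        ultimately show ?thesis by simp
      next
        assume h: "of_real c * u + of_real d = 0"
        then have "c \<noteq> 0" using L by auto
        moreover have "c * Im u = 0" using arg_cong[OF h, of Im] by simp
        ultimately show ?thesis by simp
      qed
      then have "z = map_option complex_of_real (Some (Re u))" using Some by (simp add: complex_eq_iff)
      then show ?thesis by blast
    qed
  qed simp
qed

lemma normal_form_real_quadratic:
  assumes M: "M \<in> PSL2R" and L: "L \<in> PSL2R"
  shows "real_quadratic (M \<circ> sq \<circ> L)"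
    and "critical_point (M \<circ> sq \<circ> L) z \<longleftrightarrow> L z = Some 0 \<or> L z = None"
proof -
  obtain m1 m2 m3 m4 where m: "m1 * m4 - m2 * m3 > 0" "M = mob m1 m2 m3 m4" using M PSL2R_mob by blast
  obtain a b c d where l: "a * d - b * c > 0" "L = mob a b c d" using L PSL2R_mob by blast
  note nf = normal_form_rat_map[OF m(1) l(1)]
  show "real_quadratic (M \<circ> sq \<circ> L)" unfolding m(2) l(2) nf(1) by (rule nf(2))
  obtain x y where z: "z = pt x y" "x \<noteq> 0 \<or> y \<noteq> 0" by (rule pt_cases)
  have lz: "L z = pt (a * x + b * y) (c * x + d * y)" unfolding z(1) l(2) by (rule mob_pt) (use l z in auto)
  have "pt X Y = Some 0 \<or> pt X Y = None \<longleftrightarrow> X * Y = 0" for X Y :: real by (auto simp: pt_def)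
  then show "critical_point (M \<circ> sq \<circ> L) z \<longleftrightarrow> L z = Some 0 \<or> L z = None"
    unfolding lz unfolding m(2) l(2) nf(1) z(1) using nf(3)[OF z(2)] by simp
qed

text \<open>As the critical points are real, the Wronskian form has two real roots. Numerator and
  denominator are apolar to it, hence combinations of the squares of the two linear forms that
  vanish at these roots. This is a Moebius transformation applied to the square of a Moebius
  transformation.\<close>

lemma real_quadratic_normal_form:
  assumes "real_quadratic f"
  obtains M L where "M \<in> PSL2R" "L \<in> PSL2R" "f = M \<circ> sq \<circ> L"
proof -
  obtain p q where pq: "coprime p q" "max (degree p) (degree q) = 2" "f = rat_map p q"
    and cr: "\<And>z. critical_point (rat_map (map_poly complex_of_real p) (map_poly complex_of_real q)) z \<Longrightarrow> z \<in> range (map_option complex_of_real)"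
    using assms unfolding real_quadratic_def by blast
  have cubic: "\<exists>r0 r1 r2. r = [:r0, r1, r2:]" if "degree r \<le> 2" for r :: "real poly"
  proof -
    have "r = [:coeff r 0, coeff r 1, coeff r 2:]"
    proof (rule poly_eqI)
      fix k
      show "coeff r k = coeff [:coeff r 0, coeff r 1, coeff r 2:] k"
        using coeff_eq_0[of r k] that by (auto simp: coeff_pCons numeral_2_eq_2 split: nat.split)
    qed
    then show ?thesis by blast
  qed
  have "degree p \<le> 2" "degree q \<le> 2" using pq(2) by auto
  then obtain p0 p1 p2 q0 q1 q2 where p: "p = [:p0, p1, p2:]" and q: "q = [:q0, q1, q2:]" using cubic by meson
  interpret quadratic_pair p0 p1 p2 q0 q1 q2 .
  have deg: "p2 \<noteq> 0 \<or> q2 \<noteq> 0" using pq(2) by (auto simp: p q split: if_splits)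
  have R0: "Res \<noteq> 0" using coprime_imp_Res pq(1) deg by (simp add: p q)
  note nz = Res_nonzero_imp[OF R0]
  \<comment> \<open>Otherwise the Wronskian form has a pair of non-real roots, which are non-real
    critical points.\<close>
  have "Res > 0"
  proof (rule ccontr)
    assume "\<not> Res > 0"
    then have neg: "wb\<^sup>2 - wa * wc < 0" using R0 by (simp add: Res_def)
    then have wa: "wa \<noteq> 0" by (auto simp: not_less)
    define u where "u = Complex (- wb / wa) (sqrt (wa * wc - wb\<^sup>2) / wa)"
    have "of_real wa * u + of_real wb = \<i> * of_real (sqrt (wa * wc - wb\<^sup>2))"
      using wa by (simp add: u_def complex_eq_iff)
    then have "(of_real wa * u + of_real wb)\<^sup>2 = - of_real ((sqrt (wa * wc - wb\<^sup>2))\<^sup>2)" by (simp add: power_mult_distrib)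
    also have "(sqrt (wa * wc - wb\<^sup>2))\<^sup>2 = wa * wc - wb\<^sup>2" using neg by simp
    finally have "of_real wa * (of_real wa * u\<^sup>2 + 2 * of_real wb * u + of_real wc) = 0"
      by (simp add: algebra_simps power2_eq_square)
    then have root: "of_real wa * u\<^sup>2 + 2 * of_real wb * u + of_real wc = 0" using wa by simp
    have mp: "map_poly complex_of_real [:r0, r1, r2:] = [:of_real r0, of_real r1, of_real r2:]" for r0 r1 r2
      by (simp add: map_poly_pCons)
    have degc: "complex_of_real p2 \<noteq> 0 \<or> complex_of_real q2 \<noteq> 0" using deg by simp
    have nzc: "quad_form (complex_of_real p0) (of_real p1) (of_real p2) u 1 \<noteq> 0 \<or> quad_form (complex_of_real q0) (of_real q1) (of_real q2) u 1 \<noteq> 0"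
      by (rule nz(2)) simp
    have "critical_point (rat_map (map_poly complex_of_real p) (map_poly complex_of_real q)) (pt u 1)"
      unfolding p q mp using root
      by (subst quadratic_pair_critical_point[OF degc _ nzc]) (simp_all add: wa_def wb_def wc_def)
    then obtain w where "pt u 1 = map_option complex_of_real w" using cr by blast
    then have "Im u = 0" by (cases w) auto
    then show False using neg wa by (simp add: u_def)
  qed
  have "\<exists>r1 r2 s1 s2 k. r1 * s2 - r2 * s1 \<noteq> 0 \<and> wa = k * (r2 * s2) \<and> 2 * wb = - k * (r1 * s2 + r2 * s1) \<and> wc = k * (r1 * s1)"
  proof (cases "wa = 0")
    case True
    then have "wb \<noteq> 0" using R0 by (simp add: Res_def)
    \<comment> \<open>If \<open>wa = 0\<close>, one root is infinity, with coordinates 1 and 0, and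
      the other has coordinates \<open>- wc\<close> and \<open>2 * wb\<close>.\<close>
    show ?thesis
      by (rule exI[of _ 1], rule exI[of _ 0], rule exI[of _ "- wc"], rule exI[of _ "2 * wb"], rule exI[of _ "-1"])
         (use True \<open>wb \<noteq> 0\<close> in simp)
  next
    case False
    define r where "r = sqrt Res"
    have r: "r * r = wb * wb - wa * wc" "r \<noteq> 0" using \<open>Res > 0\<close> by (simp_all add: r_def Res_def power2_eq_square)
    have e1: "wc = wa * ((- wb + r) / wa * ((- wb - r) / wa))"
    proof -
      have "wa * ((- wb + r) / wa * ((- wb - r) / wa)) = (wb * wb - r * r) / wa" using False by (simp add: field_simps)
      then show ?thesis using r False by simp
    qed
    have e2: "2 * wb = - wa * ((- wb + r) / wa * 1 + 1 * ((- wb - r) / wa))"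
    proof -
      have "(- wb + r) / wa * 1 + 1 * ((- wb - r) / wa) = (- 2 * wb) / wa" by (simp flip: add_divide_distrib)
      then show ?thesis using False by simp
    qed
    have "(- wb + r) / wa * 1 - 1 * ((- wb - r) / wa) = 2 * r / wa" by (simp flip: diff_divide_distrib)
    then have e3: "(- wb + r) / wa * 1 - 1 * ((- wb - r) / wa) \<noteq> 0" using False r(2) by simp
    have e4: "wa = wa * (1 * 1)" by simp
    show ?thesis
      by (rule exI[of _ "(- wb + r) / wa"], rule exI[of _ 1], rule exI[of _ "(- wb - r) / wa"], rule exI[of _ 1], rule exI[of _ wa])
         (intro conjI e1 e2 e3 e4)
  qed
  then obtain r1 r2 s1 s2 k where D0: "r1 * s2 - r2 * s1 \<noteq> 0"
    and w: "wa = k * (r2 * s2)" "2 * wb = - k * (r1 * s2 + r2 * s1)" "wc = k * (r1 * s1)" by blast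
  have k0: "k \<noteq> 0" using R0 w by (auto simp: Res_def)
  have wbk: "wb = - k * (r1 * s2 + r2 * s1) / 2" using w(2) by simp
  \<comment> \<open>Apolarity: the Wronskian of two forms is orthogonal to each of them under the
    invariant pairing \<open>p2 * wc - p1 * wb + p0 * wa\<close>.\<close>
  have polar: "p2 * (r1 * s1) + p1 * (r1 * s2 + r2 * s1) / 2 + p0 * (r2 * s2) = 0"
  proof -
    have "k * (p2 * (r1 * s1) + p1 * (r1 * s2 + r2 * s1) / 2 + p0 * (r2 * s2)) = p2 * wc - p1 * wb + p0 * wa"
      unfolding w(1) w(3) wbk by (simp add: field_simps)
    also have "\<dots> = 0" by (simp add: wa_def wb_def wc_def algebra_simps)
    finally show ?thesis using k0 by simp
  qed
  have polarq: "q2 * (r1 * s1) + q1 * (r1 * s2 + r2 * s1) / 2 + q0 * (r2 * s2) = 0"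
  proof -
    have "k * (q2 * (r1 * s1) + q1 * (r1 * s2 + r2 * s1) / 2 + q0 * (r2 * s2)) = q2 * wc - q1 * wb + q0 * wa"
      unfolding w(1) w(3) wbk by (simp add: field_simps)
    also have "\<dots> = 0" by (simp add: wa_def wb_def wc_def algebra_simps)
    finally show ?thesis using k0 by simp
  qed
  have key: "\<exists>M\<in>PSL2R. \<exists>L\<in>PSL2R. f = M \<circ> sq \<circ> L"
    if D: "r1 * s2 - r2 * s1 > 0"
      and pol: "p2 * (r1 * s1) + p1 * (r1 * s2 + r2 * s1) / 2 + p0 * (r2 * s2) = 0"
        "q2 * (r1 * s1) + q1 * (r1 * s2 + r2 * s1) / 2 + q0 * (r2 * s2) = 0" for r1 r2 s1 s2
  proof -
    define d where "d = r1 * s2 - r2 * s1"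
    have d: "d > 0" using D by (simp add: d_def)
    define PR where "PR = quad_form p0 p1 p2 r1 r2"
    define PS where "PS = quad_form p0 p1 p2 s1 s2"
    define QR where "QR = quad_form q0 q1 q2 r1 r2"
    define QS where "QS = quad_form q0 q1 q2 s1 s2"
    \<comment> \<open>A form apolar to a product of two linear forms has no mixed term when it is
      written in these; the two coefficients are found by evaluation at the roots.\<close>
    have ex: "d\<^sup>2 * quad_form h0 h1 h2 x y = quad_form h0 h1 h2 s1 s2 * (r2 * x - r1 * y)\<^sup>2 + quad_form h0 h1 h2 r1 r2 * (s2 * x - s1 * y)\<^sup>2"
      if "h2 * (r1 * s1) + h1 * (r1 * s2 + r2 * s1) / 2 + h0 * (r2 * s2) = 0" for h0 h1 h2 x y :: real
    proof -
      define g where "g = h1 / 2"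
      have h1: "h1 = 2 * g" by (simp add: g_def)
      have "quad_form h0 h1 h2 s1 s2 * (r2 * x - r1 * y)\<^sup>2 + quad_form h0 h1 h2 r1 r2 * (s2 * x - s1 * y)\<^sup>2
        - d\<^sup>2 * quad_form h0 h1 h2 x y =
        2 * (h2 * (r1 * s1) + g * (r1 * s2 + r2 * s1) + h0 * (r2 * s2)) * (r2 * x - r1 * y) * (s2 * x - s1 * y)"
        unfolding h1 by (simp add: quad_form_def d_def algebra_simps power2_eq_square)
      moreover have "h2 * (r1 * s1) + g * (r1 * s2 + r2 * s1) + h0 * (r2 * s2) = 0" using that by (simp add: g_def)
      ultimately show ?thesis by simp
    qed
    have fpt: "f (pt x y) = pt (PS * (r2 * x - r1 * y)\<^sup>2 + PR * (s2 * x - s1 * y)\<^sup>2) (QS * (r2 * x - r1 * y)\<^sup>2 + QR * (s2 * x - s1 * y)\<^sup>2)"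
      if "x \<noteq> 0 \<or> y \<noteq> 0" for x y
    proof -
      have "f (pt x y) = pt (d\<^sup>2 * quad_form p0 p1 p2 x y) (d\<^sup>2 * quad_form q0 q1 q2 x y)"
        using rat_map_quad_pt[OF deg that] d by (simp add: pq(3) p q pt_scale)
      then show ?thesis unfolding ex[OF pol(1)] ex[OF pol(2)] PS_def PR_def QS_def QR_def .
    qed
    have det0: "PS * QR - PR * QS \<noteq> 0"
    proof
      assume z: "PS * QR - PR * QS = 0"
      have bil: "quad_form h0 h1 h2 x y * QS - PS * quad_form g0 g1 g2 x y = 0" if "h0 = p0" "h1 = p1" "h2 = p2" "g0 = q0" "g1 = q1" "g2 = q2" for h0 h1 h2 g0 g1 g2 x y
      proof -
        define l1 where "l1 = (r2 * x - r1 * y)\<^sup>2"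
        define l2 where "l2 = (s2 * x - s1 * y)\<^sup>2"
        have "d\<^sup>2 * (quad_form p0 p1 p2 x y * QS - PS * quad_form q0 q1 q2 x y) = (d\<^sup>2 * quad_form p0 p1 p2 x y) * QS - PS * (d\<^sup>2 * quad_form q0 q1 q2 x y)"
          by (simp add: right_diff_distrib mult.left_commute mult.assoc)
        also have "d\<^sup>2 * quad_form p0 p1 p2 x y = PS * l1 + PR * l2" unfolding ex[OF pol(1)] PS_def PR_def l1_def l2_def ..
        also have "d\<^sup>2 * quad_form q0 q1 q2 x y = QS * l1 + QR * l2" unfolding ex[OF pol(2)] QS_def QR_def l1_def l2_def ..
        also have "(PS * l1 + PR * l2) * QS - PS * (QS * l1 + QR * l2) = - (PS * QR - PR * QS) * l2" by (simp add: algebra_simps)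
        finally have "d\<^sup>2 * (quad_form p0 p1 p2 x y * QS - PS * quad_form q0 q1 q2 x y) = - (PS * QR - PR * QS) * l2" .
        then show ?thesis using z d that by simp
      qed
      note bil = bil[OF refl refl refl refl refl refl]
      have e: "p0 * QS = PS * q0" "p2 * QS = PS * q2" "(p0 + p1 + p2) * QS = PS * (q0 + q1 + q2)"
        using bil[of 0 1] bil[of 1 0] bil[of 1 1] by (auto simp: quad_form_def)
      then have e1: "p1 * QS = PS * q1" by (simp add: distrib_left distrib_right)
      have "QS * Res = 0 \<and> PS * Res = 0"
      proof -
        have "QS * wa = (p2 * QS) * q1 - (p1 * QS) * q2" "QS * wb = (p2 * QS) * q0 - (p0 * QS) * q2" "QS * wc = (p1 * QS) * q0 - (p0 * QS) * q1"
          by (simp_all add: wa_def wb_def wc_def algebra_simps)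
        then have "QS * wa = 0" "QS * wb = 0" "QS * wc = 0" unfolding e e1 by (simp_all add: mult_ac)
        moreover have "PS * wa = p2 * (PS * q1) - p1 * (PS * q2)" "PS * wb = p2 * (PS * q0) - p0 * (PS * q2)" "PS * wc = p1 * (PS * q0) - p0 * (PS * q1)"
          by (simp_all add: wa_def wb_def wc_def algebra_simps)
        then have "PS * wa = 0" "PS * wb = 0" "PS * wc = 0" unfolding e(1,2)[symmetric] e1[symmetric] by (simp_all add: mult_ac)
        ultimately show ?thesis by (auto simp: Res_def)
      qed
      then have "PS = 0" "QS = 0" using R0 by auto
      moreover have "s1 \<noteq> 0 \<or> s2 \<noteq> 0" using D by auto
      ultimately show False using nz(1)[of s1 s2] by (simp add: PS_def QS_def)
    qed
    show ?thesis
    proof (cases "PS * QR - PR * QS > 0")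
      case True
      have l: "r2 * (- s1) - (- r1) * s2 > 0" using D by simp
      have "f = mob PS PR QS QR \<circ> sq \<circ> mob r2 (- r1) s2 (- s1)"
      proof
        fix z :: "real option" obtain x y where z: "z = pt x y" "x \<noteq> 0 \<or> y \<noteq> 0" by (rule pt_cases)
        have "r2 * x - r1 * y \<noteq> 0 \<or> s2 * x - s1 * y \<noteq> 0"
        proof (rule ccontr)
          assume H: "\<not> ?thesis"
          have "d * x = r1 * (s2 * x - s1 * y) - s1 * (r2 * x - r1 * y)" "d * y = r2 * (s2 * x - s1 * y) - s2 * (r2 * x - r1 * y)"
            by (simp_all add: d_def algebra_simps)
          then show False using H d z by auto
        qed
        then show "f z = (mob PS PR QS QR \<circ> sq \<circ> mob r2 (- r1) s2 (- s1)) z"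
          unfolding z(1) fpt[OF z(2)] using l z(2) True by (simp add: mob_pt sq_pt)
      qed
      then show ?thesis using True l PSL2R_mob by blast
    next
      case False
      then have neg: "PR * QS - PS * QR > 0" using det0 by simp
      have l: "(- s2) * (- r1) - s1 * r2 > 0" using D by (simp add: mult.commute)
      \<comment> \<open>If the determinant has the wrong sign, the two roots are exchanged. The sign
        change in the first row keeps the inner determinant positive and disappears in the
        square.\<close>
      have "f = mob PR PS QR QS \<circ> sq \<circ> mob (- s2) s1 r2 (- r1)"
      proof
        fix z :: "real option" obtain x y where z: "z = pt x y" "x \<noteq> 0 \<or> y \<noteq> 0" by (rule pt_cases)
        have nzl: "s1 * y - s2 * x \<noteq> 0 \<or> r2 * x - r1 * y \<noteq> 0"
        proof (rule ccontr)
          assume H: "\<not> ?thesis"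
          have "d * x = - r1 * (s1 * y - s2 * x) - s1 * (r2 * x - r1 * y)" "d * y = - r2 * (s1 * y - s2 * x) - s2 * (r2 * x - r1 * y)"
            by (simp_all add: d_def algebra_simps)
          then show False using H d z by auto
        qed
        have "(s2 * x - s1 * y)\<^sup>2 = (s1 * y - s2 * x)\<^sup>2" by (simp add: power2_eq_square algebra_simps)
        then show "f z = (mob PR PS QR QS \<circ> sq \<circ> mob (- s2) s1 r2 (- r1)) z"
          unfolding z(1) fpt[OF z(2)] using l z(2) neg nzl by (simp add: mob_pt sq_pt add.commute)
      qed
      then show ?thesis using neg l PSL2R_mob by blast
    qed
  qed
  show ?thesis
  proof (cases "r1 * s2 - r2 * s1 > 0")
    case True
    then show ?thesis using key[OF True polar polarq] that by blast
  next
    case False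
    then have "s1 * r2 - s2 * r1 > 0" using D0 by (simp add: mult.commute)
    then show ?thesis using key[of s1 r2 s2 r1] polar polarq that by (auto simp: algebra_simps)
  qed
qed

section \<open>Arcs, laps and branches of the square root\<close>

lemma arc_0_inf: "circle_arc (Some (0::real)) None = {None} \<union> Some ` {0..}"
proof (rule set_eqI)
  fix z :: "real option"
  show "z \<in> circle_arc (Some 0) None \<longleftrightarrow> z \<in> {None} \<union> Some ` {0..}"
    by (cases z) (auto simp: circle_arc_def cyc_def)
qed

lemma arc_inf_0: "circle_arc None (Some (0::real)) = {None} \<union> Some ` {..0}"
proof (rule set_eqI)
  fix z :: "real option"
  show "z \<in> circle_arc None (Some 0) \<longleftrightarrow> z \<in> {None} \<union> Some ` {..0}"
    by (cases z) (auto simp: circle_arc_def cyc_def)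
qed

lemma arc_eq_0_inf:
  fixes c d :: "real option"
  assumes "c \<noteq> d" and eq: "circle_arc c d = circle_arc (Some 0) None"
  shows "c = Some 0 \<and> d = None"
proof -
  have mem: "z \<in> circle_arc c d \<longleftrightarrow> z = None \<or> (\<exists>x\<ge>0. z = Some x)" for z
    unfolding eq arc_0_inf by auto
  show ?thesis
  proof (cases c)
    case None
    then obtain y where d: "d = Some y" using assms(1) by (cases d) auto
    have "Some (min (-1) (y - 1)) \<in> circle_arc c d" using None d by (auto simp: circle_arc_def cyc_def)
    then show ?thesis unfolding mem by auto
  next
    case (Some x)
    show ?thesis
    proof (cases d)
      case None
      have "Some x \<in> circle_arc c d" "Some 0 \<in> circle_arc c d"
        using Some mem[of "Some 0"] by (auto simp: circle_arc_def)
      then have "x \<ge> 0" "x = 0 \<or> x < 0" using mem[of "Some x"] Some None by (auto simp: circle_arc_def cyc_def)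
      then show ?thesis using Some None by auto
    next
      case d: (Some y)
      have "None \<in> circle_arc c d" using mem by blast
      then have "y < x" using Some d by (auto simp: circle_arc_def cyc_def)
      then have "Some (min y (-1)) \<in> circle_arc c d" using Some d by (auto simp: circle_arc_def cyc_def min_def)
      then show ?thesis unfolding mem by auto
    qed
  qed
qed

lemma arc_inj:
  fixes a b c d :: "real option"
  assumes "a \<noteq> b" "c \<noteq> d" "circle_arc a b = circle_arc c d"
  shows "a = c \<and> b = d"
proof -
  obtain L where L: "L \<in> PSL2R" "L (Some 0) = a" "L None = b" using PSL2R_0_inf[OF assms(1)] by blast
  have iL: "inv L \<in> PSL2R" by (rule PSL2R_inv[OF L(1)])
  have "circle_arc (inv L c) (inv L d) = inv L ` circle_arc a b" unfolding assms(3) PSL2R_arc[OF iL] ..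
  also have "\<dots> = circle_arc (Some 0) None" unfolding PSL2R_arc[OF iL] using L by (metis PSL2R_inv_simps(1))
  finally have "inv L c = Some 0 \<and> inv L d = None" using assms(2) iL by (intro arc_eq_0_inf) auto
  then show ?thesis using L by (metis PSL2R_inv_simps(2))
qed

lemma range_sq: "range sq = circle_arc (Some 0) None"
proof (rule set_eqI)
  fix z :: "real option"
  show "z \<in> range sq \<longleftrightarrow> z \<in> circle_arc (Some 0) None"
  proof (cases z)
    case None
    then have "z = sq None" by simp
    then show ?thesis unfolding arc_0_inf using None by blast
  next
    case (Some x)
    have "x \<ge> 0 \<Longrightarrow> Some x = sq (Some (sqrt x))" by simp
    then have "z \<in> range sq \<longleftrightarrow> x \<ge> 0" using Some
      by (metis (no_types, lifting) image_iff map_option_eq_Some option.inject rangeI zero_le_power2)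
    then show ?thesis unfolding arc_0_inf using Some by auto
  qed
qed

lemma range_normal_form:
  assumes "M \<in> PSL2R" "L \<in> PSL2R"
  shows "range (M \<circ> sq \<circ> L) = circle_arc (M (Some 0)) (M None)"
proof -
  have "range (M \<circ> sq \<circ> L) = M ` sq ` range L" by (simp add: image_comp)
  also have "range L = UNIV" using PSL2R_bij[OF assms(2)] by (simp add: bij_is_surj)
  finally show ?thesis by (simp add: range_sq PSL2R_arc[OF assms(1)])
qed

definition branch :: "bool \<Rightarrow> real option \<Rightarrow> real option" where
  "branch s = map_option (\<lambda>x. (if s then 1 else - 1) * sqrt x)"

definition lap :: "bool \<Rightarrow> real option set" where
  "lap s = (if s then circle_arc (Some 0) None else circle_arc None (Some 0))"

lemma lap_simps [simp]: "None \<in> lap s" "Some x \<in> lap True \<longleftrightarrow> 0 \<le> x" "Some x \<in> lap False \<longleftrightarrow> x \<le> 0"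
  by (auto simp: lap_def arc_0_inf arc_inf_0)

lemma sq_branch: "z \<in> lap True \<Longrightarrow> sq (branch s z) = z"
  by (cases z) (auto simp: branch_def power_mult_distrib)

lemma branch_in_lap: "z \<in> lap True \<Longrightarrow> branch s z \<in> lap s"
  by (cases z; cases s) (auto simp: branch_def)

lemma branch_sq: "z \<in> lap s \<Longrightarrow> branch s (sq z) = z"
  by (cases z; cases s) (auto simp: branch_def real_sqrt_abs)

lemma sq_in_lap: "sq z \<in> lap True"
  by (cases z) auto

lemma branch_scale: "t > 0 \<Longrightarrow> branch s (scale t z) = scale (sqrt t) (branch s z)"
  by (cases z) (auto simp: branch_def real_sqrt_mult)

lemma sq_less:
  assumes "u \<in> lap s" "v \<in> lap s"
  shows "sq u < sq v \<longleftrightarrow> (if s then u < v else (u = None \<and> v \<noteq> None) \<or> (u \<noteq> None \<and> v \<noteq> None \<and> v < u))"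
proof (cases "u = None \<or> v = None")
  case True
  then show ?thesis by (cases u; cases v) auto
next
  case False
  then obtain x y where xy: "u = Some x" "v = Some y" by auto
  show ?thesis
  proof (cases s)
    case True
    then have "x \<ge> 0" "y \<ge> 0" using assms xy by auto
    then have "x\<^sup>2 < y\<^sup>2 \<longleftrightarrow> x < y" by (metis power2_less_imp_less power_strict_mono zero_less_numeral)
    then show ?thesis using True xy by simp
  next
    case s: False
    then have "- x \<ge> 0" "- y \<ge> 0" using assms xy by auto
    then have "(- x)\<^sup>2 < (- y)\<^sup>2 \<longleftrightarrow> - x < - y" by (metis power2_less_imp_less power_strict_mono zero_less_numeral)
    then show ?thesis using s xy by simp
  qed
qed

lemma sq_cyc_increasing: "u \<in> lap True \<Longrightarrow> v \<in> lap True \<Longrightarrow> w \<in> lap True \<Longrightarrow> cyc u v w \<Longrightarrow> cyc (sq u) (sq v) (sq w)"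
  unfolding cyc_def by (simp add: sq_less)

lemma sq_cyc_decreasing:
  assumes "u \<in> lap False" "v \<in> lap False" "w \<in> lap False" "cyc u v w"
  shows "cyc (sq w) (sq v) (sq u)"
  using assms(4)
  unfolding cyc_def sq_less[OF assms(1,2)] sq_less[OF assms(2,3)] sq_less[OF assms(3,1)] sq_less[OF assms(2,1)] sq_less[OF assms(3,2)] sq_less[OF assms(1,3)] if_False
  by (cases u; cases v; cases w) auto

lemma cyc_antisym: "cyc a b c \<Longrightarrow> \<not> cyc c b (a :: 'a::linorder)"
  by (auto simp: cyc_def)

lemma cyc_rotate: "cyc a b c \<longleftrightarrow> cyc b c (a :: 'a::linorder)"
  by (auto simp: cyc_def)

lemma cyc_distinct: "cyc a b c \<Longrightarrow> a \<noteq> b \<and> b \<noteq> c \<and> a \<noteq> (c :: 'a::linorder)"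
  by (auto simp: cyc_def)

lemma cyc_total: "a \<noteq> b \<Longrightarrow> b \<noteq> c \<Longrightarrow> a \<noteq> c \<Longrightarrow> cyc a b c \<or> cyc c b (a :: 'a::linorder)"
  by (auto simp: cyc_def not_less_iff_gr_or_eq)

text \<open>The critical points bound exactly two arcs, and on each of them a single triple of
  points excludes the wrong orientation behaviour.\<close>

lemma normal_form_laps:
  assumes M: "M \<in> PSL2R" and L: "L \<in> PSL2R"
  shows "increasing_lap (M \<circ> sq \<circ> L) A \<longleftrightarrow> A = inv L ` lap True"
    and "decreasing_lap (M \<circ> sq \<circ> L) A \<longleftrightarrow> A = inv L ` lap False"
proof -
  let ?f = "M \<circ> sq \<circ> L"
  have iL: "inv L \<in> PSL2R" by (rule PSL2R_inv[OF L])
  have crit: "critical_point ?f c \<longleftrightarrow> c = inv L (Some 0) \<or> c = inv L None" for c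
    unfolding normal_form_real_quadratic(2)[OF M L] using L by (metis PSL2R_inv_simps(1,2))
  have ne: "inv L (Some 0) \<noteq> inv L None" using iL by simp
  have arcs: "(\<exists>c d. c \<noteq> d \<and> critical_point ?f c \<and> critical_point ?f d \<and> A = circle_arc c d) \<longleftrightarrow>
    A = inv L ` lap True \<or> A = inv L ` lap False"
    unfolding crit lap_def PSL2R_arc[OF iL] if_True if_False using ne PSL2R_arc[OF iL] by metis
  have img: "(\<forall>u\<in>inv L ` B. P u) \<longleftrightarrow> (\<forall>u\<in>B. P (inv L u))" for B P by blast
  have tr: "cyc (?f (inv L u)) (?f (inv L v)) (?f (inv L w)) \<longleftrightarrow> cyc (sq u) (sq v) (sq w)" for u v w
    using M L by simp
  have c1: "cyc (Some (-2)) (Some (-1)) (Some (0::real))" "\<not> cyc (Some 4) (Some 1) (Some (0::real))"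
    "cyc (Some 0) (Some 1) (Some (2::real))" "\<not> cyc (Some 4) (Some 1) (Some (0::real))" by (auto simp: cyc_def)
  have incF: "\<not> (\<forall>u\<in>lap False. \<forall>v\<in>lap False. \<forall>w\<in>lap False. cyc u v w \<longrightarrow> cyc (sq u) (sq v) (sq w))"
  proof
    assume H: "\<forall>u\<in>lap False. \<forall>v\<in>lap False. \<forall>w\<in>lap False. cyc u v w \<longrightarrow> cyc (sq u) (sq v) (sq w)"
    have "cyc (sq (Some (-2))) (sq (Some (-1))) (sq (Some 0))" using c1(1) by (intro H[rule_format]) auto
    then show False using c1(2) by simp
  qed
  have decT: "\<not> (\<forall>u\<in>lap True. \<forall>v\<in>lap True. \<forall>w\<in>lap True. cyc u v w \<longrightarrow> cyc (sq w) (sq v) (sq u))"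
  proof
    assume H: "\<forall>u\<in>lap True. \<forall>v\<in>lap True. \<forall>w\<in>lap True. cyc u v w \<longrightarrow> cyc (sq w) (sq v) (sq u)"
    have "cyc (sq (Some 2)) (sq (Some 1)) (sq (Some 0))" using c1(3) by (intro H[rule_format]) auto
    then show False using c1(2) by simp
  qed
  show "increasing_lap ?f A \<longleftrightarrow> A = inv L ` lap True"
  proof
    assume "increasing_lap ?f A"
    then have A: "A = inv L ` lap True \<or> A = inv L ` lap False"
      and pr: "\<forall>u\<in>A. \<forall>v\<in>A. \<forall>w\<in>A. cyc u v w \<longrightarrow> cyc (?f u) (?f v) (?f w)"
      unfolding increasing_lap_def arcs by blast+
    show "A = inv L ` lap True"
    proof (rule ccontr)
      assume "A \<noteq> inv L ` lap True"
      then have AF: "A = inv L ` lap False" using A by blast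
      show False using pr[unfolded AF img tr PSL2R_cyc[OF iL]] incF by blast
    qed
  next
    assume A: "A = inv L ` lap True"
    show "increasing_lap ?f A"
      unfolding increasing_lap_def arcs
    proof (intro conjI)
      show "\<forall>u\<in>A. \<forall>v\<in>A. \<forall>w\<in>A. cyc u v w \<longrightarrow> cyc (?f u) (?f v) (?f w)"
        unfolding A img tr PSL2R_cyc[OF iL] by (intro ballI impI) (rule sq_cyc_increasing)
    qed (use A in blast)
  qed
  show "decreasing_lap ?f A \<longleftrightarrow> A = inv L ` lap False"
  proof
    assume "decreasing_lap ?f A"
    then have A: "A = inv L ` lap True \<or> A = inv L ` lap False"
      and pr: "\<forall>u\<in>A. \<forall>v\<in>A. \<forall>w\<in>A. cyc u v w \<longrightarrow> cyc (?f w) (?f v) (?f u)"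
      unfolding decreasing_lap_def arcs by blast+
    show "A = inv L ` lap False"
    proof (rule ccontr)
      assume "A \<noteq> inv L ` lap False"
      then have AT: "A = inv L ` lap True" using A by blast
      show False using pr[unfolded AT img tr PSL2R_cyc[OF iL]] decT by blast
    qed
  next
    assume A: "A = inv L ` lap False"
    show "decreasing_lap ?f A"
      unfolding decreasing_lap_def arcs
    proof (intro conjI)
      show "\<forall>u\<in>A. \<forall>v\<in>A. \<forall>w\<in>A. cyc u v w \<longrightarrow> cyc (?f w) (?f v) (?f u)"
        unfolding A img tr PSL2R_cyc[OF iL] by (intro ballI impI) (rule sq_cyc_decreasing)
    qed (use A in blast)
  qed
qed

section \<open>Configurations modulo \<open>PSL2R\<close> and the formula for the pull-back\<close>

lemma config_ext: "x \<in> config n \<Longrightarrow> restrict x {..n} = x"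
  by (simp add: config_def PiE_iff extensional_restrict)

lemma config_inj: "x \<in> config n \<Longrightarrow> i \<le> n \<Longrightarrow> k \<le> n \<Longrightarrow> x i = x k \<longleftrightarrow> i = k"
  by (auto simp: config_def inj_on_def)

lemma config_cyc:
  assumes x: "x \<in> config n" and le: "i \<le> n" "j \<le> n" "k \<le> n"
  shows "cyc (x i) (x j) (x k) \<longleftrightarrow> cyc i j k"
proof -
  have base: "cyc (x a) (x b) (x c)" if "a < b" "b < c" "c \<le> n" for a b c
    using x that by (auto simp: config_def)
  have imp: "cyc (x a) (x b) (x c)" if c: "cyc a b c" and "a \<le> n" "b \<le> n" "c \<le> n" for a b c
    using c unfolding cyc_def[of a b c]
  proof (elim disjE conjE)
    assume "a < b" "b < c" then show ?thesis using base that by blast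
  next
    assume "b < c" "c < a" then show ?thesis using base[of b c a] that cyc_rotate by metis
  next
    assume "c < a" "a < b" then show ?thesis using base[of c a b] that cyc_rotate by metis
  qed
  show ?thesis
  proof
    assume h: "cyc (x i) (x j) (x k)"
    then have "i \<noteq> j" "j \<noteq> k" "i \<noteq> k" using cyc_distinct by metis+
    then have "cyc i j k \<or> cyc k j i" by (rule cyc_total)
    then show "cyc i j k" using imp[of k j i] le h cyc_antisym by metis
  qed (use imp le in blast)
qed

lemma configI:
  assumes "x \<in> extensional {..n}" "inj_on x {..n}" "\<And>i j k. i < j \<Longrightarrow> j < k \<Longrightarrow> k \<le> n \<Longrightarrow> cyc (x i) (x j) (x k)"
  shows "x \<in> config n"
  using assms by (auto simp: config_def PiE_iff)

lemma config_PSL2R: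
  assumes "x \<in> config n" "K \<in> PSL2R" shows "restrict (K \<circ> x) {..n} \<in> config n"
proof (rule configI)
  show "inj_on (restrict (K \<circ> x) {..n}) {..n}"
    using assms config_inj by (auto simp: inj_on_def)
  show "cyc (restrict (K \<circ> x) {..n} i) (restrict (K \<circ> x) {..n} j) (restrict (K \<circ> x) {..n} k)" if "i < j" "j < k" "k \<le> n" for i j k
  proof -
    have "cyc i j k" using that by (simp add: cyc_def)
    then show ?thesis using that config_cyc[OF assms(1), of i j k] assms(2) by simp
  qed
qed simp

lemma orbit_PSL2R:
  assumes K: "K \<in> PSL2R" shows "orbit n (restrict (K \<circ> x) {..n}) = orbit n x"
proof -
  have r: "restrict (L \<circ> restrict (K \<circ> x) {..n}) {..n} = restrict ((L \<circ> K) \<circ> x) {..n}" for L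
    by (auto simp: restrict_def)
  have r': "restrict (L \<circ> x) {..n} = restrict ((L \<circ> inv K) \<circ> restrict (K \<circ> x) {..n}) {..n}" for L
    using K by (auto simp: restrict_def)
  show ?thesis
    unfolding orbit_def
  proof (intro equalityI subsetI; clarify)
    fix L assume "L \<in> PSL2R"
    then show "\<exists>L'. restrict (L \<circ> restrict (K \<circ> x) {..n}) {..n} = restrict (L' \<circ> x) {..n} \<and> L' \<in> PSL2R"
      using r PSL2R_comp[OF _ K] by blast
  next
    fix L assume "L \<in> PSL2R"
    then show "\<exists>L'. restrict (L \<circ> x) {..n} = restrict (L' \<circ> restrict (K \<circ> x) {..n}) {..n} \<and> L' \<in> PSL2R"
      using r' PSL2R_comp[OF _ PSL2R_inv[OF K]] by blast
  qed
qed

lemma orbit_self: "x \<in> config n \<Longrightarrow> x \<in> orbit n x"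
  unfolding orbit_def using config_ext PSL2R_id by (metis (mono_tags, lifting) comp_id id_comp mem_Collect_eq)

lemma orbit_eqD:
  assumes "orbit n x = orbit n y" "x \<in> config n"
  obtains K where "K \<in> PSL2R" "\<And>i. i \<le> n \<Longrightarrow> x i = K (y i)"
proof -
  have "x \<in> orbit n y" using assms orbit_self by blast
  then obtain K where "K \<in> PSL2R" "x = restrict (K \<circ> y) {..n}" by (auto simp: orbit_def)
  then show ?thesis using that[of K] by simp
qed

text \<open>Stated with explicit \<open>n\<close>, \<open>j1\<close>, \<open>j2\<close> to be rid of
  the descriptions in \<open>crit_min\<close> and \<open>crit_max\<close>.\<close>

definition comb_ok :: "nat list \<Rightarrow> nat \<Rightarrow> nat \<Rightarrow> nat \<Rightarrow> bool" where
  "comb_ok m n j1 j2 \<longleftrightarrow> length m = n + 1 \<and> crit_min m = j1 \<and> crit_max m = j2 \<and> j1 \<le> n \<and> j2 \<le> n \<and> j1 \<noteq> j2 \<and>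
    (\<forall>j\<le>n. m ! j \<le> n \<and> (j \<noteq> j1 \<longrightarrow> m ! j1 < m ! j) \<and> (j \<noteq> j2 \<longrightarrow> m ! j < m ! j2))"

lemma comb_okD:
  assumes "comb_ok m n j1 j2"
  shows "length m = n + 1" "crit_min m = j1" "crit_max m = j2" "j1 \<le> n" "j2 \<le> n" "j1 \<noteq> j2"
    and "j \<le> n \<Longrightarrow> m ! j \<le> n" "j \<le> n \<Longrightarrow> j \<noteq> j1 \<Longrightarrow> m ! j1 < m ! j" "j \<le> n \<Longrightarrow> j \<noteq> j2 \<Longrightarrow> m ! j < m ! j2"
  using assms unfolding comb_ok_def by blast+

lemma comb_ok_in_lap:
  assumes ok: "comb_ok m n j1 j2" and x: "x \<in> config n" and G: "G \<in> PSL2R"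
    and G0: "G (x (m ! j1)) = Some 0" "G (x (m ! j2)) = None" and j: "j \<le> n"
  shows "G (x (m ! j)) \<in> lap True"
proof -
  have le: "m ! j \<le> n" "m ! j1 \<le> n" "m ! j2 \<le> n" using ok j by (auto simp: comb_ok_def)
  show ?thesis
  proof (cases "j = j1 \<or> j = j2")
    case True
    then show ?thesis using G0 by auto
  next
    case False
    then have "m ! j1 < m ! j" "m ! j < m ! j2" using ok j by (auto simp: comb_ok_def)
    then have "cyc (m ! j1) (m ! j) (m ! j2)" by (simp add: cyc_def)
    then have "cyc (G (x (m ! j1))) (G (x (m ! j))) (G (x (m ! j2)))"
      using config_cyc[OF x le(2,1,3)] G by simp
    then show ?thesis unfolding G0 by (auto simp: lap_def circle_arc_def)
  qed
qed

text \<open>Every map with the prescribed range is \<open>M \<circ> sq \<circ> L\<close> with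
  \<open>M\<close> fixed up to a scaling by some \<open>t\<close>, and the scaling passes through
  the square root as \<open>sqrt t\<close>. So other choices of the representative and of the map
  change the result by an element of \<open>PSL2R\<close>, and any \<open>G\<close> that takes the
  two critical values to 0 and infinity computes it.\<close>

lemma pullback_eq:
  assumes ok: "comb_ok m n j1 j2" and x: "x \<in> config n" and G: "G \<in> PSL2R"
    and G0: "G (x (m ! j1)) = Some 0" "G (x (m ! j2)) = None"
  shows "pullback m (orbit n x) = orbit n (\<lambda>j\<in>{..n}. branch (j \<in> circle_arc j1 j2) (G (x (m ! j))))"
proof -
  have len: "length m - 1 = n" "crit_min m = j1" "crit_max m = j2" using comb_okD(1-3)[OF ok] by simp_all
  have mle: "m ! j \<le> n" if "j \<le> n" for j using comb_okD(7)[OF ok that] .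
  have jn: "j1 \<le> n" "j2 \<le> n" "m ! j1 \<noteq> m ! j2" using comb_okD(4-6)[OF ok] comb_okD(8)[OF ok, of j2] by simp_all
  define y where "y = (\<lambda>j\<in>{..n}. branch (j \<in> circle_arc j1 j2) (G (x (m ! j))))"
  have compute: "orbit n (\<lambda>j\<in>{..n}. inv_into (if j \<in> circle_arc j1 j2 then inv L ` lap True else inv L ` lap False) (M \<circ> sq \<circ> L) (x' (m ! j))) = orbit n y"
    if K: "K \<in> PSL2R" and x': "x' = restrict (K \<circ> x) {..n}" and M: "M \<in> PSL2R" and L: "L \<in> PSL2R"
      and M0: "M (Some 0) = x' (m ! j1)" "M None = x' (m ! j2)" for K x' M L
  proof -
    \<comment> \<open>\<open>H\<close> compares the two normalizations of the range; it fixes 0 and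
      infinity, so it is a scaling.\<close>
    define H where "H = (inv M \<circ> K) \<circ> inv G"
    have H: "H \<in> PSL2R" unfolding H_def by (intro PSL2R_comp PSL2R_inv M K G)
    have iG: "inv G (Some 0) = x (m ! j1)" "inv G None = x (m ! j2)" unfolding G0[symmetric] using G by simp_all
    have iM: "inv M (x' (m ! j1)) = Some 0" "inv M (x' (m ! j2)) = None" unfolding M0[symmetric] using M by simp_all
    have "H (Some 0) = Some 0" "H None = None"
      using iG iM x' mle jn by (auto simp: H_def)
    then obtain t where t: "t > 0" "H = scale t" by (rule PSL2R_fix_0_inf[OF H])
    have iL: "inv L \<in> PSL2R" by (rule PSL2R_inv[OF L])
    have S: "scale (sqrt t) \<in> PSL2R" using t by (intro scale_PSL2R) simp
    have val: "inv_into (inv L ` lap s) (M \<circ> sq \<circ> L) (x' (m ! j)) = (inv L \<circ> scale (sqrt t)) (branch s (G (x (m ! j))))"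
      if j: "j \<le> n" for s j
    proof -
      define w where "w = G (x (m ! j))"
      have w: "w \<in> lap True" unfolding w_def by (rule comb_ok_in_lap[OF ok x G G0 j])
      have xw: "inv M (x' (m ! j)) = scale t w"
        unfolding t(2)[symmetric] using G x' mle[OF j] by (simp add: H_def w_def)
      have rw: "branch s (scale t w) \<in> lap s"
        using w t(1) by (intro branch_in_lap) (cases w, auto)
      have sw: "sq (branch s (scale t w)) = scale t w"
        using w t(1) by (intro sq_branch) (cases w, auto)
      have "inv_into (inv L ` lap s) (M \<circ> sq \<circ> L) (x' (m ! j)) = inv L (branch s (scale t w))"
      proof (rule inv_into_f_eq)
        show "inj_on (M \<circ> sq \<circ> L) (inv L ` lap s)"
        proof (rule inj_onI, clarify)
          fix u v assume uv: "u \<in> lap s" "v \<in> lap s" "(M \<circ> sq \<circ> L) (inv L u) = (M \<circ> sq \<circ> L) (inv L v)"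
          then have "sq u = sq v" using M L by simp
          then show "inv L u = inv L v" using branch_sq uv by metis
        qed
        show "inv L (branch s (scale t w)) \<in> inv L ` lap s" using rw by blast
        have "(M \<circ> sq \<circ> L) (inv L (branch s (scale t w))) = M (scale t w)" using L sw by simp
        also have "\<dots> = x' (m ! j)" using xw M by (metis PSL2R_inv_simps(2))
        finally show "(M \<circ> sq \<circ> L) (inv L (branch s (scale t w))) = x' (m ! j)" .
      qed
      then show ?thesis using branch_scale[OF t(1)] by (simp add: w_def)
    qed
    have "(\<lambda>j\<in>{..n}. inv_into (if j \<in> circle_arc j1 j2 then inv L ` lap True else inv L ` lap False) (M \<circ> sq \<circ> L) (x' (m ! j)))
      = restrict ((inv L \<circ> scale (sqrt t)) \<circ> y) {..n}"
      by (rule restrict_ext) (auto simp: val y_def)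
    then show ?thesis using orbit_PSL2R[OF PSL2R_comp[OF iL S]] by simp
  qed
  show ?thesis
    unfolding pullback_def Let_def len y_def[symmetric]
  proof (rule the_equality)
    have iG: "inv G (Some 0) = x (m ! j1)" "inv G None = x (m ! j2)" unfolding G0[symmetric] using G by simp_all
    have iGP: "inv G \<in> PSL2R" by (rule PSL2R_inv[OF G])
    let ?f = "inv G \<circ> sq \<circ> id"
    show "\<exists>x'\<in>orbit n x. \<exists>f A B. real_quadratic f \<and> range f = circle_arc (x' (m ! j1)) (x' (m ! j2)) \<and>
        increasing_lap f A \<and> decreasing_lap f B \<and>
        orbit n y = orbit n (\<lambda>j\<in>{..n}. inv_into (if j \<in> circle_arc j1 j2 then A else B) f (x' (m ! j)))"
    proof (intro bexI exI conjI)
      show "real_quadratic ?f" by (rule normal_form_real_quadratic(1)[OF iGP PSL2R_id])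
      show "range ?f = circle_arc (x (m ! j1)) (x (m ! j2))" unfolding range_normal_form[OF iGP PSL2R_id] iG ..
      show "increasing_lap ?f (inv id ` lap True)" unfolding normal_form_laps(1)[OF iGP PSL2R_id] ..
      show "decreasing_lap ?f (inv id ` lap False)" unfolding normal_form_laps(2)[OF iGP PSL2R_id] ..
      show "orbit n y = orbit n (\<lambda>j\<in>{..n}. inv_into (if j \<in> circle_arc j1 j2 then inv id ` lap True else inv id ` lap False) ?f (x (m ! j)))"
        by (rule compute[OF PSL2R_id _ iGP PSL2R_id iG, symmetric]) (simp add: config_ext[OF x])
      show "x \<in> orbit n x" by (rule orbit_self[OF x])
    qed
  next
    fix \<eta>
    assume "\<exists>x'\<in>orbit n x. \<exists>f A B. real_quadratic f \<and> range f = circle_arc (x' (m ! j1)) (x' (m ! j2)) \<and>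
        increasing_lap f A \<and> decreasing_lap f B \<and>
        \<eta> = orbit n (\<lambda>j\<in>{..n}. inv_into (if j \<in> circle_arc j1 j2 then A else B) f (x' (m ! j)))"
    then obtain x' f A B where x': "x' \<in> orbit n x" and f: "real_quadratic f" "range f = circle_arc (x' (m ! j1)) (x' (m ! j2))"
      "increasing_lap f A" "decreasing_lap f B"
      and \<eta>: "\<eta> = orbit n (\<lambda>j\<in>{..n}. inv_into (if j \<in> circle_arc j1 j2 then A else B) f (x' (m ! j)))" by blast
    obtain K where K: "K \<in> PSL2R" "x' = restrict (K \<circ> x) {..n}" using x' by (auto simp: orbit_def)
    obtain M L where NF: "M \<in> PSL2R" "L \<in> PSL2R" "f = M \<circ> sq \<circ> L" by (rule real_quadratic_normal_form[OF f(1)])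
    have ne: "x' (m ! j1) \<noteq> x' (m ! j2)" using K mle jn config_inj[OF x] by auto
    have "M (Some 0) \<noteq> M None" using NF by simp
    then have M0: "M (Some 0) = x' (m ! j1)" "M None = x' (m ! j2)"
      using arc_inj[OF _ ne] f(2) unfolding NF(3) range_normal_form[OF NF(1,2)] by blast+
    have AB: "A = inv L ` lap True" "B = inv L ` lap False"
      using f(3,4) unfolding NF(3) normal_form_laps[OF NF(1,2)] by auto
    show "\<eta> = orbit n y" unfolding \<eta> NF(3) AB by (rule compute[OF K NF(1,2) M0])
  qed
qed

section \<open>Labellings\<close>

text \<open>Besides the normal form it names the critical points. The range is the arc from
  \<open>g c0\<close> to \<open>g ci\<close>, so \<open>c0\<close> has the least and
  \<open>ci\<close> the greatest value once the range avoids infinity.\<close>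

locale nf =
  fixes M L g :: "real option \<Rightarrow> real option" and c0 ci :: "real option"
  assumes M: "M \<in> PSL2R" and L: "L \<in> PSL2R" and g: "g = M \<circ> sq \<circ> L"
    and c0: "L c0 = Some 0" and ci: "L ci = None"
begin

lemma L_eq: "L z = Some 0 \<longleftrightarrow> z = c0" "L z = None \<longleftrightarrow> z = ci"
  unfolding c0[symmetric] ci[symmetric] using L by simp_all

lemma crit: "critical_point g z \<longleftrightarrow> z = c0 \<or> z = ci"
  unfolding g normal_form_real_quadratic(2)[OF M L] L_eq ..

lemma c_ne: "c0 \<noteq> ci"
  using c0 ci by auto

lemma g_c: "g c0 = M (Some 0)" "g ci = M None"
  unfolding g using c0 ci by simp_all

lemma range_g: "range g = circle_arc (g c0) (g ci)"
  unfolding g_c unfolding g by (rule range_normal_form[OF M L])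

lemma g_eq: "g z = g c0 \<longleftrightarrow> z = c0" "g z = g ci \<longleftrightarrow> z = ci"
proof -
  have "sq w = Some 0 \<longleftrightarrow> w = Some 0" "sq w = None \<longleftrightarrow> w = None" for w by (cases w; simp)+
  then show "g z = g c0 \<longleftrightarrow> z = c0" "g z = g ci \<longleftrightarrow> z = ci"
    unfolding g_c unfolding g using M L_eq by simp_all
qed

lemma marked: "marked_points g = range (\<lambda>k. (g ^^ k) c0) \<union> range (\<lambda>k. (g ^^ k) ci)"
  unfolding marked_points_def crit by auto

lemma crit_marked: "c0 \<in> marked_points g" "ci \<in> marked_points g"
proof -
  have "(g ^^ 0) c0 \<in> marked_points g" "(g ^^ 0) ci \<in> marked_points g" unfolding marked by blast+
  then show "c0 \<in> marked_points g" "ci \<in> marked_points g" by simp_all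
qed

lemma marked_cases:
  assumes "z \<in> marked_points g" shows "z = c0 \<or> z = ci \<or> z \<in> range g"
proof -
  obtain k c where kc: "z = (g ^^ k) c" "c = c0 \<or> c = ci" using assms by (auto simp: marked_points_def crit)
  then show ?thesis by (cases k) auto
qed

lemma real_range:
  assumes "None \<notin> range g"
  shows "g c0 \<le> g z" "g z \<le> g ci" "g c0 < g ci" "z \<noteq> c0 \<Longrightarrow> g c0 < g z" "z \<noteq> ci \<Longrightarrow> g z < g ci"
proof -
  have pos: "None < g y" for y using assms by (metis less_option_None_Some not_None_eq rangeI)
  have "\<not> cyc (g c0) None (g ci)" using assms unfolding range_g by (simp add: circle_arc_def)
  moreover have "g c0 \<noteq> g ci" using g_eq c_ne by blast
  ultimately show 1: "g c0 < g ci" using pos[of c0] pos[of ci] by (auto simp: cyc_def)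
  have "g z \<in> circle_arc (g c0) (g ci)" unfolding range_g[symmetric] by blast
  then show 2: "g c0 \<le> g z" "g z \<le> g ci" using 1 by (auto simp: circle_arc_def cyc_def)
  show "z \<noteq> c0 \<Longrightarrow> g c0 < g z" "z \<noteq> ci \<Longrightarrow> g z < g ci" using 2 g_eq[of z] by (auto simp: less_le)
qed

lemma normalized_iff:
  "normalized g \<longleftrightarrow> None \<notin> range g \<and>
    (c0 \<notin> range g \<longrightarrow> c0 \<noteq> None \<and> (\<forall>z. g z < c0)) \<and> (ci \<notin> range g \<longrightarrow> ci \<noteq> None \<and> (\<forall>z. ci < g z))"
proof (cases "None \<in> range g")
  case False
  note r = real_range[OF False]
  have "(\<forall>z. g z \<le> g ci)" "(\<forall>z. g c0 \<le> g z)" "\<not> (\<forall>z. g z \<le> g c0)" "\<not> (\<forall>z. g ci \<le> g z)"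
    using r(1,2) r(3) by (auto simp: not_le)
  then show ?thesis using False unfolding normalized_def crit by metis
qed (simp add: normalized_def)

lemma conj: "K \<in> PSL2R \<Longrightarrow> nf (K \<circ> M) (L \<circ> inv K) (K \<circ> g \<circ> inv K) (K c0) (K ci)"
  unfolding nf_def using M L c0 ci by (auto simp: g PSL2R_comp PSL2R_inv fun_eq_iff)

end

lemma conj_pow: "K \<in> PSL2R \<Longrightarrow> ((K \<circ> g \<circ> inv K) ^^ k) (K z) = K ((g ^^ k) z)"
  by (induction k) auto

lemma range_conj: "K \<in> PSL2R \<Longrightarrow> range (K \<circ> g \<circ> inv K) = K ` range g"
  using PSL2R_bij[OF PSL2R_inv, of K] by (metis bij_is_surj image_comp)

lemma (in nf) marked_conj:
  assumes K: "K \<in> PSL2R" shows "marked_points (K \<circ> g \<circ> inv K) = K ` marked_points g"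
  unfolding nf.marked[OF conj[OF K]] marked conj_pow[OF K] by (simp add: image_Un image_image)

lemma real_quadratic_nf:
  assumes "real_quadratic f"
  shows "\<exists>M L c0 ci. nf M L f c0 ci"
proof -
  obtain M L where NF: "M \<in> PSL2R" "L \<in> PSL2R" "f = M \<circ> sq \<circ> L" by (rule real_quadratic_normal_form[OF assms])
  then have "nf M L f (inv L (Some 0)) (inv L None)" by (simp add: nf_def)
  then show ?thesis by blast
qed

lemma conjugate_refl: "conjugate f f"
  unfolding conjugate_def by (rule bexI[of _ id]) (simp_all add: fun_eq_iff)

lemma conjugate_sym: assumes "conjugate f g" shows "conjugate g f"
proof -
  obtain K where K: "K \<in> PSL2R" "g = K \<circ> f \<circ> inv K" using assms by (auto simp: conjugate_def)
  then have "f = inv K \<circ> g \<circ> inv (inv K)" by (simp add: fun_eq_iff)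
  then show ?thesis unfolding conjugate_def using PSL2R_inv[OF K(1)] by blast
qed

lemma conjugate_trans: assumes "conjugate f g" "conjugate g h" shows "conjugate f h"
proof -
  obtain K where K: "K \<in> PSL2R" "g = K \<circ> f \<circ> inv K" using assms by (auto simp: conjugate_def)
  obtain K' where K': "K' \<in> PSL2R" "h = K' \<circ> g \<circ> inv K'" using assms by (auto simp: conjugate_def)
  have "inv (K' \<circ> K) = inv K \<circ> inv K'" using o_inv_distrib PSL2R_bij K(1) K'(1) by blast
  then have "h = (K' \<circ> K) \<circ> f \<circ> inv (K' \<circ> K)" using K K' by (simp add: comp_assoc)
  then show ?thesis unfolding conjugate_def using PSL2R_comp[OF K'(1) K(1)] by blast
qed

lemma strict_mono_on_nat_unique:
  fixes x y :: "nat \<Rightarrow> real"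
  assumes x: "strict_mono_on {..n} x" and y: "strict_mono_on {..n'} y" and eq: "x ` {..n} = y ` {..n'}"
  shows "n = n' \<and> (\<forall>i\<le>n. x i = y i)"
proof -
  have list: "map x [0..<Suc n] = sorted_list_of_set (x ` {..n})" if x: "strict_mono_on {..n} x" for x :: "nat \<Rightarrow> real" and n
  proof (rule sorted_distinct_set_unique)
    show "sorted (map x [0..<Suc n])" using x by (auto simp: sorted_iff_nth_mono strict_mono_on_def nth_append simp del: upt_Suc intro: less_imp_le) (metis atMost_iff less_Suc_eq_le le_trans order.order_iff_strict)
    show "distinct (map x [0..<Suc n])" using strict_mono_on_imp_inj_on[OF x] by (simp add: distinct_map atLeast0LessThan lessThan_Suc_atMost del: upt_Suc)
  qed (auto simp: atLeast0LessThan lessThan_Suc_atMost simp del: upt_Suc)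
  have e: "map x [0..<Suc n] = map y [0..<Suc n']" unfolding list[OF x] list[OF y] eq ..
  then have n: "n = n'" by (metis Suc_inject diff_zero length_map length_upt)
  have "x i = y i" if "i \<le> n" for i
  proof -
    have "map x [0..<Suc n] ! i = map y [0..<Suc n] ! i" using e unfolding n by (rule arg_cong)
    then show ?thesis using that by (simp del: upt_Suc)
  qed
  then show ?thesis using n by blast
qed

lemma finite_real_enum:
  fixes S :: "real set"
  assumes "finite S" "S \<noteq> {}"
  shows "\<exists>(n::nat) x. strict_mono_on {..n} x \<and> x ` {..n} = S"
proof -
  define l where "l = sorted_list_of_set S"
  define n where "n = card S - 1"
  have len: "length l = Suc n" using assms by (simp add: l_def n_def card_gt_0_iff)
  have "strict_mono_on {..n} ((!) l)"
  proof (rule strict_mono_onI)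
    fix r s assume "r \<in> {..n}" "s \<in> {..n}" "r < s"
    then show "l ! r < l ! s" using sorted_wrt_nth_less[OF strict_sorted_list_of_set[of S], of r s] len by (simp add: l_def)
  qed
  moreover have "(!) l ` {..n} = set l" using len by (auto simp: set_conv_nth less_Suc_eq_le)
  moreover have "set l = S" using assms by (simp add: l_def)
  ultimately have "strict_mono_on {..n} ((!) l) \<and> (!) l ` {..n} = S" by simp
  then show ?thesis by blast
qed

text \<open>\<open>cyc j2 i k\<close> says that \<open>i\<close> precedes \<open>k\<close> on the
  line that remains after removing \<open>j2\<close>, so the middle conditions are monotonicity on
  the two laps. The two inequalities at the end record the side on which \<open>normalized\<close>
  puts a critical point outside the range; they exclude two patterns in
  \<open>isometric_comb\<close>.\<close>

definition good_comb :: "nat list \<Rightarrow> nat \<Rightarrow> nat \<Rightarrow> nat \<Rightarrow> bool" where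
  "good_comb m n j1 j2 \<longleftrightarrow> comb_ok m n j1 j2 \<and>
    (\<forall>i\<le>n. \<forall>k\<le>n. cyc j2 i k \<longrightarrow>
      (k \<in> circle_arc j2 j1 \<longrightarrow> m ! k < m ! i) \<and> (i \<in> circle_arc j1 j2 \<longrightarrow> m ! i < m ! k)) \<and>
    (\<forall>i\<le>n. \<exists>k. i = ((!) m ^^ k) j1 \<or> i = ((!) m ^^ k) j2) \<and> m ! j1 \<le> j1 \<and> j2 \<le> m ! j2"

lemma (in nf) labelled:
  assumes norm: "normalized g" and x: "strict_mono_on {..n} x" and img: "Some ` x ` {..n} = marked_points g"
    and len: "length m = n + 1" and mx: "\<forall>j\<le>n. m ! j \<le> n \<and> g (Some (x j)) = Some (x (m ! j))"
  shows "\<exists>j1 j2. good_comb m n j1 j2 \<and> c0 = Some (x j1) \<and> ci = Some (x j2) \<and>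
    (\<lambda>j\<in>{..n}. Some (x j)) \<in> config n \<and>
    pullback m (orbit n (\<lambda>j\<in>{..n}. Some (x j))) = orbit n (\<lambda>j\<in>{..n}. Some (x j))"
proof -
  define X where "X = (\<lambda>j\<in>{..n}. Some (x j))"
  have NR: "None \<notin> range g" using norm unfolding normalized_def by blast
  note R = real_range[OF NR]
  have xless: "x i < x k \<longleftrightarrow> i < k" if "i \<le> n" "k \<le> n" for i k
    using x that by (metis atMost_iff strict_mono_on_less)
  have gx: "g (Some (x j)) = Some (x (m ! j))" and mle: "m ! j \<le> n" if "j \<le> n" for j using mx that by blast+
  obtain j1 where j1: "j1 \<le> n" "c0 = Some (x j1)" using crit_marked(1) unfolding img[symmetric] by auto
  obtain j2 where j2: "j2 \<le> n" "ci = Some (x j2)" using crit_marked(2) unfolding img[symmetric] by auto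
  have j12: "j1 \<noteq> j2" using c_ne j1 j2 by auto
  have inj: "x i = x k \<longleftrightarrow> i = k" if "i \<le> n" "k \<le> n" for i k
    using xless[OF that] xless[OF that(2,1)] by (metis less_irrefl nat_neq_iff)
  have lo: "m ! j1 < m ! j" if "j \<le> n" "j \<noteq> j1" for j
  proof -
    have "g c0 < g (Some (x j))" using R(4) that j1 inj by auto
    then show ?thesis using gx[OF that(1)] gx[OF j1(1)] j1(2) xless mle that(1) j1(1) by auto
  qed
  have hi: "m ! j < m ! j2" if "j \<le> n" "j \<noteq> j2" for j
  proof -
    have "g (Some (x j)) < g ci" using R(5) that j2 inj by auto
    then show ?thesis using gx[OF that(1)] gx[OF j2(1)] j2(2) xless mle that(1) j2(1) by auto
  qed
  have setm: "set m = (!) m ` {..n}" using len by (auto simp: set_conv_nth less_Suc_eq_le)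
  have mn: "Min (set m) = m ! j1" 
  proof (rule Min_eqI)
    fix y assume "y \<in> set m"
    then obtain j where "j \<le> n" "y = m ! j" unfolding setm by blast
    then show "m ! j1 \<le> y" using lo[of j] by (cases "j = j1") simp_all
  qed (use j1 setm in auto)
  have mxx: "Max (set m) = m ! j2" 
  proof (rule Max_eqI)
    fix y assume "y \<in> set m"
    then obtain j where "j \<le> n" "y = m ! j" unfolding setm by blast
    then show "y \<le> m ! j2" using hi[of j] by (cases "j = j2") simp_all
  qed (use j2 setm in auto)
  have cmin: "crit_min m = j1" unfolding crit_min_def mn

  proof (rule the_equality)
    show "j1 < length m \<and> m ! j1 = m ! j1" using j1 len by simp
    show "j = j1" if "j < length m \<and> m ! j = m ! j1" for j
      using that len lo[of j] by (cases "j = j1") simp_all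
  qed
  have cmax: "crit_max m = j2" unfolding crit_max_def mxx

  proof (rule the_equality)
    show "j2 < length m \<and> m ! j2 = m ! j2" using j2 len by simp
    show "j = j2" if "j < length m \<and> m ! j = m ! j2" for j
      using that len hi[of j] by (cases "j = j2") simp_all
  qed
  have ok: "comb_ok m n j1 j2"
    unfolding comb_ok_def using len cmin cmax j1(1) j2(1) j12 mle lo hi by blast
  have cX: "X \<in> config n"
  proof (rule configI)
    show "X \<in> extensional {..n}" by (simp add: X_def)
    show "inj_on X {..n}" using inj by (auto simp: inj_on_def X_def)
    show "cyc (X i) (X j) (X k)" if "i < j" "j < k" "k \<le> n" for i j k
      using that xless by (simp add: X_def cyc_def)
  qed
  have LX: "cyc (L (X i)) (L (X j)) (L (X k)) \<longleftrightarrow> cyc i j k" if "i \<le> n" "j \<le> n" "k \<le> n" for i j k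
    using config_cyc[OF cX that] L by simp
  have X12: "L (X j1) = Some 0" "L (X j2) = None" using c0 ci j1 j2 by (simp_all add: X_def)
  have gX: "g (X j) = X (m ! j)" if "j \<le> n" for j using gx[OF that] mle[OF that] that by (simp add: X_def)
  have lap: "L (X j) \<in> lap (j \<in> circle_arc j1 j2)" if "j \<le> n" for j
  proof (cases "j = j1 \<or> j = j2")
    case True then show ?thesis using X12 by (cases "j \<in> circle_arc j1 j2") auto
  next
    case False
    have "cyc j1 j j2 \<or> cyc j2 j j1" using cyc_total[of j1 j j2] False j12 by auto
    then show ?thesis
      using LX[OF j1(1) that j2(1)] LX[OF j2(1) that j1(1)] False cyc_antisym[of j1 j j2]
      unfolding X12 by (auto simp: lap_def circle_arc_def)
  qed
  have iM: "inv M (X (m ! j)) = sq (L (X j))" if "j \<le> n" for j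
    unfolding gX[OF that, symmetric] using M by (simp add: g)
  have "pullback m (orbit n X) = orbit n (\<lambda>j\<in>{..n}. branch (j \<in> circle_arc j1 j2) (inv M (X (m ! j))))"
    using iM[OF j1(1)] iM[OF j2(1)] X12 by (intro pullback_eq[OF ok cX PSL2R_inv[OF M]]) auto
  also have "(\<lambda>j\<in>{..n}. branch (j \<in> circle_arc j1 j2) (inv M (X (m ! j)))) = restrict (L \<circ> X) {..n}"
    by (rule restrict_ext) (use iM lap branch_sq in auto)
  finally have pb: "pullback m (orbit n X) = orbit n X" unfolding orbit_PSL2R[OF L] .
  have mono: "(k \<in> circle_arc j2 j1 \<longrightarrow> m ! k < m ! i) \<and> (i \<in> circle_arc j1 j2 \<longrightarrow> m ! i < m ! k)"
    if ik: "i \<le> n" "k \<le> n" and c: "cyc j2 i k" for i k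
  proof -
    \<comment> \<open>\<open>M\<close> carries the order on the range of \<open>sq\<close>, cut at
      infinity, to the linear order of the indices above \<open>m ! j1\<close>.\<close>
    have less_m: "m ! i < m ! k" if "i \<le> n" "k \<le> n" "sq (L (X i)) < sq (L (X k))" "sq (L (X i)) \<noteq> None" for i k
    proof -
      have ne: "k \<noteq> j1" using that(3,4) X12 by (cases "L (X i)") (auto simp: not_less)
      show ?thesis
      proof (cases "i = j1")
        case True then show ?thesis using lo that(2) ne by blast
      next
        case False
        have n0: "sq (L (X k)) \<noteq> Some 0" "sq (L (X i)) \<noteq> Some 0"
          using ne False that L_eq j1 inj by (cases "L (X k)"; cases "L (X i)"; auto simp: X_def)+
        have "cyc (Some 0) (sq (L (X i))) (sq (L (X k)))"
          using that(3,4) n0 sq_in_lap[of "L (X i)"] sq_in_lap[of "L (X k)"]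
          by (cases "L (X i)"; cases "L (X k)") (auto simp: cyc_def)
        then have "cyc (M (Some 0)) (M (sq (L (X i)))) (M (sq (L (X k))))" using M by simp
        then have "cyc (X (m ! j1)) (X (m ! i)) (X (m ! k))"
          using gX[OF that(1)] gX[OF that(2)] gX[OF j1(1)] X12 by (simp add: g)
        then have "cyc (m ! j1) (m ! i) (m ! k)" using config_cyc[OF cX] mle that j1 by blast
        then show ?thesis using lo[OF that(1) False] lo[OF that(2) ne] unfolding cyc_def by linarith
      qed
    qed
    have ne: "i \<noteq> j2" "k \<noteq> j2" "i \<noteq> k" using cyc_distinct[OF c] by auto
    have "cyc None (L (X i)) (L (X k))" using LX[OF j2(1) ik] c X12 by simp
    then have ls: "L (X i) < L (X k)" "L (X i) \<noteq> None" "L (X k) \<noteq> None" by (cases "L (X i)"; cases "L (X k)"; auto simp: cyc_def)+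
    show ?thesis
    proof (intro conjI impI)
      assume "i \<in> circle_arc j1 j2"
      then have li: "L (X i) \<in> lap True" using lap[OF ik(1)] by simp
      have lk: "L (X k) \<in> lap True" using li ls by (cases "L (X i)"; cases "L (X k)") auto
      have "sq (L (X i)) < sq (L (X k))" using sq_less[OF li lk] ls by simp
      then show "m ! i < m ! k" using less_m[OF ik] ls by simp
    next
      assume k: "k \<in> circle_arc j2 j1"
      have lk: "L (X k) \<in> lap False"
      proof (cases "k = j1")
        case True then show ?thesis using X12 by simp
      next
        case False
        then have "cyc j2 k j1" using k ne by (auto simp: circle_arc_def)
        then have "k \<notin> circle_arc j1 j2" using False ne cyc_antisym[of j2 k j1] by (auto simp: circle_arc_def)
        then show ?thesis using lap[OF ik(2)] by simp
      qed
      have li: "L (X i) \<in> lap False" using lk ls by (cases "L (X i)"; cases "L (X k)") auto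
      have "sq (L (X k)) < sq (L (X i))" using sq_less[OF lk li] ls by simp
      then show "m ! k < m ! i" using less_m[OF ik(2,1)] ls by simp
    qed
  qed
  have post: "\<exists>k. i = ((!) m ^^ k) j1 \<or> i = ((!) m ^^ k) j2" if "i \<le> n" for i
  proof -
    have it: "(g ^^ k) (X j) = X (((!) m ^^ k) j) \<and> ((!) m ^^ k) j \<le> n" if "j \<le> n" for j k
      by (induction k) (use gX mle that in auto)
    have "X i \<in> marked_points g" unfolding img[symmetric] X_def using that by auto
    then obtain k c where k: "X i = (g ^^ k) c" "c = X j1 \<or> c = X j2"
      unfolding marked using j1 j2 by (auto simp: X_def)
    then have "X i = X (((!) m ^^ k) j1) \<or> X i = X (((!) m ^^ k) j2)" using it j1 j2 by metis
    then have "i = ((!) m ^^ k) j1 \<or> i = ((!) m ^^ k) j2"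
      using config_inj[OF cX that] it[OF j1(1), of k] it[OF j2(1), of k] by blast
    then show ?thesis by blast
  qed
  \<comment> \<open>If the minimum of the range were to the right of \<open>c0\<close>, so would be
    the whole range, but \<open>normalized\<close> wants a \<open>c0\<close> outside the range to be
    to the right of it.\<close>
  have N1: "m ! j1 \<le> j1"
  proof (rule ccontr)
    assume "\<not> m ! j1 \<le> j1"
    then have "c0 < g c0" using gx[OF j1(1)] j1 xless mle by simp
    then have "c0 < g z" for z using R(1)[of z] by (rule less_le_trans)
    then have "c0 \<notin> range g \<and> \<not> g c0 < c0" by (metis imageE less_irrefl less_asym)
    then show False using norm unfolding normalized_iff by blast
  qed
  have N2: "j2 \<le> m ! j2"
  proof (rule ccontr)
    assume "\<not> j2 \<le> m ! j2"
    then have "g ci < ci" using gx[OF j2(1)] j2 xless mle by simp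
    then have "g z < ci" for z using R(2)[of z] by (rule le_less_trans[rotated])
    then have "ci \<notin> range g \<and> \<not> ci < g ci" by (metis imageE less_irrefl less_asym)
    then show False using norm unfolding normalized_iff by blast
  qed
  have "good_comb m n j1 j2" unfolding good_comb_def using ok mono post N1 N2 by blast
  then show ?thesis using j1 j2 cX pb unfolding X_def by blast
qed

section \<open>Uniqueness and existence of the normalized labelling\<close>

definition cfg :: "nat \<Rightarrow> (nat \<Rightarrow> real) \<Rightarrow> nat \<Rightarrow> real option" where
  "cfg n x = (\<lambda>j\<in>{..n}. Some (x j))"

text \<open>\<open>K\<close> preserves the order of points that lie on one side of the point
  \<open>w\<close> which it sends to infinity. The range, an arc avoiding both \<open>w\<close> and
  infinity, lies on one side. A critical point outside the range is on the same side, because both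
  normalizations prescribe in the same way how it lies relative to the range.\<close>

lemma normalized_order_unique:
  assumes g: "nf M L g c0 ci" and K: "K \<in> PSL2R"
    and norm: "normalized g" "normalized (K \<circ> g \<circ> inv K)"
    and uv: "u \<in> marked_points g" "v \<in> marked_points g" "u < v"
    and None: "None \<notin> marked_points g" "None \<notin> marked_points (K \<circ> g \<circ> inv K)"
  shows "K u < K v"
proof -
  interpret nf M L g c0 ci by (rule g)
  interpret K: nf "K \<circ> M" "L \<circ> inv K" "K \<circ> g \<circ> inv K" "K c0" "K ci" by (rule conj[OF K])
  have NR: "None \<notin> range g" using norm unfolding normalized_def by blast
  note R = real_range[OF NR]
  have NR': "None \<notin> K ` range g" using norm(2) unfolding normalized_def range_conj[OF K] by blast
  define w where "w = inv K None"
  have Kw: "K w = None" using K by (simp add: w_def)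
  have wR: "w \<noteq> g z" for z using NR' Kw by (metis image_eqI rangeI)
  have wm: "w \<noteq> z" if "z \<in> marked_points g" for z
    using None(2) Kw that unfolding marked_conj[OF K] by (metis image_eqI)
  have Kless: "K a < K b \<longleftrightarrow> cyc w a b" if "a \<noteq> w" "b \<noteq> w" for a b
  proof -
    have "K a \<noteq> None" "K b \<noteq> None" using that K Kw by (metis PSL2R_eq_iff)+
    then have "K a < K b \<longleftrightarrow> cyc None (K a) (K b)" by (auto simp: cyc_def)
    then show ?thesis unfolding Kw[symmetric] using K by simp
  qed
  have n0: "None < z" if "z \<in> marked_points g \<or> z \<in> range g" for z
    using that None(1) NR by (metis less_option_None_Some not_None_eq)
  have cases: "z \<in> range g \<or> (z = c0 \<and> g ci < z) \<or> (z = ci \<and> z < g c0)" if "z \<in> marked_points g" for z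
    using marked_cases[OF that] norm(1) unfolding normalized_iff by blast
  have rng: "g c0 \<le> z \<and> z \<le> g ci" if "z \<in> range g" for z using R(1,2) that by blast
  show ?thesis
  proof (cases "w = None")
    case True
    have "cyc w u v" using uv n0 True by (auto simp: cyc_def)
    then show ?thesis using Kless wm uv by metis
  next
    case False
    then have w0: "None < w" by (metis less_option_None_Some not_None_eq)
    have "w \<notin> circle_arc (g c0) (g ci)" using wR unfolding range_g[symmetric] by blast
    then have out: "w < g c0 \<or> g ci < w" using R(3) by (auto simp: circle_arc_def cyc_def)
    have side: "(\<forall>z\<in>marked_points g. z < w) \<or> (\<forall>z\<in>marked_points g. w < z)"
      using out
    proof
      assume lt: "w < g c0"
      have "w < z" if z: "z \<in> marked_points g" for z
      proof (rule ccontr)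
        assume "\<not> w < z"
        then have zw: "z < w" using wm[OF z] by auto
        then have zr: "z \<notin> range g" using rng[of z] lt by (meson less_le_trans order.asym)
        then have zc: "z = ci" using cases[OF z] zw lt R(3) by (metis less_trans order.asym)
        have "K ci \<notin> K ` range g" using zr zc K by (auto simp: image_iff)
        then have "K ci < K (g c0)"
          using norm(2) unfolding K.normalized_iff range_conj[OF K] using K
          by (metis comp_apply PSL2R_inv_simps(1))
        then have "cyc w z (g c0)" using Kless[of z "g c0"] wR[of c0] zw zc by auto
        then show False using zw lt by (auto simp: cyc_def)
      qed
      then show ?thesis by blast
    next
      assume gt: "g ci < w"
      have "z < w" if z: "z \<in> marked_points g" for z
      proof (rule ccontr)
        assume "\<not> z < w"
        then have zw: "w < z" using wm[OF z] by auto
        then have zr: "z \<notin> range g" using rng[of z] gt by (meson le_less_trans order.asym)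
        then have zc: "z = c0" using cases[OF z] zw gt R(3) by (metis less_trans order.asym)
        have "K c0 \<notin> K ` range g" using zr zc K by (auto simp: image_iff)
        then have "K (g ci) < K c0"
          using norm(2) unfolding K.normalized_iff range_conj[OF K] using K
          by (metis comp_apply PSL2R_inv_simps(1))
        then have "cyc w (g ci) z" using Kless[of "g ci" z] wR[of ci] zw zc by auto
        then show False using zw gt by (auto simp: cyc_def)
      qed
      then show ?thesis by blast
    qed
    then have "cyc w u v" using uv by (auto simp: cyc_def)
    then show ?thesis using Kless wm uv by metis
  qed
qed

lemma labelling_unique:
  assumes f: "real_quadratic f" and l: "labelling f m n x" and l': "labelling f m' n' x'"
  shows "m = m' \<and> n = n' \<and> orbit n (cfg n x) = orbit n (cfg n x')"
proof -
  obtain g where g: "conjugate f g" "normalized g" "strict_mono_on {..n} x" "Some ` x ` {..n} = marked_points g"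
    "length m = n + 1" "\<forall>j\<le>n. m ! j \<le> n \<and> g (Some (x j)) = Some (x (m ! j))"
    using l unfolding labelling_def by blast
  obtain g' where g': "conjugate f g'" "normalized g'" "strict_mono_on {..n'} x'" "Some ` x' ` {..n'} = marked_points g'"
    "length m' = n' + 1" "\<forall>j\<le>n'. m' ! j \<le> n' \<and> g' (Some (x' j)) = Some (x' (m' ! j))"
    using l' unfolding labelling_def by blast
  obtain K where K: "K \<in> PSL2R" "g' = K \<circ> g \<circ> inv K"
    using conjugate_trans[OF conjugate_sym[OF g(1)] g'(1)] unfolding conjugate_def by blast
  obtain M L c0 ci where "nf M L f c0 ci" using real_quadratic_nf[OF f] by blast
  moreover obtain K0 where "K0 \<in> PSL2R" "g = K0 \<circ> f \<circ> inv K0" using g(1) unfolding conjugate_def by blast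
  ultimately obtain M L c0 ci where nf: "nf M L g c0 ci" using nf.conj by blast
  have mk: "marked_points g' = K ` marked_points g" unfolding K(2) by (rule nf.marked_conj[OF nf K(1)])
  define y where "y = (\<lambda>i. the (K (Some (x i))))"
  have N: "None \<notin> marked_points g" "None \<notin> marked_points g'" unfolding g(4)[symmetric] g'(4)[symmetric] by auto
  have xm: "Some (x i) \<in> marked_points g" if "i \<le> n" for i unfolding g(4)[symmetric] using that by blast
  have Ky: "K (Some (x i)) = Some (y i)" if "i \<le> n" for i
  proof -
    have "K (Some (x i)) \<in> marked_points g'" unfolding mk using xm[OF that] by blast
    then show ?thesis using N unfolding y_def by (cases "K (Some (x i))") auto
  qed
  have ymono: "strict_mono_on {..n} y"
  proof (rule strict_mono_onI)
    fix r s assume rs: "r \<in> {..n}" "s \<in> {..n}" "r < s"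
    then have "Some (x r) < Some (x s)" using g(3) by (auto simp: strict_mono_on_def)
    then have "K (Some (x r)) < K (Some (x s))"
      using normalized_order_unique[OF nf K(1) g(2) g'(2)[unfolded K(2)] xm xm _ N(1) N(2)[unfolded K(2)]] rs by auto
    then show "y r < y s" using Ky rs by auto
  qed
  have "Some ` y ` {..n} = K ` Some ` x ` {..n}" using Ky by (auto simp: image_image)
  then have "Some ` y ` {..n} = Some ` x' ` {..n'}" unfolding g(4) g'(4) mk .
  then have "y ` {..n} = x' ` {..n'}" by (rule inj_image_eq_iff[THEN iffD1, OF inj_Some])
  then have n: "n = n'" and xy: "y i = x' i" if "i \<le> n" for i
    using strict_mono_on_nat_unique[OF ymono g'(3)] that by blast+
  have n: "n = n'" using n[of 0] by simp
  have Kx: "K (Some (x i)) = Some (x' i)" if "i \<le> n" for i using Ky[OF that] xy[OF that] by simp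
  have "m ! j = m' ! j" if "j \<le> n" for j
  proof -
    have j: "m ! j \<le> n" "m' ! j \<le> n" using g(6) g'(6) n that by auto
    have "Some (x' (m' ! j)) = g' (K (Some (x j)))" using g'(6) n that Kx by auto
    also have "\<dots> = K (Some (x (m ! j)))" unfolding K(2) using K(1) g(6) that by simp
    also have "\<dots> = Some (x' (m ! j))" using Kx j by simp
    finally show ?thesis using strict_mono_on_imp_inj_on[OF g'(3)] j n by (auto simp: inj_on_def)
  qed
  then have m: "m = m'" using g(5) g'(5) n by (intro nth_equalityI) auto
  have "cfg n x' = restrict (K \<circ> cfg n x) {..n}" unfolding cfg_def by (rule restrict_ext[symmetric, THEN sym]) (simp add: Kx)
  then have "orbit n (cfg n x) = orbit n (cfg n x')" using orbit_PSL2R[OF K(1)] by metis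
  then show ?thesis using m n by simp
qed

lemma combinatorics_eq: "real_quadratic f \<Longrightarrow> labelling f m n x \<Longrightarrow> combinatorics f = m"
  unfolding combinatorics_def by (rule the_equality) (use labelling_unique in blast)+

lemma class_point_eq:
  assumes f: "real_quadratic f" and l: "labelling f m n x" shows "class_point f = orbit n (cfg n x)"
  unfolding class_point_def
proof (rule the_equality)
  show "\<exists>m n' x'. labelling f m n' x' \<and> orbit n (cfg n x) = orbit n' (\<lambda>j\<in>{..n'}. Some (x' j))"
    using l unfolding cfg_def by blast
  fix \<xi> assume "\<exists>m n x. labelling f m n x \<and> \<xi> = orbit n (\<lambda>j\<in>{..n}. Some (x j))"
  then obtain m' n' x' where l': "labelling f m' n' x'" and \<xi>: "\<xi> = orbit n' (cfg n' x')" unfolding cfg_def by blast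
  show "\<xi> = orbit n (cfg n x)" unfolding \<xi> using labelling_unique[OF f l l'] by metis
qed

text \<open>
  Here \<open>\<omega>\<close> is the point that a normalizing conjugation sends to infinity. If both critical points
  lie outside the range and no suitable \<open>\<omega>\<close> exists, then the range lies in the increasing half-circle and
  the orbit of \<open>0\<close> is strictly increasing.
\<close>

lemma normalizing_point:
  assumes N: "N \<in> PSL2R" and fin: "finite (range (\<lambda>k. ((N \<circ> sq) ^^ k) (Some 0)))"
  shows "\<exists>q<0. let \<omega> = N (Some q); R = range (N \<circ> sq) in
    (Some 0 \<notin> R \<longrightarrow> (\<forall>r\<in>R. cyc \<omega> r (Some 0))) \<and> (None \<notin> R \<longrightarrow> (\<forall>r\<in>R. cyc \<omega> None r))"
proof -
  have R: "range (N \<circ> sq) = N ` lap True" by (auto simp: lap_def range_sq[symmetric])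
  have out: "\<exists>s>0. z = N (Some (- s))" if "z \<notin> N ` lap True" for z
  proof -
    have z: "z = N (inv N z)" using N by simp
    then have "inv N z \<notin> lap True" using that by blast
    then obtain t where "inv N z = Some t" "t < 0" by (cases "inv N z") auto
    then show ?thesis using z by (intro exI[of _ "- t"]) auto
  qed
  have c1: "cyc (Some q) r (Some s)" if "r \<in> lap True" "s < q" "q < 0" for q s r
    using that by (cases r) (auto simp: cyc_def)
  have c2: "cyc (Some q) (Some s) r" if "r \<in> lap True" "q < s" "s < 0" for q s r
    using that by (cases r) (auto simp: cyc_def)
  \<comment> \<open>Negative parameters describe the complement of the range. If the critical point
    0 has parameter \<open>s\<close>, then \<open>s < q\<close> is required, and if infinity has
    parameter \<open>s\<close>, then \<open>q < s\<close>.\<close>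
  have goal: "?thesis" if "q < 0" "Some 0 \<notin> N ` lap True \<Longrightarrow> \<exists>s<q. Some 0 = N (Some s)"
    "None \<notin> N ` lap True \<Longrightarrow> \<exists>s>q. s < 0 \<and> None = N (Some s)" for q
  proof -
    have "\<forall>r\<in>N ` lap True. cyc (N (Some q)) r (Some 0)" if h: "Some 0 \<notin> N ` lap True"
    proof -
      obtain s where "s < q" "Some 0 = N (Some s)" using \<open>Some 0 \<notin> N ` lap True \<Longrightarrow> \<exists>s<q. Some 0 = N (Some s)\<close>[OF h] by blast
      then show ?thesis using c1[OF _ _ \<open>q < 0\<close>] N by auto
    qed
    moreover have "\<forall>r\<in>N ` lap True. cyc (N (Some q)) None r" if h: "None \<notin> N ` lap True"
    proof -
      obtain s where s: "s > q" "s < 0" "None = N (Some s)" using \<open>None \<notin> N ` lap True \<Longrightarrow> \<exists>s>q. s < 0 \<and> None = N (Some s)\<close>[OF h] by blast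
      show ?thesis unfolding s(3) using c2[OF _ s(1,2)] N by auto
    qed
    ultimately show ?thesis unfolding R Let_def using \<open>q < 0\<close> by blast
  qed
  show ?thesis
  proof (cases "Some 0 \<in> N ` lap True")
    case z: True
    show ?thesis
    proof (cases "None \<in> N ` lap True")
      case True
      show ?thesis by (rule goal[of "-1"]) (use z True in auto)
    next
      case False
      then obtain s where "s > 0" "None = N (Some (- s))" using out by blast
      then show ?thesis by (intro goal[of "- s - 1"]) (use z in auto)
    qed
  next
    case False
    then obtain s where s: "s > 0" "Some 0 = N (Some (- s))" using out by blast
    show ?thesis
    proof (cases "None \<in> N ` lap True")
      case True
      show ?thesis
      proof (rule goal[of "- s / 2"])
        show "\<exists>t< - s / 2. Some 0 = N (Some t)" using s by (intro exI[of _ "- s"]) auto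
      qed (use s True in auto)
    next
      case n: False
      then obtain t where t: "t > 0" "None = N (Some (- t))" using out by blast
      have "s \<noteq> t" using s t by auto
      \<comment> \<open>A parameter \<open>q\<close> between \<open>- s\<close> and
        \<open>- t\<close> in this order exists only for \<open>t < s\<close>; in the other case the
        critical orbit of 0 is shown to be infinite.\<close>
      then consider "t < s" | "s < t" by linarith
      then show ?thesis
      proof cases
        case 1
        show ?thesis
        proof (rule goal[of "- (s + t) / 2"])
          show "\<exists>r< - (s + t) / 2. Some 0 = N (Some r)" using s 1 by (intro exI[of _ "- s"]) auto
          show "\<exists>r> - (s + t) / 2. r < 0 \<and> None = N (Some r)" using t 1 by (intro exI[of _ "- t"]) auto
        qed (use s t in auto)
      next
        case 2
        define u where "u = (\<lambda>k. ((N \<circ> sq) ^^ k) (Some 0))"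
        have u: "u 0 = Some 0" "u (Suc k) = N (sq (u k))" for k by (simp_all add: u_def)
        have pos: "Some 0 < N r" if "r \<in> lap True" for r
        proof -
          have "cyc (Some (- t)) (Some (- s)) r" using that s t 2 by (cases r) (auto simp: cyc_def)
          then have "cyc None (Some 0) (N r)" unfolding s(2) t(2) using N by simp
          then show ?thesis by (auto simp: cyc_def)
        qed
        have mono: "N (Some x) < N (Some y)" if "0 \<le> x" "x < y" for x y
        proof -
          have "cyc (Some (- t)) (Some x) (Some y)" using that t by (auto simp: cyc_def)
          then have "cyc None (N (Some x)) (N (Some y))" unfolding t(2) using N by simp
          then show ?thesis by (auto simp: cyc_def)
        qed
        have step: "Some 0 \<le> u k \<and> u k < u (Suc k)" for k
        proof (induction k)
          case 0
          show ?case using pos[of "Some 0"] u by simp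
        next
          case (Suc k)
          have p: "Some 0 < u (Suc k)" unfolding u(2) by (rule pos[OF sq_in_lap])
          obtain x y where xy: "u k = Some x" "u (Suc k) = Some y" using Suc p by (cases "u k"; cases "u (Suc k)") auto
          then have "0 \<le> x" "x < y" using Suc by auto
          then have "N (Some (x\<^sup>2)) < N (Some (y\<^sup>2))" by (intro mono) (auto intro: power_strict_mono)
          moreover have "u (Suc k) = N (Some (x\<^sup>2))" unfolding u(2)[of k] xy(1) by simp
          moreover have "u (Suc (Suc k)) = N (Some (y\<^sup>2))" unfolding u(2)[of "Suc k"] xy(2) by simp
          ultimately have "u (Suc k) < u (Suc (Suc k))" by simp
          then show ?case using p by auto
        qed
        have "strict_mono u" using step by (simp add: strict_mono_Suc_iff)
        then have "inj u" by (rule strict_mono_imp_inj_on)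
        then have "infinite (range u)" by (rule range_inj_infinite)
        then show ?thesis using fin unfolding u_def by simp
      qed
    qed
  qed
qed

lemma labelling_exists:
  assumes f: "real_quadratic f" and cf: "critically_finite f"
  shows "\<exists>m n x. labelling f m n x"
proof -
  obtain M L c0 ci where nf: "nf M L f c0 ci" using real_quadratic_nf[OF f] by blast
  interpret nf M L f c0 ci by (rule nf)
  interpret h: nf "L \<circ> M" "L \<circ> inv L" "L \<circ> f \<circ> inv L" "L c0" "L ci" by (rule conj[OF L])
  define N where "N = L \<circ> M"
  have N: "N \<in> PSL2R" unfolding N_def by (rule PSL2R_comp[OF L M])
  have h: "L \<circ> f \<circ> inv L = N \<circ> sq" using L by (simp add: g N_def fun_eq_iff)
  have finf: "finite (range (\<lambda>k. (f ^^ k) c0))" "finite (range (\<lambda>k. (f ^^ k) ci))"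
    using cf unfolding critically_finite_def crit by blast+
  then have finm: "finite (marked_points f)" unfolding marked by blast
  have "range (\<lambda>k. ((N \<circ> sq) ^^ k) (Some 0)) = L ` range (\<lambda>k. (f ^^ k) c0)"
    unfolding h[symmetric] c0[symmetric] conj_pow[OF L] by (simp add: image_image)
  then have "finite (range (\<lambda>k. ((N \<circ> sq) ^^ k) (Some 0)))" using finf(1) by simp
  from normalizing_point[OF N this] obtain q where q: "q < 0"
    "Some 0 \<notin> range (N \<circ> sq) \<longrightarrow> (\<forall>r\<in>range (N \<circ> sq). cyc (N (Some q)) r (Some 0))"
    "None \<notin> range (N \<circ> sq) \<longrightarrow> (\<forall>r\<in>range (N \<circ> sq). cyc (N (Some q)) None r)"
    unfolding Let_def by blast
  \<comment> \<open>Only the image of infinity matters; \<open>q + 1\<close> supplies some other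
    point.\<close>
  obtain K0 where K0: "K0 \<in> PSL2R" "K0 (Some 0) = N (Some (q + 1))" "K0 None = N (Some q)"
    by (rule PSL2R_0_inf[of "N (Some (q + 1))" "N (Some q)"]) (use N in simp)
  define K where "K = inv K0"
  have K: "K \<in> PSL2R" "K (N (Some q)) = None" using K0 by (simp_all add: K_def PSL2R_inv flip: K0(3))
  define g where "g = K \<circ> (N \<circ> sq) \<circ> inv K"
  have gc: "conjugate f g"
  proof (rule conjugate_trans)
    show "conjugate f (N \<circ> sq)" unfolding h[symmetric] conjugate_def using L by blast
    show "conjugate (N \<circ> sq) g" unfolding g_def conjugate_def using K by blast
  qed
  have nfh: "nf N id (N \<circ> sq) (Some 0) None" using N by (simp add: nf_def)
  have nfg: "nf (K \<circ> N) (id \<circ> inv K) g (K (Some 0)) (K None)"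
    unfolding g_def by (rule nf.conj[OF nfh K(1)])
  have Rg: "range g = K ` range (N \<circ> sq)" unfolding g_def by (rule range_conj[OF K(1)])
  have memR: "K z \<in> range g \<longleftrightarrow> z \<in> range (N \<circ> sq)" for z unfolding Rg using K(1) by (auto simp: image_iff)
  have q_out: "N (Some q) \<notin> range (N \<circ> sq)"
  proof
    assume "N (Some q) \<in> range (N \<circ> sq)"
    then obtain z where "N (Some q) = N (sq z)" by auto
    then have "Some q = sq z" using N by simp
    then show False using q(1) sq_in_lap[of z] by (metis lap_simps(2) not_less)
  qed
  have NR: "None \<notin> range g" using memR[of "N (Some q)"] q_out K(2) by simp
  have norm: "normalized g"
    unfolding nf.normalized_iff[OF nfg] memR
  proof (intro conjI impI allI)
    show "None \<notin> range g" by (rule NR)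
  next
    assume h: "Some 0 \<notin> range (N \<circ> sq)"
    show "K (Some 0) \<noteq> None"
      using q(2) h K by (metis PSL2R_eq_iff cyc_distinct rangeI)
    fix z
    have "g z \<in> K ` range (N \<circ> sq)" unfolding Rg[symmetric] by blast
    then obtain r where r: "r \<in> range (N \<circ> sq)" "g z = K r" by blast
    have "cyc (K (N (Some q))) (K r) (K (Some 0))" unfolding PSL2R_cyc[OF K(1)] using q(2) h r(1) by blast
    then show "g z < K (Some 0)" unfolding K(2) r(2) by (auto simp: cyc_def)
  next
    assume h: "None \<notin> range (N \<circ> sq)"
    show "K None \<noteq> None"
      using q(3) h K by (metis PSL2R_eq_iff cyc_distinct rangeI)
    fix z
    have "g z \<in> K ` range (N \<circ> sq)" unfolding Rg[symmetric] by blast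
    then obtain r where r: "r \<in> range (N \<circ> sq)" "g z = K r" by blast
    have "cyc (K (N (Some q))) (K None) (K r)" unfolding PSL2R_cyc[OF K(1)] using q(3) h r(1) by blast
    then show "K None < g z" unfolding K(2) r(2) by (auto simp: cyc_def)
  qed
  have fing: "finite (marked_points g)"
  proof -
    have "marked_points g = K ` L ` marked_points f"
      unfolding g_def nf.marked_conj[OF nfh K(1)] unfolding h[symmetric] marked_conj[OF L] ..
    then show ?thesis using finm by simp
  qed
  have Nm: "None \<notin> marked_points g"
  proof
    assume "None \<in> marked_points g"
    then have "None = K (Some 0) \<or> None = K None" using nf.marked_cases[OF nfg] NR by blast
    then show False using norm NR unfolding nf.normalized_iff[OF nfg] by metis
  qed
  define S where "S = {r. Some r \<in> marked_points g}"
  have SM: "Some ` S = marked_points g"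
  proof (intro equalityI subsetI)
    fix z assume "z \<in> marked_points g"
    then show "z \<in> Some ` S" using Nm by (cases z) (auto simp: S_def)
  qed (auto simp: S_def)
  have "finite S" using fing unfolding SM[symmetric] by (rule finite_imageD) simp
  moreover have "S \<noteq> {}" using nf.crit_marked(1)[OF nfg] SM by blast
  ultimately have "\<exists>(n::nat) x. strict_mono_on {..n} x \<and> x ` {..n} = S" by (rule finite_real_enum)
  then obtain n :: nat and x where x: "strict_mono_on {..n} x" "x ` {..n} = S" by (elim exE conjE)
  have ex: "\<exists>i\<le>n. g (Some (x j)) = Some (x i)" if "j \<le> n" for j
  proof -
    have "Some (x j) \<in> marked_points g" unfolding SM[symmetric] x(2)[symmetric] using that by blast
    then obtain k c where k: "Some (x j) = (g ^^ k) c" "critical_point g c" unfolding marked_points_def by blast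
    have "(g ^^ Suc k) c \<in> marked_points g" using k(2) unfolding marked_points_def by blast
    then have "g (Some (x j)) \<in> marked_points g" unfolding k(1) by simp
    then show ?thesis unfolding SM[symmetric] x(2)[symmetric] by auto
  qed
  define ix where "ix = (\<lambda>j. SOME i. i \<le> n \<and> g (Some (x j)) = Some (x i))"
  have ix: "ix j \<le> n \<and> g (Some (x j)) = Some (x (ix j))" if "j \<le> n" for j
    unfolding ix_def by (rule someI_ex) (use ex[OF that] in blast)
  have "labelling f (map ix [0..<Suc n]) n x"
    unfolding labelling_def
  proof (rule exI[of _ g], intro conjI)
    show "Some ` x ` {..n} = marked_points g" unfolding x(2) by (rule SM)
    show "\<forall>j\<le>n. map ix [0..<Suc n] ! j \<le> n \<and> g (Some (x j)) = Some (x (map ix [0..<Suc n] ! j))"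
      using ix by (simp del: upt_Suc)
  qed (use gc norm x in auto)
  then show ?thesis by blast
qed

lemma labelling_good:
  assumes f: "real_quadratic f" and l: "labelling f m n x"
  shows "\<exists>M L g j1 j2. conjugate f g \<and> nf M L g (cfg n x j1) (cfg n x j2) \<and> good_comb m n j1 j2 \<and>
    cfg n x \<in> config n \<and> pullback m (orbit n (cfg n x)) = orbit n (cfg n x) \<and>
    (\<forall>j\<le>n. g (cfg n x j) = cfg n x (m ! j))"
proof -
  obtain g where g: "conjugate f g" "normalized g" "strict_mono_on {..n} x" "Some ` x ` {..n} = marked_points g"
    "length m = n + 1" "\<forall>j\<le>n. m ! j \<le> n \<and> g (Some (x j)) = Some (x (m ! j))"
    using l unfolding labelling_def by blast
  obtain M L c0 ci where "nf M L f c0 ci" using real_quadratic_nf[OF f] by blast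
  moreover obtain K0 where "K0 \<in> PSL2R" "g = K0 \<circ> f \<circ> inv K0" using g(1) unfolding conjugate_def by blast
  ultimately obtain M L c0 ci where nf: "nf M L g c0 ci" using nf.conj by blast
  obtain j1 j2 where j: "good_comb m n j1 j2" "c0 = Some (x j1)" "ci = Some (x j2)" "cfg n x \<in> config n"
    "pullback m (orbit n (cfg n x)) = orbit n (cfg n x)"
    using nf.labelled[OF nf g(2-6)] unfolding cfg_def by blast
  have le: "j1 \<le> n" "j2 \<le> n" using j(1) comb_okD(4,5) unfolding good_comb_def by blast+
  have "nf M L g (cfg n x j1) (cfg n x j2)" using nf le by (simp add: cfg_def j)
  moreover have "\<forall>j\<le>n. g (cfg n x j) = cfg n x (m ! j)" using g(6) by (simp add: cfg_def)
  ultimately show ?thesis using g(1) j by blast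
qed

section \<open>The pull-back in coordinates\<close>

locale coords =
  fixes ml :: "nat list" and n j1 j2 a :: nat
  assumes good: "good_comb ml n j1 j2" and a: "a \<le> n" "a \<noteq> j1" "a \<noteq> j2"
begin

abbreviation m :: "nat \<Rightarrow> nat" where "m \<equiv> (!) ml"

lemma ok: "comb_ok ml n j1 j2"
  using good by (simp add: good_comb_def)

lemmas j12 = comb_okD(4-6)[OF ok] and m_le' = comb_okD(7)[OF ok] and m_lo = comb_okD(8)[OF ok] and m_hi = comb_okD(9)[OF ok]

lemma laps:
  assumes "i \<le> n" "k \<le> n" "cyc j2 i k"
  shows "k \<in> circle_arc j2 j1 \<Longrightarrow> m k < m i" "i \<in> circle_arc j1 j2 \<Longrightarrow> m i < m k"
  using good assms unfolding good_comb_def by blast+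

lemma m_ne: "m j1 \<noteq> m j2" "i \<le> n \<Longrightarrow> i \<noteq> j1 \<Longrightarrow> i \<noteq> j2 \<Longrightarrow> m i \<noteq> m j1 \<and> m i \<noteq> m j2"
  using m_lo[of j2] m_lo[of i] m_hi[of i] j12 by auto

definition \<sigma> :: "nat \<Rightarrow> real" where "\<sigma> i = (if i \<in> circle_arc j1 j2 then 1 else - 1)"

lemma \<sigma>: "\<sigma> i = 1 \<or> \<sigma> i = - 1" "\<sigma> i \<noteq> 0"
  by (auto simp: \<sigma>_def)

definition prec :: "nat \<Rightarrow> nat \<Rightarrow> bool" where "prec i k = cyc j2 i k"

definition Y :: "(nat \<Rightarrow> real) set" where
  "Y = {X. X j1 = 0 \<and> X j2 = 1 \<and> X a = \<sigma> a \<and> (\<forall>i\<le>n. \<forall>k\<le>n. prec i k \<longrightarrow> X i < X k)}"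

definition T :: "(nat \<Rightarrow> real) \<Rightarrow> nat \<Rightarrow> real" where
  "T X i = (if i = j1 then 0 else if i = j2 then 1 else \<sigma> i * sqrt (cross_ratio j2 X (m i) (m a) (m j1) (m j2)))"

definition opt :: "(nat \<Rightarrow> real) \<Rightarrow> nat \<Rightarrow> real option" where
  "opt X = (\<lambda>j\<in>{..n}. if j = j2 then None else Some (X j))"

lemma opt: "j \<le> n \<Longrightarrow> j \<noteq> j2 \<Longrightarrow> opt X j = Some (X j)" "opt X j2 = None"
  using j12 by (simp_all add: opt_def)

lemma Y_less: "X \<in> Y \<Longrightarrow> i \<le> n \<Longrightarrow> k \<le> n \<Longrightarrow> cyc j2 i k \<Longrightarrow> X i < X k"
  unfolding Y_def prec_def by blast

lemma opt_cyc:
  assumes X: "X \<in> Y" and le: "i \<le> n" "j \<le> n" "k \<le> n" and c: "cyc i j k"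
  shows "cyc (opt X i) (opt X j) (opt X k)"
proof -
  have inf: "cyc None (opt X i) (opt X j)" if "i \<le> n" "j \<le> n" "cyc j2 i j" for i j
    using Y_less[OF X that] cyc_distinct[OF that(3)] that by (auto simp: opt cyc_def)
  consider "i = j2" | "j = j2" | "k = j2" | "i \<noteq> j2" "j \<noteq> j2" "k \<noteq> j2" by blast
  then show ?thesis
  proof cases
    case 1 then show ?thesis using inf[of j k] le c by (simp add: opt)
  next
    case 2
    then have "cyc j2 k i" using c cyc_rotate by metis
    then show ?thesis using inf[of k i] le 2 cyc_rotate opt(2) by metis
  next
    case 3
    then have "cyc j2 i j" using c cyc_rotate by metis
    then show ?thesis using inf[of i j] le 3 cyc_rotate opt(2) by metis
  next
    case 4
    \<comment> \<open>Cutting the circle at \<open>j2\<close> turns a cyclic triple into an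
      increasing one, up to rotation.\<close>
    have "cyc j2 i j \<and> cyc j2 j k \<or> cyc j2 j k \<and> cyc j2 k i \<or> cyc j2 k i \<and> cyc j2 i j"
      using c 4 unfolding cyc_def by linarith
    then have "X i < X j \<and> X j < X k \<or> X j < X k \<and> X k < X i \<or> X k < X i \<and> X i < X j"
      using Y_less[OF X] le by blast
    then show ?thesis using 4 le by (auto simp: opt cyc_def)
  qed
qed

lemma opt_config:
  assumes "X \<in> Y" shows "opt X \<in> config n"
proof (rule configI)
  show c: "cyc (opt X i) (opt X j) (opt X k)" if "i < j" "j < k" "k \<le> n" for i j k
    using opt_cyc[OF assms, of i j k] that by (simp add: cyc_def)
  show "inj_on (opt X) {..n}"
  proof (rule inj_onI, rule ccontr)
    fix i k assume ik: "i \<in> {..n}" "k \<in> {..n}" "opt X i = opt X k" "i \<noteq> k"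
    obtain l where l: "l \<in> {j1, j2, a}" "l \<noteq> i" "l \<noteq> k" using a j12 by (metis insertCI)
    then have "cyc i k l \<or> cyc l k i" using cyc_total[of i k l] ik by auto
    moreover have "l \<le> n" using l a j12 by auto
    ultimately show False using opt_cyc[OF assms, of i k l] opt_cyc[OF assms, of l k i] ik cyc_distinct by (metis atMost_iff)
  qed
qed (simp add: opt_def)

lemma Y_sign:
  assumes X: "X \<in> Y" and i: "i \<le> n" "i \<noteq> j1" "i \<noteq> j2" shows "\<sigma> i * X i > 0"
proof -
  have "X j1 = 0" using X by (simp add: Y_def)
  moreover have "cyc j2 j1 i \<or> cyc i j1 j2" using cyc_total[of j2 j1 i] i j12 by auto
  then have "cyc j2 j1 i \<and> i \<in> circle_arc j1 j2 \<or> cyc j2 i j1 \<and> i \<notin> circle_arc j1 j2"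
    using i cyc_rotate[of j2 j1 i] cyc_rotate[of j2 i j1] cyc_antisym[of j1 i j2] by (auto simp: circle_arc_def)
  ultimately show ?thesis using Y_less[OF X j12(1) i(1)] Y_less[OF X i(1) j12(1)] by (auto simp: \<sigma>_def)
qed

text \<open>Moving \<open>j1\<close> and \<open>j2\<close> to 0 and infinity leaves a scaling, which
  takes \<open>a\<close> to 1 or -1 according to its lap.\<close>

lemma config_coord:
  assumes x: "x \<in> config n" shows "\<exists>X\<in>Y. orbit n (opt X) = orbit n x"
proof -
  have "x j1 \<noteq> x j2" using config_inj[OF x] j12 by blast
  then obtain K where K: "K \<in> PSL2R" "K (Some 0) = x j1" "K None = x j2" by (rule PSL2R_0_inf)
  define y where "y = restrict (inv K \<circ> x) {..n}"
  have iK: "inv K \<in> PSL2R" by (rule PSL2R_inv[OF K(1)])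
  have y: "y \<in> config n" "orbit n y = orbit n x"
    unfolding y_def by (rule config_PSL2R[OF x iK], rule orbit_PSL2R[OF iK])
  have y12: "y j1 = Some 0" "y j2 = None" using K j12 by (simp_all add: y_def flip: K(2,3))
  have "y a \<noteq> y j2" using config_inj[OF y(1)] a j12 by blast
  then obtain t where t: "y a = Some t" using y12 by auto
  have "cyc j1 a j2 \<or> cyc j2 a j1" using cyc_total[of j1 a j2] a j12 by auto
  then have t0: "\<sigma> a * t > 0"
    using config_cyc[OF y(1) j12(1) a(1) j12(2)] config_cyc[OF y(1) j12(2) a(1) j12(1)] a cyc_antisym[of j1 a j2]
    unfolding y12 t by (auto simp: \<sigma>_def circle_arc_def cyc_def)
  define s where "s = 1 / (\<sigma> a * t)"
  have s: "s > 0" "s * t = \<sigma> a" using t0 \<sigma>(1)[of a] by (auto simp: s_def)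
  define X where "X = (\<lambda>j. if j = j2 then 1 else s * the (y j))"
  have X: "opt X = restrict (scale s \<circ> y) {..n}"
    unfolding opt_def
  proof (rule restrict_ext)
    fix j assume j: "j \<in> {..n}"
    show "(if j = j2 then None else Some (X j)) = (scale s \<circ> y) j"
    proof (cases "j = j2")
      case False
      then have "y j \<noteq> None" using config_inj[OF y(1), of j j2] j j12 y12 by auto
      then show ?thesis using False by (auto simp: X_def)
    qed (simp add: y12)
  qed
  have S: "scale s \<in> PSL2R" by (rule scale_PSL2R[OF s(1)])
  have cX: "opt X \<in> config n" unfolding X by (rule config_PSL2R[OF y(1) S])
  have "X \<in> Y"
    unfolding Y_def prec_def
  proof (intro CollectI conjI allI impI)
    show "X j1 = 0" "X j2 = 1" "X a = \<sigma> a" using y12 t s j12 a by (simp_all add: X_def)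
    fix i k assume ik: "i \<le> n" "k \<le> n" "cyc j2 i k"
    then have "cyc (opt X j2) (opt X i) (opt X k)" using config_cyc[OF cX j12(2)] by blast
    then show "X i < X k" using cyc_distinct[OF ik(3)] ik by (auto simp: opt cyc_def)
  qed
  moreover have "orbit n (opt X) = orbit n x" unfolding X orbit_PSL2R[OF S] by (rule y(2))
  ultimately show ?thesis by blast
qed

lemma opt_orbit_inj:
  assumes X: "X \<in> Y" "X' \<in> Y" and eq: "orbit n (opt X) = orbit n (opt X')" and i: "i \<le> n"
  shows "X i = X' i"
proof -
  obtain K where K: "K \<in> PSL2R" and KX: "\<And>i. i \<le> n \<Longrightarrow> opt X i = K (opt X' i)"
    using orbit_eqD[OF eq opt_config[OF X(1)]] by metis
  have v: "X j1 = 0" "X' j1 = 0" "X j2 = 1" "X' j2 = 1" "X a = \<sigma> a" "X' a = \<sigma> a" using X by (auto simp: Y_def)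
  have "K (Some 0) = Some 0" "K None = None" using KX[OF j12(1)] KX[OF j12(2)] v j12 by (simp_all add: opt)
  then obtain t where t: "t > 0" "K = scale t" by (rule PSL2R_fix_0_inf[OF K])
  have "\<sigma> a = t * \<sigma> a" using KX[OF a(1)] a v t by (simp add: opt)
  then have "t = 1" using \<sigma>(2)[of a] by simp
  then show ?thesis using KX[OF i] i t v by (cases "i = j2") (simp_all add: opt)
qed

definition cr :: "(nat \<Rightarrow> real) \<Rightarrow> nat \<Rightarrow> real" where
  "cr X l = cross_ratio j2 X l (m a) (m j1) (m j2)"

lemma opt_pt: "X \<in> Y \<Longrightarrow> l \<le> n \<Longrightarrow> opt X l = pt (X l) (of_bool (l \<noteq> j2))"
  by (cases "l = j2") (simp_all add: opt Y_def)

lemma bracket_nonzero: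
  assumes "X \<in> Y" "l \<le> n" "k \<le> n" "l \<noteq> k" shows "bracket j2 X l k \<noteq> 0"
proof -
  have nz: "X l \<noteq> 0 \<or> (of_bool (l \<noteq> j2) :: real) \<noteq> 0" for l using assms(1) by (cases "l = j2") (auto simp: Y_def)
  show ?thesis
    using config_inj[OF opt_config[OF assms(1)] assms(2,3)] assms(4) pt_eq_iff[OF nz nz, of l k]
    unfolding opt_pt[OF assms(1,2)] opt_pt[OF assms(1,3)] by (simp add: bracket_def)
qed

text \<open>The cross ratio is the Moebius coordinate with \<open>m j1\<close>, \<open>m a\<close>,
  \<open>m j2\<close> at 0, 1, infinity. It preserves the orientation because these three indices
  are in increasing order.\<close>

lemma normalizer:
  assumes X: "X \<in> Y"
  shows "\<exists>G\<in>PSL2R. (\<forall>l\<le>n. l \<noteq> m j2 \<longrightarrow> G (opt X l) = Some (cr X l)) \<and> G (opt X (m j2)) = None"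
    and "cr X (m j1) = 0" "cr X (m a) = 1"
proof -
  have le: "m j1 \<le> n" "m j2 \<le> n" "m a \<le> n" using m_le' j12 a by blast+
  let ?b = "bracket j2 X"
  have nz: "X l \<noteq> 0 \<or> (of_bool (l \<noteq> j2) :: real) \<noteq> 0" for l using X by (cases "l = j2") (auto simp: Y_def)
  have bne: "?b l k \<noteq> 0" if "l \<le> n" "k \<le> n" "l \<noteq> k" for l k
    by (rule bracket_nonzero[OF X that])
  have anti: "?b l k = - ?b k l" for l k by (simp add: bracket_def)
  have "m j1 < m a" "m a < m j2" using m_lo[of a] m_hi[of a] a by auto
  then have "cyc (opt X (m j1)) (opt X (m a)) (opt X (m j2))"
    using le by (intro opt_cyc[OF X]) (auto simp: cyc_def)
  then have "?b (m j1) (m a) * ?b (m a) (m j2) * ?b (m j2) (m j1) > 0"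
    unfolding opt_pt[OF X le(1)] opt_pt[OF X le(2)] opt_pt[OF X le(3)] cyc_pt[OF nz nz nz] by (simp add: bracket_def)
  then have det: "?b (m a) (m j2) * ?b (m a) (m j1) * ?b (m j1) (m j2) > 0"
    using anti[of "m j1" "m a"] anti[of "m j2" "m j1"] by (simp add: algebra_simps)
  define e where "e = (\<lambda>l. of_bool (l \<noteq> j2) :: real)"
  have e: "e l = of_bool (l \<noteq> j2)" for l by (simp add: e_def)
  have b: "?b l k = X l * e k - X k * e l" for l k by (simp add: bracket_def e)
  define G where "G = mob (e (m j1) * ?b (m a) (m j2)) (- X (m j1) * ?b (m a) (m j2))
    (e (m j2) * ?b (m a) (m j1)) (- X (m j2) * ?b (m a) (m j1))"
  have D: "(e (m j1) * ?b (m a) (m j2)) * (- X (m j2) * ?b (m a) (m j1)) - (- X (m j1) * ?b (m a) (m j2)) * (e (m j2) * ?b (m a) (m j1)) > 0"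
    using det unfolding b[of "m j1" "m j2"] by (simp add: algebra_simps)
  have G: "G \<in> PSL2R" unfolding PSL2R_mob G_def using D by blast
  have Gl: "G (opt X l) = pt (?b l (m j1) * ?b (m a) (m j2)) (?b l (m j2) * ?b (m a) (m j1))" if "l \<le> n" for l
  proof -
    have "G (opt X l) = pt (e (m j1) * ?b (m a) (m j2) * X l + - X (m j1) * ?b (m a) (m j2) * e l)
      (e (m j2) * ?b (m a) (m j1) * X l + - X (m j2) * ?b (m a) (m j1) * e l)"
      using mob_pt[OF less_imp_neq[OF D, symmetric], of "X l" "e l"] nz[of l] unfolding G_def opt_pt[OF X that] e by blast
    also have "\<dots> = pt (?b l (m j1) * ?b (m a) (m j2)) (?b l (m j2) * ?b (m a) (m j1))"
      by (rule arg_cong2[of _ _ _ _ pt]) (simp_all add: b algebra_simps)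
    finally show ?thesis .
  qed
  show "\<exists>G\<in>PSL2R. (\<forall>l\<le>n. l \<noteq> m j2 \<longrightarrow> G (opt X l) = Some (cr X l)) \<and> G (opt X (m j2)) = None"
  proof (intro bexI[OF _ G] conjI allI impI)
    fix l assume "l \<le> n" "l \<noteq> m j2"
    then show "G (opt X l) = Some (cr X l)"
      using Gl bne[OF _ le(2)] bne[OF le(3,1)] m_ne(2)[OF a] by (simp add: pt_def cr_def cross_ratio_def)
  next
    show "G (opt X (m j2)) = None" unfolding Gl[OF le(2)] by (simp add: bracket_def)
  qed
  show "cr X (m j1) = 0" by (simp add: cr_def cross_ratio_def bracket_def)
  show "cr X (m a) = 1" using bne[OF le(3,2)] bne[OF le(3,1)] m_ne(2)[OF a] by (simp add: cr_def cross_ratio_def)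
qed

lemma cr_less:
  assumes X: "X \<in> Y" and l: "l < l'" "l' < m j2"
  shows "cr X l < cr X l'"
proof -
  have le: "m j2 \<le> n" using m_le' j12 by blast
  obtain G where G: "G \<in> PSL2R" "\<forall>l\<le>n. l \<noteq> m j2 \<longrightarrow> G (opt X l) = Some (cr X l)" "G (opt X (m j2)) = None"
    using normalizer(1)[OF X] by blast
  have "cyc (m j2) l l'" using l by (simp add: cyc_def)
  then have "cyc (opt X (m j2)) (opt X l) (opt X l')" using l le by (intro opt_cyc[OF X]) auto
  then have "cyc (G (opt X (m j2))) (G (opt X l)) (G (opt X l'))" using G(1) by simp
  then show ?thesis using G(2,3) l le by (auto simp: cyc_def)
qed

lemma cr_m_pos:
  assumes X: "X \<in> Y" and i: "i \<le> n" "i \<noteq> j1" "i \<noteq> j2" shows "cr X (m i) > 0"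
  using cr_less[OF X, of "m j1" "m i"] m_lo[of i] m_hi[of i] i normalizer(3)[OF X] normalizer(2)[OF X] by simp

lemma T_cr: "X \<in> Y \<Longrightarrow> i \<noteq> j2 \<Longrightarrow> T X i = \<sigma> i * sqrt (cr X (m i))"
  using normalizer(2) by (simp add: T_def cr_def)

text \<open>On each lap \<open>m\<close> is monotone by \<open>laps\<close> and the cross ratio is
  monotone in the index by \<open>cr_less\<close>; the signs separate the laps.\<close>

lemma T_Y:
  assumes X: "X \<in> Y" shows "T X \<in> Y"
  unfolding Y_def prec_def
proof (intro CollectI conjI allI impI)
  show "T X j1 = 0" "T X j2 = 1" using j12 by (simp_all add: T_def)
  show "T X a = \<sigma> a" using T_cr[OF X a(3)] normalizer(3)[OF X] by simp
  fix i k assume ik: "i \<le> n" "k \<le> n" "cyc j2 i k"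
  have ne: "i \<noteq> j2" "k \<noteq> j2" "i \<noteq> k" using cyc_distinct[OF ik(3)] by auto
  have cr0: "cr X (m l) \<ge> 0" if "l \<le> n" "l \<noteq> j2" for l
    using cr_m_pos[OF X that(1) _ that(2)] normalizer(2)[OF X] by (cases "l = j1") (auto intro: less_imp_le)
  have mh: "m i < m j2" "m k < m j2" using m_hi ik ne by auto
  show "T X i < T X k"
  proof (cases "i \<in> circle_arc j1 j2")
    case True
    then have k: "k \<in> circle_arc j1 j2" using ik(3) ne j12 unfolding circle_arc_def cyc_def by auto
    have "cr X (m i) < cr X (m k)" using laps(2)[OF ik True] mh by (intro cr_less[OF X])
    then show ?thesis using T_cr[OF X] ne True k by (simp add: \<sigma>_def)
  next
    case i: False
    then have i1: "i \<noteq> j1" by (auto simp: circle_arc_def)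
    have Ti: "T X i = - sqrt (cr X (m i))" using T_cr[OF X] ne i by (simp add: \<sigma>_def)
    have pos: "cr X (m i) > 0" using cr_m_pos[OF X ik(1) i1 ne(1)] .
    show ?thesis
    proof (cases "k \<in> circle_arc j1 j2")
      case True
      then have "T X k = sqrt (cr X (m k))" using T_cr[OF X] ne by (simp add: \<sigma>_def)
      moreover have "sqrt (cr X (m k)) \<ge> 0" using cr0 ik ne by simp
      moreover have "sqrt (cr X (m i)) > 0" using pos by simp
      ultimately show ?thesis using Ti by linarith
    next
      case k: False
      then have "k \<noteq> j1" by (auto simp: circle_arc_def)
      then have "k \<in> circle_arc j2 j1" using k ne j12 cyc_total[of j1 k j2] by (auto simp: circle_arc_def)
      then have "cr X (m k) < cr X (m i)" using laps(1)[OF ik] mh by (intro cr_less[OF X])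
      then show ?thesis using T_cr[OF X] ne k Ti by (simp add: \<sigma>_def)
    qed
  qed
qed

lemma pullback_opt:
  assumes X: "X \<in> Y" shows "pullback ml (orbit n (opt X)) = orbit n (opt (T X))"
proof -
  obtain G where G: "G \<in> PSL2R" "\<forall>l\<le>n. l \<noteq> m j2 \<longrightarrow> G (opt X l) = Some (cr X l)" "G (opt X (m j2)) = None"
    using normalizer(1)[OF X] by blast
  have G1: "G (opt X (m j1)) = Some 0" using G(2) m_le' j12 m_ne(1) normalizer(2)[OF X] by simp
  have "(\<lambda>j\<in>{..n}. branch (j \<in> circle_arc j1 j2) (G (opt X (m j)))) = opt (T X)"
    unfolding opt_def[of "T X"]
  proof (rule restrict_ext)
    fix j assume j: "j \<in> {..n}"
    show "branch (j \<in> circle_arc j1 j2) (G (opt X (m j))) = (if j = j2 then None else Some (T X j))"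
    proof (cases "j = j2")
      case False
      then have "m j \<noteq> m j2" "m j \<le> n" using j m_hi[of j] m_le'[of j] by auto
      then have "G (opt X (m j)) = Some (cr X (m j))" using G(2) by blast
      then show ?thesis using False T_cr[OF X False] by (simp add: branch_def \<sigma>_def)
    qed (simp add: G(3) branch_def)
  qed
  then show ?thesis using pullback_eq[OF ok opt_config[OF X] G(1) G1 G(3)] by simp
qed

sublocale lift_data n j1 j2 a m \<sigma> prec Y T
proof
  show "prec i k \<or> prec k i" if "i \<le> n" "k \<le> n" "i \<noteq> j2" "k \<noteq> j2" "i \<noteq> k" for i k
    using cyc_total[of j2 i k] that cyc_rotate[of j2 k i] cyc_rotate[of k i j2] unfolding prec_def by auto
  show "i \<noteq> j2 \<and> k \<noteq> j2" if "prec i k" for i k using cyc_distinct that unfolding prec_def by blast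
  show "cross_ratio j2 X (m i) (m a) (m j1) (m j2) > 0" if "X \<in> Y" "i \<le> n" "i \<noteq> j1" "i \<noteq> j2" for X i
    using cr_m_pos[OF that] by (simp add: cr_def)
qed (fact j12 a m_le' m_ne \<sigma>(1) Y_def T_def T_Y)+

lemma moduli_coord: "\<xi> \<in> moduli n \<Longrightarrow> \<exists>X\<in>Y. \<xi> = orbit n (opt X)"
  using config_coord unfolding moduli_def by (metis imageE)

lemma opt_moduli: "X \<in> Y \<Longrightarrow> orbit n (opt X) \<in> moduli n"
  using opt_config unfolding moduli_def by blast

lemma fixed_point_coord:
  assumes X: "X \<in> Y" and fixed: "pullback ml (orbit n (opt X)) = orbit n (opt X)" and i: "i \<le> n"
  shows "T X i = X i"
  using opt_orbit_inj[OF T_Y[OF X] X _ i] pullback_opt[OF X] fixed by simp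

lemma pullback_pow: "X \<in> Y \<Longrightarrow> (pullback ml ^^ k) (orbit n (opt X)) = orbit n (opt ((T ^^ k) X))"
  by (induction k) (simp_all add: pullback_opt T_pow_Y)

text \<open>The coordinates converge on the circle, hence the configurations converge in the
  product, and the map to the moduli space is continuous by definition of the quotient
  topology.\<close>

lemma opt_limit:
  assumes Xk: "\<And>k. X k \<in> Y" and p: "p \<in> Y" and lim: "\<And>i. i \<le> n \<Longrightarrow> (\<lambda>k. X k i) \<longlonglongrightarrow> p i"
  shows "limitin (moduli_topology n) (\<lambda>k. orbit n (opt (X k))) (orbit n (opt p)) sequentially"
proof -
  have top: "topspace circle_topology = UNIV" by (simp add: circle_topology_def UNIV_option_conv)
  have "limitin circle_topology (\<lambda>k. opt (X k) i) (opt p i) sequentially" if i: "i \<le> n" for i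
  proof (cases "i = j2")
    case True
    then show ?thesis by (simp add: opt top)
  next
    case False
    have "limitin circle_topology (Some \<circ> (\<lambda>k. X k i)) (Some (p i)) sequentially"
      unfolding circle_topology_def using lim[OF i] by (intro continuous_map_limit[OF continuous_map_Some]) simp
    then show ?thesis using False i by (simp add: opt o_def)
  qed
  then have "limitin (product_topology (\<lambda>_. circle_topology) {..n}) (\<lambda>k. opt (X k)) (opt p) sequentially"
    unfolding limitin_componentwise using top by (auto simp: opt_def)
  then have conf: "limitin (config_topology n) (\<lambda>k. opt (X k)) (opt p) sequentially"
    unfolding config_topology_def limitin_subtopology using opt_config Xk p by simp
  show ?thesis
    unfolding limitin_def
  proof (intro conjI allI impI)
    show "orbit n (opt p) \<in> topspace (moduli_topology n)"
      unfolding topspace_moduli_topology by (rule opt_moduli[OF p])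
    fix U assume U: "openin (moduli_topology n) U \<and> orbit n (opt p) \<in> U"
    then have "openin (config_topology n) {x \<in> config n. orbit n x \<in> U}" unfolding openin_moduli_topology by blast
    moreover have "opt p \<in> {x \<in> config n. orbit n x \<in> U}" using U opt_config[OF p] by blast
    ultimately have "\<forall>\<^sub>F k in sequentially. opt (X k) \<in> {x \<in> config n. orbit n x \<in> U}"
      using conf unfolding limitin_def by blast
    then show "\<forall>\<^sub>F k in sequentially. orbit n (opt (X k)) \<in> U" by (rule eventually_mono) simp
  qed
qed

end

section \<open>The exceptional combinatorics\<close>

context coords
begin

lemma fixed_sqrt: "X \<in> Y \<Longrightarrow> T X i = X i \<Longrightarrow> i \<noteq> j2 \<Longrightarrow> X i = \<sigma> i * sqrt (cr X (m i))"
  using T_cr by metis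

text \<open>Multiplying the fixed point equations of \<open>i\<close> and \<open>k\<close> crosswise
  eliminates the factor that depends on \<open>a\<close>.\<close>

lemma fixed_ratio:
  assumes X: "X \<in> Y" and fx: "T X i = X i" "T X k = X k"
    and i: "i \<le> n" "i \<noteq> j1" "i \<noteq> j2" and k: "k \<le> n" "k \<noteq> j1" "k \<noteq> j2"
  shows "(X k)\<^sup>2 * bracket j2 X (m k) (m j2) * bracket j2 X (m i) (m j1) =
    (X i)\<^sup>2 * bracket j2 X (m i) (m j2) * bracket j2 X (m k) (m j1)"
proof -
  let ?b = "bracket j2 X"
  define C D where "C = ?b (m a) (m j2)" and "D = ?b (m a) (m j1)"
  have le: "m j1 \<le> n" "m j2 \<le> n" "m a \<le> n" using m_le' j12 a by blast+
  have D: "D \<noteq> 0" unfolding D_def using bracket_nonzero[OF X le(3,1)] m_ne(2)[OF a] by blast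
  have sq: "(X j)\<^sup>2 * (?b (m j) (m j2) * D) = ?b (m j) (m j1) * C" if j: "j \<le> n" "j \<noteq> j1" "j \<noteq> j2" "T X j = X j" for j
  proof -
    have "(X j)\<^sup>2 = cr X (m j)"
      using fixed_sqrt[OF X j(4,3)] cr_m_pos[OF X j(1-3)] \<sigma>(1)[of j]
      by (metis less_imp_le mult_1 power_mult_distrib power2_minus power_one real_sqrt_pow2)
    then have "(X j)\<^sup>2 = ?b (m j) (m j1) * C / (?b (m j) (m j2) * D)" by (simp add: cr_def cross_ratio_def C_def D_def)
    moreover have "?b (m j) (m j2) \<noteq> 0" using bracket_nonzero[OF X m_le'[OF j(1)] le(2)] m_ne(2)[OF j(1-3)] by blast
    ultimately show ?thesis using D by simp
  qed
  have C: "C \<noteq> 0" unfolding C_def using bracket_nonzero[OF X le(3,2)] m_ne(2)[OF a] by blast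
  have "((X k)\<^sup>2 * ?b (m k) (m j2) * ?b (m i) (m j1)) * (C * D) = ((X k)\<^sup>2 * (?b (m k) (m j2) * D)) * (?b (m i) (m j1) * C)" by simp
  also have "\<dots> = ((X i)\<^sup>2 * ?b (m i) (m j2) * ?b (m k) (m j1)) * (C * D)"
    unfolding sq[OF k fx(2)] sq[OF i fx(1), symmetric] by simp
  finally show ?thesis using C D by simp
qed

lemma silver_ratio:
  fixes A B :: real
  assumes "0 < A" "A < B" "B\<^sup>2 * (B - A)\<^sup>2 = A\<^sup>2 * (A + B)\<^sup>2" shows "B = (1 + sqrt 2) * A"
proof -
  have "(B * (B - A))\<^sup>2 = (A * (A + B))\<^sup>2" using assms(3) by (simp add: power_mult_distrib)
  then have "B * (B - A) = A * (A + B)" by (rule power2_eq_imp_eq) (use assms in auto)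
  then have "(B - A)\<^sup>2 = (sqrt 2 * A)\<^sup>2" by (simp add: power2_eq_square algebra_simps)
  then have "B - A = sqrt 2 * A" by (rule power2_eq_imp_eq) (use assms in auto)
  then show ?thesis by (simp add: algebra_simps)
qed

text \<open>
  Attraction is not available for the two exceptional lists. There the coordinates of a fixed point
  are \<open>\<plusminus> A\<close> and \<open>\<plusminus> B\<close> with \<open>B / A = 1 + sqrt 2\<close>.
\<close>

lemma exceptional_unique:
  assumes ml: "ml = [1, 3, 4, 3, 1, 0] \<or> ml = [5, 4, 2, 1, 2, 4]"
    and X: "X \<in> Y" "\<And>i. i \<le> n \<Longrightarrow> T X i = X i" and X': "X' \<in> Y" "\<And>i. i \<le> n \<Longrightarrow> T X' i = X' i" and i: "i \<le> n"
  shows "X i = X' i"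
proof -
  have n: "n = 5" using ml comb_okD(1)[OF ok] by auto
  have m5: "m 0 = 1 \<and> m 1 = 3 \<and> m 2 = 4 \<and> m 3 = 3 \<and> m 4 = 1 \<and> m 5 = 0 \<or>
      m 0 = 5 \<and> m 1 = 4 \<and> m 2 = 2 \<and> m 3 = 1 \<and> m 4 = 2 \<and> m 5 = 4" using ml by auto
  \<comment> \<open>One pattern for both lists: \<open>r1\<close>, \<open>r2\<close> lie on the
    increasing and \<open>r3\<close>, \<open>r4\<close> on the decreasing lap; \<open>r1\<close> and
    \<open>r4\<close> have the same image, and so have \<open>r2\<close> and \<open>r3\<close>. The
    copies \<open>d1\<close>, \<open>d2\<close> of \<open>j1\<close>, \<open>j2\<close> are
    instantiated with numerals.\<close>
  have "\<exists>r1 r2 r3 r4 d1 d2. d1 \<le> 5 \<and> d2 \<le> 5 \<and> j1 = d1 \<and> j2 = d2 \<and> {r1, r2, r3, r4} = {..5} - {d1, d2} \<and> distinct [r1, r2, r3, r4] \<and>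
      m r1 = m r4 \<and> m r2 = m r3 \<and> m r1 = (if d1 = 5 then r2 else r4) \<and> m r2 = (if d1 = 5 then r3 else r1) \<and>
      m j1 = (if d1 = 5 then r1 else r3) \<and> m j2 = (if d1 = 5 then r4 else r2) \<and>
      \<sigma> r1 = 1 \<and> \<sigma> r2 = 1 \<and> \<sigma> r3 = -1 \<and> \<sigma> r4 = -1 \<and> cyc j2 r1 r2"
    using m5
  proof
    assume m: "m 0 = 1 \<and> m 1 = 3 \<and> m 2 = 4 \<and> m 3 = 3 \<and> m 4 = 1 \<and> m 5 = 0"
    have j1: "j1 = 5" using m_lo[of 5] m n by (cases "j1 = 5") auto
    have "j2 = 0 \<or> j2 = 1 \<or> j2 = 2 \<or> j2 = 3 \<or> j2 = 4 \<or> j2 = 5" using j12(2) n by linarith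
    then have j2: "j2 = 2" using m_hi[of 2] m n by (elim disjE) auto
    show ?thesis unfolding \<sigma>_def
      by (rule exI[of _ 0], rule exI[of _ 1], rule exI[of _ 3], rule exI[of _ 4], rule exI[of _ 5], rule exI[of _ 2])
        (use m in \<open>auto simp: j1 j2 circle_arc_def cyc_def\<close>)
  next
    assume m: "m 0 = 5 \<and> m 1 = 4 \<and> m 2 = 2 \<and> m 3 = 1 \<and> m 4 = 2 \<and> m 5 = 4"
    have "j1 = 0 \<or> j1 = 1 \<or> j1 = 2 \<or> j1 = 3 \<or> j1 = 4 \<or> j1 = 5" using j12(1) n by linarith
    then have j1: "j1 = 3" using m_lo[of 3] m n by (elim disjE) auto
    have j2: "j2 = 0" using m_hi[of 0] m_le'[of j2] j12 m n by (cases "j2 = 0") auto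
    show ?thesis unfolding \<sigma>_def
      by (rule exI[of _ 4], rule exI[of _ 5], rule exI[of _ 1], rule exI[of _ 2], rule exI[of _ 3], rule exI[of _ 0])
        (use m in \<open>auto simp: j1 j2 circle_arc_def cyc_def\<close>)
  qed
  then obtain r1 r2 r3 r4 where r: "{r1, r2, r3, r4} = {..5} - {j1, j2}" "distinct [r1, r2, r3, r4]"
    "m r1 = m r4" "m r2 = m r3" "m r1 = (if j1 = 5 then r2 else r4)" "m r2 = (if j1 = 5 then r3 else r1)"
    "m j1 = (if j1 = 5 then r1 else r3)" "m j2 = (if j1 = 5 then r4 else r2)"
    "\<sigma> r1 = 1" "\<sigma> r2 = 1" "\<sigma> r3 = -1" "\<sigma> r4 = -1" "cyc j2 r1 r2"
    by (elim exE conjE) blast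
  have rr: "q \<le> n \<and> q \<noteq> j1 \<and> q \<noteq> j2" if "q \<in> {r1, r2, r3, r4}" for q using that r(1) n by auto
  have sol: "X r3 = - X r2 \<and> X r4 = - X r1 \<and> X r2 = (1 + sqrt 2) * X r1"
    if X: "X \<in> Y" "\<And>i. i \<le> n \<Longrightarrow> T X i = X i" for X
  proof -
    have s: "X q = \<sigma> q * sqrt (cr X (m q))" if "q \<in> {r1, r2, r3, r4}" for q
      using fixed_sqrt[OF X(1)] X(2) rr[OF that] by blast
    have 1: "X r3 = - X r2" "X r4 = - X r1" using s[of r1] s[of r2] s[of r3] s[of r4] r(3,4,9-12) by simp_all
    have pos: "X r1 > 0" using Y_sign[OF X(1), of r1] rr[of r1] r(9) by auto
    have lt: "X r1 < X r2" using Y_less[OF X(1) _ _ r(13)] rr by blast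
    have b: "bracket j2 X p q = X p - X q" if "p \<in> {r1, r2, r3, r4}" "q \<in> {r1, r2, r3, r4}" for p q
      using rr[OF that(1)] rr[OF that(2)] by (simp add: bracket_def)
    have "(X r2)\<^sup>2 * bracket j2 X (m r2) (m j2) * bracket j2 X (m r1) (m j1) =
      (X r1)\<^sup>2 * bracket j2 X (m r1) (m j2) * bracket j2 X (m r2) (m j1)"
      by (rule fixed_ratio[OF X(1)]) (use X(2) rr in blast)+
    then have "(X r2)\<^sup>2 * (X r2 - X r1)\<^sup>2 = (X r1)\<^sup>2 * (X r1 + X r2)\<^sup>2"
      unfolding r(5-8) by (cases "j1 = 5") (simp_all add: b 1 power2_eq_square algebra_simps)
    then show ?thesis using silver_ratio[OF pos lt] 1 by simp
  qed
  have eq1: "X r1 = X' r1"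
  proof -
    \<comment> \<open>\<open>a\<close> is one of the four indices and its coordinate is normalized,
      which fixes the common scale.\<close>
    have "X a = X' a" using X X' by (simp add: Y_def)
    moreover have "a \<in> {r1, r2, r3, r4}" unfolding r(1) using a n by auto
    moreover have "1 + sqrt 2 \<noteq> 0" by (smt (verit) real_sqrt_ge_zero)
    ultimately show ?thesis using sol[OF X] sol[OF X'] by auto
  qed
  have "i \<in> {r1, r2, r3, r4} \<or> i = j1 \<or> i = j2" unfolding r(1) using i n by auto
  then show ?thesis using eq1 sol[OF X] sol[OF X'] X(1) X'(1) by (auto simp: Y_def)
qed

end

section \<open>Combinatorics on which the push-forward is isometric\<close>

locale coords_fixed = coords +
  fixes p :: "nat \<Rightarrow> real"
  assumes p: "p \<in> Y" and pfix: "i \<le> n \<Longrightarrow> T p i = p i"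
begin

sublocale attracting_data n j1 j2 a m \<sigma> prec Y T p
  by unfold_locales (use p pfix in blast)+

text \<open>The two values besides \<open>m j1\<close> and \<open>m j2\<close> have one preimage on
  each lap. Monotonicity on the laps fixes the cyclic order \<open>j1\<close>, \<open>r1\<close>,
  \<open>r2\<close>, \<open>j2\<close>, \<open>r3\<close>, \<open>r4\<close>, so only the position
  of 0 is open. Of the six rotations two contradict the normalization, two admit no fixed point, and
  two are the exceptional lists.\<close>

lemma isometric_comb:
  assumes iso: "\<And>k. L1 ((row_action ^^ k) c) = L1 c" and c: "L1 c \<noteq> 0"
  shows "ml = [1, 3, 4, 3, 1, 0] \<or> ml = [5, 4, 2, 1, 2, 4]"
proof -
  define S where "S = {..n} - {j1, j2}"
  have post: "\<exists>k. i = (m ^^ Suc k) j1 \<or> i = (m ^^ Suc k) j2" if i: "i \<le> n" "i \<notin> {j1, j2}" for i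
  proof -
    obtain k where k: "i = (m ^^ k) j1 \<or> i = (m ^^ k) j2" using good i(1) unfolding good_comb_def by blast
    then show ?thesis using i(2) by (cases k) auto
  qed
  have E: "card S = 4" "{m j1, m j2} \<subseteq> S" "m ` S \<subseteq> S - {m j1, m j2}"
    "\<forall>l\<in>S - {m j1, m j2}. \<exists>r\<in>S. \<exists>r'\<in>S. r \<noteq> r' \<and> p r' = - p r \<and> m r = l \<and> m r' = l"
    using isometric_imp_exceptional[OF iso c post S_def] by blast+
  have n: "n = 5" using E(1) j12 unfolding S_def by (simp add: card_Diff_subset)
  have "card (S - {m j1, m j2}) = 2" using E(1,2) m_ne(1) by (simp add: card_Diff_subset)
  then obtain l l' where ll: "S - {m j1, m j2} = {l, l'}" "l \<noteq> l'" by (auto simp: card_2_iff)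
  obtain l1 l2 where l: "S - {m j1, m j2} = {l1, l2}" "l1 < l2"
    using ll by (cases "l < l'") (metis insert_commute nat_neq_iff)+
  have pair: "\<exists>r r'. r \<in> S \<and> r' \<in> S \<and> \<sigma> r = 1 \<and> \<sigma> r' = - 1 \<and> p r' = - p r \<and> m r = q \<and> m r' = q"
    if "q \<in> {l1, l2}" for q
  proof -
    have "\<exists>r\<in>S. \<exists>r'\<in>S. r \<noteq> r' \<and> p r' = - p r \<and> m r = q \<and> m r' = q"
      by (rule bspec[OF E(4)]) (use that l(1) in simp)
    then obtain r r' where r: "r \<in> S" "r' \<in> S" "p r' = - p r" "m r = q" "m r' = q" by (elim bexE conjE)
    have "\<sigma> r * p r > 0" "\<sigma> r' * p r' > 0" using Y_sign[OF p] r(1,2) by (auto simp: S_def)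
    then have "\<sigma> r = 1 \<and> \<sigma> r' = - 1 \<or> \<sigma> r = - 1 \<and> \<sigma> r' = 1" using \<sigma>(1)[of r] \<sigma>(1)[of r'] r(3) by auto
    then show ?thesis
    proof
      assume "\<sigma> r = 1 \<and> \<sigma> r' = - 1"
      then show ?thesis using r by (intro exI[of _ r] exI[of _ r'] conjI) simp_all
    next
      assume "\<sigma> r = - 1 \<and> \<sigma> r' = 1"
      moreover have "p r = - p r'" using r(3) by simp
      ultimately show ?thesis using r by (intro exI[of _ r'] exI[of _ r] conjI) simp_all
    qed
  qed
  obtain r1 r4 where r14: "r1 \<in> S" "r4 \<in> S" "\<sigma> r1 = 1" "\<sigma> r4 = - 1" "p r4 = - p r1" "m r1 = l1" "m r4 = l1"
    using pair[OF insertI1] by (elim exE conjE)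
  obtain r2 r3 where r23: "r2 \<in> S" "r3 \<in> S" "\<sigma> r2 = 1" "\<sigma> r3 = - 1" "p r3 = - p r2" "m r2 = l2" "m r3 = l2"
    using pair[OF insertI2[OF singletonI]] by (elim exE conjE)
  have le: "r1 \<le> 5" "r2 \<le> 5" "r3 \<le> 5" "r4 \<le> 5" "j1 \<le> 5" "j2 \<le> 5" using r14 r23 n j12 by (auto simp: S_def)
  have ne: "r1 \<noteq> j1" "r1 \<noteq> j2" "r2 \<noteq> j1" "r2 \<noteq> j2" "r3 \<noteq> j1" "r3 \<noteq> j2" "r4 \<noteq> j1" "r4 \<noteq> j2" "j1 \<noteq> j2"
    "r1 \<noteq> r2" "r3 \<noteq> r4" using r14 r23 j12 l(2) by (auto simp: S_def)
  have pos: "cyc j1 q j2" if "\<sigma> q = 1" "q \<noteq> j1" "q \<noteq> j2" for q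
    using that by (auto simp: \<sigma>_def circle_arc_def split: if_splits)
  have neg: "cyc j2 q j1" if "\<sigma> q = - 1" "q \<noteq> j1" "q \<noteq> j2" for q
    using that cyc_total[of j1 q j2] j12 by (auto simp: \<sigma>_def circle_arc_def split: if_splits)
  have cyc4: "cyc j1 r1 j2" "cyc j1 r2 j2" "cyc j2 r3 j1" "cyc j2 r4 j1"
    using pos[OF r14(3)] pos[OF r23(3)] neg[OF r23(4)] neg[OF r14(4)] ne by blast+
  have c12: "cyc j2 r1 r2"
  proof (rule ccontr)
    assume "\<not> cyc j2 r1 r2"
    then have "cyc j2 r2 r1" using cyc_total[of j2 r1 r2] ne cyc_rotate[of r2 r1 j2] cyc_rotate[of j2 r2 r1] by auto
    then have "m r2 < m r1" using cyc4(2) le n by (intro laps(2)) (auto simp: circle_arc_def)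
    then show False using r14 r23 l(2) by simp
  qed
  have c34: "cyc j2 r3 r4"
  proof (rule ccontr)
    assume "\<not> cyc j2 r3 r4"
    then have "cyc j2 r4 r3" using cyc_total[of j2 r3 r4] ne cyc_rotate[of r4 r3 j2] cyc_rotate[of j2 r4 r3] by auto
    then have "m r3 < m r4" using cyc4(3) le n by (intro laps(1)) (auto simp: circle_arc_def)
    then show False using r14 r23 l(2) by simp
  qed
  have idx: "(j1 = 0 \<and> r1 = 1 \<and> r2 = 2 \<and> j2 = 3 \<and> r3 = 4 \<and> r4 = 5) \<or>
    (j1 = 1 \<and> r1 = 2 \<and> r2 = 3 \<and> j2 = 4 \<and> r3 = 5 \<and> r4 = 0) \<or>
    (j1 = 2 \<and> r1 = 3 \<and> r2 = 4 \<and> j2 = 5 \<and> r3 = 0 \<and> r4 = 1) \<or>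
    (j1 = 3 \<and> r1 = 4 \<and> r2 = 5 \<and> j2 = 0 \<and> r3 = 1 \<and> r4 = 2) \<or>
    (j1 = 4 \<and> r1 = 5 \<and> r2 = 0 \<and> j2 = 1 \<and> r3 = 2 \<and> r4 = 3) \<or>
    (j1 = 5 \<and> r1 = 0 \<and> r2 = 1 \<and> j2 = 2 \<and> r3 = 3 \<and> r4 = 4)"
  proof -
    have "j1 = 0 \<or> j1 = 1 \<or> j1 = 2 \<or> j1 = 3 \<or> j1 = 4 \<or> j1 = 5"
      "j2 = 0 \<or> j2 = 1 \<or> j2 = 2 \<or> j2 = 3 \<or> j2 = 4 \<or> j2 = 5" using le(5,6) by linarith+
    then show ?thesis
      using le(1-4) cyc4 c12 c34 by (elim disjE; simp add: cyc_def; linarith)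
  qed
  \<comment> \<open>\<open>m j1 < l1 < l2 < m j2\<close> lie in the four-element set
    \<open>S\<close>, so they are its elements in increasing order and a rotation determines the
    list.\<close>
  have ord: "m j1 < l1" "l2 < m j2" "m j1 \<in> S" "l1 \<in> S" "l2 \<in> S" "m j2 \<in> S"
    using m_lo[of r1] m_hi[of r2] r14 r23 ne le n l E(2) by auto
  then have v: "m j1 \<noteq> j1" "m j1 \<noteq> j2" "l1 \<noteq> j1" "l1 \<noteq> j2" "l2 \<noteq> j1" "l2 \<noteq> j2" "m j2 \<noteq> j1" "m j2 \<noteq> j2" "m j2 \<le> 5"
    using n by (auto simp: S_def)
  have N: "m j1 \<le> j1" "j2 \<le> m j2" using good unfolding good_comb_def by blast+
  have len: "length ml = 6" using comb_okD(1)[OF ok] n by simp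
  have list: "ml = [m 0, m 1, m 2, m 3, m 4, m 5]"
    using len by (intro nth_equalityI) (auto simp: less_Suc_eq numeral_eq_Suc)
  \<comment> \<open>With \<open>A = p r1 < B = p r2\<close> the fixed point equation becomes
    \<open>4 * B ^ 3 = A * (A + B)\<^sup>2\<close>, whose right side is less than
    \<open>B * (2 * B)\<^sup>2\<close>.\<close>
  have contra: False if b: "m r1 = j \<and> m r2 = k \<and> m j1 = i \<and> m j2 = q" and "{i, j, k, q} = {r1, r2, r3, r4}"
    and e: "(j = r1 \<and> k = r2 \<and> i = r4 \<and> q = r3) \<or> (j = r3 \<and> k = r4 \<and> i = r2 \<and> q = r1)" for i j k q
  proof -
    have A: "p r1 > 0" "p r1 < p r2"
      using Y_sign[OF p, of r1] Y_less[OF p _ _ c12] r14(3) ne le n by auto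
    have br: "bracket j2 p u w = p u - p w" if "u \<in> {r1, r2, r3, r4}" "w \<in> {r1, r2, r3, r4}" for u w
      using that ne by (auto simp: bracket_def)
    have ratio: "(p r2)\<^sup>2 * bracket j2 p (m r2) (m j2) * bracket j2 p (m r1) (m j1) =
      (p r1)\<^sup>2 * bracket j2 p (m r1) (m j2) * bracket j2 p (m r2) (m j1)"
      by (rule fixed_ratio[OF p]) (use pfix ne le n in auto)
    have "(p r2)\<^sup>2 * (2 * p r2) * (2 * p r1) = (p r1)\<^sup>2 * (p r1 + p r2) * (p r1 + p r2)"
      using e
    proof
      assume "j = r1 \<and> k = r2 \<and> i = r4 \<and> q = r3"
      then have M: "m r1 = r1" "m r2 = r2" "m j1 = r4" "m j2 = r3" using b by simp_all
      show ?thesis using ratio[unfolded M] by (simp add: br r14(5) r23(5) algebra_simps)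
    next
      assume "j = r3 \<and> k = r4 \<and> i = r2 \<and> q = r1"
      then have M: "m r1 = r3" "m r2 = r4" "m j1 = r2" "m j2 = r1" using b by simp_all
      show ?thesis using ratio[unfolded M] by (simp add: br r14(5) r23(5) algebra_simps)
    qed
    then have h: "p r1 * (4 * (p r2)^3) = p r1 * (p r1 * (p r1 + p r2)\<^sup>2)" by (simp add: power2_eq_square power3_eq_cube algebra_simps)
    then have "4 * (p r2)^3 = p r1 * (p r1 + p r2)\<^sup>2" using A by simp
    moreover have "p r1 * (p r1 + p r2)\<^sup>2 < p r2 * (2 * p r2)\<^sup>2"
      using A by (intro mult_strict_mono power_strict_mono) auto
    ultimately show False by (simp add: power2_eq_square power3_eq_cube)
  qed
  from idx show ?thesis
  proof (elim disjE)
    assume c: "j1 = 0 \<and> r1 = 1 \<and> r2 = 2 \<and> j2 = 3 \<and> r3 = 4 \<and> r4 = 5"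
    then show ?thesis using N(1) v(1) by simp
  next
    assume c: "j1 = 1 \<and> r1 = 2 \<and> r2 = 3 \<and> j2 = 4 \<and> r3 = 5 \<and> r4 = 0"
    have "m j1 = 0 \<and> l1 = 2 \<and> l2 = 3 \<and> m j2 = 5" using c v ord(1,2) l(2) by (simp; linarith)
    then have False using contra[of 2 3 0 5] c r14 r23 by auto
    then show ?thesis ..
  next
    assume c: "j1 = 2 \<and> r1 = 3 \<and> r2 = 4 \<and> j2 = 5 \<and> r3 = 0 \<and> r4 = 1"
    then show ?thesis using N(2) v by simp
  next
    assume c: "j1 = 3 \<and> r1 = 4 \<and> r2 = 5 \<and> j2 = 0 \<and> r3 = 1 \<and> r4 = 2"
    have "m j1 = 1 \<and> l1 = 2 \<and> l2 = 4 \<and> m j2 = 5" using c v ord(1,2) l(2) by (simp; linarith)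
    then show ?thesis using c r14 r23 list by simp
  next
    assume c: "j1 = 4 \<and> r1 = 5 \<and> r2 = 0 \<and> j2 = 1 \<and> r3 = 2 \<and> r4 = 3"
    have "m j1 = 0 \<and> l1 = 2 \<and> l2 = 3 \<and> m j2 = 5" using c v ord(1,2) l(2) by (simp; linarith)
    then have False using contra[of 2 3 0 5] c r14 r23 by auto
    then show ?thesis ..
  next
    assume c: "j1 = 5 \<and> r1 = 0 \<and> r2 = 1 \<and> j2 = 2 \<and> r3 = 3 \<and> r4 = 4"
    have "m j1 = 0 \<and> l1 = 1 \<and> l2 = 3 \<and> m j2 = 4" using c v ord(1,2) l(2) by (simp; linarith)
    then show ?thesis using c r14 r23 list by simp
  qed
qed

lemma attraction:
  assumes "ml \<noteq> [1, 3, 4, 3, 1, 0]" "ml \<noteq> [5, 4, 2, 1, 2, 4]" "x \<in> Y" "i \<le> n"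
  shows "(\<lambda>k. (T ^^ k) x i) \<longlonglongrightarrow> p i"
  by (rule global_attraction) (use isometric_comb assms in blast)+

lemma fixed_point_unique:
  assumes X: "X \<in> Y" "\<And>i. i \<le> n \<Longrightarrow> T X i = X i" and i: "i \<le> n" shows "X i = p i"
proof (cases "ml = [1, 3, 4, 3, 1, 0] \<or> ml = [5, 4, 2, 1, 2, 4]")
  case True
  then show ?thesis using exceptional_unique[OF True X p pfix i] by blast
next
  case False
  have "(T ^^ k) X i = X i" if "i \<le> n" for k i
    using that
  proof (induction k arbitrary: i)
    case (Suc k)
    have "T ((T ^^ k) X) i = T X i" by (rule T_cong) (use Suc in auto)
    then show ?case using X(2) Suc.prems by simp
  qed simp
  then have "(\<lambda>k. X i) \<longlonglongrightarrow> p i" using attraction[OF _ _ X(1) i] False i by simp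
  then show ?thesis by (simp add: LIMSEQ_const_iff)
qed

end

section \<open>Maps with the same combinatorics\<close>

text \<open>\<open>PSL2R\<close> is transitive on pairs of distinct points, so the moduli space of
  two marked points is a single point.\<close>

lemma moduli_1:
  assumes "\<xi> \<in> moduli 1" "\<xi>' \<in> moduli 1" shows "\<xi> = \<xi>'"
proof -
  obtain x y where x: "x \<in> config 1" "\<xi> = orbit 1 x" and y: "y \<in> config 1" "\<xi>' = orbit 1 y"
    using assms by (auto simp: moduli_def)
  have "x 0 \<noteq> x 1" "y 0 \<noteq> y 1" using config_inj[OF x(1), of 0 1] config_inj[OF y(1), of 0 1] by simp_all
  then obtain K K' where K: "K \<in> PSL2R" "K (Some 0) = x 0" "K None = x 1" and K': "K' \<in> PSL2R" "K' (Some 0) = y 0" "K' None = y 1"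
    by (metis PSL2R_0_inf)
  have "restrict ((K \<circ> inv K') \<circ> y) {..1} = restrict x {..1}"
  proof (rule restrict_ext)
    fix i :: nat assume "i \<in> {..1}"
    then have "i = 0 \<or> i = 1" by auto
    then show "((K \<circ> inv K') \<circ> y) i = x i" using K K'(1) by (auto simp flip: K'(2,3) One_nat_def)
  qed
  then have "x = restrict ((K \<circ> inv K') \<circ> y) {..1}" using config_ext[OF x(1)] by simp
  then show ?thesis unfolding x y using orbit_PSL2R[OF PSL2R_comp[OF K(1) PSL2R_inv[OF K'(1)]]] by metis
qed

lemma good_comb_cases:
  assumes "good_comb m n j1 j2"
  shows "n = 1 \<or> (\<exists>a. coords m n j1 j2 a)"
proof (cases "n \<le> 1")
  case True
  have "j1 \<le> n" "j2 \<le> n" "j1 \<noteq> j2" using assms comb_okD(4-6) unfolding good_comb_def by blast+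
  then show ?thesis using True by linarith
next
  case False
  have "\<exists>a\<in>{0, 1, 2}. a \<noteq> j1 \<and> a \<noteq> j2" by (cases "j1 = 0"; cases "j2 = 0"; cases "j1 = 1"; cases "j2 = 1") auto
  then obtain a where "a \<in> {0, 1, 2}" "a \<noteq> j1 \<and> a \<noteq> j2" by blast
  then have "coords m n j1 j2 a" using False assms by (auto simp: coords_def)
  then show ?thesis by blast
qed

lemma (in coords) coords_fixed_point:
  assumes "\<xi> \<in> moduli n" "pullback ml \<xi> = \<xi>"
  shows "\<exists>p. coords_fixed ml n j1 j2 a p \<and> \<xi> = orbit n (opt p)"
proof -
  obtain p where p: "p \<in> Y" "\<xi> = orbit n (opt p)" using moduli_coord[OF assms(1)] by blast
  have "coords_fixed ml n j1 j2 a p"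
    by unfold_locales (use p fixed_point_coord assms(2) in auto)
  then show ?thesis using p by blast
qed

lemma pullback_fixed_point_unique:
  assumes good: "good_comb m n j1 j2"
    and \<xi>: "\<xi> \<in> moduli n" "pullback m \<xi> = \<xi>" and \<xi>': "\<xi>' \<in> moduli n" "pullback m \<xi>' = \<xi>'"
  shows "\<xi> = \<xi>'"
  using good_comb_cases[OF good]
proof
  assume "n = 1" then show ?thesis using moduli_1 \<xi> \<xi>' by simp
next
  assume "\<exists>a. coords m n j1 j2 a"
  then obtain a where a: "coords m n j1 j2 a" ..
  interpret coords m n j1 j2 a by (rule a)
  obtain p where pf: "coords_fixed m n j1 j2 a p" and \<xi>'_eq: "\<xi>' = orbit n (opt p)" using coords_fixed_point[OF \<xi>'] by blast
  interpret coords_fixed m n j1 j2 a p by (rule pf)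
  obtain X where X: "X \<in> Y" "\<xi> = orbit n (opt X)" using moduli_coord[OF \<xi>(1)] by blast
  have "T X i = X i" if "i \<le> n" for i using fixed_point_coord[OF X(1) _ that] \<xi>(2) X(2) by simp
  then have "X i = p i" if "i \<le> n" for i using fixed_point_unique[OF X(1) _ that] by blast
  then have "opt X = opt p" unfolding opt_def by (intro restrict_ext) simp
  then show ?thesis using X(2) \<xi>'_eq by simp
qed

lemma pullback_attracting:
  assumes good: "good_comb m n j1 j2" and ne: "m \<noteq> [1, 3, 4, 3, 1, 0]" "m \<noteq> [5, 4, 2, 1, 2, 4]"
    and \<xi>: "\<xi> \<in> moduli n" and \<xi>': "\<xi>' \<in> moduli n" "pullback m \<xi>' = \<xi>'"
  shows "limitin (moduli_topology n) (\<lambda>k. (pullback m ^^ k) \<xi>) \<xi>' sequentially"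
  using good_comb_cases[OF good]
proof
  assume "n = 1"
  then have "\<xi> = \<xi>'" using moduli_1 \<xi> \<xi>' by simp
  then have "(pullback m ^^ k) \<xi> = \<xi>'" for k by (induction k) (simp_all add: \<xi>'(2))
  then show ?thesis using \<xi>' by (simp add: topspace_moduli_topology)
next
  assume "\<exists>a. coords m n j1 j2 a"
  then obtain a where a: "coords m n j1 j2 a" ..
  interpret coords m n j1 j2 a by (rule a)
  obtain p where pf: "coords_fixed m n j1 j2 a p" and \<xi>'_eq: "\<xi>' = orbit n (opt p)" using coords_fixed_point[OF \<xi>'] by blast
  interpret coords_fixed m n j1 j2 a p by (rule pf)
  obtain X where X: "X \<in> Y" "\<xi> = orbit n (opt X)" using moduli_coord[OF \<xi>] by blast
  have "limitin (moduli_topology n) (\<lambda>k. orbit n (opt ((T ^^ k) X))) (orbit n (opt p)) sequentially"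
    by (rule opt_limit) (use T_pow_Y[OF X(1)] p_Y attraction[OF ne X(1)] in auto)
  then show ?thesis unfolding \<xi>'_eq X(2) pullback_pow[OF X(1)] .
qed

section \<open>Maps with the same critical points and critical values\<close>

lemma swap_scale:
  assumes P: "P \<in> PSL2R" "P (Some 0) = None" "P None = Some 0" and t: "t > 0"
  shows "P (scale t z) = scale (1 / t) (P z)"
proof -
  obtain a b c d where det: "a * d - b * c > 0"
    and Ppt: "\<And>x y. x \<noteq> 0 \<or> y \<noteq> 0 \<Longrightarrow> P (pt x y) = pt (a * x + b * y) (c * x + d * y)"
    using PSL2R_pt[OF P(1)] by metis
  have "d = 0" using Ppt[of 0 1] P(2) by (simp add: pt_def split: if_splits)
  moreover have "a = 0" using Ppt[of 1 0] P(3) by (simp add: pt_def split: if_splits)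
  ultimately have Pz: "P (pt x y) = pt (b * y) (c * x)" if "x \<noteq> 0 \<or> y \<noteq> 0" for x y using Ppt[OF that] by simp
  obtain x y where z: "z = pt x y" "x \<noteq> 0 \<or> y \<noteq> 0" by (rule pt_cases)
  have "scale t z = pt (t * x) y" unfolding z using t by (simp add: scale_pt)
  then have "P (scale t z) = pt (b * y) (c * (t * x))" using Pz[of "t * x" y] z(2) t by simp
  also have "\<dots> = pt (t * (1 / t * (b * y))) (t * (c * x))" using t by (simp add: algebra_simps)
  also have "\<dots> = pt (1 / t * (b * y)) (c * x)" by (rule pt_scale) (use t in simp)
  also have "\<dots> = scale (1 / t) (P z)" unfolding z(1) Pz[OF z(2)] using t by (subst scale_pt) simp_all
  finally show ?thesis .
qed

lemma scale_comp: "scale s (scale t z) = scale (s * t) z" "sq (scale t z) = scale (t\<^sup>2) (sq z)"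
  by (cases z; simp add: power_mult_distrib)+

text \<open>Conjugation by a scaling \<rho> inserts the factor \<rho>^(-1) after the square if
  \<open>P\<close> fixes 0 and infinity, and \<rho>^(-3) if it exchanges them. Both exponents are
  nonzero, so every \<tau> is reached.\<close>

lemma rescaling:
  assumes P: "P \<in> PSL2R" "{P (Some 0), P None} = {Some 0, None}" and \<tau>: "\<tau> > 0"
  shows "\<exists>\<rho>>0. \<forall>z. scale \<rho> (P (sq (scale (1 / \<rho>) z))) = P (scale \<tau> (sq z))"
proof (cases "P None = None")
  case True
  then have "P (Some 0) = Some 0" using P(2) by (simp add: doubleton_eq_iff)
  then obtain s where s: "s > 0" "P = scale s" using PSL2R_fix_0_inf[OF P(1) _ True] by blast
  show ?thesis
  proof (intro exI[of _ "1 / \<tau>"] conjI allI)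
    show "scale (1 / \<tau>) (P (sq (scale (1 / (1 / \<tau>)) z))) = P (scale \<tau> (sq z))" for z
      unfolding s(2) scale_comp using \<tau> by (simp add: power2_eq_square mult_ac)
  qed (use \<tau> in simp)
next
  case False
  then have sw: "P None = Some 0" "P (Some 0) = None" using P(2) by (auto simp: doubleton_eq_iff)
  define \<rho> where "\<rho> = 1 / root 3 \<tau>"
  have \<rho>: "\<rho> > 0" "1 / \<rho> * (1 / \<rho>)\<^sup>2 = \<tau>"
    using \<tau> real_root_pow_pos2[of 3 \<tau>] by (simp_all add: \<rho>_def power2_eq_square power3_eq_cube)
  show ?thesis
  proof (intro exI[of _ \<rho>] conjI allI)
    fix z
    have "scale \<rho> (P (sq (scale (1 / \<rho>) z))) = P (scale (1 / \<rho>) (sq (scale (1 / \<rho>) z)))"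
      using swap_scale[OF P(1) sw(2,1), of "1 / \<rho>"] \<rho>(1) by simp
    also have "\<dots> = P (scale \<tau> (sq z))" unfolding scale_comp using \<rho>(2) by simp
    finally show "scale \<rho> (P (sq (scale (1 / \<rho>) z))) = P (scale \<tau> (sq z))" .
  qed (rule \<rho>(1))
qed

text \<open>The critical points determine \<open>L\<close> and the critical values determine
  \<open>M\<close>, each up to a scaling; the two scalings merge into one.\<close>

lemma nf_same_points:
  assumes f: "nf M L f c0 ci" and g: "nf M' L' g c0 ci" and eq: "f c0 = g c0" "f ci = g ci"
  obtains \<tau> where "\<tau> > 0" "\<And>z. g z = M (scale \<tau> (sq (L z)))"
proof -
  interpret f: nf M L f c0 ci by (rule f)
  interpret g: nf M' L' g c0 ci by (rule g)
  have iL: "inv L (Some 0) = c0" "inv L None = ci" using f.L f.c0 f.ci by (metis PSL2R_inv_simps(1))+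
  have "(L' \<circ> inv L) \<in> PSL2R" by (rule PSL2R_comp[OF g.L PSL2R_inv[OF f.L]])
  then obtain s where s: "s > 0" "L' \<circ> inv L = scale s" by (rule PSL2R_fix_0_inf) (simp_all add: iL g.c0 g.ci)
  have M: "M' (Some 0) = M (Some 0)" "M' None = M None" using eq f.g_c g.g_c by simp_all
  have "(inv M \<circ> M') \<in> PSL2R" by (rule PSL2R_comp[OF PSL2R_inv[OF f.M] g.M])
  then obtain t where t: "t > 0" "inv M \<circ> M' = scale t" by (rule PSL2R_fix_0_inf) (simp_all add: M f.M)
  show ?thesis
  proof (rule that[of "t * s\<^sup>2"])
    fix z
    have L': "L' z = scale s (L z)" using f.L by (simp flip: s(2))
    have M': "M' w = M (scale t w)" for w using f.M by (simp flip: t(2))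
    show "g z = M (scale (t * s\<^sup>2) (sq (L z)))" unfolding g.g comp_def L' M' scale_comp ..
  qed (use s t in simp)
qed

text \<open>A third marked point has a prescribed image, which forces \<tau> to be 1 and the maps to
  be equal. With two marked points \<tau> is free, but \<open>rescaling\<close> absorbs it in a
  conjugation.\<close>

lemma combinatorics_determine:
  assumes f: "nf M L f (X j1) (X j2)" "\<forall>j\<le>n. f (X j) = X (m ! j)"
    and g: "nf M' L' g (X j1) (X j2)" "\<forall>j\<le>n. g (X j) = X (m ! j)"
    and X: "X \<in> config n" and good: "good_comb m n j1 j2"
  shows "conjugate f g"
proof -
  interpret f: nf M L f "X j1" "X j2" by (rule f(1))
  have ok: "comb_ok m n j1 j2" using good by (simp add: good_comb_def)
  note j = comb_okD(4-6)[OF ok]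
  obtain \<tau> where \<tau>: "\<tau> > 0" "\<And>z. g z = M (scale \<tau> (sq (L z)))"
    using nf_same_points[OF f(1) g(1)] f(2) g(2) j by metis
  show ?thesis
    using good_comb_cases[OF good]
  proof
    assume "\<exists>a. coords m n j1 j2 a"
    then obtain a where a: "a \<le> n" "a \<noteq> j1" "a \<noteq> j2" by (auto simp: coords_def)
    then have "X a \<noteq> X j1" "X a \<noteq> X j2" using config_inj[OF X] j by blast+
    then have L: "L (X a) \<noteq> Some 0" "L (X a) \<noteq> None" using f.L_eq by blast+
    then obtain y where y: "L (X a) = Some y" "y \<noteq> 0" by (cases "L (X a)") auto
    have "M (scale \<tau> (sq (L (X a)))) = M (sq (L (X a)))"
      using f(2) g(2) a(1) \<tau>(2)[of "X a"] f.g by simp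
    then have "scale \<tau> (sq (L (X a))) = sq (L (X a))" using f.M by simp
    then have "\<tau> = 1" using y by simp
    then have "g = f" using \<tau>(2) f.g by (simp add: fun_eq_iff option.map_ident)
    then show ?thesis using conjugate_refl by simp
  next
    assume n: "n = 1"
    have P: "L \<circ> M \<in> PSL2R" by (rule PSL2R_comp[OF f.L f.M])
    have "m ! j1 \<le> 1" "m ! j2 \<le> 1" "m ! j1 < m ! j2" using comb_okD(7,8)[OF ok] j n by auto
    then have "{m ! j1, m ! j2} = {j1, j2}" using j n by auto
    then have "{L (X (m ! j1)), L (X (m ! j2))} = {L (X j1), L (X j2)}" by (metis (no_types, lifting) doubleton_eq_iff)
    moreover have "M (Some 0) = X (m ! j1)" "M None = X (m ! j2)" using f.g_c f(2) j by auto
    ultimately have "{(L \<circ> M) (Some 0), (L \<circ> M) None} = {Some 0, None}" using f.c0 f.ci by simp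
    from rescaling[OF P this \<tau>(1)] obtain \<rho> where \<rho>: "\<rho> > 0"
      "\<And>z. scale \<rho> ((L \<circ> M) (sq (scale (1 / \<rho>) z))) = (L \<circ> M) (scale \<tau> (sq z))" by blast
    define D where "D = inv L \<circ> scale \<rho> \<circ> L"
    have D: "D \<in> PSL2R" unfolding D_def by (intro PSL2R_comp PSL2R_inv f.L scale_PSL2R \<rho>(1))
    have "inv D z = inv L (scale (1 / \<rho>) (L z))" for z
    proof -
      have "D (inv L (scale (1 / \<rho>) (L z))) = z" using f.L \<rho>(1) scale_comp(1)[of \<rho> "1 / \<rho>" "L z"] by (simp add: D_def option.map_ident)
      then show ?thesis using D by (metis PSL2R_inv_simps(1))
    qed
    then have "(D \<circ> f \<circ> inv D) z = inv L (scale \<rho> ((L \<circ> M) (sq (scale (1 / \<rho>) (L z)))))" for z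
      using f.L by (simp add: D_def f.g)
    then have "(D \<circ> f \<circ> inv D) z = g z" for z unfolding \<rho>(2) using f.L \<tau>(2) by simp
    then have "g = D \<circ> f \<circ> inv D" by (intro ext) simp
    then show ?thesis unfolding conjugate_def using D by blast
  qed
qed

theorem theorem5p1:
  fixes f :: "real option \<Rightarrow> real option" and m :: "nat list" and n :: nat
  assumes "real_quadratic f" and "critically_finite f"
    and "m = combinatorics f" and "n = length m - 1"
  shows "(\<forall>g. real_quadratic g \<and> critically_finite g \<and> combinatorics g = m \<longrightarrow> conjugate f g) \<and>
    {\<xi> \<in> moduli n. pullback m \<xi> = \<xi>} = {class_point f} \<and>
    (minimal_comb m \<and> m \<noteq> [1, 3, 4, 3, 1, 0] \<and> m \<noteq> [5, 4, 2, 1, 2, 4] \<longrightarrow>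
      (\<forall>\<xi>\<in>moduli n.
        limitin (moduli_topology n) (\<lambda>k. (pullback m ^^ k) \<xi>) (class_point f) sequentially))"
proof -
  have struct: "\<exists>x M L h j1 j2. conjugate f h \<and> nf M L h (cfg n x j1) (cfg n x j2) \<and> good_comb m n j1 j2 \<and>
      cfg n x \<in> config n \<and> pullback m (orbit n (cfg n x)) = orbit n (cfg n x) \<and>
      (\<forall>j\<le>n. h (cfg n x j) = cfg n x (m ! j)) \<and> class_point f = orbit n (cfg n x)"
    if f: "real_quadratic f" "critically_finite f" and m: "combinatorics f = m" for f
  proof -
    obtain m' n' x where l: "labelling f m' n' x" using labelling_exists[OF f] by blast
    have m': "m' = m" using combinatorics_eq[OF f(1) l] m by simp
    have "length m' = n' + 1" using l unfolding labelling_def by blast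
    then have n': "n' = n" using assms(4) m' by simp
    show ?thesis using labelling_good[OF f(1) l] class_point_eq[OF f(1) l] unfolding m' n' by blast
  qed
  obtain x M L h j1 j2 where F: "conjugate f h" "nf M L h (cfg n x j1) (cfg n x j2)" "good_comb m n j1 j2"
    "cfg n x \<in> config n" "pullback m (orbit n (cfg n x)) = orbit n (cfg n x)"
    "\<forall>j\<le>n. h (cfg n x j) = cfg n x (m ! j)" "class_point f = orbit n (cfg n x)"
    using struct[OF assms(1,2) assms(3)[symmetric]] by (elim exE conjE)
  have cp: "class_point f \<in> moduli n" "pullback m (class_point f) = class_point f"
    unfolding F(7) using F(4,5) by (auto simp: moduli_def)
  have jm: "j1 = crit_min m" "j2 = crit_max m" using comb_okD(2,3) F(3) unfolding good_comb_def by blast+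
  have "conjugate f g" if g: "real_quadratic g" "critically_finite g" "combinatorics g = m" for g
  proof -
    obtain x' M' L' h' i1 i2 where G: "conjugate g h'" "nf M' L' h' (cfg n x' i1) (cfg n x' i2)" "good_comb m n i1 i2"
      "cfg n x' \<in> config n" "pullback m (orbit n (cfg n x')) = orbit n (cfg n x')"
      "\<forall>j\<le>n. h' (cfg n x' j) = cfg n x' (m ! j)" "class_point g = orbit n (cfg n x')"
      using struct[OF g] by (elim exE conjE)
    have i: "i1 = j1" "i2 = j2" using comb_okD(2,3) G(3) jm unfolding good_comb_def by blast+
    \<comment> \<open>Both labelled configurations are fixed by the same pull-back, so uniqueness
      makes them equivalent. The element \<open>K\<close> then moves the marked points of the second
      map onto those of the first.\<close>
    have "orbit n (cfg n x) = orbit n (cfg n x')"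
      by (rule pullback_fixed_point_unique[OF F(3)]) (use F(4,5) G(4,5) in \<open>auto simp: moduli_def\<close>)
    then obtain K where K: "K \<in> PSL2R" and Kx: "\<And>i. i \<le> n \<Longrightarrow> cfg n x i = K (cfg n x' i)"
      using orbit_eqD[OF _ F(4)] by metis
    have "comb_ok m n j1 j2" using F(3) by (simp add: good_comb_def)
    note le = comb_okD(4,5,7)[OF this]
    have "nf (K \<circ> M') (L' \<circ> inv K) (K \<circ> h' \<circ> inv K) (cfg n x j1) (cfg n x j2)"
      using nf.conj[OF G(2) K] Kx le(1,2) i by simp
    moreover have "\<forall>j\<le>n. (K \<circ> h' \<circ> inv K) (cfg n x j) = cfg n x (m ! j)"
      using G(6) Kx le(3) K by simp
    ultimately have "conjugate h (K \<circ> h' \<circ> inv K)" by (rule combinatorics_determine[OF F(2,6) _ _ F(4,3)])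
    moreover have "conjugate h' (K \<circ> h' \<circ> inv K)" using K unfolding conjugate_def by blast
    ultimately show ?thesis using F(1) G(1) conjugate_trans conjugate_sym by metis
  qed
  moreover have "{\<xi> \<in> moduli n. pullback m \<xi> = \<xi>} = {class_point f}"
    using cp pullback_fixed_point_unique[OF F(3) _ _ cp] by blast
  moreover have "minimal_comb m \<and> m \<noteq> [1, 3, 4, 3, 1, 0] \<and> m \<noteq> [5, 4, 2, 1, 2, 4] \<longrightarrow>
      (\<forall>\<xi>\<in>moduli n.
        limitin (moduli_topology n) (\<lambda>k. (pullback m ^^ k) \<xi>) (class_point f) sequentially)"
    using pullback_attracting[OF F(3) _ _ _ cp] by blast
  ultimately show ?thesis by blast
qed

end
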